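(* Let $$\beta:=\max\{\|Kb\|_{L^\infty(\Omega)},\|b\|_{L^\infty(\Omega)},\|Kc\|_{L^\infty(\Omega)},\|c\|_{L^\infty(\Omega)}\},\qquad \gamma_*:=288\,\beta^2\,C_{\mathrm{tr}}^2\,\delta^{-1},$$ where $C_{\mathrm{tr}}$ is the discrete trace constant and $\delta$ the multiplier positivity constant of the context. Let $V_h$ be any linear subspace of $\mathbb P^p(\mathcal T_h)$, $p\ge1$. Then, for all $\gamma_1>0$ and all $\gamma_2,\gamma_3\ge\gamma_*$, $$\mathcal A_h(v,v)+\mathcal A_J(v,v)\ \ge\ \tfrac14\,|||v|||^2\qquad\forall v\in V_h .$$
   Context: **Problem data.** $K=K(y)$ is a real function of $y$ only with $K(y)y>0$ for $y\ne0$, $K\in C^0(\overline\Omega)\cap C^1(\Omega)$, $K'>0$. $\Omega\subset\mathbb R^2$ is a bounded domain whose boundary is decomposed as $\Gamma_0\cup\Gamma_1\cup\Gamma_2$: $\Gamma_0=\partial\Omega\cap\{y>0\}$ is a Lipschitz curve, and $\partial\Omega\cap\{y<0\}$ is the union of the characteristic curves $\Gamma_1$: $x=-1+\int_y^0\sqrt{-K(t)}\,dt$ and $\Gamma_2$: $x=1-\int_y^0\sqrt{-K(t)}\,dt$, starting at $(-1,0)$ and $(1,0)$ respectively and meeting at $(0,y_c)$, $y_c<0$. With $\mathbf n=(n_x,n_y)^\top$ the outward unit normal, $Kn_x^2+n_y^2=0$ on $\Gamma_1\cup\Gamma_2$. The unit tangent is $\mathbf t=(-n_y,n_x)^\top$;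 $v_n=\nabla v\cdot\mathbf n$, $v_t=\nabla v\cdot\mathbf t$. $\mathbf W:=\mathrm{diag}(K,1)$. **Mesh.** $\{\mathcal T_h\}_{h\in\mathcal H}$ is a sequence of partitions of $\Omega$ into disjoint open elements $T$ ($h_T=\operatorname{diam}T$, $h=\sup_T h_T$). Elements whose closure meets $\partial\Omega$ in at most a point are polygons; the others may have curved facets lying exactly on $\partial\Omega$. For distinct $T,T'$, $\partial T\cap\partial T'$ is empty, a point, or a straight segment (then called an interior facet); boundary facets are the sets $\partial T\cap\Gamma_j$ of positive length. Hanging nodes are allowed. $\mathcal F_T$: facets of $T$; $\mathcal F_h^{\mathrm I}$: interior facets; $\mathcal F_h^j$: facets in $\Gamma_j$; $\mathcal F_h^{\mathrm D}=\mathcal F_h^0\cup\mathcal F_h^1$; $h_F=\operatorname{diam}F$. Assumptions: (i) there is $0<r_\star\le\frac12$ such that every $T$ is star-shaped with respect to a ball centered in $T$ of radius $r_\star h_T$; (ii) there is $C_g>0$ with $h_T\le C_gh_F$ for all $T$ and $F\in\mathcal F_T$. $C_{\mathrm{tr}}>0$ is a constant such that $\|v\|_{L^2(\partial T)}\le C_{\mathrm{tr}}\,p\,h_T^{-1/2}\|v\|_{L^2(T)}$ for all $h\in\mathcal H$, $T\in\mathcal T_h$, $p\ge1$, $v\in\mathbb P^p(T)$ (it exists, with $C_{\mathrm{tr}}\le\sqrt{6/r_\star}$). $\mathbb P^p(T)$: polynomials of total degree $\le p$; $\mathbb P^p(\mathcal T_h)$: elementwise version. On $F=\partial T_+\cap\partial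 T_-$: averages $\{\!\{\cdot\}\!\}$ are arithmetic means of the two traces, $[\![\varphi]\!]=\varphi_+\mathbf n_{T_+}+\varphi_-\mathbf n_{T_-}$ for scalar $\varphi$ (a vector). On boundary facets $[\![\varphi]\!]=\varphi\mathbf n$. **Multiplier.** $\mathbf m=(b,c)^\top$, $\mathcal Mv:=bv_x+cv_y$, where: $b=b(x)$, $c=c(y)$, $b,c\in C^0(\overline\Omega)\cap C^1(\Omega)$; there is $\delta>0$ with $-Kb_x+(Kc)_y\ge\delta$ and $b_x-c_y\ge\delta$ in $\Omega$; $b+c\sqrt{-K}\le0$ on $\Gamma_2$; $\mathbf m\cdot\mathbf n\ge0$ on $\Gamma_0$. **Bilinear forms** (with penalty parameters $\gamma_1,\gamma_2,\gamma_3>0$): $$\mathcal A_h(u,v)=-\sum_{T}\int_T\mathbf W\nabla u\cdot\nabla(\mathcal Mv)+\sum_{F\in\mathcal F_h^{\mathrm I}}\int_F\{\!\{\mathbf W\nabla u\}\!\}\cdot[\![\mathcal Mv]\!]+\sum_{F\in\mathcal F_h^{\mathrm D}\cup\mathcal F_h^2}\int_F\mathbf W\nabla u\cdot\mathbf n\,\mathcal Mv,$$ $$\mathcal A_J(u,v)=\sum_{F\in\mathcal F_h^{\mathrm I}\cup\mathcal F_h^{\mathrm D}}\frac{\gamma_1}{h_F^3}\int_F[\![u]\!]\cdot[\![v]\!]+\sum_{F\in\mathcal F_h^{\mathrm I}}\frac{\gamma_2p^2}{h_F}\int_F\big([\![u_x]\!]\cdot[\![v_x]\!]+[\![u_y]\!]\cdot[\![v_y]\!]\big)+\sum_{F\in\mathcal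 F_h^{\mathrm D}}\frac{\gamma_3p^2}{h_F}\int_Fu_tv_t.$$ **Norm.** $|||v|||^2=\sum_T\int_T\delta(v_x^2+v_y^2)+|v|_J^2$, with $|v|_J^2=\mathcal A_J(v,v)$. *)

theory Defs
  imports "HOL-Analysis.Analysis"
begin

type_synonym point = "real \<times> real"
type_synonym mesh = "point set set"

definition hausdorff1_outer :: "'a::metric_space set \<Rightarrow> ennreal" where
  "hausdorff1_outer A =
     (SUP d\<in>{0<..}. INF C\<in>{C :: nat \<Rightarrow> 'a set. A \<subseteq> (\<Union>i. C i) \<and>
         (\<forall>i. bounded (C i) \<and> diameter (C i) \<le> d)}. \<Sum>i. ennreal (diameter (C i)))"

text \<open>One-dimensional Hausdorff measure on the Caratheodory-measurable sets. With the normalisation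
  above it is arc length on rectifiable arcs; all integrals over facets and element boundaries are
  taken with respect to it.\<close>

definition hausdorff1 :: "'a::metric_space measure" where
  "hausdorff1 = measure_of UNIV
     {A. \<forall>E. hausdorff1_outer (E \<inter> A) + hausdorff1_outer (E - A) = hausdorff1_outer E}
     hausdorff1_outer"

text \<open>The blow-up of \<open>S\<close> at \<open>z\<close> is the half plane with outward unit normal \<open>\<nu>\<close>. Such a \<open>\<nu>\<close> is unique;
  on a Lipschitz boundary it exists at almost every point and is the usual outward normal.\<close>

definition is_outer_normal :: "point set \<Rightarrow> point \<Rightarrow> point \<Rightarrow> bool" where
  "is_outer_normal S z \<nu> \<longleftrightarrow> norm \<nu> = 1 \<and>
     (\<forall>e>0. \<exists>r>0. \<forall>w\<in>ball z r.
        ((w - z) \<bullet> \<nu> < - e * norm (w - z) \<longrightarrow> w \<in> S) \<and>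
        ((w - z) \<bullet> \<nu> > e * norm (w - z) \<longrightarrow> w \<notin> S))"

definition outer_normal :: "point set \<Rightarrow> point \<Rightarrow> point" where
  "outer_normal S z =
     (if \<exists>\<nu>. is_outer_normal S z \<nu> then THE \<nu>. is_outer_normal S z \<nu> else 0)"

definition tangent :: "point set \<Rightarrow> point \<Rightarrow> point" where
  "tangent S z = (- snd (outer_normal S z), fst (outer_normal S z))"

definition L2_norm_on :: "point measure \<Rightarrow> point set \<Rightarrow> (point \<Rightarrow> real) \<Rightarrow> real" where
  "L2_norm_on \<mu> S f = sqrt (LINT z:S|\<mu>. (f z)\<^sup>2)"

definition Linf_norm :: "point set \<Rightarrow> (point \<Rightarrow> real) \<Rightarrow> real" where
  "Linf_norm S f = Inf {C. 0 \<le> C \<and> (AE z in lborel. z \<in> S \<longrightarrow> \<bar>f z\<bar> \<le> C)}"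

definition Gamma0 :: "point set \<Rightarrow> point set" where
  "Gamma0 \<Omega> = frontier \<Omega> \<inter> {z. snd z > 0}"

definition Gamma1 :: "(real \<Rightarrow> real) \<Rightarrow> real \<Rightarrow> point set" where
  "Gamma1 K yc = {(x, y). yc \<le> y \<and> y \<le> 0 \<and> x = - 1 + integral {y..0} (\<lambda>t. sqrt (- K t))}"

definition Gamma2 :: "(real \<Rightarrow> real) \<Rightarrow> real \<Rightarrow> point set" where
  "Gamma2 K yc = {(x, y). yc \<le> y \<and> y \<le> 0 \<and> x = 1 - integral {y..0} (\<lambda>t. sqrt (- K t))}"

text \<open>\<open>K\<close> depends on \<open>y\<close> only, so its regularity on \<open>\<Omega>\<close> and on the closure of \<open>\<Omega>\<close> is regularity on the
  ranges of the coordinate \<open>y\<close>; the same convention is used for the multiplier coefficients below.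
  \<open>Gamma0\<close> is an open arc with a Lipschitz parametrisation; its end points \<open>(1, 0)\<close> and
  \<open>(- 1, 0)\<close> belong to \<open>Gamma2\<close> and \<open>Gamma1\<close>. The value of the last integral says that
  \<open>Gamma1\<close> and \<open>Gamma2\<close> meet at \<open>(0, yc)\<close>.\<close>

definition mixed_type_domain :: "(real \<Rightarrow> real) \<Rightarrow> real \<Rightarrow> point set \<Rightarrow> bool" where
  "mixed_type_domain K yc \<Omega> \<longleftrightarrow>
     open \<Omega> \<and> connected \<Omega> \<and> bounded \<Omega> \<and>
     continuous_on (snd ` closure \<Omega>) K \<and> K C1_differentiable_on (snd ` \<Omega>) \<and>
     (\<forall>y\<in>snd ` closure \<Omega>. y \<noteq> 0 \<longrightarrow> K y * y > 0) \<and>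
     (\<forall>y\<in>snd ` \<Omega>. deriv K y > 0) \<and>
     frontier \<Omega> = Gamma0 \<Omega> \<union> Gamma1 K yc \<union> Gamma2 K yc \<and>
     (\<exists>g L. arc g \<and> L-lipschitz_on {0..1} g \<and> pathstart g = (1, 0) \<and> pathfinish g = (- 1, 0) \<and>
        Gamma0 \<Omega> = g ` {0<..<1}) \<and>
     yc < 0 \<and> integral {yc..0} (\<lambda>t. sqrt (- K t)) = 1"

definition polygon :: "point set \<Rightarrow> bool" where
  "polygon T \<longleftrightarrow> (\<exists>g E. simple_path g \<and> pathfinish g = pathstart g \<and> finite E \<and>
     path_image g = (\<Union>(a, b)\<in>E. closed_segment a b) \<and> T = inside (path_image g))"

definition star_shaped_wrt :: "point set \<Rightarrow> point set \<Rightarrow> bool" where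
  "star_shaped_wrt T B \<longleftrightarrow> (\<forall>w\<in>B. \<forall>z\<in>T. closed_segment w z \<subseteq> T)"

definition interior_facets :: "mesh \<Rightarrow> point set set" where
  "interior_facets M = {frontier T \<inter> frontier T' |T T'. T \<in> M \<and> T' \<in> M \<and> T \<noteq> T' \<and>
     (\<exists>a b. a \<noteq> b \<and> frontier T \<inter> frontier T' = closed_segment a b)}"

definition boundary_facets :: "point set \<Rightarrow> mesh \<Rightarrow> point set set" where
  "boundary_facets \<Gamma> M = {frontier T \<inter> \<Gamma> |T. T \<in> M \<and> emeasure hausdorff1 (frontier T \<inter> \<Gamma>) > 0}"

definition facets_D :: "(real \<Rightarrow> real) \<Rightarrow> real \<Rightarrow> point set \<Rightarrow> mesh \<Rightarrow> point set set" where
  "facets_D K yc \<Omega> M = boundary_facets (Gamma0 \<Omega>) M \<union> boundary_facets (Gamma1 K yc) M"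

definition facets_of :: "(real \<Rightarrow> real) \<Rightarrow> real \<Rightarrow> point set \<Rightarrow> mesh \<Rightarrow> point set \<Rightarrow> point set set" where
  "facets_of K yc \<Omega> M T =
     {F \<in> interior_facets M \<union> facets_D K yc \<Omega> M \<union> boundary_facets (Gamma2 K yc) M. F \<subseteq> frontier T}"

text \<open>In the last condition a one-point intersection is the degenerate segment with \<open>a = b\<close>.\<close>

definition mesh_of :: "point set \<Rightarrow> mesh \<Rightarrow> bool" where
  "mesh_of \<Omega> M \<longleftrightarrow>
     finite M \<and> (\<forall>T\<in>M. open T \<and> T \<noteq> {} \<and> T \<subseteq> \<Omega>) \<and> disjoint M \<and>
     closure \<Omega> = (\<Union>T\<in>M. closure T) \<and>
     (\<forall>T\<in>M. (\<exists>a. closure T \<inter> frontier \<Omega> \<subseteq> {a}) \<longrightarrow> polygon T) \<and>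
     (\<forall>T\<in>M. \<exists>E. finite E \<and> frontier T \<subseteq> frontier \<Omega> \<union> (\<Union>(a, b)\<in>E. closed_segment a b)) \<and>
     (\<forall>T\<in>M. \<forall>T'\<in>M. T \<noteq> T' \<longrightarrow>
        frontier T \<inter> frontier T' = {} \<or> (\<exists>a b. frontier T \<inter> frontier T' = closed_segment a b))"

definition mesh_family ::
  "(real \<Rightarrow> real) \<Rightarrow> real \<Rightarrow> point set \<Rightarrow> real \<Rightarrow> real \<Rightarrow> real set \<Rightarrow> (real \<Rightarrow> mesh) \<Rightarrow> bool" where
  "mesh_family K yc \<Omega> r Cg H Th \<longleftrightarrow>
     0 < r \<and> r \<le> 1/2 \<and> 0 < Cg \<and>
     (\<forall>h\<in>H. mesh_of \<Omega> (Th h) \<and> h = (SUP T\<in>Th h. diameter T) \<and>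
        (\<forall>T\<in>Th h. \<exists>a\<in>T. star_shaped_wrt T (ball a (r * diameter T))) \<and>
        (\<forall>T\<in>Th h. \<forall>F\<in>facets_of K yc \<Omega> (Th h) T. diameter T \<le> Cg * diameter F))"

definition poly_space :: "nat \<Rightarrow> (point \<Rightarrow> real) set" where
  "poly_space p = {f. \<exists>a :: nat \<Rightarrow> nat \<Rightarrow> real.
     \<forall>x y. f (x, y) = (\<Sum>i\<le>p. \<Sum>j\<le>p - i. a i j * x ^ i * y ^ j)}"

text \<open>A piecewise polynomial \<open>v\<close> is the family of its element polynomials: \<open>v T\<close> is the polynomial that
  \<open>v\<close> equals on \<open>T\<close>, so the trace of \<open>v\<close> from \<open>T\<close> on the boundary of \<open>T\<close> is \<open>v T\<close> itself.\<close>

type_synonym broken = "point set \<Rightarrow> point \<Rightarrow> real"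

definition broken_poly_space :: "nat \<Rightarrow> mesh \<Rightarrow> broken set" where
  "broken_poly_space p M = {v. (\<forall>T\<in>M. v T \<in> poly_space p) \<and> (\<forall>T. T \<notin> M \<longrightarrow> v T = (\<lambda>z. 0))}"

definition linear_subspace :: "broken set \<Rightarrow> bool" where
  "linear_subspace V \<longleftrightarrow> (\<lambda>T z. 0) \<in> V \<and>
     (\<forall>v\<in>V. \<forall>w\<in>V. (\<lambda>T z. v T z + w T z) \<in> V) \<and>
     (\<forall>a. \<forall>v\<in>V. (\<lambda>T z. a * v T z) \<in> V)"

definition discrete_trace_constant :: "real set \<Rightarrow> (real \<Rightarrow> mesh) \<Rightarrow> real \<Rightarrow> bool" where
  "discrete_trace_constant H Th Ctr \<longleftrightarrow> 0 < Ctr \<and>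
     (\<forall>h\<in>H. \<forall>T\<in>Th h. \<forall>p\<ge>1. \<forall>v\<in>poly_space p.
        L2_norm_on hausdorff1 (frontier T) v
          \<le> Ctr * real p * diameter T powr (- 1/2) * L2_norm_on lborel T v)"

definition pd_x :: "(point \<Rightarrow> real) \<Rightarrow> point \<Rightarrow> real" where
  "pd_x f z = deriv (\<lambda>s. f (s, snd z)) (fst z)"

definition pd_y :: "(point \<Rightarrow> real) \<Rightarrow> point \<Rightarrow> real" where
  "pd_y f z = deriv (\<lambda>s. f (fst z, s)) (snd z)"

definition grad :: "(point \<Rightarrow> real) \<Rightarrow> point \<Rightarrow> point" where
  "grad f z = (pd_x f z, pd_y f z)"

definition W_grad :: "(real \<Rightarrow> real) \<Rightarrow> (point \<Rightarrow> real) \<Rightarrow> point \<Rightarrow> point" where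
  "W_grad K f z = (K (snd z) * pd_x f z, pd_y f z)"

definition multiplier_op :: "(real \<Rightarrow> real) \<Rightarrow> (real \<Rightarrow> real) \<Rightarrow> (point \<Rightarrow> real) \<Rightarrow> point \<Rightarrow> real" where
  "multiplier_op b c f z = b (fst z) * pd_x f z + c (snd z) * pd_y f z"

text \<open>The sign condition on \<open>Gamma0\<close> is imposed wherever the outward normal exists.\<close>

definition admissible_multiplier ::
  "(real \<Rightarrow> real) \<Rightarrow> real \<Rightarrow> point set \<Rightarrow> (real \<Rightarrow> real) \<Rightarrow> (real \<Rightarrow> real) \<Rightarrow> real \<Rightarrow> bool" where
  "admissible_multiplier K yc \<Omega> b c \<delta> \<longleftrightarrow>
     continuous_on (fst ` closure \<Omega>) b \<and> b C1_differentiable_on (fst ` \<Omega>) \<and>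
     continuous_on (snd ` closure \<Omega>) c \<and> c C1_differentiable_on (snd ` \<Omega>) \<and>
     0 < \<delta> \<and>
     (\<forall>(x, y)\<in>\<Omega>. - K y * deriv b x + deriv (\<lambda>s. K s * c s) y \<ge> \<delta> \<and> deriv b x - deriv c y \<ge> \<delta>) \<and>
     (\<forall>(x, y)\<in>Gamma2 K yc. b x + c y * sqrt (- K y) \<le> 0) \<and>
     (\<forall>(x, y)\<in>Gamma0 \<Omega>. \<forall>\<nu>. is_outer_normal \<Omega> (x, y) \<nu> \<longrightarrow> (b x, c y) \<bullet> \<nu> \<ge> 0)"

text \<open>For an interior facet \<open>sides M F\<close> consists of the two elements sharing \<open>F\<close>, so the
  sums below are over the two one-sided traces and do not depend on how the elements are labelled.\<close>

definition sides :: "mesh \<Rightarrow> point set \<Rightarrow> mesh" where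
  "sides M F = {T \<in> M. F \<subseteq> frontier T}"

definition boundary_elem :: "mesh \<Rightarrow> point set \<Rightarrow> point set" where
  "boundary_elem M F = (THE T. T \<in> M \<and> F \<subseteq> frontier T)"

definition average :: "mesh \<Rightarrow> point set \<Rightarrow> (point set \<Rightarrow> point \<Rightarrow> point) \<Rightarrow> point \<Rightarrow> point" where
  "average M F \<tau> z = (1/2) *\<^sub>R (\<Sum>T\<in>sides M F. \<tau> T z)"

definition jump :: "point set \<Rightarrow> mesh \<Rightarrow> point set \<Rightarrow> broken \<Rightarrow> point \<Rightarrow> point" where
  "jump \<Omega> M F \<phi> z =
     (if F \<in> interior_facets M then \<Sum>T\<in>sides M F. \<phi> T z *\<^sub>R outer_normal T z
      else \<phi> (boundary_elem M F) z *\<^sub>R outer_normal \<Omega> z)"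

definition A_h ::
  "(real \<Rightarrow> real) \<Rightarrow> real \<Rightarrow> point set \<Rightarrow> (real \<Rightarrow> real) \<Rightarrow> (real \<Rightarrow> real) \<Rightarrow> mesh \<Rightarrow> broken \<Rightarrow> broken \<Rightarrow> real" where
  "A_h K yc \<Omega> b c M u v =
     - (\<Sum>T\<in>M. LINT z:T|lborel. W_grad K (u T) z \<bullet> grad (multiplier_op b c (v T)) z)
     + (\<Sum>F\<in>interior_facets M. LINT z:F|hausdorff1.
          average M F (\<lambda>T. W_grad K (u T)) z \<bullet> jump \<Omega> M F (\<lambda>T. multiplier_op b c (v T)) z)
     + (\<Sum>F\<in>facets_D K yc \<Omega> M \<union> boundary_facets (Gamma2 K yc) M. LINT z:F|hausdorff1.
          (W_grad K (u (boundary_elem M F)) z \<bullet> outer_normal \<Omega> z)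
            * multiplier_op b c (v (boundary_elem M F)) z)"

definition A_J ::
  "(real \<Rightarrow> real) \<Rightarrow> real \<Rightarrow> point set \<Rightarrow> real \<Rightarrow> real \<Rightarrow> real \<Rightarrow> nat \<Rightarrow> mesh \<Rightarrow> broken \<Rightarrow> broken \<Rightarrow> real" where
  "A_J K yc \<Omega> \<gamma>1 \<gamma>2 \<gamma>3 p M u v =
     (\<Sum>F\<in>interior_facets M \<union> facets_D K yc \<Omega> M. \<gamma>1 / diameter F ^ 3 *
          (LINT z:F|hausdorff1. jump \<Omega> M F u z \<bullet> jump \<Omega> M F v z))
     + (\<Sum>F\<in>interior_facets M. \<gamma>2 * (real p)\<^sup>2 / diameter F * (LINT z:F|hausdorff1.
          jump \<Omega> M F (\<lambda>T. pd_x (u T)) z \<bullet> jump \<Omega> M F (\<lambda>T. pd_x (v T)) z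
          + jump \<Omega> M F (\<lambda>T. pd_y (u T)) z \<bullet> jump \<Omega> M F (\<lambda>T. pd_y (v T)) z))
     + (\<Sum>F\<in>facets_D K yc \<Omega> M. \<gamma>3 * (real p)\<^sup>2 / diameter F * (LINT z:F|hausdorff1.
          (grad (u (boundary_elem M F)) z \<bullet> tangent \<Omega> z)
            * (grad (v (boundary_elem M F)) z \<bullet> tangent \<Omega> z)))"

definition triple_norm ::
  "(real \<Rightarrow> real) \<Rightarrow> real \<Rightarrow> point set \<Rightarrow> real \<Rightarrow> real \<Rightarrow> real \<Rightarrow> real \<Rightarrow> nat \<Rightarrow> mesh \<Rightarrow> broken \<Rightarrow> real" where
  "triple_norm K yc \<Omega> \<delta> \<gamma>1 \<gamma>2 \<gamma>3 p M v = sqrt (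
     (\<Sum>T\<in>M. LINT z:T|lborel. \<delta> * ((pd_x (v T) z)\<^sup>2 + (pd_y (v T) z)\<^sup>2))
     + A_J K yc \<Omega> \<gamma>1 \<gamma>2 \<gamma>3 p M v v)"

end

(* On each element, integration by parts turns - int W grad v . grad (M v) into
   1/2 int [(-K b_x + (K c)_y) v_x^2 + (b_x - c_y) v_y^2], which is at least delta/2 int |grad v|^2,
   minus half the boundary integral of (W grad v . grad v) (m . n). On an interior facet these boundary
   terms combine with the consistency term of A_h to an expression with the factor [grad v]; on Gamma_0
   and Gamma_1 all but a nonnegative part has the factor v_t; on Gamma_2 they form a nonnegative
   multiple of a square. By Young's inequality and the discrete trace inequality the remainders cost
   3/4 of the penalty terms and delta/8 int |grad v|^2.

   The elements are only known to be star-shaped with respect to a ball. The divergence theorem on them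
   is proved in the coordinates (t, s) of a + t * rad u s, one chart for each of the four axis directions
   u, and the boundary integral is identified with a Hausdorff integral by the area formula for
   rectifiable arcs. The derivatives of K, b, c may be unbounded near the boundary, but the monotonicity
   of K and the positivity conditions on the multiplier force them to be integrable on each element. *)

theory Submission
  imports Defs
begin

section \<open>One-dimensional Hausdorff measure\<close>

text \<open>The obstacle is low regularity. An element is the unit ball of a gauge function that is
  merely Lipschitz, so its outward normal and length density exist only almost everywhere, and all
  boundary calculus rests on differentiating Lipschitz functions of one variable. The divergence
  theorem is first proved on copies of an element shrunk towards its centre, where derivatives of
  the field are bounded. Two geometric facts are derived, not assumed. Normals on the two sides of
  an interior facet are opposite, because the gauge is linear on the cone over a flat side. On a
  boundary facet the normals of the element and of the domain agree, because the domain lies on one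
  side of its boundary; this uses the Jordan curve theorem. The constant: each facet integrand is
  bounded by \<open>10 * \<beta> * s * t\<close>, with \<open>s\<close> the size of the gradient and
  \<open>t\<close> the penalised quantity. Absorbing \<open>s\<close> with weight
  \<open>\<delta> / (8 * C\<^sup>2)\<close> costs 25 * 8 = 200 times
  \<open>\<beta>\<^sup>2 * C\<^sup>2 / \<delta>\<close> on the square of \<open>t\<close>, and 3/4 *
  288 = 216 covers this.\<close>

definition hausdorff1_cover :: "real \<Rightarrow> 'a::metric_space set \<Rightarrow> (nat \<Rightarrow> 'a set) \<Rightarrow> bool" where
  "hausdorff1_cover d A C \<longleftrightarrow> A \<subseteq> (\<Union>i. C i) \<and> (\<forall>i. bounded (C i) \<and> diameter (C i) \<le> d)"

text \<open>The premeasure at scale \<open>d\<close>. It grows as \<open>d\<close> shrinks, so the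
  supremum over \<open>d\<close> is the limit at fine scales.\<close>

definition hausdorff1_scale :: "real \<Rightarrow> 'a::metric_space set \<Rightarrow> ennreal" where
  "hausdorff1_scale d A = (INF C\<in>Collect (hausdorff1_cover d A). \<Sum>i. ennreal (diameter (C i)))"

lemma hausdorff1_outer_eq: "hausdorff1_outer A = (SUP d\<in>{0<..}. hausdorff1_scale d A)"
  unfolding hausdorff1_outer_def hausdorff1_scale_def hausdorff1_cover_def by simp

lemma hausdorff1_scale_le_outer: "0 < d \<Longrightarrow> hausdorff1_scale d A \<le> hausdorff1_outer A"
  unfolding hausdorff1_outer_eq by (intro SUP_upper) auto

lemma hausdorff1_scale_le_cover:
  "hausdorff1_cover d A C \<Longrightarrow> hausdorff1_scale d A \<le> (\<Sum>i. ennreal (diameter (C i)))"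
  unfolding hausdorff1_scale_def by (intro INF_lower) auto

lemma hausdorff1_scale_mono:
  assumes "A \<subseteq> B" "d' \<le> d"
  shows "hausdorff1_scale d A \<le> hausdorff1_scale d' B"
  unfolding hausdorff1_scale_def
proof (intro INF_superset_mono subsetI)
  fix C assume "C \<in> Collect (hausdorff1_cover d' B)"
  then show "C \<in> Collect (hausdorff1_cover d A)"
    using assms by (auto simp: hausdorff1_cover_def intro: order_trans)
qed simp

lemma hausdorff1_outer_mono: "A \<subseteq> B \<Longrightarrow> hausdorff1_outer A \<le> hausdorff1_outer B"
  unfolding hausdorff1_outer_eq by (intro SUP_mono) (auto intro: hausdorff1_scale_mono)

lemma hausdorff1_outer_le:
  assumes "\<And>d. 0 < d \<Longrightarrow> \<exists>C. hausdorff1_cover d A C \<and> (\<Sum>i. ennreal (diameter (C i))) \<le> x"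
  shows "hausdorff1_outer A \<le> x"
  unfolding hausdorff1_outer_eq
proof (intro SUP_least)
  fix d :: real assume "d \<in> {0<..}"
  then obtain C where "hausdorff1_cover d A C" "(\<Sum>i. ennreal (diameter (C i))) \<le> x"
    using assms[of d] by auto
  then show "hausdorff1_scale d A \<le> x"
    using hausdorff1_scale_le_cover order_trans by blast
qed

lemma hausdorff1_outer_empty: "hausdorff1_outer ({} :: 'a::metric_space set) = 0"
proof -
  have "hausdorff1_outer ({} :: 'a set) \<le> 0"
    by (intro hausdorff1_outer_le exI[of _ "\<lambda>i. {}"]) (auto simp: hausdorff1_cover_def)
  then show ?thesis by simp
qed

lemma hausdorff1_outer_singleton: "hausdorff1_outer {x :: 'a::metric_space} = 0"
proof -
  have "hausdorff1_outer {x} \<le> 0"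
    by (intro hausdorff1_outer_le exI[of _ "\<lambda>i. {x}"]) (auto simp: hausdorff1_cover_def)
  then show ?thesis by simp
qed

text \<open>At a fixed scale, covers of the \<open>A i\<close> that are optimal up to
  \<open>e * (1/2) ^ Suc i\<close> are merged into one sequence along \<open>prod_decode\<close>;
  the errors add up to \<open>e\<close>.\<close>

lemma hausdorff1_outer_countably_subadditive:
  fixes A :: "nat \<Rightarrow> 'a::metric_space set"
  shows "hausdorff1_outer (\<Union>i. A i) \<le> (\<Sum>i. hausdorff1_outer (A i))"
  unfolding hausdorff1_outer_eq[of "\<Union>i. A i"]
proof (intro SUP_least)
  fix d :: real assume "d \<in> {0<..}"
  then have d: "0 < d" by simp
  show "hausdorff1_scale d (\<Union>i. A i) \<le> (\<Sum>i. hausdorff1_outer (A i))"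
  proof (cases "\<exists>i. hausdorff1_outer (A i) = top")
    case True
    then obtain i where "hausdorff1_outer (A i) = top" by auto
    then have "(\<Sum>i. hausdorff1_outer (A i)) = top"
      by (metis ennreal_suminf_lessD infinity_ennreal_def less_top order_less_irrefl)
    then show ?thesis by simp
  next
    case False
    show ?thesis
    proof (rule ennreal_le_epsilon)
      fix e :: real assume e: "0 < e"
      have "\<exists>C. hausdorff1_cover d (A i) C \<and>
          (\<Sum>k. ennreal (diameter (C k))) \<le> hausdorff1_outer (A i) + ennreal (e * (1/2) ^ Suc i)" for i
      proof -
        have "hausdorff1_scale d (A i) \<le> hausdorff1_outer (A i)"
          by (rule hausdorff1_scale_le_outer[OF d])
        also have "\<dots> < hausdorff1_outer (A i) + ennreal (e * (1/2) ^ Suc i)"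
          using False e by (simp add: ennreal_add_left_cancel_less less_top[symmetric])
        finally show ?thesis
          unfolding hausdorff1_scale_def INF_less_iff by (auto intro: less_imp_le)
      qed
      then obtain C where C: "\<And>i. hausdorff1_cover d (A i) (C i)"
        and sum_C: "\<And>i. (\<Sum>k. ennreal (diameter (C i k))) \<le> hausdorff1_outer (A i) + ennreal (e * (1/2) ^ Suc i)"
        by metis
      define D where "D n = (case prod_decode n of (i, k) \<Rightarrow> C i k)" for n
      have "hausdorff1_cover d (\<Union>i. A i) D"
        unfolding hausdorff1_cover_def
      proof (intro conjI allI)
        show "(\<Union>i. A i) \<subseteq> (\<Union>n. D n)"
        proof safe
          fix x i assume "x \<in> A i"
          then obtain k where "x \<in> C i k" using C[of i] by (auto simp: hausdorff1_cover_def)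
          then show "x \<in> (\<Union>n. D n)" by (auto simp: D_def intro!: exI[of _ "prod_encode (i, k)"])
        qed
      qed (use C in \<open>auto simp: hausdorff1_cover_def D_def split: prod.split\<close>)
      then have "hausdorff1_scale d (\<Union>i. A i) \<le> (\<Sum>n. ennreal (diameter (D n)))"
        by (rule hausdorff1_scale_le_cover)
      also have "\<dots> = (\<Sum>i. \<Sum>k. ennreal (diameter (C i k)))"
      proof -
        have "(\<Sum>n. ennreal (diameter (D n))) = (\<Sum>n. (\<lambda>(i, k). ennreal (diameter (C i k))) (prod_decode n))"
          by (intro suminf_cong) (auto simp: D_def split: prod.split)
        also have "\<dots> = (\<Sum>i. \<Sum>k. ennreal (diameter (C i k)))"
          by (rule suminf_ennreal_2dimen) simp
        finally show ?thesis .
      qed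
      also have "\<dots> \<le> (\<Sum>i. hausdorff1_outer (A i) + ennreal (e * (1/2) ^ Suc i))"
        by (intro suminf_le sum_C) auto
      also have "\<dots> = (\<Sum>i. hausdorff1_outer (A i)) + (\<Sum>i. ennreal (e * (1/2) ^ Suc i))"
        by (intro suminf_add[symmetric]) auto
      also have "(\<Sum>i. ennreal (e * (1/2) ^ Suc i)) = ennreal e"
      proof -
        have "(\<lambda>i. e * (1/2) ^ Suc i) sums (e * 1)"
          by (intro sums_mult power_half_series)
        then show ?thesis using e by (intro suminf_ennreal_eq) auto
      qed
      finally show "hausdorff1_scale d (\<Union>i. A i) \<le> (\<Sum>i. hausdorff1_outer (A i)) + ennreal e" .
    qed
  qed
qed

lemma hausdorff1_outer_Un_le:
  "hausdorff1_outer (A \<union> B) \<le> hausdorff1_outer A + hausdorff1_outer (B :: 'a::metric_space set)"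
proof -
  define F where "F i = (if i = 0 then A else if i = Suc 0 then B else {})" for i :: nat
  have "hausdorff1_outer (A \<union> B) \<le> hausdorff1_outer (\<Union>i. F i)"
    by (intro hausdorff1_outer_mono) (auto simp: F_def)
  also have "\<dots> \<le> (\<Sum>i. hausdorff1_outer (F i))" by (rule hausdorff1_outer_countably_subadditive)
  also have "\<dots> = (\<Sum>i<2. hausdorff1_outer (F i))"
    by (intro suminf_finite) (auto simp: F_def hausdorff1_outer_empty)
  also have "\<dots> = hausdorff1_outer A + hausdorff1_outer B"
    by (simp add: F_def numeral_2_eq_2)
  finally show ?thesis .
qed

text \<open>A covering set of diameter below \<open>\<eta>\<close> cannot meet both \<open>A\<close>
  and \<open>B\<close>. At such scales a cover of the union splits into a cover of \<open>A\<close>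
  and a cover of \<open>B\<close> that share no nonempty member.\<close>

lemma hausdorff1_outer_separated:
  fixes A B :: "'a::metric_space set"
  assumes "0 < \<eta>" and sep: "\<And>x y. x \<in> A \<Longrightarrow> y \<in> B \<Longrightarrow> \<eta> \<le> dist x y"
  shows "hausdorff1_outer A + hausdorff1_outer B \<le> hausdorff1_outer (A \<union> B)"
proof -
  have *: "hausdorff1_scale d A + hausdorff1_scale d B \<le> hausdorff1_outer (A \<union> B)" if d: "0 < d" for d
  proof -
    define d' where "d' = min d (\<eta>/2)"
    have d': "0 < d'" "d' \<le> d" "d' < \<eta>" using assms d by (auto simp: d'_def)
    have "hausdorff1_scale d' A + hausdorff1_scale d' B \<le> hausdorff1_scale d' (A \<union> B)"
      unfolding hausdorff1_scale_def[of _ "A \<union> B"]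
    proof (intro INF_greatest)
      fix C assume "C \<in> Collect (hausdorff1_cover d' (A \<union> B))"
      then have C: "hausdorff1_cover d' (A \<union> B) C" by simp
      define D where "D S i = (if C i \<inter> S = {} then {} else C i)" for S i
      have cov: "hausdorff1_cover d' A (D A)" "hausdorff1_cover d' B (D B)"
        using C d'(1) by (auto simp: hausdorff1_cover_def D_def) blast+
      have disj: "C i \<inter> A = {} \<or> C i \<inter> B = {}" for i
      proof (rule ccontr)
        assume "\<not> ?thesis"
        then obtain x y where xy: "x \<in> C i" "x \<in> A" "y \<in> C i" "y \<in> B" by auto
        then have "dist x y \<le> diameter (C i)"
          using C by (intro diameter_bounded_bound) (auto simp: hausdorff1_cover_def)
        moreover have "diameter (C i) \<le> d'" using C by (simp add: hausdorff1_cover_def)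
        ultimately show False using sep[of x y] xy d' by linarith
      qed
      have "hausdorff1_scale d' A + hausdorff1_scale d' B
          \<le> (\<Sum>i. ennreal (diameter (D A i))) + (\<Sum>i. ennreal (diameter (D B i)))"
        by (intro add_mono hausdorff1_scale_le_cover cov)
      also have "\<dots> = (\<Sum>i. ennreal (diameter (D A i)) + ennreal (diameter (D B i)))"
        by (intro suminf_add) auto
      also have "\<dots> \<le> (\<Sum>i. ennreal (diameter (C i)))"
        using disj by (intro suminf_le) (auto simp: D_def)
      finally show "hausdorff1_scale d' A + hausdorff1_scale d' B \<le> (\<Sum>i. ennreal (diameter (C i)))" .
    qed
    moreover have "hausdorff1_scale d A + hausdorff1_scale d B \<le> hausdorff1_scale d' A + hausdorff1_scale d' B"
      using d' by (intro add_mono hausdorff1_scale_mono) auto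
    ultimately show ?thesis using hausdorff1_scale_le_outer[OF d'(1), of "A \<union> B"] by order
  qed
  \<comment> \<open>The two suprema merge into one because both premeasures increase as the scale
    decreases: the smaller of two scales serves both terms.\<close>
  have "hausdorff1_outer A + hausdorff1_outer B
      = (SUP d\<in>{0<..}. hausdorff1_scale d A + hausdorff1_scale d B)"
    unfolding hausdorff1_outer_eq
  proof (intro SUP_add_directed_ennreal[symmetric])
    fix i j :: real assume "i \<in> {0<..}" "j \<in> {0<..}"
    then show "\<exists>k\<in>{0<..}. hausdorff1_scale i A + hausdorff1_scale j B
        \<le> hausdorff1_scale k A + hausdorff1_scale k B"
      by (intro bexI[of _ "min i j"] add_mono hausdorff1_scale_mono) auto
  qed
  also have "\<dots> \<le> hausdorff1_outer (A \<union> B)" using * by (intro SUP_least) auto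
  finally show ?thesis .
qed

text \<open>Finitely many positive distances have a positive minimum, so the sets can be added one
  at a time.\<close>

lemma hausdorff1_outer_separated_sum:
  fixes R :: "nat \<Rightarrow> 'a::metric_space set"
  assumes sep: "\<And>i j. i < j \<Longrightarrow> \<exists>\<eta>>0. \<forall>x\<in>R i. \<forall>y\<in>R j. \<eta> \<le> dist x y"
  shows "(\<Sum>i<n. hausdorff1_outer (R i)) \<le> hausdorff1_outer (\<Union>i<n. R i)"
proof (induction n)
  case (Suc n)
  have "\<exists>\<eta>>0. \<forall>x\<in>(\<Union>i<m. R i). \<forall>y\<in>R n. \<eta> \<le> dist x y" if "m \<le> n" for m
    using that
  proof (induction m)
    case 0 then show ?case by (auto intro: exI[of _ 1])
  next
    case (Suc m)
    then obtain \<eta>1 where 1: "\<eta>1 > 0" "\<forall>x\<in>(\<Union>i<m. R i). \<forall>y\<in>R n. \<eta>1 \<le> dist x y" by auto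
    obtain \<eta>2 where 2: "\<eta>2 > 0" "\<forall>x\<in>R m. \<forall>y\<in>R n. \<eta>2 \<le> dist x y" using sep[of m n] Suc by auto
    show ?case using 1 2 by (intro exI[of _ "min \<eta>1 \<eta>2"]) (auto simp: less_Suc_eq min_le_iff_disj)
  qed
  then obtain \<eta> where \<eta>: "\<eta> > 0" "\<forall>x\<in>(\<Union>i<n. R i). \<forall>y\<in>R n. \<eta> \<le> dist x y" by blast
  have "(\<Sum>i<Suc n. hausdorff1_outer (R i)) \<le> hausdorff1_outer (\<Union>i<n. R i) + hausdorff1_outer (R n)"
    using Suc by (simp add: add_right_mono)
  also have "\<dots> \<le> hausdorff1_outer ((\<Union>i<n. R i) \<union> R n)"
    using \<eta> by (intro hausdorff1_outer_separated[of \<eta>]) auto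
  also have "(\<Union>i<n. R i) \<union> R n = (\<Union>i<Suc n. R i)" by (auto simp: less_Suc_eq)
  finally show ?case .
qed simp

text \<open>Caratheodory's criterion: an outer measure that is additive on separated sets makes closed sets
  measurable. The points of \<open>E\<close> off \<open>F\<close> are split into the shells \<open>R k\<close>; two shells of the
  same parity are separated, hence the shells have finite total measure and the tails vanish.\<close>

lemma hausdorff1_outer_closed_split:
  fixes E F :: "'a::metric_space set"
  assumes F: "closed F"
  shows "hausdorff1_outer (E \<inter> F) + hausdorff1_outer (E - F) \<le> hausdorff1_outer E"
proof (cases "hausdorff1_outer E = top \<or> F = {}")
  case True then show ?thesis by (auto simp: hausdorff1_outer_empty)
next
  case False
  then have fin: "hausdorff1_outer E < top" and ne: "F \<noteq> {}" by (auto simp: less_top)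
  define t where "t k = 1 / real (Suc k)" for k
  define S where "S n = {x \<in> E. t n \<le> infdist x F}" for n
  define R where "R k = {x \<in> E. t (Suc k) \<le> infdist x F \<and> infdist x F < t k}" for k
  have t_anti: "i \<le> j \<Longrightarrow> t j \<le> t i" for i j by (auto simp: t_def field_simps)
  have t_strict: "i < j \<Longrightarrow> t j < t i" for i j by (auto simp: t_def field_simps)
  have t_pos: "0 < t k" for k by (simp add: t_def)
  \<comment> \<open>\<open>infdist\<close> is 1-Lipschitz. Skipping one shell leaves the gap between
    the levels \<open>t (Suc i)\<close> and \<open>t j\<close>, whereas adjacent shells may
    touch.\<close>
  have R_sep: "\<exists>\<eta>>0. \<forall>x\<in>R i. \<forall>y\<in>R j. \<eta> \<le> dist x y" if "Suc i < j" for i j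
  proof (intro exI[of _ "t (Suc i) - t j"] conjI ballI)
    show "0 < t (Suc i) - t j" using t_strict[OF that] by simp
    fix x y assume "x \<in> R i" "y \<in> R j"
    moreover have "infdist x F \<le> infdist y F + dist x y" by (rule infdist_triangle)
    ultimately show "t (Suc i) - t j \<le> dist x y" by (auto simp: R_def)
  qed
  have half: "(\<Sum>i<n. hausdorff1_outer (R (2 * i + p))) \<le> hausdorff1_outer E" for n p
  proof -
    have "(\<Sum>i<n. hausdorff1_outer (R (2 * i + p))) \<le> hausdorff1_outer (\<Union>i<n. R (2 * i + p))"
      by (intro hausdorff1_outer_separated_sum R_sep) auto
    also have "\<dots> \<le> hausdorff1_outer E" by (intro hausdorff1_outer_mono) (auto simp: R_def)
    finally show ?thesis .
  qed
  have part: "(\<Sum>k<2 * n. hausdorff1_outer (R k)) \<le> hausdorff1_outer E + hausdorff1_outer E" for n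
  proof -
    have "(\<Sum>k<2 * n. hausdorff1_outer (R k))
        = (\<Sum>i<n. hausdorff1_outer (R (2 * i + 0))) + (\<Sum>i<n. hausdorff1_outer (R (2 * i + 1)))"
      by (induction n) (auto simp: algebra_simps)
    also have "\<dots> \<le> hausdorff1_outer E + hausdorff1_outer E" by (intro add_mono half)
    finally show ?thesis .
  qed
  have "(\<Sum>k. hausdorff1_outer (R k)) \<le> hausdorff1_outer E + hausdorff1_outer E"
    unfolding suminf_eq_SUP
  proof (intro SUP_least)
    fix n
    have "(\<Sum>k<n. hausdorff1_outer (R k)) \<le> (\<Sum>k<2 * n. hausdorff1_outer (R k))"
      by (intro sum_mono2) auto
    then show "(\<Sum>k<n. hausdorff1_outer (R k)) \<le> hausdorff1_outer E + hausdorff1_outer E"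
      using part[of n] by order
  qed
  then have sum_fin: "(\<Sum>k. hausdorff1_outer (R k)) < top"
    using fin by (meson ennreal_add_less_top order_le_less_trans)
  have tail: "(\<lambda>n. \<Sum>k. hausdorff1_outer (R (k + n))) \<longlonglongrightarrow> 0"
  proof -
    have "\<And>k. hausdorff1_outer (R k) < top"
      using sum_fin ennreal_suminf_lessD by blast
    then have f: "\<And>k. hausdorff1_outer (R k) = ennreal (f k)" "\<And>k. 0 \<le> f k"
      if "f = (\<lambda>k. enn2real (hausdorff1_outer (R k)))" for f using that by simp_all
    define f where "f = (\<lambda>k. enn2real (hausdorff1_outer (R k)))"
    note f = f[OF f_def]
    have sf: "summable f"
      using sum_fin f by (auto intro!: summable_suminf_not_top simp: less_top)
    have "(\<lambda>n. \<Sum>k. f (k + n)) \<longlonglongrightarrow> 0" using suminf_exist_split2[OF sf] .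
    then have "(\<lambda>n. ennreal (\<Sum>k. f (k + n))) \<longlonglongrightarrow> ennreal 0" by (rule tendsto_ennrealI)
    moreover have "(\<Sum>k. hausdorff1_outer (R (k + n))) = ennreal (\<Sum>k. f (k + n))" for n
      unfolding f(1) using sf f(2) by (intro suminf_ennreal2) (auto simp: summable_iff_shift)
    ultimately show ?thesis by simp
  qed
  have main: "hausdorff1_outer (E \<inter> F) + hausdorff1_outer (E - F)
      \<le> hausdorff1_outer E + (\<Sum>k. hausdorff1_outer (R (k + n)))" for n
  proof -
    have sub: "E - F \<subseteq> S n \<union> (\<Union>k. R (k + n))"
    proof
      fix x assume x: "x \<in> E - F"
      then have pos: "0 < infdist x F"
        using F ne in_closed_iff_infdist_zero[of F x] infdist_nonneg[of x F] by auto
      then obtain m where m: "t m \<le> infdist x F"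
        using reals_Archimedean[OF pos] by (force simp: t_def inverse_eq_divide intro: less_imp_le)
      show "x \<in> S n \<union> (\<Union>k. R (k + n))"
      proof (cases "t n \<le> infdist x F")
        case True then show ?thesis using x by (auto simp: S_def)
      next
        case False
        \<comment> \<open>The first level not exceeding the distance of \<open>x\<close>. As
          \<open>x\<close> is closer than \<open>t n\<close>, this level comes after
          \<open>n\<close>, and \<open>x\<close> lies in the shell that it bounds from
          below.\<close>
        define k where "k = (LEAST k. t k \<le> infdist x F)"
        have k: "t k \<le> infdist x F" unfolding k_def using m by (rule LeastI)
        have "n < k" using False k t_anti[of k n] by (meson linorder_not_le order_trans)
        then obtain j where j: "k = Suc (j + n)" by (metis add.commute less_imp_Suc_add)
        have "\<not> t (j + n) \<le> infdist x F" using j unfolding k_def by (metis lessI not_less_Least)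
        then have "x \<in> R (j + n)" using x k j by (auto simp: R_def)
        then show ?thesis by blast
      qed
    qed
    have "hausdorff1_outer (E - F) \<le> hausdorff1_outer (S n \<union> (\<Union>k. R (k + n)))"
      by (rule hausdorff1_outer_mono[OF sub])
    also have "\<dots> \<le> hausdorff1_outer (S n) + hausdorff1_outer (\<Union>k. R (k + n))"
      by (rule hausdorff1_outer_Un_le)
    also have "\<dots> \<le> hausdorff1_outer (S n) + (\<Sum>k. hausdorff1_outer (R (k + n)))"
      by (intro add_left_mono hausdorff1_outer_countably_subadditive)
    finally have 1: "hausdorff1_outer (E - F) \<le> hausdorff1_outer (S n) + (\<Sum>k. hausdorff1_outer (R (k + n)))" .
    have "hausdorff1_outer (E \<inter> F) + hausdorff1_outer (S n) \<le> hausdorff1_outer ((E \<inter> F) \<union> S n)"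
    proof (rule hausdorff1_outer_separated[OF t_pos[of n]])
      fix x y assume "x \<in> E \<inter> F" "y \<in> S n"
      then show "t n \<le> dist x y"
        using infdist_le[of x F y] by (auto simp: S_def dist_commute)
    qed
    also have "\<dots> \<le> hausdorff1_outer E" by (intro hausdorff1_outer_mono) (auto simp: S_def)
    finally have 2: "hausdorff1_outer (E \<inter> F) + hausdorff1_outer (S n) \<le> hausdorff1_outer E" .
    have "hausdorff1_outer (E \<inter> F) + hausdorff1_outer (E - F)
        \<le> hausdorff1_outer (E \<inter> F) + (hausdorff1_outer (S n) + (\<Sum>k. hausdorff1_outer (R (k + n))))"
      by (intro add_left_mono 1)
    also have "\<dots> \<le> hausdorff1_outer E + (\<Sum>k. hausdorff1_outer (R (k + n)))"
      using 2 by (simp add: add.assoc[symmetric] add_right_mono)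
    finally show ?thesis .
  qed
  have "(\<lambda>n. hausdorff1_outer E + (\<Sum>k. hausdorff1_outer (R (k + n)))) \<longlonglongrightarrow> hausdorff1_outer E + 0"
    by (intro tendsto_add tendsto_const tail)
  then show ?thesis using main by (intro LIMSEQ_le_const[of _ "hausdorff1_outer E"]) auto
qed

section \<open>Measurable sets and null sets of the Hausdorff measure\<close>

definition caratheodory_sets :: "'a::metric_space set set" where
  "caratheodory_sets =
     {A. \<forall>E. hausdorff1_outer (E \<inter> A) + hausdorff1_outer (E - A) = hausdorff1_outer (E :: 'a set)}"

lemma measure_space_hausdorff1:
  "measure_space UNIV (caratheodory_sets :: 'a::metric_space set set) hausdorff1_outer"
proof -
  have oms: "outer_measure_space (Pow UNIV) (hausdorff1_outer :: 'a set \<Rightarrow> ennreal)"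
    unfolding outer_measure_space_def positive_def increasing_def countably_subadditive_def
    using hausdorff1_outer_countably_subadditive
    by (auto simp: hausdorff1_outer_empty hausdorff1_outer_mono)
  have "caratheodory_sets = lambda_system UNIV (Pow UNIV) (hausdorff1_outer :: 'a set \<Rightarrow> ennreal)"
    unfolding caratheodory_sets_def lambda_system_def
    by (auto simp: Int_commute Diff_eq)
  then show ?thesis
    using sigma_algebra.caratheodory_lemma[OF sigma_algebra_Pow oms] by simp
qed

lemma space_hausdorff1 [simp]: "space hausdorff1 = UNIV"
  by (simp add: hausdorff1_def space_measure_of_conv)

lemma sets_hausdorff1: "sets hausdorff1 = caratheodory_sets"
proof -
  have "sigma_algebra UNIV (caratheodory_sets :: 'a set set)"
    using measure_space_hausdorff1 unfolding measure_space_def by (rule conjunct1)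
  then show ?thesis
    unfolding hausdorff1_def caratheodory_sets_def[symmetric]
    by (simp add: sets_measure_of_conv sigma_algebra.sigma_sets_eq)
qed

lemma emeasure_hausdorff1: "A \<in> sets hausdorff1 \<Longrightarrow> emeasure hausdorff1 A = hausdorff1_outer A"
proof -
  assume A: "A \<in> sets hausdorff1"
  have sa: "sigma_algebra UNIV (caratheodory_sets :: 'a set set)"
    and "positive caratheodory_sets (hausdorff1_outer :: 'a set \<Rightarrow> ennreal)"
    and "countably_additive caratheodory_sets (hausdorff1_outer :: 'a set \<Rightarrow> ennreal)"
    using measure_space_hausdorff1 by (auto simp: measure_space_def)
  then show ?thesis
    using A emeasure_measure_of_sigma[OF sa]
    by (simp add: sets_hausdorff1) (simp add: hausdorff1_def caratheodory_sets_def)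
qed

lemma borel_imp_hausdorff1: "A \<in> sets borel \<Longrightarrow> A \<in> sets hausdorff1"
proof -
  assume "A \<in> sets borel"
  moreover have "sets borel \<subseteq> sets (hausdorff1 :: 'a measure)"
  proof -
    have "Collect closed \<subseteq> sets (hausdorff1 :: 'a measure)"
    proof
      fix F :: "'a set" assume "F \<in> Collect closed"
      then have "hausdorff1_outer (E \<inter> F) + hausdorff1_outer (E - F) = hausdorff1_outer E" for E
        using hausdorff1_outer_closed_split[of F E] hausdorff1_outer_Un_le[of "E \<inter> F" "E - F"]
        by (simp add: Int_Diff_Un antisym)
      then show "F \<in> sets hausdorff1" by (simp add: sets_hausdorff1 caratheodory_sets_def)
    qed
    then have "sigma_sets UNIV (Collect closed) \<subseteq> sets (hausdorff1 :: 'a measure)"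
      using sets.sigma_sets_subset[of "Collect closed" "hausdorff1 :: 'a measure"] by simp
    then show ?thesis by (simp add: borel_eq_closed)
  qed
  ultimately show ?thesis by blast
qed

lemma borel_measurable_hausdorff1: "f \<in> borel_measurable borel \<Longrightarrow> f \<in> borel_measurable hausdorff1"
  using borel_imp_hausdorff1 by (auto simp: measurable_def)

text \<open>Caratheodory's construction gives a complete measure: a set of outer measure zero splits
  every test set additively.\<close>

lemma hausdorff1_null_set: "hausdorff1_outer A = 0 \<Longrightarrow> A \<in> null_sets hausdorff1"
proof -
  assume 0: "hausdorff1_outer A = 0"
  have "hausdorff1_outer (E \<inter> A) + hausdorff1_outer (E - A) = hausdorff1_outer E" for E
  proof (rule antisym)
    have "hausdorff1_outer (E \<inter> A) = 0" using hausdorff1_outer_mono[of "E \<inter> A" A] 0 by auto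
    then show "hausdorff1_outer (E \<inter> A) + hausdorff1_outer (E - A) \<le> hausdorff1_outer E"
      using hausdorff1_outer_mono[of "E - A" E] by auto
    show "hausdorff1_outer E \<le> hausdorff1_outer (E \<inter> A) + hausdorff1_outer (E - A)"
      using hausdorff1_outer_Un_le[of "E \<inter> A" "E - A"] by (simp add: Int_Diff_Un)
  qed
  then have "A \<in> sets hausdorff1" by (simp add: sets_hausdorff1 caratheodory_sets_def)
  then show ?thesis using 0 by (auto simp: emeasure_hausdorff1 null_sets_def)
qed

lemma hausdorff1_null_subset: "A \<subseteq> B \<Longrightarrow> B \<in> null_sets hausdorff1 \<Longrightarrow> A \<in> null_sets hausdorff1"
  using hausdorff1_outer_mono[of A B] by (intro hausdorff1_null_set) (auto simp: null_sets_def emeasure_hausdorff1)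

lemma finite_null_hausdorff1: "finite A \<Longrightarrow> A \<in> null_sets hausdorff1"
proof (induction A rule: finite_induct)
  case (insert x A)
  have "{x} \<union> A \<in> null_sets hausdorff1"
    using insert hausdorff1_null_set[OF hausdorff1_outer_singleton] by (intro null_sets.Un)
  then show ?case by simp
qed auto

text \<open>The distance from \<open>u\<close> is 1-Lipschitz and maps the connected set
  \<open>A\<close> onto a set containing the interval from 0 to \<open>dist u v\<close>. A cover of
  \<open>A\<close> thus induces a cover of that interval by intervals \<open>J i\<close> whose
  lengths are the diameters.\<close>

lemma hausdorff1_outer_connected:
  fixes A :: "'a::metric_space set"
  assumes A: "connected A" "u \<in> A" "v \<in> A"
  shows "ennreal (dist u v) \<le> hausdorff1_outer A"
proof -
  have "ennreal (dist u v) \<le> (\<Sum>i. ennreal (diameter (C i)))" if C: "hausdorff1_cover 1 A C" for C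
  proof -
    define J where "J i = (if C i = {} then {} else
      {Inf (dist u ` C i) .. Inf (dist u ` C i) + diameter (C i)})" for i
    have bnd: "bounded (C i)" for i using C by (auto simp: hausdorff1_cover_def)
    have "{0..dist u v} \<subseteq> (\<Union>i. J i)"
    proof
      fix s assume s: "s \<in> {0..dist u v}"
      have "connected (dist u ` A)"
        by (intro connected_continuous_image continuous_intros A)
      then have "s \<in> dist u ` A"
        using connected_contains_Icc[of "dist u ` A" 0 "dist u v"] imageI[OF A(2), of "dist u"] A(3) s
        by (metis dist_self imageI subsetD)
      then obtain x where x: "x \<in> A" "s = dist u x" by auto
      then obtain i where i: "x \<in> C i" using C by (auto simp: hausdorff1_cover_def)
      have "Inf (dist u ` C i) \<le> dist u x"
        using i by (intro cInf_lower) (auto intro: bdd_belowI[of _ 0])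
      moreover have "dist u x - diameter (C i) \<le> Inf (dist u ` C i)"
      proof (rule cInf_greatest)
        fix r assume "r \<in> dist u ` C i"
        then obtain y where y: "y \<in> C i" "r = dist u y" by auto
        have "dist x y \<le> diameter (C i)" by (rule diameter_bounded_bound[OF bnd i y(1)])
        then show "dist u x - diameter (C i) \<le> r"
          using dist_triangle[of u x y] y by (simp add: dist_commute)
      qed (use i in auto)
      ultimately have "s \<in> J i" using x i by (auto simp: J_def)
      then show "s \<in> (\<Union>i. J i)" by blast
    qed
    then have "emeasure lborel {0..dist u v} \<le> emeasure lborel (\<Union>i. J i)"
      by (intro emeasure_mono) (auto simp: J_def)
    also have "\<dots> \<le> (\<Sum>i. emeasure lborel (J i))"
      by (intro emeasure_subadditive_countably) (auto simp: J_def)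
    also have "\<dots> \<le> (\<Sum>i. ennreal (diameter (C i)))"
      by (intro suminf_le) (auto simp: J_def diameter_ge_0 bnd)
    finally show ?thesis by simp
  qed
  \<comment> \<open>The estimate does not depend on the scale, and any one scale bounds the supremum
    from below.\<close>
  then have "ennreal (dist u v) \<le> hausdorff1_scale 1 A"
    unfolding hausdorff1_scale_def by (intro INF_greatest) auto
  then show ?thesis using hausdorff1_scale_le_outer[of 1 A] by simp
qed

text \<open>\<open>l\<close> plays the role of arc length. Equal pieces of the parameter interval
  have images of diameter at most the increment of \<open>l\<close>; the increments telescope, and
  \<open>lip\<close> makes them as small as the scale demands.\<close>

lemma hausdorff1_outer_curve_le:
  fixes \<gamma> :: "real \<Rightarrow> 'a::metric_space"
  assumes ab: "\<alpha> \<le> \<beta>"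
    and len: "\<And>s t. \<alpha> \<le> s \<Longrightarrow> s \<le> t \<Longrightarrow> t \<le> \<beta> \<Longrightarrow> dist (\<gamma> s) (\<gamma> t) \<le> l t - l s"
    and lip: "\<And>s t. \<alpha> \<le> s \<Longrightarrow> s \<le> t \<Longrightarrow> t \<le> \<beta> \<Longrightarrow> l t - l s \<le> L * (t - s)"
  shows "hausdorff1_outer (\<gamma> ` {\<alpha>..\<beta>}) \<le> ennreal (l \<beta> - l \<alpha>)"
proof (rule hausdorff1_outer_le)
  fix d :: real assume d: "0 < d"
  obtain n :: nat where n: "L * (\<beta> - \<alpha>) / d < real n" "0 < n"
    by (metis reals_Archimedean2 gr0I less_trans of_nat_0 of_nat_0_less_iff zero_less_one not_less_iff_gr_or_eq order_less_le_trans linorder_not_le of_nat_1 of_nat_less_iff)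
  define \<sigma> where "\<sigma> i = \<alpha> + real i * ((\<beta> - \<alpha>) / real n)" for i
  have \<sigma>_mono: "i \<le> j \<Longrightarrow> \<sigma> i \<le> \<sigma> j" for i j
    using ab unfolding \<sigma>_def by (intro add_left_mono mult_right_mono) auto
  have \<sigma>0: "\<sigma> 0 = \<alpha>" and \<sigma>n: "\<sigma> n = \<beta>" using n by (auto simp: \<sigma>_def)
  have \<sigma>_in: "i \<le> n \<Longrightarrow> \<alpha> \<le> \<sigma> i \<and> \<sigma> i \<le> \<beta>" for i
    using \<sigma>_mono[of 0 i] \<sigma>_mono[of i n] \<sigma>0 \<sigma>n by auto
  define C where "C i = (if i < n then \<gamma> ` {\<sigma> i..\<sigma> (Suc i)} else {})" for i
  have dist_C: "dist x y \<le> l (\<sigma> (Suc i)) - l (\<sigma> i)" if "i < n" "x \<in> C i" "y \<in> C i" for i x y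
  proof -
    have 1: "\<alpha> \<le> \<sigma> i" "\<sigma> (Suc i) \<le> \<beta>" using \<sigma>_in[of i] \<sigma>_in[of "Suc i"] that by auto
    have *: "dist (\<gamma> s) (\<gamma> t) \<le> l (\<sigma> (Suc i)) - l (\<sigma> i)" if st: "\<sigma> i \<le> s" "s \<le> t" "t \<le> \<sigma> (Suc i)" for s t
    proof -
      have "dist (\<gamma> s) (\<gamma> t) \<le> l t - l s" using st 1 by (intro len) auto
      moreover have "0 \<le> l s - l (\<sigma> i)" using len[of "\<sigma> i" s] st 1 by (smt (verit) zero_le_dist)
      moreover have "0 \<le> l (\<sigma> (Suc i)) - l t" using len[of t "\<sigma> (Suc i)"] st 1 by (smt (verit) zero_le_dist)
      ultimately show ?thesis by linarith
    qed
    have "x \<in> \<gamma> ` {\<sigma> i..\<sigma> (Suc i)}" "y \<in> \<gamma> ` {\<sigma> i..\<sigma> (Suc i)}"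
      using that by (auto simp: C_def)
    then obtain s t where st: "x = \<gamma> s" "y = \<gamma> t" "s \<in> {\<sigma> i..\<sigma> (Suc i)}" "t \<in> {\<sigma> i..\<sigma> (Suc i)}"
      by blast
    show ?thesis
      using *[of s t] *[of t s] st by (cases "s \<le> t") (auto simp: dist_commute)
  qed
  have l_step: "0 \<le> l (\<sigma> (Suc i)) - l (\<sigma> i)" if "i < n" for i
    using len[of "\<sigma> i" "\<sigma> (Suc i)"] \<sigma>_in[of i] \<sigma>_in[of "Suc i"] \<sigma>_mono[of i "Suc i"] that
    by (smt (verit) zero_le_dist Suc_leI less_imp_le le_SucI order_refl)
  have diam_C: "diameter (C i) \<le> l (\<sigma> (Suc i)) - l (\<sigma> i)" if "i < n" for i
    unfolding diameter_def using dist_C[OF that] l_step[OF that] by (auto intro!: cSUP_least)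
  have step_d: "l (\<sigma> (Suc i)) - l (\<sigma> i) \<le> d" if "i < n" for i
  proof -
    have "l (\<sigma> (Suc i)) - l (\<sigma> i) \<le> L * (\<sigma> (Suc i) - \<sigma> i)"
      using \<sigma>_in[of i] \<sigma>_in[of "Suc i"] \<sigma>_mono[of i "Suc i"] that by (intro lip) auto
    also have "\<sigma> (Suc i) - \<sigma> i = (\<beta> - \<alpha>) / real n" by (simp add: \<sigma>_def distrib_right add_divide_distrib)
    also have "L * ((\<beta> - \<alpha>) / real n) \<le> d" using n d by (simp add: field_simps)
    finally show ?thesis .
  qed
  have "hausdorff1_cover d (\<gamma> ` {\<alpha>..\<beta>}) C"
    unfolding hausdorff1_cover_def
  proof (intro conjI allI subsetI)
    fix x assume "x \<in> \<gamma> ` {\<alpha>..\<beta>}"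
    then obtain s where s: "x = \<gamma> s" "\<alpha> \<le> s" "s \<le> \<beta>" by auto
    have "\<exists>i<n. \<sigma> i \<le> s \<and> s \<le> \<sigma> (Suc i)"
    proof (rule ccontr)
      assume c: "\<not> ?thesis"
      have "i \<le> n \<Longrightarrow> \<sigma> i \<le> s \<and> (0 < i \<longrightarrow> \<sigma> i < s)" for i
        by (induction i) (use c s \<sigma>0 in \<open>auto simp: not_le Suc_le_eq\<close>)
      from this[of n] show False using n s \<sigma>n by auto
    qed
    then show "x \<in> (\<Union>i. C i)" using s by (auto simp: C_def)
  next
    fix i
    show "bounded (C i)"
    proof (cases "i < n")
      case True then show ?thesis
        using dist_C[OF True] by (metis bounded_any_center bounded_def)
    qed (simp add: C_def)
    show "diameter (C i) \<le> d"
      using diam_C[of i] step_d[of i] d by (cases "i < n") (auto simp: C_def)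
  qed
  moreover have "(\<Sum>i. ennreal (diameter (C i))) \<le> ennreal (l \<beta> - l \<alpha>)"
  proof -
    have "(\<Sum>i. ennreal (diameter (C i))) = (\<Sum>i<n. ennreal (diameter (C i)))"
      by (intro suminf_finite) (auto simp: C_def)
    also have "\<dots> \<le> (\<Sum>i<n. ennreal (l (\<sigma> (Suc i)) - l (\<sigma> i)))"
      by (intro sum_mono ennreal_leI diam_C) auto
    also have "\<dots> = ennreal (\<Sum>i<n. l (\<sigma> (Suc i)) - l (\<sigma> i))"
      by (intro sum_ennreal) (use l_step in auto)
    also have "(\<Sum>i<n. l (\<sigma> (Suc i)) - l (\<sigma> i)) = l \<beta> - l \<alpha>"
      using sum_lessThan_telescope[of "\<lambda>i. l (\<sigma> i)" n] by (simp add: \<sigma>0 \<sigma>n)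
    finally show ?thesis .
  qed
  ultimately show "\<exists>C. hausdorff1_cover d (\<gamma> ` {\<alpha>..\<beta>}) C \<and> (\<Sum>i. ennreal (diameter (C i))) \<le> ennreal (l \<beta> - l \<alpha>)"
    by blast
qed

section \<open>Lipschitz functions of one variable and rectifiable arcs\<close>

text \<open>For \<open>F x = f x + (L + 1) * x\<close> the inverse of \<open>F\<close> pushes Lebesgue measure forward to an absolutely
  continuous measure, because Lipschitz maps preserve null sets. Its density is the derivative of
  \<open>F\<close> at every one-sided Lebesgue point from both sides.\<close>

lemma lipschitz_real_FTC:
  fixes f :: "real \<Rightarrow> real"
  assumes lip: "L-lipschitz_on UNIV f"
  obtains g where "g \<in> borel_measurable borel"
    "\<And>x y. x \<le> y \<Longrightarrow> set_integrable lborel {x..y} g"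
    "\<And>x y. x \<le> y \<Longrightarrow> (LINT t:{x..y}|lborel. g t) = f y - f x"
    "AE x in lborel. (f has_real_derivative g x) (at x)"
proof -
  have L: "0 \<le> L" using lip by (rule lipschitz_on_nonneg)
  have f_le: "\<bar>f x - f y\<bar> \<le> L * \<bar>x - y\<bar>" for x y
    using lipschitz_onD[OF lip, of x y] by (simp add: dist_real_def)
  \<comment> \<open>The added slope makes \<open>F\<close> expanding: its difference quotients lie
    between 1 and \<open>2 * L + 1\<close>, so it is a bijection of the line with a 1-Lipschitz
    inverse.\<close>
  define F where "F x = f x + (L + 1) * x" for x
  have F_inc: "y - x \<le> F y - F x" if "x \<le> y" for x y
    using f_le[of x y] that by (auto simp: F_def algebra_simps)
  have F_dec: "F y - F x \<le> (2 * L + 1) * (y - x)" if "x \<le> y" for x y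
    using f_le[of x y] that by (auto simp: F_def algebra_simps)
  have F_dist: "\<bar>x - y\<bar> \<le> \<bar>F x - F y\<bar>" "\<bar>F x - F y\<bar> \<le> (2 * L + 1) * \<bar>x - y\<bar>" for x y
    using F_inc[of x y] F_inc[of y x] F_dec[of x y] F_dec[of y x] L by (cases "x \<le> y"; simp)+
  have F_cont: "continuous_on A F" for A
  proof -
    have "(2 * L + 1)-lipschitz_on A F"
      using F_dist(2) L by (intro lipschitz_onI) (auto simp: dist_real_def)
    then show ?thesis by (rule lipschitz_on_continuous_on)
  qed
  have F_mono: "F x \<le> F y \<longleftrightarrow> x \<le> y" for x y
    using F_inc[of x y] F_inc[of y x] by (cases "x \<le> y") auto
  have F_inj: "F x = F y \<longleftrightarrow> x = y" for x y using F_mono[of x y] F_mono[of y x] by auto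
  have F_surj: "\<exists>x. F x = z" for z
  proof -
    have 1: "z \<le> F (max 0 (z - F 0))" using F_inc[of 0 "max 0 (z - F 0)"] by auto
    have 2: "F (min 0 (z - F 0)) \<le> z" using F_inc[of "min 0 (z - F 0)" 0] by auto
    show ?thesis
      using IVT'[OF 2 1 _ F_cont] by (meson min.cobounded1 max.cobounded1 order_trans)
  qed
  define G where "G = inv F"
  have FG: "F (G z) = z" for z unfolding G_def using F_surj[of z] by (metis f_inv_into_f rangeI)
  have GF: "G (F x) = x" for x using FG[of "F x"] F_inj by simp
  have "1-lipschitz_on UNIV G"
    using F_dist(1)[of "G _" "G _"] by (intro lipschitz_onI) (auto simp: dist_real_def FG)
  then have G_meas [measurable]: "G \<in> borel_measurable borel"
    by (intro borel_measurable_continuous_onI) (rule lipschitz_on_continuous_on)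
  define \<mu> where "\<mu> = distr lborel borel G"
  have G_vimage: "G -` A = F ` A" for A
  proof (intro set_eqI iffI)
    fix z assume "z \<in> G -` A" then show "z \<in> F ` A" using FG[of z] by (intro image_eqI[of _ _ "G z"]) auto
  next
    fix z assume "z \<in> F ` A" then show "z \<in> G -` A" by (auto simp: GF)
  qed
  have "absolutely_continuous lborel \<mu>"
    unfolding absolutely_continuous_def
  proof
    fix N :: "real set" assume N: "N \<in> null_sets lborel"
    have "negligible (F ` N)"
    proof (rule negligible_locally_Lipschitz_image)
      show "negligible N" using N by (simp add: negligible_iff_null_sets null_sets_completionI)
      fix x assume "x \<in> N"
      show "\<exists>T B. open T \<and> x \<in> T \<and> (\<forall>y\<in>N \<inter> T. norm (F y - F x) \<le> B * norm (y - x))"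
        using F_dist(2) by (intro exI[of _ UNIV] exI[of _ "2 * L + 1"]) auto
    qed auto
    moreover have "F ` N \<in> sets borel"
      using N measurable_sets[OF G_meas, of N] by (auto simp: G_vimage null_sets_def)
    ultimately have "emeasure lborel (F ` N) = 0"
      by (simp add: negligible_iff_null_sets null_sets_def)
    then show "N \<in> null_sets \<mu>"
      using N by (auto simp: \<mu>_def null_sets_def emeasure_distr G_vimage)
  qed
  then obtain h where h[measurable]: "h \<in> borel_measurable lborel" and dens: "density lborel h = \<mu>"
    using sigma_finite_measure.Radon_Nikodym[OF sigma_finite_lborel, of \<mu>] by (auto simp: \<mu>_def)
  define g0 where "g0 x = enn2real (h x)" for x
  have g0_meas[measurable]: "g0 \<in> borel_measurable borel"
  proof -
    have "h \<in> borel_measurable borel" using h by simp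
    then show ?thesis unfolding g0_def by measurable
  qed
  have nn: "(\<integral>\<^sup>+t. h t * indicator {x..y} t \<partial>lborel) = ennreal (F y - F x)" if "x \<le> y" for x y
  proof -
    have "(\<integral>\<^sup>+t. h t * indicator {x..y} t \<partial>lborel) = emeasure \<mu> {x..y}"
      unfolding dens[symmetric] by (simp add: emeasure_density)
    also have "\<dots> = emeasure lborel (F ` {x..y})"
      by (simp add: \<mu>_def emeasure_distr G_vimage)
    also have "F ` {x..y} = {F x..F y}"
    proof (intro set_eqI iffI)
      fix z assume "z \<in> F ` {x..y}" then show "z \<in> {F x..F y}" by (auto simp: F_mono)
    next
      fix z assume "z \<in> {F x..F y}" then show "z \<in> F ` {x..y}"
        using FG[of z] F_mono[of x "G z"] F_mono[of "G z" y] by (intro image_eqI[of _ _ "G z"]) auto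
    qed
    finally show ?thesis using that by (simp add: F_mono)
  qed
  have h_fin: "AE t in lborel. h t \<noteq> top"
  proof -
    have "AE t in lborel. h t * indicator {- real n..real n} t \<noteq> \<infinity>" for n
      by (rule nn_integral_PInf_AE) (use nn[of "- real n" "real n"] in auto)
    then have "AE t in lborel. \<forall>n. h t * indicator {- real n..real n} t \<noteq> \<infinity>"
      by (simp add: AE_all_countable)
    then show ?thesis
    proof eventually_elim
      case (elim t)
      obtain n :: nat where "\<bar>t\<bar> \<le> real n" using real_arch_simple by blast
      then show ?case using elim[rule_format, of n] by (auto simp: indicator_def ennreal_top_mult split: if_splits)
    qed
  qed
  have nn0: "(\<integral>\<^sup>+t. ennreal (indicator {x..y} t *\<^sub>R g0 t) \<partial>lborel) = ennreal (F y - F x)" if "x \<le> y" for x y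
  proof -
    have "(\<integral>\<^sup>+t. ennreal (indicator {x..y} t *\<^sub>R g0 t) \<partial>lborel) = (\<integral>\<^sup>+t. h t * indicator {x..y} t \<partial>lborel)"
      using h_fin by (intro nn_integral_cong_AE) (auto simp: g0_def indicator_def less_top[symmetric])
    then show ?thesis using nn[OF that] by simp
  qed
  have int0: "set_integrable lborel {x..y} g0" if "x \<le> y" for x y
    unfolding set_integrable_def
    by (rule integrableI_nonneg) (use nn0[OF that] in \<open>auto simp: g0_def\<close>)
  have eq0: "(LINT t:{x..y}|lborel. g0 t) = F y - F x" if "x \<le> y" for x y
    unfolding set_lebesgue_integral_def
    by (subst integral_eq_nn_integral) (use nn0[OF that] that in \<open>auto simp: g0_def F_mono\<close>)
  have hk_int: "g0 integrable_on {x..y}" and hk_eq: "integral {x..y} g0 = F y - F x" if "x \<le> y" for x y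
    using set_borel_integral_eq_integral[OF int0[OF that]] eq0[OF that] by auto
  have hk_int': "g0 integrable_on cbox x y" for x y
    using hk_int[of x y] by (cases "x \<le> y") auto
  obtain N where N: "negligible N" "\<And>x e. x \<notin> N \<Longrightarrow> 0 < e \<Longrightarrow>
      \<exists>d>0. \<forall>h. 0 < h \<and> h < d \<longrightarrow> norm (integral (cbox x (x + h *\<^sub>R One)) g0 /\<^sub>R h ^ DIM(real) - g0 x) < e"
    using integrable_ccontinuous_explicit[of g0] hk_int' by blast
  \<comment> \<open>The averages above run over intervals to the right of \<open>x\<close>. Applied
    to the reflected density, the same statement controls the averages to the left, and both are
    needed for a two-sided derivative.\<close>
  have refl_int: "(\<lambda>x. g0 (- x)) integrable_on cbox x y" for x y
    using hk_int'[of "- y" "- x"] integrable_reflect[of g0 "- x" "- y"] by (simp only: minus_minus)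
  obtain N' where N': "negligible N'" "\<And>x e. x \<notin> N' \<Longrightarrow> 0 < e \<Longrightarrow>
      \<exists>d>0. \<forall>h. 0 < h \<and> h < d \<longrightarrow> norm (integral (cbox x (x + h *\<^sub>R One)) (\<lambda>x. g0 (- x)) /\<^sub>R h ^ DIM(real) - g0 (- x)) < e"
    using integrable_ccontinuous_explicit[of "\<lambda>x. g0 (- x)"] refl_int by blast
  have deriv_F: "(F has_real_derivative g0 x) (at x)" if x: "x \<notin> N" "- x \<notin> N'" for x
    unfolding has_field_derivative_def DERIV_def LIM_eq
  proof -
    have "\<exists>d>0. \<forall>k. k \<noteq> 0 \<and> \<bar>k\<bar> < d \<longrightarrow> \<bar>(F (x + k) - F x) / k - g0 x\<bar> < e" if e: "0 < e" for e
    proof -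
      obtain d1 where d1: "d1 > 0" "\<And>k. 0 < k \<Longrightarrow> k < d1 \<Longrightarrow> \<bar>integral {x..x + k} g0 / k - g0 x\<bar> < e"
        using N(2)[OF x(1) e] by (auto simp: divide_inverse_commute)
      obtain d2 where d2: "d2 > 0" "\<And>k. 0 < k \<Longrightarrow> k < d2 \<Longrightarrow> \<bar>integral {-x..-x + k} (\<lambda>x. g0 (- x)) / k - g0 x\<bar> < e"
        using N'(2)[OF x(2) e] by (auto simp: divide_inverse_commute)
      have "\<bar>(F (x + k) - F x) / k - g0 x\<bar> < e" if k: "k \<noteq> 0" "\<bar>k\<bar> < min d1 d2" for k
      proof (cases "0 < k")
        case True
        then show ?thesis using d1(2)[of k] hk_eq[of x "x + k"] k by auto
      next
        case False
        have "integral {- x..- (x + k)} (\<lambda>x. g0 (- x)) = integral {x + k..x} g0"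
          using integral_reflect[of x "x + k" g0] by simp
        also have "\<dots> = F x - F (x + k)" using hk_eq[of "x + k" x] False by auto
        finally have "integral {- x..- x + (- k)} (\<lambda>x. g0 (- x)) / (- k) = (F (x + k) - F x) / k"
          by (simp add: minus_divide_left)
        then show ?thesis using d2(2)[of "- k"] k False by simp
      qed
      then show ?thesis using d1(1) d2(1) by (intro exI[of _ "min d1 d2"]) auto
    qed
    then show "(F has_derivative (*) (g0 x)) (at x)"
      unfolding has_field_derivative_def[symmetric] DERIV_def LIM_eq by auto
  qed
  define g where "g x = g0 x - (L + 1)" for x
  show thesis
  proof
    show "g \<in> borel_measurable borel" unfolding g_def by measurable
    have ci: "set_integrable lborel {x..y} (\<lambda>_. L + 1)" for x y :: real
      unfolding set_integrable_def
      by (intro integrable_scaleR_left integrable_real_indicator) (auto simp: emeasure_lborel_Icc_eq)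
    show "set_integrable lborel {x..y} g" if "x \<le> y" for x y
      unfolding g_def by (intro set_integral_diff int0 that ci)
    show "(LINT t:{x..y}|lborel. g t) = f y - f x" if "x \<le> y" for x y
    proof -
      have "(LINT t:{x..y}|lborel. g t) = (LINT t:{x..y}|lborel. g0 t) - (LINT t:{x..y}|lborel. L + 1)"
        unfolding g_def by (intro set_integral_diff int0 ci that)
      also have "(LINT t:{x..y}|lborel. L + 1) = (L + 1) * (y - x)"
        using that by (simp add: set_integral_const)
      finally show ?thesis using eq0[OF that] by (simp add: F_def algebra_simps)
    qed
    have negl: "negligible (N \<union> uminus ` N')"
    proof (intro negligible_Un N(1) negligible_locally_Lipschitz_image)
      show "\<exists>T B. open T \<and> x \<in> T \<and> (\<forall>y\<in>N' \<inter> T. norm (- y - - x) \<le> B * norm (y - x))" for x :: real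
        by (intro exI[of _ UNIV] exI[of _ 1]) auto
    qed (use N'(1) in auto)
    then have "AE x in lebesgue. x \<notin> N \<union> uminus ` N'"
      unfolding negligible_iff_null_sets by (rule AE_not_in)
    then have "AE x in lborel. x \<notin> N \<union> uminus ` N'"
      by (simp add: AE_completion_iff)
    then show "AE x in lborel. (f has_real_derivative g x) (at x)"
    proof eventually_elim
      case (elim x)
      then have "(F has_real_derivative g0 x) (at x)"
        by (intro deriv_F) (auto simp: image_iff)
      then have "((\<lambda>x. F x - (L + 1) * x) has_real_derivative g0 x - (L + 1) * 1) (at x)"
        by (intro DERIV_diff DERIV_cmult DERIV_ident)
      then show ?case by (simp add: F_def g_def)
    qed
  qed
qed

text \<open>Constant continuation beyond the end points; it carries results for Lipschitz functions
  on the whole line over to intervals.\<close>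

lemma lipschitz_on_clamp:
  fixes f :: "real \<Rightarrow> 'a::metric_space"
  assumes "L-lipschitz_on {a..b} f" "a \<le> b"
  shows "L-lipschitz_on UNIV (\<lambda>x. f (max a (min b x)))"
proof (rule lipschitz_onI)
  fix x y :: real
  have "dist (f (max a (min b x))) (f (max a (min b y))) \<le> L * dist (max a (min b x)) (max a (min b y))"
    using assms by (intro lipschitz_onD[OF assms(1)]) auto
  also have "\<dots> \<le> L * dist x y"
    using lipschitz_on_nonneg[OF assms(1)] by (intro mult_left_mono) (auto simp: dist_real_def)
  finally show "dist (f (max a (min b x))) (f (max a (min b y))) \<le> L * dist x y" .
qed (rule lipschitz_on_nonneg[OF assms(1)])

text \<open>Any Borel function that is the derivative almost everywhere may serve as integrand,
  since it agrees almost everywhere with the one from \<open>lipschitz_real_FTC\<close>.\<close>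

lemma lipschitz_FTC_interval:
  fixes f f' :: "real \<Rightarrow> real"
  assumes lip: "L-lipschitz_on {a..b} f" and ab: "a \<le> b"
    and der: "AE x in lborel. x \<in> {a<..<b} \<longrightarrow> (f has_real_derivative f' x) (at x)"
    and f': "f' \<in> borel_measurable borel"
  shows "set_integrable lborel {a..b} f'" "(LINT x:{a..b}|lborel. f' x) = f b - f a"
proof -
  define F where "F x = f (max a (min b x))" for x
  have "L-lipschitz_on UNIV F" unfolding F_def by (rule lipschitz_on_clamp[OF lip ab])
  then obtain g where g: "g \<in> borel_measurable borel" "\<And>x y. x \<le> y \<Longrightarrow> set_integrable lborel {x..y} g"
    "\<And>x y. x \<le> y \<Longrightarrow> (LINT t:{x..y}|lborel. g t) = F y - F x"
    "AE x in lborel. (F has_real_derivative g x) (at x)"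
    by (rule lipschitz_real_FTC) blast
  have "AE x in lborel. x \<noteq> a" "AE x in lborel. x \<noteq> b"
    by (auto intro: AE_lborel_singleton)
  with der g(4) have eq: "AE x in lborel. x \<in> {a..b} \<longrightarrow> g x = f' x"
  proof eventually_elim
    case (elim x)
    show ?case
    proof
      assume "x \<in> {a..b}"
      then have x: "x \<in> {a<..<b}" using elim by auto
      have "(F has_real_derivative f' x) (at x)"
      proof (rule has_field_derivative_transform_within_open[of f _ _ "{a<..<b}"])
        show "(f has_real_derivative f' x) (at x)" using elim x by simp
      qed (use x in \<open>auto simp: F_def\<close>)
      then show "g x = f' x" using elim DERIV_unique by blast
    qed
  qed
  have m: "set_borel_measurable lborel {a..b} g" "set_borel_measurable lborel {a..b} f'"
    unfolding set_borel_measurable_def using g(1) f' by auto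
  show "set_integrable lborel {a..b} f'"
    using g(2)[OF ab] set_integrable_cong_AE[of g lborel f' "{a..b}"] eq g(1) f' by auto
  have "(LINT x:{a..b}|lborel. f' x) = (LINT x:{a..b}|lborel. g x)"
    using eq g(1) f' by (intro set_lebesgue_integral_cong_AE) auto
  then show "(LINT x:{a..b}|lborel. f' x) = f b - f a"
    using g(3)[OF ab] ab by (simp add: F_def)
qed

section \<open>Length of Lipschitz arcs and the area formula\<close>

lemma has_vector_derivative_quotient:
  assumes "(\<gamma> has_vector_derivative v) (at t)"
  shows "((\<lambda>h. (\<gamma> (t + h) - \<gamma> t) /\<^sub>R h) \<longlongrightarrow> v) (at 0)"
proof -
  have "((\<lambda>h. norm (\<gamma> (t + h) - \<gamma> t - h *\<^sub>R v) / norm h) \<longlongrightarrow> 0) (at 0)"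
    using assms by (simp add: has_vector_derivative_def has_derivative_at)
  then have "((\<lambda>h. norm ((\<gamma> (t + h) - \<gamma> t) /\<^sub>R h - v)) \<longlongrightarrow> 0) (at 0)"
  proof (rule Lim_transform_eventually)
    have "norm (\<gamma> (t + h) - \<gamma> t - h *\<^sub>R v) / norm h = norm ((\<gamma> (t + h) - \<gamma> t) /\<^sub>R h - v)" if "h \<noteq> 0" for h
    proof -
      have "(\<gamma> (t + h) - \<gamma> t) /\<^sub>R h - v = (\<gamma> (t + h) - \<gamma> t - h *\<^sub>R v) /\<^sub>R h"
        using that by (simp add: scaleR_diff_right)
      then show ?thesis by (simp add: divide_inverse_commute)
    qed
    then show "\<forall>\<^sub>F h in at 0. norm (\<gamma> (t + h) - \<gamma> t - h *\<^sub>R v) / norm h = norm ((\<gamma> (t + h) - \<gamma> t) /\<^sub>R h - v)"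
      by (auto simp: eventually_at_filter)
  qed
  then show ?thesis by (simp add: Lim_null[of _ v] tendsto_norm_zero_iff)
qed

lemma lipschitz_norm_vector_derivative_le:
  fixes \<gamma> :: "real \<Rightarrow> 'a::real_normed_vector"
  assumes lip: "L-lipschitz_on UNIV \<gamma>" and der: "(\<gamma> has_vector_derivative v) (at t)"
  shows "norm v \<le> L"
proof -
  have "((\<lambda>h. norm ((\<gamma> (t + h) - \<gamma> t) /\<^sub>R h)) \<longlongrightarrow> norm v) (at 0)"
    by (intro tendsto_norm has_vector_derivative_quotient der)
  then show ?thesis
  proof (rule tendsto_upperbound)
    have "norm ((\<gamma> (t + h) - \<gamma> t) /\<^sub>R h) \<le> L" if "h \<noteq> 0" for h
    proof -
      have "norm (\<gamma> (t + h) - \<gamma> t) \<le> L * \<bar>h\<bar>"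
        using lipschitz_onD[OF lip, of "t + h" t] by (simp add: dist_norm)
      then have "norm (\<gamma> (t + h) - \<gamma> t) / \<bar>h\<bar> \<le> L" using that by (simp add: pos_divide_le_eq)
      then show ?thesis by (simp add: divide_inverse_commute)
    qed
    then show "\<forall>\<^sub>F h in at 0. norm ((\<gamma> (t + h) - \<gamma> t) /\<^sub>R h) \<le> L"
      by (auto simp: eventually_at_filter)
  qed simp
qed

text \<open>The Borel left inverse \<open>\<eta>\<close> makes the arc injective and turns measures
  on the arc into measures on the parameter line by \<open>distr\<close>, so images of Borel sets
  under \<open>\<gamma>\<close> need not be studied. \<open>\<gamma>'\<close> is a fixed Borel
  version of the derivative.\<close>

locale rectifiable_arc =
  fixes \<gamma> \<gamma>' :: "real \<Rightarrow> 'a::euclidean_space" and \<eta> :: "'a \<Rightarrow> real" and L a b :: real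
  assumes lip: "L-lipschitz_on UNIV \<gamma>"
    and der: "AE t in lborel. t \<in> {a<..<b} \<longrightarrow> (\<gamma> has_vector_derivative \<gamma>' t) (at t)"
    and meas_deriv: "\<gamma>' \<in> borel_measurable borel"
    and meas_inv: "\<eta> \<in> borel_measurable borel"
    and inv: "\<And>t. t \<in> {a..b} \<Longrightarrow> \<eta> (\<gamma> t) = t"
    and ab: "a \<le> b"
begin

lemma deriv_bound: "AE t in lborel. t \<in> {a..b} \<longrightarrow> norm (\<gamma>' t) \<le> L"
proof -
  have "AE t in lborel. t \<noteq> a" "AE t in lborel. t \<noteq> b" by (auto intro: AE_lborel_singleton)
  with der show ?thesis
  proof eventually_elim
    case (elim t)
    show ?case
    proof
      assume "t \<in> {a..b}"
      then have "(\<gamma> has_vector_derivative \<gamma>' t) (at t)" using elim by auto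
      then show "norm (\<gamma>' t) \<le> L" by (rule lipschitz_norm_vector_derivative_le[OF lip])
    qed
  qed
qed

lemma speed_integrable: "a \<le> s \<Longrightarrow> t \<le> b \<Longrightarrow> set_integrable lborel {s..t} (\<lambda>t. norm (\<gamma>' t))"
  unfolding set_integrable_def
proof (rule integrableI_bounded_set_indicator[where B = L])
  assume st: "a \<le> s" "t \<le> b"
  show "AE x in lborel. x \<in> {s..t} \<longrightarrow> norm (norm (\<gamma>' x)) \<le> L"
    using deriv_bound st by (auto elim!: eventually_mono)
qed (use meas_deriv in \<open>auto simp: emeasure_lborel_Icc_eq\<close>)

text \<open>Projecting the curve onto the unit vector \<open>e\<close> along its chord reduces the
  claim to the scalar fundamental theorem for Lipschitz functions.\<close>

lemma dist_le_length:
  assumes st: "a \<le> s" "s \<le> t" "t \<le> b"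
  shows "dist (\<gamma> s) (\<gamma> t) \<le> (LINT x:{s..t}|lborel. norm (\<gamma>' x))"
proof (cases "\<gamma> s = \<gamma> t")
  case True then show ?thesis unfolding set_lebesgue_integral_def by (auto intro!: integral_nonneg_AE)
next
  case False
  define e where "e = sgn (\<gamma> t - \<gamma> s)"
  have e: "norm e = 1" using False by (simp add: e_def norm_sgn)
  have lip_e: "L-lipschitz_on {s..t} (\<lambda>x. \<gamma> x \<bullet> e)"
  proof (rule lipschitz_onI)
    fix x y
    have "dist (\<gamma> x \<bullet> e) (\<gamma> y \<bullet> e) = \<bar>(\<gamma> x - \<gamma> y) \<bullet> e\<bar>" by (simp add: dist_real_def inner_diff_left)
    also have "\<dots> \<le> dist (\<gamma> x) (\<gamma> y)" using Cauchy_Schwarz_ineq2[of "\<gamma> x - \<gamma> y" e] e by (simp add: dist_norm)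
    finally show "dist (\<gamma> x \<bullet> e) (\<gamma> y \<bullet> e) \<le> L * dist x y" using lipschitz_onD[OF lip, of x y] by simp
  qed (rule lipschitz_on_nonneg[OF lip])
  have der_e: "AE x in lborel. x \<in> {s<..<t} \<longrightarrow> ((\<lambda>x. \<gamma> x \<bullet> e) has_real_derivative \<gamma>' x \<bullet> e) (at x)"
    using der
  proof eventually_elim
    case (elim x)
    show ?case
    proof
      assume "x \<in> {s<..<t}"
      then have "(\<gamma> has_vector_derivative \<gamma>' x) (at x)" using elim st by auto
      then show "((\<lambda>x. \<gamma> x \<bullet> e) has_real_derivative \<gamma>' x \<bullet> e) (at x)"
        unfolding has_real_derivative_iff_has_vector_derivative
        by (rule bounded_linear.has_vector_derivative[OF bounded_linear_inner_left])
    qed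
  qed
  have m: "(\<lambda>x. \<gamma>' x \<bullet> e) \<in> borel_measurable borel" using meas_deriv by measurable
  note F = lipschitz_FTC_interval[OF lip_e st(2) der_e m]
  have "dist (\<gamma> s) (\<gamma> t) = (\<gamma> t - \<gamma> s) \<bullet> e"
    using False by (simp add: e_def dist_norm sgn_div_norm norm_minus_commute power2_norm_eq_inner[symmetric] power2_eq_square)
  also have "\<dots> = (LINT x:{s..t}|lborel. \<gamma>' x \<bullet> e)" using F(2) by (simp add: inner_diff_left)
  also have "\<dots> \<le> (LINT x:{s..t}|lborel. norm (\<gamma>' x))"
  proof (rule set_integral_mono[OF F(1) speed_integrable])
    fix x show "\<gamma>' x \<bullet> e \<le> norm (\<gamma>' x)" using norm_cauchy_schwarz[of "\<gamma>' x" e] e by simp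
  qed (use st in auto)
  finally show ?thesis .
qed

lemma inj_arc: "s \<in> {a..b} \<Longrightarrow> t \<in> {a..b} \<Longrightarrow> \<gamma> s = \<gamma> t \<Longrightarrow> s = t"
  using inv by metis

lemma continuous_arc: "continuous_on A \<gamma>"
  using lip by (meson lipschitz_on_continuous_on lipschitz_on_subset subset_UNIV)

lemma closed_subarc: "closed (\<gamma> ` {s..t})"
  by (intro compact_imp_closed compact_continuous_image continuous_arc) auto

lemma sets_subarc: "\<gamma> ` {s..t} \<in> sets hausdorff1"
  by (intro borel_imp_hausdorff1 borel_closed closed_subarc)

lemma speed_integral_split:
  assumes "a \<le> r" "r \<le> s" "s \<le> t" "t \<le> b"
  shows "(LINT x:{r..t}|lborel. norm (\<gamma>' x)) = (LINT x:{r..s}|lborel. norm (\<gamma>' x)) + (LINT x:{s..t}|lborel. norm (\<gamma>' x))"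
proof -
  have hk: "integral {x..y} (\<lambda>x. norm (\<gamma>' x)) = (LINT x:{x..y}|lborel. norm (\<gamma>' x))"
    "(\<lambda>x. norm (\<gamma>' x)) integrable_on {x..y}" if "a \<le> x" "y \<le> b" for x y
    using set_borel_integral_eq_integral[OF speed_integrable[OF that]] by auto
  show ?thesis
    using Henstock_Kurzweil_Integration.integral_combine[of r s t "\<lambda>x. norm (\<gamma>' x)"] hk assms by auto
qed

lemma speed_integral_le:
  assumes "a \<le> s" "s \<le> t" "t \<le> b"
  shows "(LINT x:{s..t}|lborel. norm (\<gamma>' x)) \<le> L * (t - s)"
proof -
  have "(LINT x:{s..t}|lborel. norm (\<gamma>' x)) \<le> (LINT x:{s..t}|lborel. L)"
    unfolding set_lebesgue_integral_def
  proof (rule integral_mono_AE)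
    show "integrable lborel (\<lambda>x. indicator {s..t} x *\<^sub>R norm (\<gamma>' x))"
      using speed_integrable assms unfolding set_integrable_def by auto
    show "integrable lborel (\<lambda>x. indicator {s..t} x *\<^sub>R L)"
      by (intro integrable_scaleR_left integrable_real_indicator) (auto simp: emeasure_lborel_Icc_eq)
    show "AE x in lborel. indicator {s..t} x *\<^sub>R norm (\<gamma>' x) \<le> indicator {s..t} x *\<^sub>R L"
      using deriv_bound by eventually_elim (use assms in \<open>auto simp: indicator_def\<close>)
  qed
  also have "\<dots> = L * (t - s)" using assms by (simp add: set_integral_const)
  finally show ?thesis .
qed

lemma subarc_le:
  assumes "a \<le> s" "s \<le> t" "t \<le> b"
  shows "emeasure hausdorff1 (\<gamma> ` {s..t}) \<le> ennreal (LINT x:{s..t}|lborel. norm (\<gamma>' x))"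
proof -
  define l where "l x = (LINT x:{a..x}|lborel. norm (\<gamma>' x))" for x
  have l: "l y - l x = (LINT x:{x..y}|lborel. norm (\<gamma>' x))" if "a \<le> x" "x \<le> y" "y \<le> b" for x y
    using speed_integral_split[of a x y] that by (simp add: l_def)
  have "hausdorff1_outer (\<gamma> ` {s..t}) \<le> ennreal (l t - l s)"
    using assms dist_le_length l speed_integral_le
    by (intro hausdorff1_outer_curve_le[where L = L]) auto
  then show ?thesis using l assms by (simp add: emeasure_hausdorff1[OF sets_subarc])
qed

text \<open>By injectivity the two pieces share at most one point, which has measure zero.\<close>

lemma emeasure_subarc_split:
  assumes "a \<le> r" "r \<le> s" "s \<le> t" "t \<le> b"
  shows "emeasure hausdorff1 (\<gamma> ` {r..t}) = emeasure hausdorff1 (\<gamma> ` {r..s}) + emeasure hausdorff1 (\<gamma> ` {s..t})"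
proof -
  have "\<gamma> ` {r..t} = \<gamma> ` {r..s} \<union> \<gamma> ` {s..t}"
    using assms by (simp add: image_Un[symmetric] ivl_disj_un)
  moreover have "\<gamma> ` {r..s} \<inter> \<gamma> ` {s..t} \<subseteq> {\<gamma> s}"
  proof safe
    fix x y assume xy: "\<gamma> x = \<gamma> y" "x \<in> {r..s}" "y \<in> {s..t}"
    then have "x = y" using assms by (intro inj_arc) auto
    then show "\<gamma> x = \<gamma> s" using xy by auto
  qed
  then have "\<gamma> ` {r..s} \<inter> \<gamma> ` {s..t} \<in> null_sets hausdorff1"
    by (rule hausdorff1_null_subset) (simp add: finite_null_hausdorff1)
  ultimately show ?thesis using emeasure_Un'[of "\<gamma> ` {r..s}" hausdorff1 "\<gamma> ` {s..t}"] sets_subarc by simp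
qed

text \<open>For the missing lower bound let \<open>m\<close> be the measure of initial arcs. It is
  Lipschitz by \<open>subarc_le\<close>, and its increments dominate chord lengths because subarcs
  are connected. Hence the derivative of \<open>m\<close> is at least
  \<open>norm (\<gamma>' x)\<close> almost everywhere, and integration gives the claim.\<close>

lemma emeasure_subarc:
  assumes st: "a \<le> s" "s \<le> t" "t \<le> b"
  shows "emeasure hausdorff1 (\<gamma> ` {s..t}) = ennreal (LINT x:{s..t}|lborel. norm (\<gamma>' x))"
proof (rule antisym[OF subarc_le[OF st]])
  define m where "m x = enn2real (emeasure hausdorff1 (\<gamma> ` {a..x}))" for x
  have fin: "emeasure hausdorff1 (\<gamma> ` {x..y}) < top" if "a \<le> x" "y \<le> b" for x y
  proof (cases "x \<le> y")
    case True then show ?thesis using subarc_le[of x y] that by (auto intro: order_le_less_trans)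
  qed auto
  have m_diff: "ennreal (m y - m x) = emeasure hausdorff1 (\<gamma> ` {x..y})" "m x \<le> m y"
    if xy: "a \<le> x" "x \<le> y" "y \<le> b" for x y
  proof -
    have "ennreal (m y) = ennreal (m x) + emeasure hausdorff1 (\<gamma> ` {x..y})"
      using emeasure_subarc_split[of a x y] fin[of a y] fin[of a x] xy by (simp add: m_def)
    then have *: "ennreal (m y) = ennreal (m x) + ennreal (enn2real (emeasure hausdorff1 (\<gamma> ` {x..y})))"
      using fin[of x y] xy by simp
    then have **: "m y = m x + enn2real (emeasure hausdorff1 (\<gamma> ` {x..y}))"
      by (simp add: ennreal_plus[symmetric] m_def del: ennreal_plus)
    then show "m x \<le> m y" by simp
    show "ennreal (m y - m x) = emeasure hausdorff1 (\<gamma> ` {x..y})"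
      using ** fin[of x y] xy by simp
  qed
  have m_ge: "dist (\<gamma> x) (\<gamma> y) \<le> m y - m x" if xy: "a \<le> x" "x \<le> y" "y \<le> b" for x y
  proof -
    have "ennreal (dist (\<gamma> x) (\<gamma> y)) \<le> hausdorff1_outer (\<gamma> ` {x..y})"
      using xy by (intro hausdorff1_outer_connected connected_continuous_image continuous_arc) auto
    then have "ennreal (dist (\<gamma> x) (\<gamma> y)) \<le> ennreal (m y - m x)"
      using m_diff(1)[OF xy] emeasure_hausdorff1[OF sets_subarc] by simp
    then show ?thesis using m_diff(2)[OF xy] by (simp add: ennreal_le_iff)
  qed
  have m_le: "m y - m x \<le> L * (y - x)" if xy: "a \<le> x" "x \<le> y" "y \<le> b" for x y
  proof -
    have "ennreal (m y - m x) \<le> ennreal (LINT x:{x..y}|lborel. norm (\<gamma>' x))"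
      using subarc_le[OF xy] m_diff(1)[OF xy] by simp
    also have "\<dots> \<le> ennreal (L * (y - x))" by (intro ennreal_leI speed_integral_le xy)
    finally show ?thesis using lipschitz_on_nonneg[OF lip] xy by (simp add: ennreal_le_iff)
  qed
  have lip_m: "L-lipschitz_on {s..t} m"
  proof (rule lipschitz_onI)
    fix x y assume xy: "x \<in> {s..t}" "y \<in> {s..t}"
    show "dist (m x) (m y) \<le> L * dist x y"
      using xy st m_le[of x y] m_le[of y x] m_diff(2)[of x y] m_diff(2)[of y x]
      by (cases "x \<le> y") (auto simp: dist_real_def abs_if)
  qed (rule lipschitz_on_nonneg[OF lip])
  define M where "M x = m (max s (min t x))" for x
  have "L-lipschitz_on UNIV M" unfolding M_def by (rule lipschitz_on_clamp[OF lip_m st(2)])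
  then obtain g where g: "g \<in> borel_measurable borel" "\<And>x y. x \<le> y \<Longrightarrow> set_integrable lborel {x..y} g"
    "\<And>x y. x \<le> y \<Longrightarrow> (LINT t:{x..y}|lborel. g t) = M y - M x"
    "AE x in lborel. (M has_real_derivative g x) (at x)"
    by (rule lipschitz_real_FTC) blast
  have "AE x in lborel. x \<noteq> s" "AE x in lborel. x \<noteq> t" by (auto intro: AE_lborel_singleton)
  with der g(4) have ge: "AE x in lborel. x \<in> {s..t} \<longrightarrow> norm (\<gamma>' x) \<le> g x"
  proof eventually_elim
    case (elim x)
    show ?case
    proof
      assume "x \<in> {s..t}"
      then have x: "s < x" "x < t" using elim by auto
      have 1: "((\<lambda>h. norm ((\<gamma> (x + h) - \<gamma> x) /\<^sub>R h)) \<longlongrightarrow> norm (\<gamma>' x)) (at_right 0)"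
      proof -
        have "(\<gamma> has_vector_derivative \<gamma>' x) (at x)" using elim x st by auto
        then show ?thesis
          by (intro tendsto_norm tendsto_mono[OF at_le has_vector_derivative_quotient]) auto
      qed
      have 2: "((\<lambda>h. (M (x + h) - M x) / h) \<longlongrightarrow> g x) (at_right 0)"
      proof -
        have "((\<lambda>h. (M (x + h) - M x) / h) \<longlongrightarrow> g x) (at 0)" using elim by (simp add: DERIV_def)
        then show ?thesis by (rule tendsto_mono[OF at_le, rotated]) simp
      qed
      show "norm (\<gamma>' x) \<le> g x"
      proof (rule tendsto_le[OF _ 2 1])
        have "norm ((\<gamma> (x + h) - \<gamma> x) /\<^sub>R h) \<le> (M (x + h) - M x) / h" if h: "0 < h" "h < t - x" for h
          using m_ge[of x "x + h"] h x st
          by (simp add: M_def dist_norm norm_minus_commute divide_inverse_commute mult_left_mono)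
        then show "\<forall>\<^sub>F h in at_right 0. norm ((\<gamma> (x + h) - \<gamma> x) /\<^sub>R h) \<le> (M (x + h) - M x) / h"
          unfolding eventually_at_right_field using x by (intro exI[of _ "t - x"]) auto
      qed simp
    qed
  qed
  have "(LINT x:{s..t}|lborel. norm (\<gamma>' x)) \<le> (LINT x:{s..t}|lborel. g x)"
    unfolding set_lebesgue_integral_def
  proof (rule integral_mono_AE)
    show "integrable lborel (\<lambda>x. indicator {s..t} x *\<^sub>R norm (\<gamma>' x))"
      using speed_integrable st unfolding set_integrable_def by auto
    show "integrable lborel (\<lambda>x. indicator {s..t} x *\<^sub>R g x)"
      using g(2)[OF st(2)] by (simp add: set_integrable_def)
    show "AE x in lborel. indicator {s..t} x *\<^sub>R norm (\<gamma>' x) \<le> indicator {s..t} x *\<^sub>R g x"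
      using ge by eventually_elim (auto simp: indicator_def)
  qed
  also have "\<dots> = m t - m s" using g(3)[OF st(2)] st by (simp add: M_def)
  finally show "ennreal (LINT x:{s..t}|lborel. norm (\<gamma>' x)) \<le> emeasure hausdorff1 (\<gamma> ` {s..t})"
    using m_diff(1)[OF st] by (metis ennreal_leI)
qed

definition arc_measure :: "real measure" where
  "arc_measure = density lborel (\<lambda>t. ennreal (indicator {a..b} t * norm (\<gamma>' t)))"

text \<open>Both measures are finite on the half lines \<open>{x<..}\<close>, where they agree by
  \<open>emeasure_subarc\<close>; half lines determine the measure.\<close>

lemma distr_arc: "distr (restrict_space hausdorff1 (\<gamma> ` {a..b})) borel \<eta> = arc_measure"
proof (rule measure_eqI_lessThan)
  have [measurable]: "\<eta> \<in> borel_measurable (restrict_space hausdorff1 (\<gamma> ` {a..b}))"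
    by (intro measurable_restrict_space1 borel_measurable_hausdorff1 meas_inv)
  have [measurable]: "\<gamma>' \<in> borel_measurable borel" by (rule meas_deriv)
  fix x
  define c where "c = max a x"
  have 1: "emeasure arc_measure {x<..} = (if x < b then ennreal (LINT t:{c..b}|lborel. norm (\<gamma>' t)) else 0)"
  proof -
    have "emeasure arc_measure {x<..} = (\<integral>\<^sup>+t. ennreal (indicator {a..b} t * norm (\<gamma>' t)) * indicator {x<..} t \<partial>lborel)"
      unfolding arc_measure_def by (subst emeasure_density) auto
    also have "\<dots> = (if x < b then (\<integral>\<^sup>+t. ennreal (indicator {c..b} t *\<^sub>R norm (\<gamma>' t)) \<partial>lborel) else 0)"
    proof (cases "x < b")
      case True
      have "AE t in lborel. t \<noteq> x" by (rule AE_lborel_singleton)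
      then show ?thesis using True
        by (auto intro!: nn_integral_cong_AE elim!: eventually_mono simp: c_def indicator_def)
    next
      case False
      have "AE t in lborel. ennreal (indicator {a..b} t * norm (\<gamma>' t)) * indicator {x<..} t = 0"
        using False by (auto simp: indicator_def)
      then show ?thesis using False by (auto simp: nn_integral_0_iff_AE)
    qed
    also have "\<dots> = (if x < b then ennreal (LINT t:{c..b}|lborel. norm (\<gamma>' t)) else 0)"
      using speed_integrable[of c b]
      by (auto simp: set_lebesgue_integral_def set_integrable_def c_def intro!: nn_integral_eq_integral)
    finally show ?thesis .
  qed
  have 2: "emeasure (distr (restrict_space hausdorff1 (\<gamma> ` {a..b})) borel \<eta>) {x<..}
      = (if x < b then ennreal (LINT t:{c..b}|lborel. norm (\<gamma>' t)) else 0)"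
  proof -
    have "emeasure (distr (restrict_space hausdorff1 (\<gamma> ` {a..b})) borel \<eta>) {x<..}
        = emeasure hausdorff1 (\<eta> -` {x<..} \<inter> \<gamma> ` {a..b})"
      by (subst emeasure_distr) (auto simp: space_restrict_space emeasure_restrict_space sets_subarc)
    also have "\<eta> -` {x<..} \<inter> \<gamma> ` {a..b} = \<gamma> ` ({a..b} \<inter> {x<..})"
      using inv by auto
    also have "emeasure hausdorff1 (\<gamma> ` ({a..b} \<inter> {x<..})) = (if x < b then emeasure hausdorff1 (\<gamma> ` {c..b}) else 0)"
    proof (cases "x < b")
      case True
      show ?thesis
      proof (cases "x < a")
        case True
        then have "{a..b} \<inter> {x<..} = {c..b}" using ab by (auto simp: c_def)
        then show ?thesis using True ab by simp
      next
        \<comment> \<open>Here the image of the half-open interval is that of a closed one minus its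
          first point, which is a null set.\<close>
        case False
        have "\<gamma> ` ({a..b} \<inter> {x<..}) = \<gamma> ` {c..b} - {\<gamma> x}"
        proof (intro set_eqI iffI)
          fix z assume "z \<in> \<gamma> ` ({a..b} \<inter> {x<..})"
          then obtain t where t: "t \<in> {a..b}" "x < t" "z = \<gamma> t" by auto
          then have "\<gamma> t \<noteq> \<gamma> x" using inj_arc[of t x] False True by auto
          then show "z \<in> \<gamma> ` {c..b} - {\<gamma> x}" using t by (auto simp: c_def)
        next
          fix z assume "z \<in> \<gamma> ` {c..b} - {\<gamma> x}"
          then obtain t where t: "t \<in> {c..b}" "z = \<gamma> t" "\<gamma> t \<noteq> \<gamma> x" by auto
          then have "t \<in> {a..b} \<inter> {x<..}"
            using False by (cases "t = x") (auto simp: c_def)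
          then show "z \<in> \<gamma> ` ({a..b} \<inter> {x<..})" using t by blast
        qed
        then show ?thesis
          using True emeasure_Diff_null_set[of "{\<gamma> x}" hausdorff1 "\<gamma> ` {c..b}"]
          by (simp add: sets_subarc finite_null_hausdorff1)
      qed
    next
      case False
      then have "{a..b} \<inter> {x<..} = {}" by auto
      then show ?thesis using False by simp
    qed
    also have "\<dots> = (if x < b then ennreal (LINT t:{c..b}|lborel. norm (\<gamma>' t)) else 0)"
      using emeasure_subarc[of c b] ab by (auto simp: c_def)
    finally show ?thesis .
  qed
  show "emeasure (distr (restrict_space hausdorff1 (\<gamma> ` {a..b})) borel \<eta>) {x<..} = emeasure arc_measure {x<..}"
    using 1 2 by simp
  show "emeasure (distr (restrict_space hausdorff1 (\<gamma> ` {a..b})) borel \<eta>) {x<..} < \<infinity>"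
    using 2 by simp
qed (auto simp: arc_measure_def)

text \<open>On the arc \<open>f\<close> equals \<open>f\<close> after \<open>\<gamma>\<close> after
  \<open>\<eta>\<close>. Integration over the arc is therefore integration of \<open>f\<close> after
  \<open>\<gamma>\<close> against the image measure under \<open>\<eta>\<close>, which has the speed
  as density.\<close>

lemma
  fixes f :: "'a \<Rightarrow> real"
  assumes f: "f \<in> borel_measurable borel"
  shows arc_integrable_iff: "set_integrable hausdorff1 (\<gamma> ` {a..b}) f \<longleftrightarrow>
      set_integrable lborel {a..b} (\<lambda>t. f (\<gamma> t) * norm (\<gamma>' t))" (is ?I)
    and arc_integral: "(LINT z:\<gamma> ` {a..b}|hausdorff1. f z) = (LINT t:{a..b}|lborel. f (\<gamma> t) * norm (\<gamma>' t))" (is ?E)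
proof -
  let ?R = "restrict_space hausdorff1 (\<gamma> ` {a..b})"
  have [measurable]: "\<gamma>' \<in> borel_measurable borel" by (rule meas_deriv)
  have [measurable]: "\<gamma> \<in> borel_measurable borel"
    by (intro borel_measurable_continuous_onI continuous_arc)
  have [measurable]: "f \<in> borel_measurable borel" by (rule f)
  have \<eta>R: "\<eta> \<in> measurable ?R borel"
    by (intro measurable_restrict_space1 borel_measurable_hausdorff1 meas_inv)
  have fg: "(\<lambda>t. f (\<gamma> t)) \<in> borel_measurable borel" by measurable
  have cong: "f z = f (\<gamma> (\<eta> z))" if "z \<in> space ?R" for z
    using that inv by (auto simp: space_restrict_space)
  have S: "\<gamma> ` {a..b} \<inter> space hausdorff1 \<in> sets hausdorff1" using sets_subarc by simp
  have "set_integrable hausdorff1 (\<gamma> ` {a..b}) f \<longleftrightarrow> integrable ?R f"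
    unfolding set_integrable_def using integrable_restrict_space[OF S, of f] by simp
  also have "\<dots> \<longleftrightarrow> integrable ?R (\<lambda>z. f (\<gamma> (\<eta> z)))"
    by (rule Bochner_Integration.integrable_cong[OF refl cong])
  also have "\<dots> \<longleftrightarrow> integrable (distr ?R borel \<eta>) (\<lambda>t. f (\<gamma> t))"
    using integrable_distr_eq[OF \<eta>R, of "\<lambda>t. f (\<gamma> t)"] fg by simp
  also have "\<dots> \<longleftrightarrow> integrable lborel (\<lambda>t. (indicator {a..b} t * norm (\<gamma>' t)) *\<^sub>R f (\<gamma> t))"
    unfolding distr_arc arc_measure_def by (subst integrable_density) auto
  finally show ?I unfolding set_integrable_def by (simp add: mult_ac)
  have "(LINT z:\<gamma> ` {a..b}|hausdorff1. f z) = integral\<^sup>L ?R f"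
    unfolding set_lebesgue_integral_def using integral_restrict_space[OF S, of f] by simp
  also have "\<dots> = integral\<^sup>L ?R (\<lambda>z. f (\<gamma> (\<eta> z)))" by (intro Bochner_Integration.integral_cong cong refl)
  also have "\<dots> = integral\<^sup>L (distr ?R borel \<eta>) (\<lambda>t. f (\<gamma> t))"
    using integral_distr[OF \<eta>R, of "\<lambda>t. f (\<gamma> t)"] fg by simp
  also have "\<dots> = integral\<^sup>L lborel (\<lambda>t. (indicator {a..b} t * norm (\<gamma>' t)) *\<^sub>R f (\<gamma> t))"
    unfolding distr_arc arc_measure_def by (subst integral_density) auto
  finally show ?E unfolding set_lebesgue_integral_def by (simp add: mult_ac)
qed

lemma emeasure_arc_finite: "emeasure hausdorff1 (\<gamma> ` {a..b}) < top"
  using emeasure_subarc[of a b] ab by simp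

text \<open>The exceptional set of \<open>P\<close> may be nonmeasurable, so a Borel null set
  containing the bad parameters is pulled back by \<open>\<eta>\<close>.\<close>

lemma AE_arc:
  assumes "AE t in lborel. t \<in> {a..b} \<longrightarrow> P (\<gamma> t)"
  shows "AE z in hausdorff1. z \<in> \<gamma> ` {a..b} \<longrightarrow> P z"
proof -
  obtain N where N: "N \<in> null_sets lborel" "{t. \<not> (t \<in> {a..b} \<longrightarrow> P (\<gamma> t))} \<subseteq> N"
    using assms by (auto simp: eventually_ae_filter)
  let ?R = "restrict_space hausdorff1 (\<gamma> ` {a..b})"
  have \<eta>R: "\<eta> \<in> measurable ?R borel"
    by (intro measurable_restrict_space1 borel_measurable_hausdorff1 meas_inv)
  have Nb: "N \<in> sets borel" using N by (auto simp: null_sets_def)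
  have "emeasure arc_measure N = 0"
    unfolding arc_measure_def using N meas_deriv Nb
    by (subst emeasure_density)
       (auto simp: nn_integral_0_iff_AE indicator_def intro!: eventually_mono[OF AE_not_in[OF N(1)]])
  then have "emeasure hausdorff1 (\<eta> -` N \<inter> \<gamma> ` {a..b}) = 0"
    using emeasure_distr[OF \<eta>R Nb] sets_subarc
    by (simp add: distr_arc space_restrict_space emeasure_restrict_space)
  moreover have "\<eta> -` N \<inter> \<gamma> ` {a..b} \<in> sets hausdorff1"
    using measurable_sets[OF borel_measurable_hausdorff1[OF meas_inv] Nb] sets_subarc by auto
  ultimately have "\<eta> -` N \<inter> \<gamma> ` {a..b} \<in> null_sets hausdorff1" by auto
  then show ?thesis
    by (rule AE_I') (use N(2) inv in auto)
qed

end

section \<open>Outer normals and star-shaped domains\<close>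

text \<open>If \<open>\<nu>\<close> and \<open>\<mu>\<close> differ, a small step from
  \<open>z\<close> along \<open>\<mu> - \<nu>\<close> points strictly inwards for
  \<open>\<nu>\<close> and strictly outwards for \<open>\<mu>\<close>; the point reached would lie
  both in \<open>S\<close> and outside.\<close>

lemma is_outer_normal_unique:
  assumes "is_outer_normal S z \<nu>" "is_outer_normal S z \<mu>"
  shows "\<nu> = \<mu>"
proof (rule ccontr)
  assume ne: "\<nu> \<noteq> \<mu>"
  have n: "norm \<nu> = 1" "norm \<mu> = 1" using assms by (auto simp: is_outer_normal_def)
  define h where "h = \<mu> - \<nu>"
  have h0: "norm h > 0" using ne by (simp add: h_def)
  have inner1: "\<nu> \<bullet> \<nu> = 1" "\<mu> \<bullet> \<mu> = 1" using n by (auto simp: norm_eq_1)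
  have hh: "norm h * norm h = 2 * (1 - \<nu> \<bullet> \<mu>)"
    using inner1 by (simp add: h_def power2_norm_eq_inner[symmetric] power2_eq_square[symmetric])
       (simp add: power2_norm_eq_inner inner_diff inner_commute)
  have hn: "h \<bullet> \<nu> = - (norm h * norm h / 2)" "h \<bullet> \<mu> = norm h * norm h / 2"
  proof -
    have "h \<bullet> \<nu> = \<nu> \<bullet> \<mu> - 1" "h \<bullet> \<mu> = 1 - \<nu> \<bullet> \<mu>"
      using inner1 by (simp_all add: h_def inner_diff inner_commute)
    then show "h \<bullet> \<nu> = - (norm h * norm h / 2)" "h \<bullet> \<mu> = norm h * norm h / 2"
      using hh by (simp_all add: field_simps)
  qed
  \<comment> \<open>Along \<open>h\<close> the inner products with \<open>\<nu>\<close> and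
    \<open>\<mu>\<close> are minus and plus \<open>norm h / 2\<close> times the step length; half of
    that ratio leaves strict inequalities.\<close>
  define e where "e = norm h / 4"
  have e: "0 < e" using h0 by (simp add: e_def)
  obtain r where r: "r > 0" "\<forall>w\<in>ball z r. (w - z) \<bullet> \<nu> < - e * norm (w - z) \<longrightarrow> w \<in> S"
    using assms(1) e unfolding is_outer_normal_def by blast
  obtain r' where r': "r' > 0" "\<forall>w\<in>ball z r'. (w - z) \<bullet> \<mu> > e * norm (w - z) \<longrightarrow> w \<notin> S"
    using assms(2) e unfolding is_outer_normal_def by blast
  define k where "k = min r r' / (2 * norm h)"
  have k: "k > 0" "k * norm h < r" "k * norm h < r'" using r r' h0 by (auto simp: k_def field_simps min_def)
  define w where "w = z + k *\<^sub>R h"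
  have w: "w \<in> ball z r" "w \<in> ball z r'" using k by (auto simp: w_def dist_norm)
  have 1: "(w - z) \<bullet> \<nu> < - e * norm (w - z)" using k h0 by (simp add: w_def hn e_def)
  have 2: "(w - z) \<bullet> \<mu> > e * norm (w - z)" using k h0 by (simp add: w_def hn e_def)
  show False using r(2) r'(2) w 1 2 by blast
qed

lemma outer_normal_eqI: "is_outer_normal S z \<nu> \<Longrightarrow> outer_normal S z = \<nu>"
proof -
  assume n: "is_outer_normal S z \<nu>"
  then have "(THE \<nu>. is_outer_normal S z \<nu>) = \<nu>"
    using is_outer_normal_unique by (intro the_equality) blast+
  moreover have ex: "\<exists>\<nu>. is_outer_normal S z \<nu>" using n by (rule exI)
  ultimately show ?thesis unfolding outer_normal_def if_P[OF ex] by simp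
qed

text \<open>This transfers normals between an element and the whole domain at boundary points where
  the two sets coincide locally.\<close>

lemma is_outer_normal_local:
  assumes "0 < r" "\<And>w. w \<in> ball z r \<Longrightarrow> w \<in> S \<longleftrightarrow> w \<in> S'"
  shows "is_outer_normal S z \<nu> \<longleftrightarrow> is_outer_normal S' z \<nu>"
proof -
  have *: "is_outer_normal B z \<nu>" if A: "is_outer_normal A z \<nu>" and eq: "\<And>w. w \<in> ball z r \<Longrightarrow> w \<in> A \<longleftrightarrow> w \<in> B" for A B
    unfolding is_outer_normal_def
  proof (intro conjI allI impI)
    fix e :: real assume "e > 0"
    then obtain r' where r': "r' > 0" "\<forall>w\<in>ball z r'.
        ((w - z) \<bullet> \<nu> < - e * norm (w - z) \<longrightarrow> w \<in> A) \<and> ((w - z) \<bullet> \<nu> > e * norm (w - z) \<longrightarrow> w \<notin> A)"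
      using A unfolding is_outer_normal_def by blast
    then show "\<exists>r>0. \<forall>w\<in>ball z r.
        ((w - z) \<bullet> \<nu> < - e * norm (w - z) \<longrightarrow> w \<in> B) \<and> ((w - z) \<bullet> \<nu> > e * norm (w - z) \<longrightarrow> w \<notin> B)"
      using assms(1) eq by (intro exI[of _ "min r r'"]) auto
  qed (use A in \<open>auto simp: is_outer_normal_def\<close>)
  show ?thesis using *[of S S'] *[of S' S] assms(2) by blast
qed

text \<open>The first-order expansion decides the sign of \<open>g w - 1\<close> outside every
  double cone around the tangent line. Differentiability at the single point \<open>z\<close> is
  enough, which is what a Lipschitz gauge offers almost everywhere.\<close>

lemma is_outer_normal_sublevel:
  fixes g :: "point \<Rightarrow> real"
  assumes g: "(g has_derivative (\<lambda>h. p \<bullet> h)) (at z)" "g z = 1" and p: "p \<noteq> 0"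
    and S: "\<And>w. w \<in> S \<longleftrightarrow> g w < 1"
  shows "is_outer_normal S z (p /\<^sub>R norm p)"
  unfolding is_outer_normal_def
proof (intro conjI allI impI)
  show "norm (p /\<^sub>R norm p) = 1" using p by simp
  fix e :: real assume e: "e > 0"
  then have "e * norm p > 0" using p by simp
  then obtain r where r: "r > 0" "\<And>w. norm (w - z) < r \<Longrightarrow> norm (g w - g z - p \<bullet> (w - z)) \<le> e * norm p * norm (w - z)"
    using g(1) unfolding has_derivative_at_alt by blast
  show "\<exists>r>0. \<forall>w\<in>ball z r. ((w - z) \<bullet> (p /\<^sub>R norm p) < - e * norm (w - z) \<longrightarrow> w \<in> S) \<and>
      ((w - z) \<bullet> (p /\<^sub>R norm p) > e * norm (w - z) \<longrightarrow> w \<notin> S)"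
  proof (intro exI[of _ r] conjI ballI r(1) impI)
    fix w assume w: "w \<in> ball z r"
    have b: "\<bar>g w - 1 - p \<bullet> (w - z)\<bar> \<le> e * norm p * norm (w - z)"
      using r(2)[of w] w g(2) by (auto simp: dist_norm norm_minus_commute)
    { assume "(w - z) \<bullet> (p /\<^sub>R norm p) < - e * norm (w - z)"
      then have "p \<bullet> (w - z) < - (e * norm p * norm (w - z))"
        using p by (simp add: inner_commute field_simps)
      then show "w \<in> S" using b S by (auto simp: abs_le_iff) }
    { assume "(w - z) \<bullet> (p /\<^sub>R norm p) > e * norm (w - z)"
      then have "p \<bullet> (w - z) > e * norm p * norm (w - z)"
        using p by (simp add: inner_commute field_simps)
      then show "w \<notin> S" using b S by (auto simp: abs_le_iff) }
  qed
qed

lemma half_ratio_less_1: "0 \<le> x \<Longrightarrow> x / (2 * (x + 1)) < (1 :: real)"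
  by (simp add: pos_divide_less_eq)

definition rot :: "point \<Rightarrow> point" where "rot v = (- snd v, fst v)"

lemma inner_prod: "(v :: point) \<bullet> w = fst v * fst w + snd v * snd w"
  by (simp add: inner_prod_def)

lemma norm_prod_sq: "(norm (v :: point))\<^sup>2 = (fst v)\<^sup>2 + (snd v)\<^sup>2"
  by (simp add: norm_prod_def real_sqrt_pow2)

text \<open>Axis directions keep the change of variables elementary: each frame of \<open>u\<close>
  and \<open>rot u\<close> is the standard one up to a permutation and reflections. The set is
  invariant under \<open>rot\<close>, so the four quarters of directions fit together
  cyclically.\<close>

definition axis_dirs :: "point set" where "axis_dirs = {(1, 0), (0, 1), (-1, 0), (0, -1)}"

lemma finite_axis_dirs [simp]: "finite axis_dirs"
  by (simp add: axis_dirs_def)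

section \<open>The gauge of a star-shaped domain\<close>

locale star_domain =
  fixes T :: "point set" and a :: point and \<rho> :: real
  assumes open_T: "open T" and bounded_T: "bounded T" and \<rho>: "0 < \<rho>" and a_in: "a \<in> T"
    and star: "star_shaped_wrt T (ball a \<rho>)"
begin

lemma segment: "w \<in> ball a \<rho> \<Longrightarrow> z \<in> T \<Longrightarrow> 0 \<le> k \<Longrightarrow> k \<le> 1 \<Longrightarrow> (1 - k) *\<^sub>R w + k *\<^sub>R z \<in> T"
  using star unfolding star_shaped_wrt_def by (force simp: in_segment)

definition scales :: "point \<Rightarrow> real set" where
  "scales z = {t. 0 < t \<and> a + z /\<^sub>R t \<in> T}"

definition gauge_fun :: "point \<Rightarrow> real" where "gauge_fun z = Inf (scales z)"

lemma scales_bdd: "bdd_below (scales z)"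
  by (intro bdd_belowI[of _ 0]) (auto simp: scales_def)

text \<open>With \<open>d = t' - t\<close>, the point \<open>a + z' / t'\<close> is the convex
  combination, with weights \<open>d / t'\<close> and \<open>t / t'\<close>, of the point
  \<open>a + (z' - z) / d\<close> of the ball and the point \<open>a + z / t\<close> of
  \<open>T\<close>. This is where the Lipschitz constant \<open>1 / \<rho>\<close> of the gauge
  comes from.\<close>

lemma scales_step:
  assumes t: "t \<in> scales z" and t': "t + norm (z' - z) / \<rho> < t'"
  shows "t' \<in> scales z'"
proof -
  define d where "d = t' - t"
  have t0: "0 < t" "a + z /\<^sub>R t \<in> T" using t by (auto simp: scales_def)
  have nn: "0 \<le> norm (z' - z) / \<rho>" using \<rho> by simp
  have lt: "norm (z' - z) / \<rho> < d" using t' by (simp add: d_def)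
  have d: "0 < d" "norm (z' - z) < \<rho> * d" and t'0: "0 < t'"
  proof -
    show "0 < d" using nn lt by simp
    then show "0 < t'" using t0(1) by (simp add: d_def)
    show "norm (z' - z) < \<rho> * d" using lt \<rho> by (simp add: pos_divide_less_eq mult.commute)
  qed
  define w where "w = a + (z' - z) /\<^sub>R d"
  have "dist a w = norm (z' - z) / d"
    using d by (simp add: w_def dist_norm divide_inverse_commute)
  then have "w \<in> ball a \<rho>" using d by (simp add: pos_divide_less_eq)
  then have "(1 - t / t') *\<^sub>R w + (t / t') *\<^sub>R (a + z /\<^sub>R t) \<in> T"
    using t0 t'0 d by (intro segment) (auto simp: d_def)
  also have "(1 - t / t') *\<^sub>R w + (t / t') *\<^sub>R (a + z /\<^sub>R t) = a + z' /\<^sub>R t'"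
  proof -
    have 1: "1 - t / t' = d / t'" using t'0 by (simp add: d_def field_simps)
    have "(1 - t / t') *\<^sub>R w = (1 - t / t') *\<^sub>R a + (z' - z) /\<^sub>R t'"
      unfolding w_def scaleR_add_right 1 using d by (simp add: divide_inverse)
    moreover have "(t / t') *\<^sub>R (a + z /\<^sub>R t) = (t / t') *\<^sub>R a + z /\<^sub>R t'"
      using t0 by (simp add: scaleR_add_right divide_inverse)
    ultimately have "(1 - t / t') *\<^sub>R w + (t / t') *\<^sub>R (a + z /\<^sub>R t)
        = ((1 - t / t') *\<^sub>R a + (t / t') *\<^sub>R a) + ((z' - z) /\<^sub>R t' + z /\<^sub>R t')"
      by (simp only: add_ac)
    also have "\<dots> = a + z' /\<^sub>R t'"
      by (simp flip: scaleR_left_distrib scaleR_right_distrib)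
    finally show ?thesis .
  qed
  finally show ?thesis using t'0 by (simp add: scales_def)
qed

lemma scales_nonempty: "scales z \<noteq> {}"
proof -
  have "1 \<in> scales 0" using a_in by (simp add: scales_def)
  then show ?thesis using scales_step[of 1 0 z "1 + norm z / \<rho> + 1"] by auto
qed

lemma gauge_le: "gauge_fun z' \<le> gauge_fun z + norm (z' - z) / \<rho>"
proof (rule field_le_epsilon)
  fix e :: real assume e: "0 < e"
  obtain t where t: "t \<in> scales z" "t < gauge_fun z + e / 2"
    using cInf_lessD[OF scales_nonempty, of z "gauge_fun z + e / 2"] e by (auto simp: gauge_fun_def)
  have "t + norm (z' - z) / \<rho> + e / 2 \<in> scales z'" using e by (intro scales_step[OF t(1)]) auto
  then have "gauge_fun z' \<le> t + norm (z' - z) / \<rho> + e / 2"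
    unfolding gauge_fun_def by (intro cInf_lower scales_bdd)
  then show "gauge_fun z' \<le> gauge_fun z + norm (z' - z) / \<rho> + e" using t by simp
qed

lemma gauge_lipschitz: "(1 / \<rho>)-lipschitz_on X gauge_fun"
proof (rule lipschitz_onI)
  fix z z'
  show "dist (gauge_fun z) (gauge_fun z') \<le> 1 / \<rho> * dist z z'"
    using gauge_le[of z z'] gauge_le[of z' z] by (auto simp: dist_real_def dist_norm norm_minus_commute abs_le_iff)
qed (use \<rho> in auto)

lemma continuous_gauge: "continuous_on X gauge_fun"
  by (rule lipschitz_on_continuous_on[OF gauge_lipschitz])

text \<open>One inequality holds because multiplication by a positive factor maps scales to scales;
  the reverse one is the same statement for the inverse factor.\<close>

lemma gauge_scale: assumes "0 \<le> k" shows "gauge_fun (k *\<^sub>R z) = k * gauge_fun z"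
proof (cases "k = 0")
  case True
  have "gauge_fun 0 \<le> e" if "e > 0" for e
    unfolding gauge_fun_def using that a_in by (intro cInf_lower scales_bdd) (simp add: scales_def)
  then have "gauge_fun 0 \<le> 0" by (meson dense_ge)
  moreover have "0 \<le> gauge_fun 0"
    unfolding gauge_fun_def by (intro cInf_greatest scales_nonempty) (auto simp: scales_def)
  ultimately show ?thesis using True by simp
next
  case False
  then have k: "0 < k" using assms by simp
  have sub: "(*) j ` scales y \<subseteq> scales (j *\<^sub>R y)" if "0 < j" for j y
    using that by (auto simp: scales_def field_simps)
  have le: "gauge_fun (j *\<^sub>R y) \<le> j * gauge_fun y" if j: "0 < j" for j y
  proof -
    have "gauge_fun (j *\<^sub>R y) / j \<le> t" if t: "t \<in> scales y" for t
    proof -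
      have "gauge_fun (j *\<^sub>R y) \<le> j * t"
        unfolding gauge_fun_def by (intro cInf_lower scales_bdd) (use sub[OF j, of y] t in blast)
      then show ?thesis using j by (simp add: field_simps)
    qed
    then have "gauge_fun (j *\<^sub>R y) / j \<le> gauge_fun y"
      unfolding gauge_fun_def[of y] by (intro cInf_greatest scales_nonempty) auto
    then show ?thesis using j by (simp add: field_simps)
  qed
  have "gauge_fun ((1 / k) *\<^sub>R k *\<^sub>R z) \<le> 1 / k * gauge_fun (k *\<^sub>R z)" using k by (intro le) simp
  then have "k * gauge_fun z \<le> gauge_fun (k *\<^sub>R z)" using k by (simp add: field_simps)
  then show ?thesis using le[OF k, of z] by simp
qed

lemma gauge_less_1: "gauge_fun z < 1 \<longleftrightarrow> a + z \<in> T"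
proof
  assume "gauge_fun z < 1"
  then obtain t where t: "t \<in> scales z" "t < 1"
    using cInf_lessD[OF scales_nonempty, of z 1] by (auto simp: gauge_fun_def)
  then have "(1 - t) *\<^sub>R a + t *\<^sub>R (a + z /\<^sub>R t) \<in> T"
    using \<rho> by (intro segment) (auto simp: scales_def)
  moreover have "(1 - t) *\<^sub>R a + t *\<^sub>R (a + z /\<^sub>R t) = a + z"
    using t by (simp add: scales_def algebra_simps)
  ultimately show "a + z \<in> T" by simp
next
  assume "a + z \<in> T"
  then obtain r where r: "0 < r" "ball (a + z) r \<subseteq> T" using open_T by (meson openE)
  \<comment> \<open>A dilation factor above 1 that moves the point by less than \<open>r\<close>;
    the summand 1 in the denominator covers \<open>z = 0\<close>.\<close>
  define k where "k = 1 + r / (2 * (norm z + 1))"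
  have k: "1 < k" using r norm_ge_zero[of z] by (simp add: k_def add_nonneg_pos)
  have "dist (a + z) (a + k *\<^sub>R z) < r"
  proof -
    have "dist (a + z) (a + k *\<^sub>R z) = norm (z - k *\<^sub>R z)" by (simp add: dist_norm)
    also have "z - k *\<^sub>R z = - ((r / (2 * (norm z + 1))) *\<^sub>R z)" by (simp add: k_def algebra_simps)
    also have "norm \<dots> = r * (norm z / (2 * (norm z + 1)))" using r norm_ge_zero[of z] by simp
    also have "\<dots> < r * 1"
      by (intro mult_strict_left_mono r(1) half_ratio_less_1) simp
    finally show ?thesis by simp
  qed
  then have "a + k *\<^sub>R z \<in> T" using r by auto
  then have "1 / k \<in> scales z" using k by (simp add: scales_def)
  then have "gauge_fun z \<le> 1 / k" unfolding gauge_fun_def by (intro cInf_lower scales_bdd)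
  also have "\<dots> < 1" using k by simp
  finally show "gauge_fun z < 1" .
qed

lemma mem_T_iff: "z \<in> T \<longleftrightarrow> gauge_fun (z - a) < 1"
  using gauge_less_1[of "z - a"] by simp

definition R where "R = (SOME R. 0 < R \<and> (\<forall>z\<in>T. norm (z - a) \<le> R))"

lemma R: "0 < R" "z \<in> T \<Longrightarrow> norm (z - a) \<le> R"
proof -
  obtain e where e: "\<forall>z\<in>T. dist a z \<le> e" using bounded_T by (meson bounded_any_center)
  have "\<exists>R. 0 < R \<and> (\<forall>z\<in>T. norm (z - a) \<le> R)"
    using e by (intro exI[of _ "\<bar>e\<bar> + 1"]) (force simp: dist_norm norm_minus_commute)
  then have *: "0 < R \<and> (\<forall>z\<in>T. norm (z - a) \<le> R)" unfolding R_def by (rule someI_ex)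
  show "0 < R" "z \<in> T \<Longrightarrow> norm (z - a) \<le> R" using * by auto
qed

lemma norm_le_gauge: "norm z / R \<le> gauge_fun z"
  unfolding gauge_fun_def
proof (intro cInf_greatest scales_nonempty)
  fix t assume "t \<in> scales z"
  then have "0 < t" "norm (z /\<^sub>R t) \<le> R" using R(2)[of "a + z /\<^sub>R t"] by (auto simp: scales_def)
  then show "norm z / R \<le> t" using R(1) by (simp add: field_simps)
qed

lemma gauge_pos: "z \<noteq> 0 \<Longrightarrow> 0 < gauge_fun z"
  using norm_le_gauge[of z] R(1) by (smt (verit) divide_pos_pos zero_less_norm_iff)

lemma scaled_in_T: "gauge_fun z \<le> 1 \<Longrightarrow> 0 \<le> k \<Longrightarrow> k < 1 \<Longrightarrow> a + k *\<^sub>R z \<in> T"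
  unfolding gauge_less_1[symmetric]
  using gauge_scale[of k z] mult_left_mono[of "gauge_fun z" 1 k] by simp

lemma closure_T: "closure T = {z. gauge_fun (z - a) \<le> 1}"
proof
  have "closed {z. gauge_fun (z - a) \<le> 1}"
    by (intro closed_Collect_le continuous_on_compose2[OF continuous_gauge] continuous_intros) auto
  then show "closure T \<subseteq> {z. gauge_fun (z - a) \<le> 1}"
    by (intro closure_minimal) (auto simp: mem_T_iff)
  show "{z. gauge_fun (z - a) \<le> 1} \<subseteq> closure T"
  proof
    fix z assume z: "z \<in> {z. gauge_fun (z - a) \<le> 1}"
    have "(\<lambda>n. a + (1 - 1 / real (Suc n)) *\<^sub>R (z - a)) \<longlonglongrightarrow> a + (1 - 0) *\<^sub>R (z - a)"
      by (intro tendsto_intros LIMSEQ_Suc lim_1_over_n)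
    moreover have "a + (1 - 1 / real (Suc n)) *\<^sub>R (z - a) \<in> T" for n
      using z by (intro scaled_in_T) auto
    ultimately show "z \<in> closure T" unfolding closure_sequential by force
  qed
qed

lemma frontier_T: "frontier T = {z. gauge_fun (z - a) = 1}"
  unfolding frontier_def interior_open[OF open_T] closure_T by (auto simp: mem_T_iff)

text \<open>A star-shaped element has no slits: if a whole neighbourhood of \<open>z\<close> lies in
  the closure, so does a slightly dilated point, and by homogeneity the gauge at \<open>z\<close> is
  below 1.\<close>

lemma interior_closure_T: "interior (closure T) = T"
proof
  show "T \<subseteq> interior (closure T)" using open_T by (simp add: closure_subset interior_maximal)
  show "interior (closure T) \<subseteq> T"
  proof
    fix z assume "z \<in> interior (closure T)"
    then obtain r where r: "0 < r" "ball z r \<subseteq> closure T" by (meson interior_subset openE open_interior subset_trans)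
    define k where "k = 1 + r / (2 * (norm (z - a) + 1))"
    have k: "1 < k" using r norm_ge_zero[of "z - a"] by (simp add: k_def add_nonneg_pos)
    have "dist z (a + k *\<^sub>R (z - a)) < r"
    proof -
      have "z - (a + k *\<^sub>R (z - a)) = - ((r / (2 * (norm (z - a) + 1))) *\<^sub>R (z - a))" by (simp add: k_def algebra_simps)
      then have "dist z (a + k *\<^sub>R (z - a)) = r * (norm (z - a) / (2 * (norm (z - a) + 1)))"
        using r norm_ge_zero[of "z - a"] by (simp add: dist_norm del: minus_diff_eq)
      also have "\<dots> < r * 1"
        by (intro mult_strict_left_mono r(1) half_ratio_less_1) simp
      finally show ?thesis by simp
    qed
    then have "a + k *\<^sub>R (z - a) \<in> closure T" using r by auto
    then have "k * gauge_fun (z - a) \<le> 1" using k gauge_scale[of k "z - a"] by (simp add: closure_T)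
    moreover have "k * 1 \<le> k * gauge_fun (z - a)" if "\<not> gauge_fun (z - a) < 1"
      using that k by (intro mult_left_mono) auto
    ultimately have "gauge_fun (z - a) < 1" using k by linarith
    then show "z \<in> T" by (simp add: mem_T_iff)
  qed
qed

lemma compact_closure_T: "compact (closure T)" using bounded_T by simp

section \<open>Charts of the boundary by slopes around a fixed direction\<close>

definition ray :: "point \<Rightarrow> real \<Rightarrow> point" where "ray u s = u + s *\<^sub>R rot u"

text \<open>A reciprocal radius: the boundary point in the direction \<open>ray u s\<close> is
  \<open>a + ray u s /\<^sub>R q u s\<close>.\<close>

definition q :: "point \<Rightarrow> real \<Rightarrow> real" where "q u s = gauge_fun (ray u s)"

text \<open>One Borel function that is the derivative of \<open>q u\<close> almost everywhere, fixed
  by choice so that all later integrands in \<open>s\<close> are measurable; elsewhere its values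
  are unspecified.\<close>

definition q' :: "point \<Rightarrow> real \<Rightarrow> real" where
  "q' u = (SOME g. g \<in> borel_measurable borel \<and> (AE s in lborel. (q u has_real_derivative g s) (at s)))"

text \<open>Freezes the slope outside \<open>[-1, 1]\<close>, which makes the chart globally
  Lipschitz, as \<open>rectifiable_arc\<close> asks.\<close>

definition clamp1 :: "real \<Rightarrow> real" where "clamp1 s = max (-1) (min 1 s)"

text \<open>The part of the boundary seen from \<open>a\<close> in the quarter of directions around \<open>u\<close>, relative
  to \<open>a\<close>, parametrised by the slope \<open>s \<in> [-1, 1]\<close> with respect to \<open>u\<close>.\<close>

definition rad :: "point \<Rightarrow> real \<Rightarrow> point" where "rad u s = ray u (clamp1 s) /\<^sub>R q u (clamp1 s)"

text \<open>The quotient rule for \<open>ray u s /\<^sub>R q u s\<close>, with \<open>q'\<close> in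
  place of the derivative of \<open>q\<close>.\<close>

definition rad' :: "point \<Rightarrow> real \<Rightarrow> point" where
  "rad' u s = (1 / q u s) *\<^sub>R rot u - (q' u s / (q u s)\<^sup>2) *\<^sub>R ray u s"

text \<open>The gradient of the gauge. In coordinates \<open>x\<close>, \<open>y\<close> along
  \<open>u\<close> and \<open>rot u\<close> the gauge is \<open>x * q u (y / x)\<close> for positive
  \<open>x\<close>, and its gradient at slope \<open>s = y / x\<close> is this vector.\<close>

definition conormal :: "point \<Rightarrow> real \<Rightarrow> point" where
  "conormal u s = (q u s - s * q' u s) *\<^sub>R u + q' u s *\<^sub>R rot u"

definition slope :: "point \<Rightarrow> point \<Rightarrow> real" where
  "slope u z = ((z - a) \<bullet> rot u) / ((z - a) \<bullet> u)"

definition arc_of :: "point \<Rightarrow> real \<Rightarrow> point" where "arc_of u s = a + rad u s"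

context
  fixes u :: point
  assumes u: "norm u = 1"
begin

lemma u_rel: "u \<bullet> u = 1" "rot u \<bullet> rot u = 1" "u \<bullet> rot u = 0" "rot u \<bullet> u = 0" "fst u * fst u + snd u * snd u = 1"
proof -
  show "fst u * fst u + snd u * snd u = 1" using u norm_prod_sq[of u] by (simp add: power2_eq_square)
  then show "u \<bullet> u = 1" "rot u \<bullet> rot u = 1" "u \<bullet> rot u = 0" "rot u \<bullet> u = 0"
    by (auto simp: inner_prod rot_def)
qed

lemma norm_rot: "norm (rot u) = 1"
  using u_rel by (simp add: norm_eq_1)

lemma ray_inner: "ray u s \<bullet> u = 1" "ray u s \<bullet> rot u = s"
  by (auto simp: ray_def inner_add_left u_rel)

lemma ray_nonzero: "ray u s \<noteq> 0"
  using ray_inner(1)[of s] by auto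

lemma norm_ray_ge: "1 \<le> norm (ray u s)"
  using Cauchy_Schwarz_ineq2[of "ray u s" u] u by (simp add: ray_inner)

lemma norm_ray_le: "\<bar>s\<bar> \<le> 1 \<Longrightarrow> norm (ray u s) \<le> 2"
  unfolding ray_def by (rule norm_triangle_le) (simp add: u norm_rot)

lemma q_pos: "0 < q u s" unfolding q_def by (rule gauge_pos[OF ray_nonzero])

lemma q_ge: "1 / R \<le> q u s"
proof -
  have "1 / R \<le> norm (ray u s) / R" using R(1) norm_ray_ge by (simp add: divide_right_mono)
  then show ?thesis unfolding q_def using norm_le_gauge order_trans by blast
qed

lemma q_lipschitz: "(1 / \<rho>)-lipschitz_on X (q u)"
proof (rule lipschitz_onI)
  fix s t
  have "dist (ray u s) (ray u t) = norm ((s - t) *\<^sub>R rot u)" by (simp add: ray_def dist_norm algebra_simps)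
  then have "dist (ray u s) (ray u t) = dist s t" by (simp add: norm_rot dist_real_def)
  then show "dist (q u s) (q u t) \<le> 1 / \<rho> * dist s t"
    unfolding q_def using lipschitz_onD[OF gauge_lipschitz[of UNIV], of "ray u s" "ray u t"] by simp
qed (use \<rho> in auto)

lemma q_continuous: "continuous_on X (q u)"
  by (rule lipschitz_on_continuous_on[OF q_lipschitz])

lemma q': "q' u \<in> borel_measurable borel" "AE s in lborel. (q u has_real_derivative q' u s) (at s)"
proof -
  obtain g where "g \<in> borel_measurable borel" "AE s in lborel. (q u has_real_derivative g s) (at s)"
    using lipschitz_real_FTC[OF q_lipschitz] by metis
  then have "\<exists>g. g \<in> borel_measurable borel \<and> (AE s in lborel. (q u has_real_derivative g s) (at s))" by blast
  then have "q' u \<in> borel_measurable borel \<and> (AE s in lborel. (q u has_real_derivative q' u s) (at s))"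
    unfolding q'_def by (rule someI_ex)
  then show "q' u \<in> borel_measurable borel" "AE s in lborel. (q u has_real_derivative q' u s) (at s)" by auto
qed

lemma clamp1: "s \<in> {-1..1} \<Longrightarrow> clamp1 s = s" "\<bar>clamp1 s\<bar> \<le> 1" "clamp1 s \<in> {-1..1}"
  by (auto simp: clamp1_def)

lemma rad_eq: "s \<in> {-1..1} \<Longrightarrow> rad u s = ray u s /\<^sub>R q u s"
  by (simp add: rad_def clamp1)

lemma gauge_rad: "gauge_fun (rad u s) = 1"
  unfolding rad_def using q_pos[of "clamp1 s"] gauge_scale[of "inverse (q u (clamp1 s))" "ray u (clamp1 s)"]
  by (simp add: q_def)

lemma arc_in_frontier: "arc_of u s \<in> frontier T"
  by (simp add: arc_of_def frontier_T gauge_rad)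

lemma rad_lipschitz: "\<exists>L. L-lipschitz_on UNIV (rad u)"
proof -
  \<comment> \<open>The change splits into that of the ray, multiplied by
    \<open>1 / q \<le> R\<close>, and that of \<open>1 / q\<close>, which has Lipschitz constant
    \<open>R * R / \<rho>\<close>, multiplied by a ray of length at most 2.\<close>
  have "(R + 2 * (R * R / \<rho>))-lipschitz_on {-1..1} (\<lambda>s. ray u s /\<^sub>R q u s)"
  proof (rule lipschitz_onI)
    fix s t :: real assume st: "s \<in> {-1..1}" "t \<in> {-1..1}"
    have inv_le: "inverse (q u x) \<le> R" for x
      using q_ge[of x] q_pos[of x] R(1) by (simp add: field_simps)
    have "ray u s /\<^sub>R q u s - ray u t /\<^sub>R q u t
        = inverse (q u s) *\<^sub>R (ray u s - ray u t) + (inverse (q u s) - inverse (q u t)) *\<^sub>R ray u t"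
      by (simp add: algebra_simps)
    then have "dist (ray u s /\<^sub>R q u s) (ray u t /\<^sub>R q u t)
        \<le> norm (inverse (q u s) *\<^sub>R (ray u s - ray u t)) + norm ((inverse (q u s) - inverse (q u t)) *\<^sub>R ray u t)"
      unfolding dist_norm by (metis norm_triangle_ineq)
    also have "norm (inverse (q u s) *\<^sub>R (ray u s - ray u t)) \<le> R * dist s t"
    proof -
      have "ray u s - ray u t = (s - t) *\<^sub>R rot u" by (simp add: ray_def algebra_simps)
      then have "norm (inverse (q u s) *\<^sub>R (ray u s - ray u t)) = inverse (q u s) * dist s t"
        using q_pos[of s] by (simp add: norm_rot dist_real_def abs_mult)
      then show ?thesis using inv_le[of s] by (simp add: mult_right_mono)
    qed
    also have "norm ((inverse (q u s) - inverse (q u t)) *\<^sub>R ray u t) \<le> (R * R / \<rho> * dist s t) * 2"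
      unfolding norm_scaleR
    proof (rule mult_mono)
      have "inverse (q u s) - inverse (q u t) = (q u t - q u s) * (inverse (q u s) * inverse (q u t))"
        using q_pos[of s] q_pos[of t] by (simp add: field_simps)
      then have "\<bar>inverse (q u s) - inverse (q u t)\<bar> = \<bar>q u t - q u s\<bar> * (inverse (q u s) * inverse (q u t))"
        using q_pos[of s] q_pos[of t] by (simp add: abs_mult)
      also have "\<dots> \<le> (1 / \<rho> * dist s t) * (R * R)"
        using lipschitz_onD[OF q_lipschitz[of UNIV], of t s] inv_le[of s] inv_le[of t] q_pos[of s] q_pos[of t] R(1) \<rho>
        by (intro mult_mono) (auto simp: dist_real_def abs_minus_commute)
      finally show "\<bar>inverse (q u s) - inverse (q u t)\<bar> \<le> R * R / \<rho> * dist s t" by (simp add: mult_ac)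
      show "norm (ray u t) \<le> 2" using st by (intro norm_ray_le) auto
    qed (use R(1) \<rho> in auto)
    finally show "dist (ray u s /\<^sub>R q u s) (ray u t /\<^sub>R q u t) \<le> (R + 2 * (R * R / \<rho>)) * dist s t"
      by (simp add: algebra_simps)
  qed (use R(1) \<rho> in auto)
  then have "(R + 2 * (R * R / \<rho>))-lipschitz_on UNIV (\<lambda>s. ray u (max (-1) (min 1 s)) /\<^sub>R q u (max (-1) (min 1 s)))"
    by (rule lipschitz_on_clamp) simp
  then show ?thesis unfolding rad_def clamp1_def by blast
qed

lemma rad_derivative:
  assumes s: "s \<in> {-1<..<1}" and d: "(q u has_real_derivative q' u s) (at s)"
  shows "(rad u has_vector_derivative rad' u s) (at s)"
proof -
  have 1: "((\<lambda>s. inverse (q u s)) has_real_derivative - (q' u s / (q u s)\<^sup>2)) (at s)"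
    using DERIV_inverse_fun[OF d] q_pos[of s] by (simp add: power2_eq_square field_simps)
  have 2: "(ray u has_vector_derivative rot u) (at s)"
    unfolding ray_def by (auto intro!: derivative_eq_intros)
  have "((\<lambda>s. ray u s /\<^sub>R q u s) has_vector_derivative
      (inverse (q u s) *\<^sub>R rot u + (- (q' u s / (q u s)\<^sup>2)) *\<^sub>R ray u s)) (at s)"
    by (rule has_vector_derivative_scaleR[OF 1 2])
  then have "((\<lambda>s. ray u s /\<^sub>R q u s) has_vector_derivative rad' u s) (at s)"
    by (simp add: rad'_def divide_inverse)
  then show ?thesis
  proof (rule has_vector_derivative_transform_within_open[of _ _ _ "{-1<..<1}"])
    fix x :: real assume "x \<in> {-1<..<1}"
    then show "ray u x /\<^sub>R q u x = rad u x" by (intro rad_eq[symmetric]) auto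
  qed (use s in auto)
qed

lemma slope_measurable: "slope u \<in> borel_measurable borel"
  unfolding slope_def by measurable

lemma slope_arc: "s \<in> {-1..1} \<Longrightarrow> slope u (arc_of u s) = s"
  using q_pos[of s] by (simp add: slope_def arc_of_def rad_eq ray_inner)

lemma rad'_measurable: "rad' u \<in> borel_measurable borel"
proof -
  have [measurable]: "q u \<in> borel_measurable borel" by (intro borel_measurable_continuous_onI q_continuous)
  have [measurable]: "q' u \<in> borel_measurable borel" by (rule q')
  show ?thesis unfolding rad'_def ray_def by measurable
qed

lemma conormal_measurable: "conormal u \<in> borel_measurable borel"
proof -
  have [measurable]: "q u \<in> borel_measurable borel" by (intro borel_measurable_continuous_onI q_continuous)
  have [measurable]: "q' u \<in> borel_measurable borel" by (rule q')
  show ?thesis unfolding conormal_def by measurable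
qed

lemma AE_rad_derivative: "AE s in lborel. s \<in> {-1<..<1} \<longrightarrow> (rad u has_vector_derivative rad' u s) (at s)"
  using q'(2) by eventually_elim (auto intro: rad_derivative)

lemma arc_is_rectifiable: "\<exists>L. rectifiable_arc (arc_of u) (rad' u) (slope u) L (-1) 1"
proof -
  obtain L where L: "L-lipschitz_on UNIV (rad u)" using rad_lipschitz by blast
  have "rectifiable_arc (arc_of u) (rad' u) (slope u) L (-1) 1"
  proof
    show "L-lipschitz_on UNIV (arc_of u)"
      using L unfolding lipschitz_on_def arc_of_def by (auto simp: dist_norm)
    show "AE t in lborel. t \<in> {- 1<..<1} \<longrightarrow> (arc_of u has_vector_derivative rad' u t) (at t)"
      using AE_rad_derivative unfolding arc_of_def by eventually_elim (auto intro!: derivative_eq_intros)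
  qed (use slope_arc slope_measurable rad'_measurable in auto)
  then show ?thesis by blast
qed

lemma conormal_nonzero: "conormal u s \<noteq> 0"
proof
  assume "conormal u s = 0"
  then have "conormal u s \<bullet> rot u = 0" "conormal u s \<bullet> u = 0" by auto
  then have "q' u s = 0" "q u s - s * q' u s = 0" by (auto simp: conormal_def inner_add_left u_rel)
  then show False using q_pos[of s] by simp
qed

text \<open>\<open>- rot\<close> turns the tangent of the counterclockwise boundary curve into its outward conormal.\<close>

lemma conormal_eq: "conormal u s /\<^sub>R (q u s)\<^sup>2 = - rot (rad' u s)"
  using q_pos[of s]
  by (simp add: conormal_def rad'_def rot_def ray_def prod_eq_iff field_simps power2_eq_square)

lemma norm_rad': "norm (rad' u s) = norm (conormal u s) / (q u s)\<^sup>2"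
proof -
  have "norm (rad' u s) = norm (- rot (rad' u s))"
    by (simp add: norm_prod_def rot_def add.commute)
  also have "\<dots> = norm (conormal u s) / (q u s)\<^sup>2"
    unfolding conormal_eq[symmetric] by (simp add: divide_inverse)
  finally show ?thesis .
qed

text \<open>On the half plane in front of \<open>a\<close> the gauge is
  \<open>(z - a) \<bullet> u\<close> times \<open>q u\<close> of the slope, which is differentiable
  at every boundary point at whose slope \<open>q u\<close> is. The normal is then the one of a
  sublevel set.\<close>

lemma outer_normal_arc:
  assumes s: "s \<in> {-1<..<1}" and d: "(q u has_real_derivative q' u s) (at s)"
  shows "is_outer_normal T (arc_of u s) (conormal u s /\<^sub>R norm (conormal u s))"
proof (rule is_outer_normal_sublevel[where g = "\<lambda>z. gauge_fun (z - a)"])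
  define z where "z = arc_of u s"
  have sl: "slope u z = s" using s slope_arc[of s] by (simp add: z_def)
  have zu: "(z - a) \<bullet> u = 1 / q u s" "(z - a) \<bullet> rot u = s / q u s"
    using s by (auto simp: z_def arc_of_def rad_eq ray_inner divide_inverse)
  have pos: "0 < (z - a) \<bullet> u" using zu q_pos[of s] by simp
  have dx: "((\<lambda>z. (z - a) \<bullet> u) has_derivative (\<lambda>h. h \<bullet> u)) (at z)"
    by (auto intro!: derivative_eq_intros)
  have dy: "((\<lambda>z. (z - a) \<bullet> rot u) has_derivative (\<lambda>h. h \<bullet> rot u)) (at z)"
    by (auto intro!: derivative_eq_intros)
  have ds: "(slope u has_derivative (\<lambda>h. (h \<bullet> rot u - s * (h \<bullet> u)) * q u s)) (at z)"
    unfolding slope_def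
  proof (rule has_derivative_eq_rhs[OF has_derivative_divide[OF dy dx]])
    show "(z - a) \<bullet> u \<noteq> 0" using pos by simp
    show "(\<lambda>h. - ((z - a) \<bullet> rot u) * (inverse ((z - a) \<bullet> u) * (h \<bullet> u) * inverse ((z - a) \<bullet> u))
          + h \<bullet> rot u / ((z - a) \<bullet> u)) = (\<lambda>h. (h \<bullet> rot u - s * (h \<bullet> u)) * q u s)"
      unfolding zu using q_pos[of s] by (intro ext) (simp add: field_simps)
  qed
  have "((\<lambda>z. (z - a) \<bullet> u * q u (slope u z)) has_derivative
      (\<lambda>h. (z - a) \<bullet> u * (q' u s * ((h \<bullet> rot u - s * (h \<bullet> u)) * q u s)) + (h \<bullet> u) * q u (slope u z))) (at z)"
  proof (intro has_derivative_mult dx)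
    have "(q u has_derivative (*) (q' u s)) (at (slope u z))"
      using d by (simp add: sl has_field_derivative_def)
    from has_derivative_compose[OF ds this]
    show "((\<lambda>z. q u (slope u z)) has_derivative (\<lambda>h. q' u s * ((h \<bullet> rot u - s * (h \<bullet> u)) * q u s))) (at z)" .
  qed
  also have "(\<lambda>h. (z - a) \<bullet> u * (q' u s * ((h \<bullet> rot u - s * (h \<bullet> u)) * q u s)) + (h \<bullet> u) * q u (slope u z))
      = (\<lambda>h. conormal u s \<bullet> h)"
    unfolding sl zu conormal_def inner_add_left inner_scaleR_left inner_commute[of u] inner_commute[of "rot u"]
    using q_pos[of s] by (intro ext) (simp add: field_simps)
  finally have 1: "((\<lambda>z. (z - a) \<bullet> u * q u (slope u z)) has_derivative (\<lambda>h. conormal u s \<bullet> h)) (at z)" .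
  show "((\<lambda>z. gauge_fun (z - a)) has_derivative (\<lambda>h. conormal u s \<bullet> h)) (at (arc_of u s))"
  proof (rule has_derivative_transform_within_open[OF 1[unfolded z_def], where s = "{y. 0 < (y - a) \<bullet> u}"])
    show "open {y. 0 < (y - a) \<bullet> u}" by (intro open_Collect_less continuous_intros)
    show "arc_of u s \<in> {y. 0 < (y - a) \<bullet> u}" using pos by (simp add: z_def)
    fix y assume "y \<in> {y. 0 < (y - a) \<bullet> u}"
    then have p: "0 < (y - a) \<bullet> u" by simp
    have "((y - a) \<bullet> u) *\<^sub>R ray u (slope u y) = ((y - a) \<bullet> u) *\<^sub>R u + ((y - a) \<bullet> rot u) *\<^sub>R rot u"
      using p by (simp add: ray_def slope_def scaleR_add_right)
    also have "\<dots> = y - a"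
    proof -
      have "fst v * (fst u * fst u + snd u * snd u) = fst v" "snd v * (fst u * fst u + snd u * snd u) = snd v" for v :: point
        by (simp_all add: u_rel)
      from this[of "y - a"] show ?thesis
        by (simp add: prod_eq_iff inner_prod rot_def algebra_simps)
    qed
    finally show "(y - a) \<bullet> u * q u (slope u y) = gauge_fun (y - a)"
      using gauge_scale[of "(y - a) \<bullet> u" "ray u (slope u y)"] p by (simp add: q_def)
  qed
  show "gauge_fun (arc_of u s - a) = 1" by (simp add: arc_of_def gauge_rad)
  show "conormal u s \<noteq> 0" by (rule conormal_nonzero)
  show "w \<in> T \<longleftrightarrow> gauge_fun (w - a) < 1" for w by (rule mem_T_iff)
qed

lemma AE_normal_arc:
  "AE z in hausdorff1. z \<in> arc_of u ` {-1..1} \<longrightarrow>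
     is_outer_normal T z (conormal u (slope u z) /\<^sub>R norm (conormal u (slope u z)))"
proof -
  obtain L where L: "rectifiable_arc (arc_of u) (rad' u) (slope u) L (-1) 1" using arc_is_rectifiable by blast
  have "AE s :: real in lborel. s \<noteq> -1" "AE s :: real in lborel. s \<noteq> 1" by (auto intro: AE_lborel_singleton)
  with q'(2) show ?thesis
  proof (intro rectifiable_arc.AE_arc[OF L], eventually_elim)
    case (elim s)
    then show ?case using outer_normal_arc[of s] slope_arc[of s] by auto
  qed
qed

end

end

section \<open>Integration over a star-shaped domain and over its boundary\<close>

lemma nn_integral_affine_plane:
  fixes D :: "point \<Rightarrow> ennreal"
  assumes D: "D \<in> borel_measurable borel" and c: "\<bar>c1\<bar> = 1" "\<bar>c2\<bar> = 1"
  shows "(\<integral>\<^sup>+z. D z \<partial>lborel) = (\<integral>\<^sup>+x. \<integral>\<^sup>+y. D (p + c1 * x, r + c2 * y) \<partial>lborel \<partial>lborel)"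
proof -
  have [measurable]: "D \<in> borel_measurable (borel \<Otimes>\<^sub>M borel)" using D by (simp add: borel_prod)
  have c0: "c1 \<noteq> 0" "c2 \<noteq> 0" using c by auto
  have "(\<integral>\<^sup>+z. D z \<partial>lborel) = (\<integral>\<^sup>+z. D z \<partial>(lborel \<Otimes>\<^sub>M lborel))"
    by (simp add: lborel_prod)
  also have "\<dots> = (\<integral>\<^sup>+x. \<integral>\<^sup>+y. D (x, y) \<partial>lborel \<partial>lborel)"
    by (rule lborel.nn_integral_fst[symmetric]) (simp add: D lborel_prod)
  also have "\<dots> = \<bar>c1\<bar> * (\<integral>\<^sup>+x. \<integral>\<^sup>+y. D (p + c1 * x, y) \<partial>lborel \<partial>lborel)"
    by (intro nn_integral_real_affine c0) measurable
  also have "\<dots> = (\<integral>\<^sup>+x. \<integral>\<^sup>+y. D (p + c1 * x, y) \<partial>lborel \<partial>lborel)" using c by simp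
  also have "\<dots> = (\<integral>\<^sup>+x. \<bar>c2\<bar> * (\<integral>\<^sup>+y. D (p + c1 * x, r + c2 * y) \<partial>lborel) \<partial>lborel)"
    by (intro nn_integral_cong nn_integral_real_affine c0) measurable
  finally show ?thesis using c by simp
qed

text \<open>The four frames are handled case by case with Fubini and one-dimensional reflections and
  translations; for vertical \<open>u\<close> the order of integration is exchanged.\<close>

lemma nn_integral_axis_coords:
  fixes D :: "point \<Rightarrow> ennreal"
  assumes D: "D \<in> borel_measurable borel" and u: "u \<in> axis_dirs"
  shows "(\<integral>\<^sup>+z. D z \<partial>lborel) = (\<integral>\<^sup>+x. \<integral>\<^sup>+y. D (a + x *\<^sub>R u + y *\<^sub>R rot u) \<partial>lborel \<partial>lborel)"
proof -
  have [measurable]: "D \<in> borel_measurable (borel \<Otimes>\<^sub>M borel)" using D by (simp add: borel_prod)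
  have swap: "(\<integral>\<^sup>+x. \<integral>\<^sup>+y. D (p + c1 * x, r + c2 * y) \<partial>lborel \<partial>lborel)
      = (\<integral>\<^sup>+y. \<integral>\<^sup>+x. D (p + c1 * x, r + c2 * y) \<partial>lborel \<partial>lborel)" for p r c1 c2 :: real
    by (intro lborel_pair.Fubini'[symmetric]) measurable
  obtain p r where a: "a = (p, r)" by (cases a)
  consider "u = (1, 0)" | "u = (0, 1)" | "u = (-1, 0)" | "u = (0, -1)" using u by (auto simp: axis_dirs_def)
  then show ?thesis
  proof cases
    case 1 then show ?thesis using nn_integral_affine_plane[OF D, of 1 1 p r] by (simp add: a rot_def)
  next
    case 2 then show ?thesis using nn_integral_affine_plane[OF D, of "-1" 1 p r] swap[of p "-1" r 1] by (simp add: a rot_def)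
  next
    case 3 then show ?thesis using nn_integral_affine_plane[OF D, of "-1" "-1" p r] by (simp add: a rot_def)
  next
    case 4 then show ?thesis using nn_integral_affine_plane[OF D, of 1 "-1" p r] swap[of p 1 r "-1"] by (simp add: a rot_def)
  qed
qed

lemma axis_dirs_norm: "u \<in> axis_dirs \<Longrightarrow> norm u = 1"
  by (auto simp: axis_dirs_def norm_prod_def)

text \<open>Completeness of the measure: a change on a null set keeps measurability. It is what
  makes \<open>outer_normal\<close>, defined by a description operator, a measurable
  function.\<close>

lemma hausdorff1_measurable_AE:
  fixes f g :: "'a::metric_space \<Rightarrow> 'b::topological_space"
  assumes g: "g \<in> borel_measurable hausdorff1" and eq: "AE z in hausdorff1. f z = g z"
  shows "f \<in> borel_measurable hausdorff1"
proof (rule measurableI)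
  fix B :: "'b set" assume B: "B \<in> sets borel"
  have N: "{z. f z \<noteq> g z} \<in> null_sets hausdorff1"
    using eq hausdorff1_null_subset by (auto simp: eventually_ae_filter)
  have split: "f -` B \<inter> space hausdorff1 = (g -` B - {z. f z \<noteq> g z}) \<union> (f -` B \<inter> {z. f z \<noteq> g z})" by auto
  have "g -` B \<in> sets hausdorff1" using measurable_sets[OF g B] by simp
  moreover have "f -` B \<inter> {z. f z \<noteq> g z} \<in> null_sets hausdorff1"
    by (rule hausdorff1_null_subset[OF _ N]) auto
  ultimately have "(g -` B - {z. f z \<noteq> g z}) \<union> (f -` B \<inter> {z. f z \<noteq> g z}) \<in> sets hausdorff1"
    using null_setsD2[OF N] by (intro sets.Un sets.Diff) (auto dest: null_setsD2)
  then show "f -` B \<inter> space hausdorff1 \<in> sets hausdorff1" using split by simp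
qed simp

lemma rot_axis_dirs: "(\<Sum>u\<in>axis_dirs. f (rot u)) = (\<Sum>u\<in>axis_dirs. f u)"
  by (simp add: axis_dirs_def rot_def algebra_simps)

section \<open>Change of variables on the cone over one chart\<close>

context star_domain
begin

text \<open>Half open on purpose: the diagonal belonging to two neighbouring quarters is assigned to
  exactly one of them, so the four sectors partition the plane without \<open>a\<close>.\<close>

definition sector :: "point \<Rightarrow> point set" where
  "sector u = {z. 0 < (z - a) \<bullet> u \<and> - ((z - a) \<bullet> u) \<le> (z - a) \<bullet> rot u \<and> (z - a) \<bullet> rot u < (z - a) \<bullet> u}"

lemma sector_borel [measurable]: "sector u \<in> sets borel"
  unfolding sector_def by measurable

lemma sector_partition: "z \<noteq> a \<Longrightarrow> (\<Sum>u\<in>axis_dirs. indicator (sector u) z) = (1 :: real)"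
proof -
  assume z: "z \<noteq> a"
  define x y where "x = fst z - fst a" and "y = snd z - snd a"
  have xy: "x \<noteq> 0 \<or> y \<noteq> 0" using z by (auto simp: x_def y_def prod_eq_iff)
  have "(\<Sum>u\<in>axis_dirs. indicator (sector u) z)
      = of_bool (0 < x \<and> - x \<le> y \<and> y < x) + of_bool (0 < y \<and> - y \<le> - x \<and> - x < y)
      + of_bool (0 < - x \<and> x \<le> - y \<and> - y < - x) + (of_bool (0 < - y \<and> y \<le> x \<and> x < - y) :: real)"
    by (simp add: axis_dirs_def sector_def indicator_def inner_prod rot_def x_def y_def)
  also have "\<dots> = 1" using xy by (auto simp: of_bool_def)
  finally show ?thesis .
qed

text \<open>Two one-dimensional substitutions: \<open>y = x * s\<close> with factor
  \<open>x\<close>, then, after Fubini, \<open>x = t / q u s\<close> with factor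
  \<open>1 / q u s\<close>. Together they give the Jacobian \<open>t / (q u s)\<^sup>2\<close>,
  although the chart is only Lipschitz in \<open>s\<close>.\<close>

lemma sector_nn_integral:
  fixes D :: "point \<Rightarrow> ennreal"
  assumes D: "D \<in> borel_measurable borel" and u: "u \<in> axis_dirs"
  shows "(\<integral>\<^sup>+z. D z * indicator (sector u) z \<partial>lborel) =
    (\<integral>\<^sup>+s. (\<integral>\<^sup>+t. ennreal (indicator {-1..<1} s * indicator {0<..} t * (t / (q u s)\<^sup>2)) * D (a + t *\<^sub>R rad u s) \<partial>lborel) \<partial>lborel)"
proof -
  note u1 = axis_dirs_norm[OF u]
  note rel = u_rel[OF u1]
  have [measurable]: "D \<in> borel_measurable borel" by (rule D)
  have [measurable]: "q u \<in> borel_measurable borel" by (intro borel_measurable_continuous_onI q_continuous[OF u1])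
  have [measurable]: "ray u \<in> borel_measurable borel" unfolding ray_def by measurable
  have "(\<integral>\<^sup>+z. D z * indicator (sector u) z \<partial>lborel)
      = (\<integral>\<^sup>+x. \<integral>\<^sup>+y. D (a + x *\<^sub>R u + y *\<^sub>R rot u) * indicator (sector u) (a + x *\<^sub>R u + y *\<^sub>R rot u) \<partial>lborel \<partial>lborel)"
    by (intro nn_integral_axis_coords u) measurable
  also have "\<dots> = (\<integral>\<^sup>+x. \<integral>\<^sup>+y. D (a + x *\<^sub>R u + y *\<^sub>R rot u) * indicator {0<..} x * indicator {-x..<x} y \<partial>lborel \<partial>lborel)"
  proof (intro nn_integral_cong)
    fix x y
    have "(a + x *\<^sub>R u + y *\<^sub>R rot u - a) \<bullet> u = x" "(a + x *\<^sub>R u + y *\<^sub>R rot u - a) \<bullet> rot u = y"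
      using rel by (auto simp: inner_add_left)
    then show "D (a + x *\<^sub>R u + y *\<^sub>R rot u) * indicator (sector u) (a + x *\<^sub>R u + y *\<^sub>R rot u)
        = D (a + x *\<^sub>R u + y *\<^sub>R rot u) * indicator {0<..} x * indicator {-x..<x} y"
      unfolding sector_def by (auto simp: indicator_def)
  qed
  also have "\<dots> = (\<integral>\<^sup>+x. \<integral>\<^sup>+s. ennreal x * D (a + x *\<^sub>R ray u s) * indicator {0<..} x * indicator {-1..<1} s \<partial>lborel \<partial>lborel)"
  proof (rule nn_integral_cong)
    fix x :: real
    show "(\<integral>\<^sup>+y. D (a + x *\<^sub>R u + y *\<^sub>R rot u) * indicator {0<..} x * indicator {-x..<x} y \<partial>lborel)
        = (\<integral>\<^sup>+s. ennreal x * D (a + x *\<^sub>R ray u s) * indicator {0<..} x * indicator {-1..<1} s \<partial>lborel)"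
    proof (cases "0 < x")
      case True
      have "(\<integral>\<^sup>+y. D (a + x *\<^sub>R u + y *\<^sub>R rot u) * indicator {0<..} x * indicator {-x..<x} y \<partial>lborel)
          = \<bar>x\<bar> * (\<integral>\<^sup>+s. D (a + x *\<^sub>R u + (0 + x * s) *\<^sub>R rot u) * indicator {0<..} x * indicator {-x..<x} (0 + x * s) \<partial>lborel)"
        using True by (intro nn_integral_real_affine) auto
      also have "\<dots> = (\<integral>\<^sup>+s. \<bar>x\<bar> * (D (a + x *\<^sub>R u + (0 + x * s) *\<^sub>R rot u) * indicator {0<..} x * indicator {-x..<x} (0 + x * s)) \<partial>lborel)"
        by (intro nn_integral_cmult[symmetric]) measurable
      also have "\<dots> = (\<integral>\<^sup>+s. ennreal x * D (a + x *\<^sub>R ray u s) * indicator {0<..} x * indicator {-1..<1} s \<partial>lborel)"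
      proof (intro nn_integral_cong)
        fix s :: real
        have mem: "0 + x * s \<in> {-x..<x} \<longleftrightarrow> s \<in> {-1..<1}"
          using True mult_le_cancel_left_pos[of x "-1" s] mult_less_cancel_left_pos[of x s 1] by auto
        have pt: "a + x *\<^sub>R u + (0 + x * s) *\<^sub>R rot u = a + x *\<^sub>R ray u s"
          by (simp add: ray_def scaleR_add_right)
        show "\<bar>x\<bar> * (D (a + x *\<^sub>R u + (0 + x * s) *\<^sub>R rot u) * indicator {0<..} x * indicator {-x..<x} (0 + x * s))
            = ennreal x * D (a + x *\<^sub>R ray u s) * indicator {0<..} x * indicator {-1..<1} s"
          unfolding pt indicator_def mem using True by auto
      qed
      finally show ?thesis .
    qed auto
  qed
  also have "\<dots> = (\<integral>\<^sup>+s. \<integral>\<^sup>+x. ennreal x * D (a + x *\<^sub>R ray u s) * indicator {0<..} x * indicator {-1..<1} s \<partial>lborel \<partial>lborel)"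
    by (intro lborel_pair.Fubini') measurable
  also have "\<dots> = (\<integral>\<^sup>+s. (\<integral>\<^sup>+t. ennreal (indicator {-1..<1} s * indicator {0<..} t * (t / (q u s)\<^sup>2)) * D (a + t *\<^sub>R rad u s) \<partial>lborel) \<partial>lborel)"
  proof (rule nn_integral_cong)
    fix s :: real
    define k where "k = 1 / q u s"
    have k: "0 < k" using q_pos[OF u1, of s] by (simp add: k_def)
    have "(\<integral>\<^sup>+x. ennreal x * D (a + x *\<^sub>R ray u s) * indicator {0<..} x * indicator {-1..<1} s \<partial>lborel)
        = \<bar>k\<bar> * (\<integral>\<^sup>+t. ennreal (0 + k * t) * D (a + (0 + k * t) *\<^sub>R ray u s) * indicator {0<..} (0 + k * t) * indicator {-1..<1} s \<partial>lborel)"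
      using k by (intro nn_integral_real_affine) auto
    also have "\<dots> = (\<integral>\<^sup>+t. \<bar>k\<bar> * (ennreal (0 + k * t) * D (a + (0 + k * t) *\<^sub>R ray u s) * indicator {0<..} (0 + k * t) * indicator {-1..<1} s) \<partial>lborel)"
      by (intro nn_integral_cmult[symmetric]) measurable
    also have "\<dots> = (\<integral>\<^sup>+t. ennreal (indicator {-1..<1} s * indicator {0<..} t * (t / (q u s)\<^sup>2)) * D (a + t *\<^sub>R rad u s) \<partial>lborel)"
    proof (intro nn_integral_cong)
      fix t :: real
      have 1: "k * t \<in> {0<..} \<longleftrightarrow> t \<in> {0<..}" using k by (simp add: zero_less_mult_iff)
      show "\<bar>k\<bar> * (ennreal (0 + k * t) * D (a + (0 + k * t) *\<^sub>R ray u s) * indicator {0<..} (0 + k * t) * indicator {-1..<1} s)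
          = ennreal (indicator {-1..<1} s * indicator {0<..} t * (t / (q u s)\<^sup>2)) * D (a + t *\<^sub>R rad u s)"
      proof (cases "t \<in> {0<..} \<and> s \<in> {-1..<1}")
        case True
        have "rad u s = k *\<^sub>R ray u s" using True by (simp add: rad_eq[OF u1] k_def divide_inverse)
        then have "a + (0 + k * t) *\<^sub>R ray u s = a + t *\<^sub>R rad u s" by (simp add: mult.commute)
        moreover have "ennreal k * ennreal (k * t) = ennreal (t / (q u s)\<^sup>2)"
          using True k by (simp add: ennreal_mult[symmetric] k_def power2_eq_square)
        ultimately show ?thesis using True 1 k by (simp add: mult.assoc[symmetric])
      next
        case False then show ?thesis using 1 by (auto simp: indicator_def)
      qed
    qed
    finally show "(\<integral>\<^sup>+x. ennreal x * D (a + x *\<^sub>R ray u s) * indicator {0<..} x * indicator {-1..<1} s \<partial>lborel)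
        = (\<integral>\<^sup>+t. ennreal (indicator {-1..<1} s * indicator {0<..} t * (t / (q u s)\<^sup>2)) * D (a + t *\<^sub>R rad u s) \<partial>lborel)" .
  qed
  finally show ?thesis .
qed

definition weight :: "point \<Rightarrow> real \<times> real \<Rightarrow> real" where
  "weight u = (\<lambda>(s, t). indicator {-1..<1} s * indicator {0<..} t * (t / (q u s)\<^sup>2))"

definition cone_map :: "point \<Rightarrow> real \<times> real \<Rightarrow> point" where
  "cone_map u = (\<lambda>(s, t). a + t *\<^sub>R rad u s)"

lemma rad_continuous: "norm u = 1 \<Longrightarrow> continuous_on X (rad u)"
  using rad_lipschitz by (meson lipschitz_on_continuous_on lipschitz_on_subset subset_UNIV)

lemma weight_measurable: "norm u = 1 \<Longrightarrow> weight u \<in> borel_measurable (borel \<Otimes>\<^sub>M borel)"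
proof -
  assume u: "norm u = 1"
  have [measurable]: "q u \<in> borel_measurable borel" by (intro borel_measurable_continuous_onI q_continuous[OF u])
  show ?thesis unfolding weight_def by measurable
qed

lemma cone_map_measurable: "norm u = 1 \<Longrightarrow> cone_map u \<in> borel_measurable (borel \<Otimes>\<^sub>M borel)"
proof -
  assume u: "norm u = 1"
  have [measurable]: "rad u \<in> borel_measurable borel" by (intro borel_measurable_continuous_onI rad_continuous[OF u])
  show ?thesis unfolding cone_map_def by measurable
qed

lemma weight_nonneg: "0 \<le> weight u p"
  by (auto simp: weight_def indicator_def split: prod.split)

text \<open>The formula for nonnegative integrands, restated as an equality of measures, gives
  integrals of functions of either sign.\<close>

lemma distr_cone_map:
  assumes u: "u \<in> axis_dirs"
  shows "distr (density (lborel \<Otimes>\<^sub>M lborel) (\<lambda>p. ennreal (weight u p))) borel (cone_map u)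
    = density lborel (\<lambda>z. ennreal (indicator (sector u) z))"
proof (rule measure_eqI)
  note u1 = axis_dirs_norm[OF u]
  have [measurable]: "weight u \<in> borel_measurable (borel \<Otimes>\<^sub>M borel)" by (rule weight_measurable[OF u1])
  have [measurable]: "cone_map u \<in> borel_measurable (borel \<Otimes>\<^sub>M borel)" by (rule cone_map_measurable[OF u1])
  fix A assume "A \<in> sets (distr (density (lborel \<Otimes>\<^sub>M lborel) (\<lambda>p. ennreal (weight u p))) borel (cone_map u))"
  then have A[measurable]: "A \<in> sets borel" by simp
  have "emeasure (distr (density (lborel \<Otimes>\<^sub>M lborel) (\<lambda>p. ennreal (weight u p))) borel (cone_map u)) A
      = (\<integral>\<^sup>+p. ennreal (weight u p) * indicator (cone_map u -` A) p \<partial>(lborel \<Otimes>\<^sub>M lborel))"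
  proof -
    have "cone_map u -` A \<inter> space (borel \<Otimes>\<^sub>M borel) \<in> sets (borel \<Otimes>\<^sub>M borel)" by measurable
    then have "cone_map u -` A \<in> sets (lborel \<Otimes>\<^sub>M lborel)" by (simp add: space_pair_measure cong: sets_pair_measure_cong)
    then show ?thesis by (subst emeasure_distr) (auto simp: emeasure_density space_pair_measure)
  qed
  also have "\<dots> = (\<integral>\<^sup>+p. ennreal (weight u p) * indicator A (cone_map u p) \<partial>(lborel \<Otimes>\<^sub>M lborel))"
    by (intro nn_integral_cong) (auto simp: indicator_def)
  also have "\<dots> = (\<integral>\<^sup>+s. \<integral>\<^sup>+t. ennreal (weight u (s, t)) * indicator A (cone_map u (s, t)) \<partial>lborel \<partial>lborel)"
    by (intro lborel.nn_integral_fst[symmetric]) measurable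
  also have "\<dots> = (\<integral>\<^sup>+z. indicator A z * indicator (sector u) z \<partial>lborel)"
    by (subst sector_nn_integral[OF _ u]) (auto simp: weight_def cone_map_def)
  also have "\<dots> = emeasure (density lborel (\<lambda>z. ennreal (indicator (sector u) z))) A"
    by (subst emeasure_density) (auto intro!: nn_integral_cong simp: indicator_def)
  finally show "emeasure (distr (density (lborel \<Otimes>\<^sub>M lborel) (\<lambda>p. ennreal (weight u p))) borel (cone_map u)) A
      = emeasure (density lborel (\<lambda>z. ennreal (indicator (sector u) z))) A" .
qed simp

lemma sector_integral:
  fixes D :: "point \<Rightarrow> real"
  assumes D: "D \<in> borel_measurable borel" and u: "u \<in> axis_dirs"
  shows "(\<integral>z. indicator (sector u) z * D z \<partial>lborel) =
      (\<integral>p. weight u p * D (cone_map u p) \<partial>(lborel \<Otimes>\<^sub>M lborel))"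
proof -
  note u1 = axis_dirs_norm[OF u]
  have [measurable]: "weight u \<in> borel_measurable (borel \<Otimes>\<^sub>M borel)" by (rule weight_measurable[OF u1])
  have [measurable]: "cone_map u \<in> borel_measurable (borel \<Otimes>\<^sub>M borel)" by (rule cone_map_measurable[OF u1])
  have [measurable]: "D \<in> borel_measurable borel" by (rule D)
  let ?M = "density (lborel \<Otimes>\<^sub>M lborel) (\<lambda>p. ennreal (weight u p))"
  have cm: "cone_map u \<in> measurable ?M borel" by measurable
  have "(\<integral>z. indicator (sector u) z *\<^sub>R D z \<partial>lborel) = integral\<^sup>L (density lborel (\<lambda>z. ennreal (indicator (sector u) z))) D"
    by (intro integral_density[symmetric]) auto
  also have "\<dots> = (\<integral>p. D (cone_map u p) \<partial>?M)"
    unfolding distr_cone_map[OF u, symmetric] by (rule integral_distr[OF cm D])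
  also have "\<dots> = (\<integral>p. weight u p *\<^sub>R D (cone_map u p) \<partial>(lborel \<Otimes>\<^sub>M lborel))"
    by (intro integral_density) (auto simp: weight_nonneg)
  finally show ?thesis by simp
qed

lemma integral_sectors:
  fixes D :: "point \<Rightarrow> real"
  assumes D: "integrable lborel D"
  shows "(\<integral>z. D z \<partial>lborel) = (\<Sum>u\<in>axis_dirs. \<integral>z. indicator (sector u) z * D z \<partial>lborel)"
proof -
  have I: "integrable lborel (\<lambda>z. indicator (sector u) z * D z)" for u
    using integrable_mult_indicator[of "sector u" lborel D] D by simp
  have "(\<Sum>u\<in>axis_dirs. \<integral>z. indicator (sector u) z * D z \<partial>lborel) = (\<integral>z. (\<Sum>u\<in>axis_dirs. indicator (sector u) z * D z) \<partial>lborel)"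
    by (rule Bochner_Integration.integral_sum[OF I, symmetric])
  also have "\<dots> = (\<integral>z. D z \<partial>lborel)"
  proof (rule integral_cong_AE)
    show "AE z in lborel. (\<Sum>u\<in>axis_dirs. indicator (sector u) z * D z) = D z"
      using AE_lborel_singleton[of a]
      by eventually_elim (simp add: sum_distrib_right[symmetric] sector_partition)
    show "(\<lambda>z. \<Sum>u\<in>axis_dirs. indicator (sector u) z * D z) \<in> borel_measurable lborel"
      by (intro borel_measurable_integrable Bochner_Integration.integrable_sum I)
  qed (use D in auto)
  finally show ?thesis by simp
qed

section \<open>The boundary as a union of four arcs\<close>

definition arcs :: "point set" where "arcs = (\<Union>u\<in>axis_dirs. arc_of u ` {-1..1})"

lemma frontier_eq_arcs: "frontier T = arcs"
proof
  show "arcs \<subseteq> frontier T"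
    unfolding arcs_def using arc_in_frontier axis_dirs_norm by auto
  show "frontier T \<subseteq> arcs"
  proof
    fix z assume "z \<in> frontier T"
    then have g: "gauge_fun (z - a) = 1" by (simp add: frontier_T)
    then have "z \<noteq> a" using gauge_scale[of 0 0] by auto
    from sector_partition[OF this] obtain u where u: "u \<in> axis_dirs" "z \<in> sector u"
      by (metis (mono_tags, lifting) indicator_simps(2) sum.neutral zero_neq_one)
    note u1 = axis_dirs_norm[OF u(1)]
    define x s where "x = (z - a) \<bullet> u" and "s = slope u z"
    have x: "0 < x" and s: "s \<in> {-1..1}" using u(2) by (auto simp: x_def s_def slope_def sector_def field_simps)
    have za: "z - a = x *\<^sub>R ray u s"
      using x u(1) by (auto simp: axis_dirs_def rot_def ray_def s_def slope_def x_def inner_prod prod_eq_iff)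
    then have "x * q u s = 1" using g gauge_scale[of x "ray u s"] x by (simp add: q_def)
    then have "x = inverse (q u s)" using q_pos[OF u1, of s] by (simp add: field_simps)
    then have "z = arc_of u s" using za s by (simp add: arc_of_def rad_eq[OF u1] algebra_simps)
    then show "z \<in> arcs" unfolding arcs_def using u(1) s by (intro UN_I[of u]) auto
  qed
qed

lemma arc_closed: "u \<in> axis_dirs \<Longrightarrow> closed (arc_of u ` {-1..1})"
  using arc_is_rectifiable[OF axis_dirs_norm] rectifiable_arc.closed_subarc by blast

lemma emeasure_arc_finite': "u \<in> axis_dirs \<Longrightarrow> emeasure hausdorff1 (arc_of u ` {-1..1}) < top"
  using arc_is_rectifiable[OF axis_dirs_norm] rectifiable_arc.emeasure_arc_finite by blast

lemma emeasure_frontier_finite: "emeasure hausdorff1 (frontier T) < top"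
proof -
  have "emeasure hausdorff1 (frontier T) \<le> (\<Sum>u\<in>axis_dirs. emeasure hausdorff1 (arc_of u ` {-1..1}))"
    unfolding frontier_eq_arcs arcs_def
    by (intro emeasure_subadditive_finite) (auto intro: borel_imp_hausdorff1 borel_closed arc_closed)
  also have "\<dots> < top" using emeasure_arc_finite' by (auto simp: ennreal_sum_less_top)
  finally show ?thesis .
qed

text \<open>Neighbouring closed arcs share an end point. Off the four end points of slope 1, lying
  on an arc means lying on the frontier and in its sector, and the sectors form a partition.\<close>

lemma AE_arcs_disjoint:
  "AE z in hausdorff1. (\<Sum>u\<in>axis_dirs. indicator (arc_of u ` {-1..1}) z) = (indicator (frontier T) z :: real)"
proof -
  define N where "N = (\<lambda>u. arc_of u 1) ` axis_dirs"
  have null: "N \<in> null_sets hausdorff1" by (intro finite_null_hausdorff1) (simp add: N_def)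
  have sub: "{z \<in> space hausdorff1. (\<Sum>u\<in>axis_dirs. indicator (arc_of u ` {-1..1}) z) \<noteq> (indicator (frontier T) z :: real)} \<subseteq> N"
  proof
    fix z assume "z \<in> {z \<in> space hausdorff1. (\<Sum>u\<in>axis_dirs. indicator (arc_of u ` {-1..1}) z) \<noteq> (indicator (frontier T) z :: real)}"
    then have ne: "(\<Sum>u\<in>axis_dirs. indicator (arc_of u ` {-1..1}) z) \<noteq> (indicator (frontier T) z :: real)" by simp
    show "z \<in> N"
    proof (rule ccontr)
      assume zN: "z \<notin> N"
      have *: "indicator (arc_of u ` {-1..1}) z = (indicator (frontier T) z * indicator (sector u) z :: real)" if u: "u \<in> axis_dirs" for u
      proof -
        note u1 = axis_dirs_norm[OF u]
        have "z \<in> sector u" if z: "z \<in> arc_of u ` {-1..1}"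
        proof -
          obtain s where s: "s \<in> {-1..1}" "z = arc_of u s" using z by auto
          then have "s \<noteq> 1" using zN u by (auto simp: N_def)
          then have s1: "s < 1" "-1 \<le> s" using s by auto
          have "(z - a) \<bullet> u = 1 / q u s" "(z - a) \<bullet> rot u = s / q u s"
            using s by (auto simp: arc_of_def rad_eq[OF u1] ray_inner[OF u1] divide_inverse)
          then show ?thesis
            using s1 q_pos[OF u1, of s] by (simp add: sector_def divide_strict_right_mono divide_right_mono flip: minus_divide_left)
              (simp add: divide_right_mono[of "-1" s "q u s", simplified])
        qed
        moreover have "z \<in> arc_of u ` {-1..1}" if z: "z \<in> frontier T" "z \<in> sector u"
        proof -
          define x s where "x = (z - a) \<bullet> u" and "s = slope u z"
          have x: "0 < x" and s: "s \<in> {-1..1}" using z(2) by (auto simp: x_def s_def slope_def sector_def field_simps)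
          have za: "z - a = x *\<^sub>R ray u s"
            using x u by (auto simp: axis_dirs_def rot_def ray_def s_def slope_def x_def inner_prod prod_eq_iff)
          then have "x * q u s = 1" using z(1) gauge_scale[of x "ray u s"] x by (simp add: q_def frontier_T)
          then have "x = inverse (q u s)" using q_pos[OF u1, of s] by (simp add: field_simps)
          then have "z = arc_of u s" using za s by (simp add: arc_of_def rad_eq[OF u1] algebra_simps)
          then show ?thesis using s by blast
        qed
        moreover have "z \<in> arc_of u ` {-1..1} \<Longrightarrow> z \<in> frontier T" using u by (auto simp: frontier_eq_arcs arcs_def)
        ultimately show ?thesis by (auto simp: indicator_def)
      qed
      have "(\<Sum>u\<in>axis_dirs. indicator (arc_of u ` {-1..1}) z) = (indicator (frontier T) z * (\<Sum>u\<in>axis_dirs. indicator (sector u) z) :: real)"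
        unfolding sum_distrib_left by (intro sum.cong refl *)
      also have "\<dots> = indicator (frontier T) z"
      proof (cases "z = a")
        case True
        then have "z \<notin> frontier T" using a_in open_T by (simp add: frontier_def interior_open)
        then show ?thesis by simp
      qed (simp add: sector_partition)
      finally show False using ne by simp
    qed
  qed
  show ?thesis by (rule AE_I'[OF null sub])
qed

text \<open>An explicit Borel candidate for the outward normal. At shared end points the sum counts
  two arcs, but these points are negligible.\<close>

definition normal_field :: "point \<Rightarrow> point" where
  "normal_field z = (\<Sum>u\<in>axis_dirs. indicator (arc_of u ` {-1..1}) z *\<^sub>R
     (conormal u (slope u z) /\<^sub>R norm (conormal u (slope u z))))"

lemma normal_field_borel: "normal_field \<in> borel_measurable borel"
proof -
  have "(\<lambda>z. indicator (arc_of u ` {-1..1}) z *\<^sub>R (conormal u (slope u z) /\<^sub>R norm (conormal u (slope u z)))) \<in> borel_measurable borel"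
    if u: "u \<in> axis_dirs" for u
  proof -
    note u1 = axis_dirs_norm[OF u]
    have [measurable]: "conormal u \<in> borel_measurable borel" "slope u \<in> borel_measurable borel"
      using conormal_measurable[OF u1] slope_measurable[OF u1] by auto
    have [measurable]: "arc_of u ` {-1..1} \<in> sets borel" using arc_closed[OF u] by (rule borel_closed)
    show ?thesis by measurable
  qed
  then show ?thesis unfolding normal_field_def by (intro borel_measurable_sum) auto
qed

lemma AE_normal_field:
  "AE z in hausdorff1. z \<in> frontier T \<longrightarrow> is_outer_normal T z (normal_field z) \<and> outer_normal T z = normal_field z"
proof -
  have "AE z in hausdorff1. \<forall>u\<in>axis_dirs. z \<in> arc_of u ` {-1..1} \<longrightarrow>
     is_outer_normal T z (conormal u (slope u z) /\<^sub>R norm (conormal u (slope u z)))"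
    by (intro AE_finite_allI AE_normal_arc axis_dirs_norm) auto
  then show ?thesis using AE_arcs_disjoint
  proof eventually_elim
    case (elim z)
    show ?case
    proof
      assume z: "z \<in> frontier T"
      then have sum1: "(\<Sum>u\<in>axis_dirs. indicator (arc_of u ` {-1..1}) z) = (1 :: real)" using elim(2) by simp
      define n where "n u = conormal u (slope u z) /\<^sub>R norm (conormal u (slope u z))" for u
      have eq: "n u = outer_normal T z" if "u \<in> axis_dirs" "z \<in> arc_of u ` {-1..1}" for u
        using elim(1) that outer_normal_eqI unfolding n_def by metis
      have "normal_field z = (\<Sum>u\<in>axis_dirs. indicator (arc_of u ` {-1..1}) z *\<^sub>R n u)"
        by (simp add: normal_field_def n_def)
      also have "\<dots> = (\<Sum>u\<in>axis_dirs. indicator (arc_of u ` {-1..1}) z *\<^sub>R outer_normal T z)"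
        by (intro sum.cong refl) (auto simp: indicator_def eq)
      also have "\<dots> = outer_normal T z" by (simp add: scaleR_sum_left[symmetric] sum1)
      finally have nf: "outer_normal T z = normal_field z" by simp
      obtain u where "u \<in> axis_dirs" "z \<in> arc_of u ` {-1..1}" using z by (auto simp: frontier_eq_arcs arcs_def)
      then have "is_outer_normal T z (n u)" "n u = outer_normal T z" using elim(1) eq by (auto simp: n_def)
      then show "is_outer_normal T z (normal_field z) \<and> outer_normal T z = normal_field z" using nf by simp
    qed
  qed
qed

lemma outer_normal_measurable: "(\<lambda>z. indicator (frontier T) z *\<^sub>R outer_normal T z) \<in> borel_measurable hausdorff1"
proof (rule hausdorff1_measurable_AE)
  show "(\<lambda>z. indicator (frontier T) z *\<^sub>R normal_field z) \<in> borel_measurable hausdorff1"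
    using normal_field_borel by (intro borel_measurable_hausdorff1) (auto simp: borel_closed)
  show "AE z in hausdorff1. indicator (frontier T) z *\<^sub>R outer_normal T z = indicator (frontier T) z *\<^sub>R normal_field z"
    using AE_normal_field by eventually_elim (auto simp: indicator_def)
qed

end

section \<open>The divergence theorem on star-shaped domains\<close>

lemma abs_fst_le_norm: "\<bar>fst v\<bar> \<le> norm (v :: point)"
  using norm_fst_le[of "fst v" "snd v"] by simp

lemma abs_snd_le_norm: "\<bar>snd v\<bar> \<le> norm (v :: point)"
  using norm_snd_le[of "snd v" "fst v"] by simp

lemma rot_borel [measurable]: "rot \<in> borel_measurable borel"
  unfolding rot_def by (intro borel_measurable_continuous_onI continuous_intros)

lemma borel_measurable_fst: "f \<in> borel_measurable M \<Longrightarrow> (\<lambda>x. fst (f x :: point)) \<in> borel_measurable M"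
  and borel_measurable_snd: "f \<in> borel_measurable M \<Longrightarrow> (\<lambda>x. snd (f x :: point)) \<in> borel_measurable M"
proof -
  have "(fst :: point \<Rightarrow> real) \<in> borel_measurable borel" "(snd :: point \<Rightarrow> real) \<in> borel_measurable borel"
    by (intro borel_measurable_continuous_onI continuous_intros)+
  then show "f \<in> borel_measurable M \<Longrightarrow> (\<lambda>x. fst (f x)) \<in> borel_measurable M"
    "f \<in> borel_measurable M \<Longrightarrow> (\<lambda>x. snd (f x)) \<in> borel_measurable M"
    by (auto intro: measurable_compose)
qed

lemma norm_rot_eq: "norm (rot v) = norm v"
  by (simp add: norm_prod_def rot_def add.commute)

lemma norm_pair_comb_le:
  assumes "norm A \<le> B" "norm C \<le> B" "norm x \<le> M"
  shows "norm (fst x *\<^sub>R A + snd x *\<^sub>R C :: point) \<le> 2 * (M * B)"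
proof -
  have 0: "0 \<le> B" "0 \<le> M" using assms by (auto intro: order_trans[OF norm_ge_zero])
  have "\<bar>fst x\<bar> \<le> M" "\<bar>snd x\<bar> \<le> M" using abs_fst_le_norm[of x] abs_snd_le_norm[of x] assms(3) by linarith+
  then have "norm (fst x *\<^sub>R A) \<le> M * B" "norm (snd x *\<^sub>R C) \<le> M * B"
    using assms 0 by (auto intro!: mult_mono)
  then show ?thesis using norm_triangle_ineq[of "fst x *\<^sub>R A" "snd x *\<^sub>R C"] by linarith
qed

text \<open>\<open>K\<close> may be nonconvex, so the mean value inequality is used on small balls
  only and compactness does the rest. The set \<open>{0}\<close> is a dummy time parameter of
  \<open>local_lipschitz\<close>.\<close>

lemma lipschitz_on_compact_of_C1:
  fixes F Fx Fy :: "point \<Rightarrow> point"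
  assumes "open T" "K \<subseteq> T" "compact K"
    and der: "\<And>z. z \<in> T \<Longrightarrow> (F has_derivative (\<lambda>h. fst h *\<^sub>R Fx z + snd h *\<^sub>R Fy z)) (at z)"
    and cont: "continuous_on T Fx" "continuous_on T Fy"
  shows "\<exists>L. L-lipschitz_on K F"
proof -
  have "local_lipschitz {0 :: real} T (\<lambda>_. F)"
  proof (rule local_lipschitzI)
    fix t x assume "t \<in> {0 :: real}" and x: "x \<in> T"
    obtain u where u: "u > 0" "cball x u \<subseteq> T" using \<open>open T\<close> x open_contains_cball by blast
    have "bounded (Fx ` cball x u)" "bounded (Fy ` cball x u)"
      using cont u by (auto intro!: compact_imp_bounded compact_continuous_image continuous_on_subset[of T])
    then obtain B1 B2 where B: "\<And>z. z \<in> cball x u \<Longrightarrow> norm (Fx z) \<le> B1" "\<And>z. z \<in> cball x u \<Longrightarrow> norm (Fy z) \<le> B2"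
      unfolding bounded_iff by (metis imageI)
    have B0: "0 \<le> B1" "0 \<le> B2"
      using B[of x] u by (auto intro: order_trans[OF norm_ge_zero])
    have "(B1 + B2)-lipschitz_on (cball x u) F"
    proof (rule lipschitz_onI)
      fix y z assume yz: "y \<in> cball x u" "z \<in> cball x u"
      have "norm (F y - F z) \<le> (B1 + B2) * norm (y - z)"
      proof (rule differentiable_bound[OF convex_cball])
        fix w assume w: "w \<in> cball x u"
        show "(F has_derivative (\<lambda>h. fst h *\<^sub>R Fx w + snd h *\<^sub>R Fy w)) (at w within cball x u)"
          by (rule has_derivative_at_withinI[OF der]) (use w u in blast)
        show "onorm (\<lambda>h. fst h *\<^sub>R Fx w + snd h *\<^sub>R Fy w) \<le> B1 + B2"
        proof (rule onorm_le)
          fix h :: point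
          have "norm (fst h *\<^sub>R Fx w) \<le> norm h * B1" "norm (snd h *\<^sub>R Fy w) \<le> norm h * B2"
            using B[OF w] abs_fst_le_norm[of h] abs_snd_le_norm[of h] B0 by (auto intro!: mult_mono)
          then show "norm (fst h *\<^sub>R Fx w + snd h *\<^sub>R Fy w) \<le> (B1 + B2) * norm h"
            using norm_triangle_ineq[of "fst h *\<^sub>R Fx w" "snd h *\<^sub>R Fy w"] by (simp add: algebra_simps)
        qed
      qed (use yz in auto)
      then show "dist (F y) (F z) \<le> (B1 + B2) * dist y z" by (simp add: dist_norm)
    qed (use B0 in auto)
    then show "\<exists>u>0. \<exists>L. \<forall>t\<in>cball t u \<inter> {0}. L-lipschitz_on (cball x u \<inter> T) F"
      using u by (meson inf_le1 lipschitz_on_subset)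
  qed
  then have "local_lipschitz {0 :: real} K (\<lambda>_. F)"
    by (rule local_lipschitz_subset) (use assms in auto)
  then obtain L where "\<And>t. t \<in> {0 :: real} \<Longrightarrow> L-lipschitz_on K F"
    by (rule local_lipschitz_compact_implies_lipschitz) (use assms in auto)
  then show ?thesis by blast
qed

lemma lipschitz_on_inner:
  fixes f g :: "'a::metric_space \<Rightarrow> 'b::real_inner"
  assumes f: "L-lipschitz_on X f" and g: "M-lipschitz_on X g"
    and B: "\<And>x. x \<in> X \<Longrightarrow> norm (f x) \<le> B" "\<And>x. x \<in> X \<Longrightarrow> norm (g x) \<le> C" "0 \<le> B" "0 \<le> C"
  shows "(L * C + B * M)-lipschitz_on X (\<lambda>x. f x \<bullet> g x)"
proof (rule lipschitz_onI)
  have LM: "0 \<le> L" "0 \<le> M" using f g lipschitz_on_nonneg by auto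
  then show "0 \<le> L * C + B * M" using B by simp
  fix x y assume xy: "x \<in> X" "y \<in> X"
  have "f x \<bullet> g x - f y \<bullet> g y = (f x - f y) \<bullet> g x + f y \<bullet> (g x - g y)"
    by (simp add: inner_diff_left inner_diff_right)
  then have "\<bar>f x \<bullet> g x - f y \<bullet> g y\<bar> \<le> norm (f x - f y) * norm (g x) + norm (f y) * norm (g x - g y)"
    using Cauchy_Schwarz_ineq2[of "f x - f y" "g x"] Cauchy_Schwarz_ineq2[of "f y" "g x - g y"] by linarith
  also have "\<dots> \<le> (L * dist x y) * C + B * (M * dist x y)"
    using lipschitz_onD[OF f xy] lipschitz_onD[OF g xy] B(1)[OF xy(2)] B(2)[OF xy(1)] B(3,4) LM
    by (intro add_mono mult_mono) (auto simp: dist_norm)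
  finally show "dist (f x \<bullet> g x) (f y \<bullet> g y) \<le> (L * C + B * M) * dist x y"
    by (simp add: dist_real_def algebra_simps)
qed

text \<open>Only \<open>F\<close> itself is controlled up to the boundary. Its derivatives are
  continuous inside \<open>T\<close> and may blow up at the frontier, as those of the coefficients
  may.\<close>

locale star_domain_field = star_domain +
  fixes F Fx Fy :: "point \<Rightarrow> point"
  assumes cont: "continuous_on (closure T) F"
    and der: "\<And>z. z \<in> T \<Longrightarrow> (F has_derivative (\<lambda>h. fst h *\<^sub>R Fx z + snd h *\<^sub>R Fy z)) (at z)"
    and cont_x: "continuous_on T Fx" and cont_y: "continuous_on T Fy"
begin

definition "dv z = fst (Fx z) + snd (Fy z)"

text \<open>Extension by zero turns fields that are only known on \<open>T\<close> or its closure
  into Borel functions on the plane.\<close>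

definition "FB z = indicator (closure T) z *\<^sub>R F z"

definition "FxB z = indicator T z *\<^sub>R Fx z"

definition "FyB z = indicator T z *\<^sub>R Fy z"

lemma T_borel [measurable]: "T \<in> sets borel" using open_T by simp

lemma field_borel [measurable]: "FB \<in> borel_measurable borel" "FxB \<in> borel_measurable borel" "FyB \<in> borel_measurable borel"
  unfolding FB_def FxB_def FyB_def
  using borel_measurable_continuous_on_indicator[OF borel_closed[OF closed_closure] cont]
    borel_measurable_continuous_on_indicator[OF T_borel cont_x]
    borel_measurable_continuous_on_indicator[OF T_borel cont_y] by auto

lemma in_T_rad: "norm u = 1 \<Longrightarrow> 0 \<le> t \<Longrightarrow> t < 1 \<Longrightarrow> a + t *\<^sub>R rad u s \<in> T"
  by (rule scaled_in_T) (auto simp: gauge_rad)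

lemma in_closure_rad: "norm u = 1 \<Longrightarrow> 0 \<le> t \<Longrightarrow> t \<le> 1 \<Longrightarrow> a + t *\<^sub>R rad u s \<in> closure T"
  unfolding closure_T using gauge_scale[of t "rad u s"] by (simp add: gauge_rad)

text \<open>Copies of the element shrunk by a factor below 1 keep away from the frontier, so the
  derivatives of the field are bounded on them.\<close>

lemma compact_sub: "\<tau> < 1 \<Longrightarrow> compact {z. gauge_fun (z - a) \<le> \<tau>}" "\<tau> < 1 \<Longrightarrow> {z. gauge_fun (z - a) \<le> \<tau>} \<subseteq> T"
proof -
  assume \<tau>: "\<tau> < 1"
  then show "{z. gauge_fun (z - a) \<le> \<tau>} \<subseteq> T" by (auto simp: mem_T_iff)
  then have "bounded {z. gauge_fun (z - a) \<le> \<tau>}" using bounded_T bounded_subset by blast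
  moreover have "closed {z. gauge_fun (z - a) \<le> \<tau>}"
    by (intro closed_Collect_le continuous_on_compose2[OF continuous_gauge] continuous_intros) auto
  ultimately show "compact {z. gauge_fun (z - a) \<le> \<tau>}" by (simp add: compact_eq_bounded_closed)
qed

lemma bound_on_compact:
  assumes "\<tau> < 1"
  shows "\<exists>B\<ge>0. \<forall>z. gauge_fun (z - a) \<le> \<tau> \<longrightarrow> norm (F z) \<le> B \<and> norm (Fx z) \<le> B \<and> norm (Fy z) \<le> B"
proof -
  let ?K = "{z. gauge_fun (z - a) \<le> \<tau>}"
  have "continuous_on T F" by (rule continuous_on_subset[OF cont closure_subset])
  then have "bounded (F ` ?K)" "bounded (Fx ` ?K)" "bounded (Fy ` ?K)"
    using cont_x cont_y compact_sub[OF assms]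
    by (auto intro!: compact_imp_bounded compact_continuous_image intro: continuous_on_subset)
  then obtain B1 B2 B3 where "\<And>z. z \<in> ?K \<Longrightarrow> norm (F z) \<le> B1" "\<And>z. z \<in> ?K \<Longrightarrow> norm (Fx z) \<le> B2" "\<And>z. z \<in> ?K \<Longrightarrow> norm (Fy z) \<le> B3"
    unfolding bounded_iff by (metis imageI)
  then have "norm (F z) \<le> \<bar>B1\<bar> + \<bar>B2\<bar> + \<bar>B3\<bar> \<and> norm (Fx z) \<le> \<bar>B1\<bar> + \<bar>B2\<bar> + \<bar>B3\<bar> \<and> norm (Fy z) \<le> \<bar>B1\<bar> + \<bar>B2\<bar> + \<bar>B3\<bar>"
    if "z \<in> ?K" for z using that by (smt (verit))
  then show ?thesis by (intro exI[of _ "\<bar>B1\<bar> + \<bar>B2\<bar> + \<bar>B3\<bar>"]) simp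
qed

lemma F_bound: "\<exists>B\<ge>0. \<forall>z\<in>closure T. norm (F z) \<le> B"
proof -
  have "bounded (F ` closure T)" by (intro compact_imp_bounded compact_continuous_image cont compact_closure_T)
  then obtain B where "\<And>z. z \<in> closure T \<Longrightarrow> norm (F z) \<le> B" unfolding bounded_iff by (metis imageI)
  then show ?thesis by (intro exI[of _ "\<bar>B\<bar>"]) (force intro: order_trans)
qed

text \<open>The outward normal multiplied by the speed of the boundary curve, that is, the normal
  together with the length element.\<close>

definition "ndir u s = - rot (rad' u s)"

text \<open>With \<open>z = a + t * rad u s\<close> the two integrands are \<open>d/dt (t * F z \<bullet> ndir u s)\<close> and
  \<open>d/ds (F z \<bullet> - rot (rad u s))\<close>. Their difference is the divergence times the Jacobian \<open>t / q\<^sup>2\<close>.\<close>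

definition "dt_term u s t = FB (a + t *\<^sub>R rad u s) \<bullet> ndir u s
  + t * ((fst (rad u s) *\<^sub>R FxB (a + t *\<^sub>R rad u s) + snd (rad u s) *\<^sub>R FyB (a + t *\<^sub>R rad u s)) \<bullet> ndir u s)"

definition "ds_term u s t = FB (a + t *\<^sub>R rad u s) \<bullet> ndir u s
  + t * ((fst (rad' u s) *\<^sub>R FxB (a + t *\<^sub>R rad u s) + snd (rad' u s) *\<^sub>R FyB (a + t *\<^sub>R rad u s)) \<bullet> (- rot (rad u s)))"

text \<open>The flux through the straight segment that bounds a sector;
  \<open>- rot (rad u s)\<close> is normal to it and has the length of its velocity in
  \<open>t\<close>.\<close>

definition "edge u \<tau> s = (LINT t:{0<..<\<tau>}|lborel. F (a + t *\<^sub>R rad u s) \<bullet> (- rot (rad u s)))"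

text \<open>With \<open>DF\<close> the matrix with columns \<open>A\<close> and \<open>B\<close>,
  this is the planar identity det(DF x, y) + det(x, DF y) = tr(DF) det(x, y), where
  \<open>v \<bullet> (- rot y)\<close> is det(v, y).\<close>

lemma cross_identity:
  fixes A B x y :: point
  shows "(fst x *\<^sub>R A + snd x *\<^sub>R B) \<bullet> (- rot y) - (fst y *\<^sub>R A + snd y *\<^sub>R B) \<bullet> (- rot x)
    = (fst A + snd B) * (fst x * snd y - snd x * fst y)"
  by (simp add: inner_prod rot_def algebra_simps)

section \<open>Calculus in a single chart\<close>

context
  fixes u :: point
  assumes u: "norm u = 1"
begin

lemma rad_cross: "s \<in> {-1..1} \<Longrightarrow> fst (rad u s) * snd (rad' u s) - snd (rad u s) * fst (rad' u s) = 1 / (q u s)\<^sup>2"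
proof -
  assume s: "s \<in> {-1..1}"
  have "fst (rad u s) * snd (rad' u s) - snd (rad u s) * fst (rad' u s)
      = (fst u * fst u + snd u * snd u) / (q u s)\<^sup>2"
    using q_pos[OF u, of s]
    by (simp add: rad_eq[OF u s] rad'_def ray_def rot_def field_simps power2_eq_square)
  then show ?thesis using u_rel[OF u] by simp
qed

lemma term_diff:
  assumes "s \<in> {-1..1}" "0 \<le> t" "t < 1"
  shows "dt_term u s t - ds_term u s t = t / (q u s)\<^sup>2 * dv (a + t *\<^sub>R rad u s)"
proof -
  define z where "z = a + t *\<^sub>R rad u s"
  have "z \<in> T" using in_T_rad[OF u] assms by (simp add: z_def)
  then have "FxB z = Fx z" "FyB z = Fy z" by (auto simp: FxB_def FyB_def)
  then have "dt_term u s t - ds_term u s t = t * ((fst (rad u s) *\<^sub>R Fx z + snd (rad u s) *\<^sub>R Fy z) \<bullet> (- rot (rad' u s))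
      - (fst (rad' u s) *\<^sub>R Fx z + snd (rad' u s) *\<^sub>R Fy z) \<bullet> (- rot (rad u s)))"
    unfolding dt_term_def ds_term_def ndir_def z_def[symmetric] by (simp add: right_diff_distrib)
  also have "\<dots> = t / (q u s)\<^sup>2 * dv z"
    unfolding cross_identity rad_cross[OF assms(1)] by (simp add: dv_def)
  finally show ?thesis by (simp add: z_def)
qed

lemma rad_measurable [measurable]: "rad u \<in> borel_measurable borel"
  by (intro borel_measurable_continuous_onI rad_continuous u)

lemma rad'_meas [measurable]: "rad' u \<in> borel_measurable borel"
  by (rule rad'_measurable[OF u])



lemma ndir_meas [measurable]: "ndir u \<in> borel_measurable borel"
  unfolding ndir_def by measurable

lemma term_measurable:
  "(\<lambda>p. dt_term u (fst p) (snd p)) \<in> borel_measurable (borel \<Otimes>\<^sub>M borel)"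
  "(\<lambda>p. ds_term u (fst p) (snd p)) \<in> borel_measurable (borel \<Otimes>\<^sub>M borel)"
proof -
  have fs: "(\<lambda>s. fst (rad u s)) \<in> borel_measurable borel" "(\<lambda>s. snd (rad u s)) \<in> borel_measurable borel"
    "(\<lambda>s. fst (rad' u s)) \<in> borel_measurable borel" "(\<lambda>s. snd (rad' u s)) \<in> borel_measurable borel"
    by (intro borel_measurable_fst borel_measurable_snd rad_measurable rad'_meas)+
  have 1: "(\<lambda>p :: real \<times> real. g (fst p)) \<in> borel_measurable (borel \<Otimes>\<^sub>M borel)"
    if "g \<in> borel_measurable borel" for g :: "real \<Rightarrow> real"
    using that by measurable
  note m = fs[THEN 1]
  have z: "(\<lambda>p. a + snd p *\<^sub>R rad u (fst p)) \<in> borel_measurable (borel \<Otimes>\<^sub>M borel)" by measurable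
  have G: "(\<lambda>p. G (a + snd p *\<^sub>R rad u (fst p))) \<in> borel_measurable (borel \<Otimes>\<^sub>M borel)"
    if "G \<in> borel_measurable borel" for G :: "point \<Rightarrow> point"
    using measurable_compose[OF z that] by simp
  have n: "(\<lambda>p. ndir u (fst p)) \<in> borel_measurable (borel \<Otimes>\<^sub>M borel)" "(\<lambda>p. - rot (rad u (fst p))) \<in> borel_measurable (borel \<Otimes>\<^sub>M borel)"
    by measurable
  show "(\<lambda>p. dt_term u (fst p) (snd p)) \<in> borel_measurable (borel \<Otimes>\<^sub>M borel)"
    "(\<lambda>p. ds_term u (fst p) (snd p)) \<in> borel_measurable (borel \<Otimes>\<^sub>M borel)"
    unfolding dt_term_def ds_term_def
    by (intro borel_measurable_add borel_measurable_inner borel_measurable_times borel_measurable_scaleR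
        m n measurable_snd G[OF field_borel(1)] G[OF field_borel(2)] G[OF field_borel(3)])+
qed

lemma term_measurable_slice:
  "dt_term u s \<in> borel_measurable borel" "(\<lambda>s. ds_term u s t) \<in> borel_measurable borel"
  using measurable_compose[OF measurable_Pair1' term_measurable(1), of s]
    measurable_compose[OF measurable_Pair2' term_measurable(2), of t] by simp_all

lemma rad'_bound: "\<exists>L\<ge>0. AE s in lborel. s \<in> {-1..1} \<longrightarrow> norm (rad' u s) \<le> L"
proof -
  obtain L where L: "rectifiable_arc (arc_of u) (rad' u) (slope u) L (-1) 1" using arc_is_rectifiable[OF u] by blast
  then show ?thesis using rectifiable_arc.deriv_bound[OF L] lipschitz_on_nonneg[OF rectifiable_arc.lip[OF L]] by blast
qed

lemma rad_bound: "norm (rad u s) \<le> R"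
proof -
  have "norm (rad u s) / R \<le> 1" using norm_le_gauge[of "rad u s"] by (simp add: gauge_rad[OF u])
  then show ?thesis using R(1) by (simp add: pos_divide_le_eq)
qed

text \<open>Stopping at \<open>\<tau> < 1\<close> keeps the derivatives of the field bounded, and
  \<open>rad'\<close> is bounded almost everywhere; both terms are thus bounded on a rectangle. This
  licenses Fubini in either order.\<close>

lemma term_integrable:
  assumes \<tau>: "0 < \<tau>" "\<tau> < 1"
  shows "integrable (lborel \<Otimes>\<^sub>M lborel) (\<lambda>p. indicator ({-1..<1} \<times> {0<..<\<tau>}) p *\<^sub>R dt_term u (fst p) (snd p))" (is ?G)
    and "integrable (lborel \<Otimes>\<^sub>M lborel) (\<lambda>p. indicator ({-1..<1} \<times> {0<..<\<tau>}) p *\<^sub>R ds_term u (fst p) (snd p))" (is ?H)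
proof -
  obtain L where L: "0 \<le> L" "AE s in lborel. s \<in> {-1..1} \<longrightarrow> norm (rad' u s) \<le> L" using rad'_bound by blast
  obtain B where B: "0 \<le> B" "\<And>z. gauge_fun (z - a) \<le> \<tau> \<Longrightarrow> norm (F z) \<le> B \<and> norm (Fx z) \<le> B \<and> norm (Fy z) \<le> B"
    using bound_on_compact[OF \<tau>(2)] by blast
  have L': "AE p in lborel \<Otimes>\<^sub>M (lborel :: real measure). fst p \<in> {-1..1} \<longrightarrow> norm (rad' u (fst p)) \<le> L"
  proof (rule lborel_pair.AE_pair_measure)
    show "{p \<in> space (lborel \<Otimes>\<^sub>M lborel). fst p \<in> {-1..1} \<longrightarrow> norm (rad' u (fst p)) \<le> L} \<in> sets (lborel \<Otimes>\<^sub>M (lborel :: real measure))"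
      by measurable
    show "AE x in lborel. AE y :: real in lborel. fst (x, y) \<in> {-1..1} \<longrightarrow> norm (rad' u (fst (x, y))) \<le> L"
      using L(2) by (auto elim!: eventually_mono)
  qed
  have fin: "emeasure (lborel \<Otimes>\<^sub>M lborel) ({-1..<1 :: real} \<times> {0<..<\<tau>}) < \<infinity>"
    using emeasure_bounded_finite[of "{-1..<1 :: real} \<times> {0<..<\<tau>}"] by (simp add: lborel_prod bounded_Times)
  have sets: "{-1..<1 :: real} \<times> {0<..<\<tau>} \<in> sets (lborel \<Otimes>\<^sub>M lborel)" by (intro pair_measureI) auto
  have bnds: "norm (FB z) \<le> B" "norm (FxB z) \<le> B" "norm (FyB z) \<le> B" if "gauge_fun (z - a) \<le> \<tau>" for z
    using B(2)[OF that] B(1) by (auto simp: FB_def FxB_def FyB_def indicator_def)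
  have g: "gauge_fun (a + t *\<^sub>R rad u s - a) \<le> \<tau>" if "0 < t" "t < \<tau>" for s t
    using gauge_scale[of t "rad u s"] that by (simp add: gauge_rad[OF u])
  have bnd: "\<bar>dt_term u s t\<bar> \<le> B * L + 2 * (R * B) * L \<and> \<bar>ds_term u s t\<bar> \<le> B * L + 2 * (L * B) * R"
    if st: "norm (rad' u s) \<le> L" "0 < t" "t < \<tau>" for s t
  proof -
    define z where "z = a + t *\<^sub>R rad u s"
    note b = bnds[OF g[OF st(2,3), of s], folded z_def]
    have n: "norm (ndir u s) \<le> L" using st by (simp add: ndir_def norm_rot_eq)
    have R0: "0 \<le> R" using R(1) by simp
    have prod: "\<bar>X \<bullet> Y\<bar> \<le> b * c" if "norm X \<le> b" "norm Y \<le> c" for X Y :: point and b c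
      using Cauchy_Schwarz_ineq2[of X Y] mult_mono[OF that] that
      by (meson norm_ge_zero order_trans)
    have tm: "\<bar>t * X\<bar> \<le> b" if "\<bar>X\<bar> \<le> b" for X b :: real
    proof -
      have "\<bar>t * X\<bar> \<le> 1 * \<bar>X\<bar>" unfolding abs_mult using st \<tau> by (intro mult_right_mono) auto
      then show ?thesis using that by simp
    qed
    have 1: "\<bar>FB z \<bullet> ndir u s\<bar> \<le> B * L" by (rule prod[OF b(1) n])
    have 2: "\<bar>t * ((fst (rad u s) *\<^sub>R FxB z + snd (rad u s) *\<^sub>R FyB z) \<bullet> ndir u s)\<bar> \<le> 2 * (R * B) * L"
      by (intro tm prod norm_pair_comb_le b rad_bound n)
    have 3: "\<bar>t * ((fst (rad' u s) *\<^sub>R FxB z + snd (rad' u s) *\<^sub>R FyB z) \<bullet> (- rot (rad u s)))\<bar> \<le> 2 * (L * B) * R"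
      by (intro tm prod norm_pair_comb_le b st(1)) (simp add: norm_rot_eq rad_bound)
    show ?thesis unfolding dt_term_def ds_term_def z_def[symmetric] using 1 2 3 by linarith
  qed
  show ?G
    by (rule integrableI_bounded_set_indicator[OF sets _ fin, where B = "B * L + 2 * (R * B) * L"])
       (use term_measurable in simp, use L' bnd in \<open>auto elim!: eventually_mono\<close>)
  show ?H
    by (rule integrableI_bounded_set_indicator[OF sets _ fin, where B = "B * L + 2 * (L * B) * R"])
       (use term_measurable in simp, use L' bnd in \<open>auto elim!: eventually_mono\<close>)
qed

lemma F_along_rad: "s \<in> S \<Longrightarrow> a + t *\<^sub>R rad u s \<in> T \<Longrightarrow> (rad u has_vector_derivative rad' u s) (at s) \<Longrightarrow>
   ((\<lambda>s. F (a + t *\<^sub>R rad u s)) has_vector_derivative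
     t *\<^sub>R (fst (rad' u s) *\<^sub>R Fx (a + t *\<^sub>R rad u s) + snd (rad' u s) *\<^sub>R Fy (a + t *\<^sub>R rad u s))) (at s)"
proof -
  assume z: "a + t *\<^sub>R rad u s \<in> T" and d: "(rad u has_vector_derivative rad' u s) (at s)"
  have "((\<lambda>s. a + t *\<^sub>R rad u s) has_derivative (\<lambda>h. h *\<^sub>R (t *\<^sub>R rad' u s))) (at s)"
    using d unfolding has_vector_derivative_def by (auto intro!: derivative_eq_intros)
  from has_derivative_compose[OF this der[OF z]]
  show ?thesis unfolding has_vector_derivative_def by (simp add: algebra_simps)
qed

lemma integral_dt:
  assumes \<tau>: "0 < \<tau>" "\<tau> < 1"
  shows "(\<integral>t. indicator {0<..<\<tau>} t * dt_term u s t \<partial>lborel) = \<tau> * (F (a + \<tau> *\<^sub>R rad u s) \<bullet> ndir u s)"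
proof -
  have inT: "a + t *\<^sub>R rad u s \<in> T" if "t \<in> {0..\<tau>}" for t using in_T_rad[OF u] that \<tau> by auto
  have dvv: "((\<lambda>t. t * (F (a + t *\<^sub>R rad u s) \<bullet> ndir u s)) has_vector_derivative dt_term u s t) (at t within {0..\<tau>})"
    if t: "t \<in> {0..\<tau>}" for t
  proof -
    define z where "z = a + t *\<^sub>R rad u s"
    have z: "z \<in> T" using inT[OF t] by (simp add: z_def)
    have "((\<lambda>t. a + t *\<^sub>R rad u s) has_derivative (\<lambda>h. h *\<^sub>R rad u s)) (at t)"
      by (auto intro!: derivative_eq_intros)
    from has_derivative_compose[OF this der[OF z[unfolded z_def]]]
    have 1: "((\<lambda>t. F (a + t *\<^sub>R rad u s)) has_derivative
        (\<lambda>h. (h * fst (rad u s)) *\<^sub>R Fx z + (h * snd (rad u s)) *\<^sub>R Fy z)) (at t)" by (simp add: z_def)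
    have "((\<lambda>t. t * (F (a + t *\<^sub>R rad u s) \<bullet> ndir u s)) has_derivative
        (\<lambda>h. t * (((h * fst (rad u s)) *\<^sub>R Fx z + (h * snd (rad u s)) *\<^sub>R Fy z) \<bullet> ndir u s) + h * (F z \<bullet> ndir u s))) (at t)"
      unfolding z_def by (intro has_derivative_mult has_derivative_inner_left has_derivative_ident 1[unfolded z_def])
    moreover have "(\<lambda>h. t * (((h * fst (rad u s)) *\<^sub>R Fx z + (h * snd (rad u s)) *\<^sub>R Fy z) \<bullet> ndir u s) + h * (F z \<bullet> ndir u s))
        = (\<lambda>h. h *\<^sub>R dt_term u s t)"
      using z closure_subset[of T] unfolding dt_term_def z_def[symmetric]
      by (auto simp: FB_def FxB_def FyB_def inner_add_left algebra_simps)
    ultimately have "((\<lambda>t. t * (F (a + t *\<^sub>R rad u s) \<bullet> ndir u s)) has_derivative (\<lambda>h. h *\<^sub>R dt_term u s t)) (at t)"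
      by simp
    then show ?thesis unfolding has_vector_derivative_def by (rule has_derivative_at_withinI)
  qed
  have cT: "continuous_on T F" by (rule continuous_on_subset[OF cont closure_subset])
  have comp: "continuous_on {0..\<tau>} (\<lambda>t. G (a + t *\<^sub>R rad u s))" if "continuous_on T G" for G :: "point \<Rightarrow> point"
    by (rule continuous_on_compose2[OF that]) (use inT in \<open>auto intro!: continuous_intros\<close>)
  have "continuous_on {0..\<tau>} (dt_term u s)"
  proof (rule continuous_on_cong[THEN iffD1, rotated 2])
    show "continuous_on {0..\<tau>} (\<lambda>t. F (a + t *\<^sub>R rad u s) \<bullet> ndir u s
        + t * ((fst (rad u s) *\<^sub>R Fx (a + t *\<^sub>R rad u s) + snd (rad u s) *\<^sub>R Fy (a + t *\<^sub>R rad u s)) \<bullet> ndir u s))"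
      by (intro continuous_intros comp cT cont_x cont_y)
  qed (use inT closure_subset[of T] in \<open>auto simp: dt_term_def FB_def FxB_def FyB_def indicator_def\<close>)
  then have "(\<integral>t. indicator {0..\<tau>} t *\<^sub>R dt_term u s t \<partial>lborel) = \<tau> * (F (a + \<tau> *\<^sub>R rad u s) \<bullet> ndir u s)"
    using \<tau> dvv by (subst integral_FTC_Icc) auto
  moreover have "(\<integral>t. indicator {0<..<\<tau>} t * dt_term u s t \<partial>lborel) = (\<integral>t. indicator {0..\<tau>} t *\<^sub>R dt_term u s t \<partial>lborel)"
  proof (rule integral_cong_AE)
    have [measurable]: "dt_term u s \<in> borel_measurable borel" by (rule term_measurable_slice)
    show "(\<lambda>t. indicator {0<..<\<tau>} t * dt_term u s t) \<in> borel_measurable lborel"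
      "(\<lambda>t. indicator {0..\<tau>} t *\<^sub>R dt_term u s t) \<in> borel_measurable lborel" by measurable
    have "AE t :: real in lborel. t \<noteq> 0" "AE t in lborel. t \<noteq> \<tau>" by (auto intro: AE_lborel_singleton)
    then show "AE t in lborel. indicator {0<..<\<tau>} t * dt_term u s t = indicator {0..\<tau>} t *\<^sub>R dt_term u s t"
      by eventually_elim (auto simp: indicator_def)
  qed
  ultimately show ?thesis by simp
qed

text \<open>In \<open>t\<close> the chart is linear, but in \<open>s\<close> it is only Lipschitz.
  The field is Lipschitz on the compact curve at level \<open>t\<close>, so the composition is
  Lipschitz and the fundamental theorem for such functions applies.\<close>

lemma integral_ds:
  assumes t: "0 < t" "t < 1"
  shows "(\<integral>s. indicator {-1..<1} s * ds_term u s t \<partial>lborel)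
    = F (a + t *\<^sub>R rad u 1) \<bullet> (- rot (rad u 1)) - F (a + t *\<^sub>R rad u (-1)) \<bullet> (- rot (rad u (-1)))"
proof -
  let ?N = "\<lambda>s. F (a + t *\<^sub>R rad u s) \<bullet> (- rot (rad u s))"
  define K where "K = (\<lambda>s. a + t *\<^sub>R rad u s) ` {-1..1}"
  have inT: "a + t *\<^sub>R rad u s \<in> T" for s using in_T_rad[OF u] t by auto
  have K: "compact K" "K \<subseteq> T" unfolding K_def
    using inT by (auto intro!: compact_continuous_image continuous_intros rad_continuous u)
  obtain L where L: "L-lipschitz_on K F"
    using lipschitz_on_compact_of_C1[OF open_T K(2,1) der cont_x cont_y] by blast
  obtain M where M: "M-lipschitz_on UNIV (rad u)" using rad_lipschitz[OF u] by blast
  have lz: "(t * M)-lipschitz_on {-1..1} (\<lambda>s. a + t *\<^sub>R rad u s)"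
  proof (rule lipschitz_onI)
    fix x y
    have "dist (a + t *\<^sub>R rad u x) (a + t *\<^sub>R rad u y) = t * dist (rad u x) (rad u y)"
      using t by (simp add: dist_norm flip: scaleR_diff_right)
    also have "\<dots> \<le> t * (M * dist x y)" using lipschitz_onD[OF M, of x y] t by (intro mult_left_mono) auto
    finally show "dist (a + t *\<^sub>R rad u x) (a + t *\<^sub>R rad u y) \<le> t * M * dist x y" by simp
  qed (use t lipschitz_on_nonneg[OF M] in auto)
  have lF: "(L * (t * M))-lipschitz_on {-1..1} (\<lambda>s. F (a + t *\<^sub>R rad u s))"
    using lipschitz_on_compose2[OF lz, of L F] L unfolding K_def by simp
  have lR: "M-lipschitz_on {-1..1} (\<lambda>s. - rot (rad u s))"
  proof (rule lipschitz_onI)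
    fix x y
    have "dist (- rot (rad u x)) (- rot (rad u y)) = norm (rot (rad u x - rad u y))"
      unfolding dist_norm norm_prod_def rot_def by (simp add: power2_commute)
    then show "dist (- rot (rad u x)) (- rot (rad u y)) \<le> M * dist x y"
      using lipschitz_onD[OF M, of x y] by (simp add: norm_rot_eq dist_norm)
  qed (rule lipschitz_on_nonneg[OF M])
  obtain B where B: "0 \<le> B" "\<forall>z\<in>closure T. norm (F z) \<le> B" using F_bound by blast
  have "(L * (t * M) * R + B * M)-lipschitz_on {-1..1} ?N"
    by (rule lipschitz_on_inner[OF lF lR])
       (use B inT closure_subset[of T] rad_bound R(1) in \<open>auto simp: norm_rot_eq\<close>)
  moreover have "AE s in lborel. s \<in> {-1<..<1} \<longrightarrow> (?N has_real_derivative ds_term u s t) (at s)"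
    using AE_rad_derivative[OF u]
  proof eventually_elim
    case (elim s)
    show ?case
    proof
      assume s: "s \<in> {-1<..<1}"
      then have d: "(rad u has_vector_derivative rad' u s) (at s)" using elim by simp
      define z where "z = a + t *\<^sub>R rad u s"
      have dF: "((\<lambda>s. F (a + t *\<^sub>R rad u s)) has_vector_derivative
          t *\<^sub>R (fst (rad' u s) *\<^sub>R Fx z + snd (rad' u s) *\<^sub>R Fy z)) (at s)"
        unfolding z_def by (rule F_along_rad[OF UNIV_I inT d])
      have dR: "((\<lambda>s. - rot (rad u s)) has_vector_derivative ndir u s) (at s)"
      proof -
        have "bounded_linear (\<lambda>v. - rot v)"
          by (rule linear_conv_bounded_linear[THEN iffD1], rule linearI) (auto simp: rot_def prod_eq_iff)
        from bounded_linear.has_vector_derivative[OF this d] show ?thesis by (simp add: ndir_def)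
      qed
      have "(?N has_vector_derivative (F z \<bullet> ndir u s + (t *\<^sub>R (fst (rad' u s) *\<^sub>R Fx z + snd (rad' u s) *\<^sub>R Fy z)) \<bullet> (- rot (rad u s)))) (at s)"
        using bounded_bilinear.has_vector_derivative[OF bounded_bilinear_inner dF dR] by (simp add: z_def)
      moreover have "F z \<bullet> ndir u s + (t *\<^sub>R (fst (rad' u s) *\<^sub>R Fx z + snd (rad' u s) *\<^sub>R Fy z)) \<bullet> (- rot (rad u s)) = ds_term u s t"
        unfolding ds_term_def z_def[symmetric]
        using inT[of s] closure_subset[of T] by (auto simp: FB_def FxB_def FyB_def z_def indicator_def)
      ultimately show "(?N has_real_derivative ds_term u s t) (at s)"
        by (simp add: has_real_derivative_iff_has_vector_derivative)
    qed
  qed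
  moreover have m: "(\<lambda>s. ds_term u s t) \<in> borel_measurable borel" by (rule term_measurable_slice)
  ultimately have "(LINT s:{-1..1}|lborel. ds_term u s t) = ?N 1 - ?N (-1)"
    by (intro lipschitz_FTC_interval(2)) auto
  moreover have "(\<integral>s. indicator {-1..<1} s * ds_term u s t \<partial>lborel) = (LINT s:{-1..1}|lborel. ds_term u s t)"
    unfolding set_lebesgue_integral_def
  proof (rule integral_cong_AE)
    show "(\<lambda>s. indicator {-1..<1} s * ds_term u s t) \<in> borel_measurable lborel"
      "(\<lambda>s. indicator {-1..1} s *\<^sub>R ds_term u s t) \<in> borel_measurable lborel" using m by measurable
    show "AE s in lborel. indicator {-1..<1} s * ds_term u s t = indicator {-1..1} s *\<^sub>R ds_term u s t"
      using AE_lborel_singleton[of 1] by eventually_elim (auto simp: indicator_def)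
  qed
  ultimately show ?thesis by simp
qed

end

text \<open>The term that is a \<open>t\<close>-derivative is integrated in \<open>t\<close> first
  and leaves the curved side, its value at \<open>t = 0\<close> being zero thanks to the factor
  \<open>t\<close>. The term that is an \<open>s\<close>-derivative is integrated in
  \<open>s\<close> first and leaves the two straight sides.\<close>

lemma sector_divergence:
  assumes u: "u \<in> axis_dirs" and \<tau>: "0 < \<tau>" "\<tau> < 1"
  shows "(\<integral>z. indicator (sector u) z * (indicator {z. gauge_fun (z - a) < \<tau>} z * dv z) \<partial>lborel)
    = (LINT s:{-1..1}|lborel. \<tau> * (F (a + \<tau> *\<^sub>R rad u s) \<bullet> ndir u s)) - (edge u \<tau> 1 - edge u \<tau> (-1))"
proof -
  note u1 = axis_dirs_norm[OF u]
  define D where "D z = indicator {z. gauge_fun (z - a) < \<tau>} z * (fst (FxB z) + snd (FyB z))" for z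
  have [measurable]: "gauge_fun \<in> borel_measurable borel"
    by (intro borel_measurable_continuous_onI continuous_gauge)
  have [measurable]: "{z. gauge_fun (z - a) < \<tau>} \<in> sets borel"
    by (intro borel_open open_Collect_less continuous_on_compose2[OF continuous_gauge[of UNIV]] continuous_intros) auto
  have [measurable]: "(\<lambda>z. fst (FxB z)) \<in> borel_measurable borel" "(\<lambda>z. snd (FyB z)) \<in> borel_measurable borel"
    by (intro borel_measurable_fst borel_measurable_snd field_borel)+
  have D: "D \<in> borel_measurable borel"
    unfolding D_def by (intro borel_measurable_times borel_measurable_add borel_measurable_indicator; measurable)
  have D_eq: "indicator {z. gauge_fun (z - a) < \<tau>} z * dv z = D z" for z
    using \<tau> by (auto simp: D_def FxB_def FyB_def dv_def indicator_def mem_T_iff)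
  let ?I = "indicator ({-1..<1} \<times> {0<..<\<tau>}) :: real \<times> real \<Rightarrow> real"
  have W: "weight u p * D (cone_map u p) = ?I p *\<^sub>R dt_term u (fst p) (snd p) - ?I p *\<^sub>R ds_term u (fst p) (snd p)" for p
  proof -
    obtain s t where p: "p = (s, t)" by (cases p)
    show ?thesis
    proof (cases "s \<in> {-1..<1} \<and> 0 < t")
      case True
      then have g: "gauge_fun (a + t *\<^sub>R rad u s - a) = t"
        using gauge_scale[of t "rad u s"] by (simp add: gauge_rad[OF u1])
      show ?thesis
      proof (cases "t < \<tau>")
        case t: True
        have "D (a + t *\<^sub>R rad u s) = dv (a + t *\<^sub>R rad u s)"
          using g t by (simp add: D_eq[symmetric])
        then show ?thesis
          using True t \<tau> term_diff[OF u1, of s t] by (simp add: p weight_def cone_map_def)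
      next
        case False
        then have "D (a + t *\<^sub>R rad u s) = 0" using g by (simp add: D_def)
        then show ?thesis using False by (simp add: p weight_def cone_map_def)
      qed
    next
      case False then show ?thesis by (auto simp: p weight_def indicator_def)
    qed
  qed
  note int = term_integrable[OF u1 \<tau>]
  have "(\<integral>z. indicator (sector u) z * (indicator {z. gauge_fun (z - a) < \<tau>} z * dv z) \<partial>lborel)
      = (\<integral>p. ?I p *\<^sub>R dt_term u (fst p) (snd p) - ?I p *\<^sub>R ds_term u (fst p) (snd p) \<partial>(lborel \<Otimes>\<^sub>M lborel))"
    unfolding D_eq sector_integral[OF D u] W ..
  also have "\<dots> = (\<integral>p. ?I p *\<^sub>R dt_term u (fst p) (snd p) \<partial>(lborel \<Otimes>\<^sub>M lborel))
      - (\<integral>p. ?I p *\<^sub>R ds_term u (fst p) (snd p) \<partial>(lborel \<Otimes>\<^sub>M lborel))"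
    by (rule Bochner_Integration.integral_diff[OF int])
  also have "(\<integral>p. ?I p *\<^sub>R dt_term u (fst p) (snd p) \<partial>(lborel \<Otimes>\<^sub>M lborel))
      = (LINT s:{-1..1}|lborel. \<tau> * (F (a + \<tau> *\<^sub>R rad u s) \<bullet> ndir u s))"
  proof -
    have "(\<integral>p. ?I p *\<^sub>R dt_term u (fst p) (snd p) \<partial>(lborel \<Otimes>\<^sub>M lborel))
        = (\<integral>s. \<integral>t. ?I (s, t) *\<^sub>R dt_term u s t \<partial>lborel \<partial>lborel)"
      using lborel_pair.integral_fst'[OF int(1)] by simp
    also have "\<dots> = (\<integral>s. indicator {-1..<1} s * (\<tau> * (F (a + \<tau> *\<^sub>R rad u s) \<bullet> ndir u s)) \<partial>lborel)"
    proof (rule Bochner_Integration.integral_cong[OF refl])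
      fix s
      have "(\<integral>t. ?I (s, t) *\<^sub>R dt_term u s t \<partial>lborel) = (\<integral>t. indicator {-1..<1} s * (indicator {0<..<\<tau>} t * dt_term u s t) \<partial>lborel)"
        by (intro Bochner_Integration.integral_cong) (auto simp: indicator_def)
      then show "(\<integral>t. ?I (s, t) *\<^sub>R dt_term u s t \<partial>lborel) = indicator {-1..<1} s * (\<tau> * (F (a + \<tau> *\<^sub>R rad u s) \<bullet> ndir u s))"
        by (simp add: integral_dt[OF u1 \<tau>])
    qed
    also have "\<dots> = (LINT s:{-1..1}|lborel. \<tau> * (F (a + \<tau> *\<^sub>R rad u s) \<bullet> ndir u s))"
      unfolding set_lebesgue_integral_def
    proof (rule integral_cong_AE)
      have "F (a + \<tau> *\<^sub>R rad u s) = FB (a + \<tau> *\<^sub>R rad u s)" for s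
        using in_closure_rad[OF u1, of \<tau> s] \<tau> by (simp add: FB_def)
      moreover have [measurable]: "rad u \<in> borel_measurable borel" "ndir u \<in> borel_measurable borel"
        using rad_measurable[OF u1] ndir_meas[OF u1] by auto
      ultimately show "(\<lambda>s. indicator {-1..<1} s * (\<tau> * (F (a + \<tau> *\<^sub>R rad u s) \<bullet> ndir u s))) \<in> borel_measurable lborel"
        "(\<lambda>s. indicator {-1..1} s *\<^sub>R (\<tau> * (F (a + \<tau> *\<^sub>R rad u s) \<bullet> ndir u s))) \<in> borel_measurable lborel"
        by simp_all
      show "AE s in lborel. indicator {-1..<1} s * (\<tau> * (F (a + \<tau> *\<^sub>R rad u s) \<bullet> ndir u s)) = indicator {-1..1} s *\<^sub>R (\<tau> * (F (a + \<tau> *\<^sub>R rad u s) \<bullet> ndir u s))"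
        using AE_lborel_singleton[of 1] by eventually_elim (auto simp: indicator_def)
    qed
    finally show ?thesis .
  qed
  also have "(\<integral>p. ?I p *\<^sub>R ds_term u (fst p) (snd p) \<partial>(lborel \<Otimes>\<^sub>M lborel)) = edge u \<tau> 1 - edge u \<tau> (-1)"
  proof -
    have int': "integrable (lborel \<Otimes>\<^sub>M lborel) (case_prod (\<lambda>s t. ?I (s, t) *\<^sub>R ds_term u s t))"
      using int(2) by (simp add: case_prod_beta')
    have "(\<integral>p. ?I p *\<^sub>R ds_term u (fst p) (snd p) \<partial>(lborel \<Otimes>\<^sub>M lborel))
        = (\<integral>t. \<integral>s. ?I (s, t) *\<^sub>R ds_term u s t \<partial>lborel \<partial>lborel)"
      using lborel_pair.integral_snd[OF int'] by (simp add: case_prod_beta')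
    also have "\<dots> = (\<integral>t. indicator {0<..<\<tau>} t * (F (a + t *\<^sub>R rad u 1) \<bullet> (- rot (rad u 1)) - F (a + t *\<^sub>R rad u (-1)) \<bullet> (- rot (rad u (-1)))) \<partial>lborel)"
    proof (rule Bochner_Integration.integral_cong[OF refl])
      fix t
      have "(\<integral>s. ?I (s, t) *\<^sub>R ds_term u s t \<partial>lborel) = (\<integral>s. indicator {0<..<\<tau>} t * (indicator {-1..<1} s * ds_term u s t) \<partial>lborel)"
        by (intro Bochner_Integration.integral_cong) (auto simp: indicator_def)
      also have "\<dots> = indicator {0<..<\<tau>} t * (\<integral>s. indicator {-1..<1} s * ds_term u s t \<partial>lborel)" by simp
      also have "\<dots> = indicator {0<..<\<tau>} t * (F (a + t *\<^sub>R rad u 1) \<bullet> (- rot (rad u 1)) - F (a + t *\<^sub>R rad u (-1)) \<bullet> (- rot (rad u (-1))))"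
        using integral_ds[OF u1, of t] \<tau> by (cases "t \<in> {0<..<\<tau>}") auto
      finally show "(\<integral>s. ?I (s, t) *\<^sub>R ds_term u s t \<partial>lborel)
        = indicator {0<..<\<tau>} t * (F (a + t *\<^sub>R rad u 1) \<bullet> (- rot (rad u 1)) - F (a + t *\<^sub>R rad u (-1)) \<bullet> (- rot (rad u (-1))))" .
    qed
    also have "\<dots> = edge u \<tau> 1 - edge u \<tau> (-1)"
    proof -
      have cT: "continuous_on T F" by (rule continuous_on_subset[OF cont closure_subset])
      have "set_integrable lborel {0..\<tau>} (\<lambda>t. F (a + t *\<^sub>R rad u s) \<bullet> (- rot (rad u s)))" for s
      proof -
        have "continuous_on {0..\<tau>} (\<lambda>t. F (a + t *\<^sub>R rad u s) \<bullet> (- rot (rad u s)))"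
          using in_T_rad[OF u1] \<tau> by (intro continuous_intros continuous_on_compose2[OF cT]) auto
        then show ?thesis unfolding set_integrable_def by (intro borel_integrable_compact) auto
      qed
      then have ci: "set_integrable lborel {0<..<\<tau>} (\<lambda>t. F (a + t *\<^sub>R rad u s) \<bullet> (- rot (rad u s)))" for s
        by (rule set_integrable_subset) auto
      have "edge u \<tau> 1 - edge u \<tau> (-1) = (LINT t:{0<..<\<tau>}|lborel. F (a + t *\<^sub>R rad u 1) \<bullet> (- rot (rad u 1)) - F (a + t *\<^sub>R rad u (-1)) \<bullet> (- rot (rad u (-1))))"
        unfolding edge_def by (rule set_integral_diff(2)[OF ci ci, symmetric])
      then show ?thesis by (simp add: set_lebesgue_integral_def)
    qed
    finally show ?thesis .
  qed
  finally show ?thesis .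
qed

text \<open>The ray of slope 1 around \<open>u\<close> is the ray of slope -1 around
  \<open>rot u\<close>, so each straight side is counted twice with opposite signs.\<close>

lemma edges_cancel: "(\<Sum>u\<in>axis_dirs. edge u \<tau> 1 - edge u \<tau> (-1)) = 0"
proof -
  have "edge u \<tau> 1 = edge (rot u) \<tau> (-1)" for u
  proof -
    have "ray u 1 = ray (rot u) (-1)" by (simp add: ray_def rot_def prod_eq_iff)
    then have "rad u 1 = rad (rot u) (-1)" by (simp add: rad_def q_def clamp1_def)
    then show ?thesis by (simp add: edge_def)
  qed
  then have "(\<Sum>u\<in>axis_dirs. edge u \<tau> 1) = (\<Sum>u\<in>axis_dirs. edge u \<tau> (-1))"
    using rot_axis_dirs[of "\<lambda>u. edge u \<tau> (-1)"] by simp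
  then show ?thesis by (simp add: sum_subtractf)
qed


lemma dv_scaled_integrable:
  assumes \<tau>: "0 < \<tau>" "\<tau> < 1"
  shows "integrable lborel (\<lambda>z. indicator {z. gauge_fun (z - a) < \<tau>} z * dv z)"
proof -
  let ?K = "{z. gauge_fun (z - a) < \<tau>}"
  obtain B where B: "0 \<le> B" "\<And>z. gauge_fun (z - a) \<le> \<tau> \<Longrightarrow> norm (F z) \<le> B \<and> norm (Fx z) \<le> B \<and> norm (Fy z) \<le> B"
    using bound_on_compact[OF \<tau>(2)] by blast
  have K: "?K \<in> sets borel"
    by (intro borel_open open_Collect_less continuous_on_compose2[OF continuous_gauge[of UNIV]] continuous_intros) auto
  have "bounded ?K" using bounded_T by (rule bounded_subset) (use \<tau> in \<open>auto simp: mem_T_iff\<close>)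
  then have fin: "emeasure lborel ?K < \<infinity>" by (rule emeasure_bounded_finite)
  have "(\<lambda>z. fst (FxB z) + snd (FyB z)) \<in> borel_measurable lborel"
    by (simp, intro borel_measurable_add borel_measurable_fst borel_measurable_snd field_borel)
  then have "integrable lborel (\<lambda>z. indicator ?K z *\<^sub>R (fst (FxB z) + snd (FyB z)))"
  proof (rule integrableI_bounded_set_indicator[of _ _ _ "2 * B", rotated])
    have "norm (fst (FxB z) + snd (FyB z)) \<le> 2 * B" if "z \<in> ?K" for z
    proof -
      have "norm (Fx z) \<le> B" "norm (Fy z) \<le> B" using B(2)[of z] that by auto
      then have "\<bar>fst (FxB z)\<bar> \<le> B" "\<bar>snd (FyB z)\<bar> \<le> B"
        using abs_fst_le_norm[of "Fx z"] abs_snd_le_norm[of "Fy z"] B(1)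
        by (auto simp: FxB_def FyB_def indicator_def)
      then show ?thesis by (simp add: abs_le_iff)
    qed
    then show "AE z in lborel. z \<in> ?K \<longrightarrow> norm (fst (FxB z) + snd (FyB z)) \<le> 2 * B" by simp
  qed (use K fin in auto)
  moreover have "indicator ?K z *\<^sub>R (fst (FxB z) + snd (FyB z)) = indicator ?K z * dv z" for z
    using \<tau> by (auto simp: FxB_def FyB_def dv_def indicator_def mem_T_iff)
  ultimately show ?thesis by (simp only:)
qed

lemma divergence_scaled:
  assumes \<tau>: "0 < \<tau>" "\<tau> < 1"
  shows "(\<integral>z. indicator {z. gauge_fun (z - a) < \<tau>} z * dv z \<partial>lborel)
    = (\<Sum>u\<in>axis_dirs. LINT s:{-1..1}|lborel. \<tau> * (F (a + \<tau> *\<^sub>R rad u s) \<bullet> ndir u s))"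
proof -
  have "(\<integral>z. indicator {z. gauge_fun (z - a) < \<tau>} z * dv z \<partial>lborel)
      = (\<Sum>u\<in>axis_dirs. (LINT s:{-1..1}|lborel. \<tau> * (F (a + \<tau> *\<^sub>R rad u s) \<bullet> ndir u s)) - (edge u \<tau> 1 - edge u \<tau> (-1)))"
    unfolding integral_sectors[OF dv_scaled_integrable[OF \<tau>]]
    by (intro sum.cong refl sector_divergence \<tau>)
  also have "\<dots> = (\<Sum>u\<in>axis_dirs. LINT s:{-1..1}|lborel. \<tau> * (F (a + \<tau> *\<^sub>R rad u s) \<bullet> ndir u s))"
    unfolding sum_subtractf[of "\<lambda>u. LINT s:{-1..1}|lborel. \<tau> * (F (a + \<tau> *\<^sub>R rad u s) \<bullet> ndir u s)"] edges_cancel by simp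
  finally show ?thesis .
qed

lemma norm_ndir_integrable: "norm u = 1 \<Longrightarrow> set_integrable lborel {-1..1} (\<lambda>s. norm (ndir u s))"
proof -
  assume u: "norm u = 1"
  obtain L where L: "rectifiable_arc (arc_of u) (rad' u) (slope u) L (-1) 1" using arc_is_rectifiable[OF u] by blast
  show ?thesis using rectifiable_arc.speed_integrable[OF L, of "-1" 1] by (simp add: ndir_def norm_rot_eq)
qed

text \<open>The limit \<open>\<tau>\<close> to 1 of the shrunken copies. The volume side is
  dominated by the integrable \<open>\<bar>dv\<bar>\<close> on \<open>T\<close>; the boundary side
  by a bound of \<open>F\<close> times the integrable \<open>norm (ndir u s)\<close>.\<close>

lemma divergence_arcs:
  assumes int: "set_integrable lborel T dv"
  shows "(LINT z:T|lborel. dv z) = (\<Sum>u\<in>axis_dirs. LINT s:{-1..1}|lborel. F (arc_of u s) \<bullet> ndir u s)"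
proof -
  \<comment> \<open>The shift by 2 keeps all \<open>\<tau> n\<close> strictly positive.\<close>
  define \<tau> where "\<tau> n = 1 - 1 / real (n + 2)" for n
  have \<tau>: "0 < \<tau> n" "\<tau> n < 1" for n by (auto simp: \<tau>_def)
  have \<tau>_lim: "\<tau> \<longlonglongrightarrow> 1"
    unfolding \<tau>_def using tendsto_diff[OF tendsto_const LIMSEQ_ignore_initial_segment[OF lim_1_over_n, of 2], of 1] by simp
  have lhs: "(\<lambda>n. \<integral>z. indicator {z. gauge_fun (z - a) < \<tau> n} z * dv z \<partial>lborel) \<longlonglongrightarrow> (\<integral>z. indicator T z *\<^sub>R dv z \<partial>lborel)"
  proof (rule integral_dominated_convergence[where w = "\<lambda>z. norm (indicator T z *\<^sub>R dv z)"])
    show "(\<lambda>z. indicator T z *\<^sub>R dv z) \<in> borel_measurable lborel" "integrable lborel (\<lambda>z. norm (indicator T z *\<^sub>R dv z))"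
      using int by (auto simp: set_integrable_def)
    show "(\<lambda>z. indicator {z. gauge_fun (z - a) < \<tau> n} z * dv z) \<in> borel_measurable lborel" for n
      using dv_scaled_integrable[OF \<tau>] by (rule borel_measurable_integrable)
    show "AE z in lborel. (\<lambda>n. indicator {z. gauge_fun (z - a) < \<tau> n} z * dv z) \<longlonglongrightarrow> indicator T z *\<^sub>R dv z"
    proof (intro AE_I2)
      fix z
      show "(\<lambda>n. indicator {z. gauge_fun (z - a) < \<tau> n} z * dv z) \<longlonglongrightarrow> indicator T z *\<^sub>R dv z"
      proof (cases "z \<in> T")
        case True
        then have "\<forall>\<^sub>F n in sequentially. gauge_fun (z - a) < \<tau> n"
          using \<tau>_lim by (intro order_tendstoD(1)) (auto simp: mem_T_iff)
        then have "\<forall>\<^sub>F n in sequentially. indicator {z. gauge_fun (z - a) < \<tau> n} z * dv z = indicator T z *\<^sub>R dv z"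
          by eventually_elim (use True in auto)
        then show ?thesis by (rule tendsto_eventually)
      next
        case False
        then have "\<not> gauge_fun (z - a) < \<tau> n" for n using \<tau>(2)[of n] by (auto simp: mem_T_iff)
        then show ?thesis using False by simp
      qed
    qed
    show "AE z in lborel. norm (indicator {z. gauge_fun (z - a) < \<tau> n} z * dv z) \<le> norm (indicator T z *\<^sub>R dv z)" for n
      using \<tau>(2)[of n] by (auto simp: indicator_def mem_T_iff)
  qed
  have rhs: "(\<lambda>n. \<integral>s. indicator {-1..1} s *\<^sub>R (\<tau> n * (F (a + \<tau> n *\<^sub>R rad u s) \<bullet> ndir u s)) \<partial>lborel)
      \<longlonglongrightarrow> (\<integral>s. indicator {-1..1} s *\<^sub>R (F (arc_of u s) \<bullet> ndir u s) \<partial>lborel)" if u: "u \<in> axis_dirs" for u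
  proof -
    note u1 = axis_dirs_norm[OF u]
    obtain B where B: "0 \<le> B" "\<forall>z\<in>closure T. norm (F z) \<le> B" using F_bound by blast
    have [measurable]: "rad u \<in> borel_measurable borel" "ndir u \<in> borel_measurable borel"
      using rad_measurable[OF u1] ndir_meas[OF u1] by auto
    have FB: "F (a + t *\<^sub>R rad u s) = FB (a + t *\<^sub>R rad u s)" if "0 \<le> t" "t \<le> 1" for s t
      using in_closure_rad[OF u1 that, of s] by (simp add: FB_def)
    have arc: "arc_of u s = a + 1 *\<^sub>R rad u s" for s by (simp add: arc_of_def)
    show ?thesis
    proof (rule integral_dominated_convergence[where w = "\<lambda>s. B * (indicator {-1..1} s *\<^sub>R norm (ndir u s))"])
      show "(\<lambda>s. indicator {-1..1} s *\<^sub>R (F (arc_of u s) \<bullet> ndir u s)) \<in> borel_measurable lborel"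
        using FB[of 1] by (simp add: arc)
      show "(\<lambda>s. indicator {-1..1} s *\<^sub>R (\<tau> n * (F (a + \<tau> n *\<^sub>R rad u s) \<bullet> ndir u s))) \<in> borel_measurable lborel" for n
        using FB[of "\<tau> n"] \<tau>[of n] by simp
      show "integrable lborel (\<lambda>s. B * (indicator {-1..1} s *\<^sub>R norm (ndir u s)))"
        using norm_ndir_integrable[OF u1] unfolding set_integrable_def by (intro integrable_mult_right) simp
      show "AE s in lborel. (\<lambda>n. indicator {-1..1} s *\<^sub>R (\<tau> n * (F (a + \<tau> n *\<^sub>R rad u s) \<bullet> ndir u s)))
          \<longlonglongrightarrow> indicator {-1..1} s *\<^sub>R (F (arc_of u s) \<bullet> ndir u s)"
      proof (intro AE_I2)
        fix s
        have lim: "(\<lambda>n. a + \<tau> n *\<^sub>R rad u s) \<longlonglongrightarrow> a + 1 *\<^sub>R rad u s" by (intro tendsto_intros \<tau>_lim)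
        have ev: "\<forall>\<^sub>F n in sequentially. a + \<tau> n *\<^sub>R rad u s \<in> closure T"
          using in_closure_rad[OF u1] \<tau> by (simp add: less_imp_le)
        have "(\<lambda>n. F (a + \<tau> n *\<^sub>R rad u s)) \<longlonglongrightarrow> F (a + 1 *\<^sub>R rad u s)"
          by (rule continuous_on_tendsto_compose[OF cont lim in_closure_rad[OF u1] ev]) auto
        then have "(\<lambda>n. indicator {-1..1} s *\<^sub>R (\<tau> n * (F (a + \<tau> n *\<^sub>R rad u s) \<bullet> ndir u s)))
            \<longlonglongrightarrow> indicator {-1..1} s *\<^sub>R (1 * (F (a + 1 *\<^sub>R rad u s) \<bullet> ndir u s))"
          by (intro tendsto_intros \<tau>_lim)
        then show "(\<lambda>n. indicator {-1..1} s *\<^sub>R (\<tau> n * (F (a + \<tau> n *\<^sub>R rad u s) \<bullet> ndir u s)))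
            \<longlonglongrightarrow> indicator {-1..1} s *\<^sub>R (F (arc_of u s) \<bullet> ndir u s)" by (simp add: arc)
      qed
      show "AE s in lborel. norm (indicator {-1..1} s *\<^sub>R (\<tau> n * (F (a + \<tau> n *\<^sub>R rad u s) \<bullet> ndir u s)))
          \<le> B * (indicator {-1..1} s *\<^sub>R norm (ndir u s))" for n
      proof (intro AE_I2)
        fix s
        have "\<bar>F (a + \<tau> n *\<^sub>R rad u s) \<bullet> ndir u s\<bar> \<le> B * norm (ndir u s)"
          using Cauchy_Schwarz_ineq2[of "F (a + \<tau> n *\<^sub>R rad u s)" "ndir u s"] B in_closure_rad[OF u1, of "\<tau> n" s] \<tau>[of n]
          by (meson less_imp_le mult_right_mono norm_ge_zero order_trans)
        then have "\<bar>\<tau> n\<bar> * \<bar>F (a + \<tau> n *\<^sub>R rad u s) \<bullet> ndir u s\<bar> \<le> 1 * (B * norm (ndir u s))"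
          using \<tau>[of n] by (intro mult_mono) auto
        then show "norm (indicator {-1..1} s *\<^sub>R (\<tau> n * (F (a + \<tau> n *\<^sub>R rad u s) \<bullet> ndir u s)))
            \<le> B * (indicator {-1..1} s *\<^sub>R norm (ndir u s))"
          by (auto simp: indicator_def abs_mult)
      qed
    qed
  qed
  have "(\<lambda>n. \<Sum>u\<in>axis_dirs. LINT s:{-1..1}|lborel. \<tau> n * (F (a + \<tau> n *\<^sub>R rad u s) \<bullet> ndir u s))
      \<longlonglongrightarrow> (\<Sum>u\<in>axis_dirs. LINT s:{-1..1}|lborel. F (arc_of u s) \<bullet> ndir u s)"
    unfolding set_lebesgue_integral_def by (intro tendsto_sum rhs)
  moreover have "(\<lambda>n. \<Sum>u\<in>axis_dirs. LINT s:{-1..1}|lborel. \<tau> n * (F (a + \<tau> n *\<^sub>R rad u s) \<bullet> ndir u s)) \<longlonglongrightarrow> (LINT z:T|lborel. dv z)"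
    using lhs unfolding divergence_scaled[OF \<tau>] by (simp add: set_lebesgue_integral_def)
  ultimately show ?thesis using LIMSEQ_unique by blast
qed

text \<open>Each arc integral over \<open>s\<close> becomes a Hausdorff integral by the area
  formula. The integrand \<open>f u\<close> is Borel and coincides almost everywhere on its arc with
  the flux density, and the arcs overlap in a null set.\<close>

theorem divergence:
  assumes int: "set_integrable lborel T dv"
  shows "set_integrable hausdorff1 (frontier T) (\<lambda>z. F z \<bullet> outer_normal T z)"
    and "(LINT z:T|lborel. dv z) = (LINT z:frontier T|hausdorff1. F z \<bullet> outer_normal T z)"
proof -
  define f where "f u z = FB z \<bullet> (conormal u (slope u z) /\<^sub>R norm (conormal u (slope u z)))" for u z
  have fb: "f u \<in> borel_measurable borel" if u: "u \<in> axis_dirs" for u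
  proof -
    note u1 = axis_dirs_norm[OF u]
    have [measurable]: "conormal u \<in> borel_measurable borel" "slope u \<in> borel_measurable borel"
      using conormal_measurable[OF u1] slope_measurable[OF u1] by auto
    show ?thesis unfolding f_def by measurable
  qed
  \<comment> \<open>Unit conormal times speed is \<open>ndir\<close>, because the speed is
    \<open>norm (conormal u s) / (q u s)\<^sup>2\<close>.\<close>
  have f_arc: "f u (arc_of u s) * norm (rad' u s) = F (arc_of u s) \<bullet> ndir u s" if u: "u \<in> axis_dirs" and s: "s \<in> {-1..1}" for u s
  proof -
    note u1 = axis_dirs_norm[OF u]
    have "arc_of u s \<in> closure T" using arc_in_frontier[OF u1, of s] by (simp add: frontier_def)
    then have "FB (arc_of u s) = F (arc_of u s)" by (simp add: FB_def)
    moreover have "ndir u s = conormal u s /\<^sub>R (q u s)\<^sup>2" by (simp add: ndir_def conormal_eq[OF u1])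
    ultimately show ?thesis
      using conormal_nonzero[OF u1, of s] by (simp add: f_def slope_arc[OF u1 s] norm_rad'[OF u1] divide_inverse)
  qed
  have int_arc: "set_integrable hausdorff1 (arc_of u ` {-1..1}) (f u)"
    and eq_arc: "(LINT z:arc_of u ` {-1..1}|hausdorff1. f u z) = (LINT s:{-1..1}|lborel. F (arc_of u s) \<bullet> ndir u s)"
    if u: "u \<in> axis_dirs" for u
  proof -
    note u1 = axis_dirs_norm[OF u]
    obtain L where L: "rectifiable_arc (arc_of u) (rad' u) (slope u) L (-1) 1" using arc_is_rectifiable[OF u1] by blast
    obtain B where B: "0 \<le> B" "\<forall>z\<in>closure T. norm (F z) \<le> B" using F_bound by blast
    have [measurable]: "rad u \<in> borel_measurable borel" "ndir u \<in> borel_measurable borel"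
      using rad_measurable[OF u1] ndir_meas[OF u1] by auto
    have cl: "a + rad u s \<in> closure T" for s using in_closure_rad[OF u1, of 1 s] by simp
    have "set_integrable lborel {-1..1} (\<lambda>s. F (arc_of u s) \<bullet> ndir u s)"
      unfolding set_integrable_def
    proof (rule Bochner_Integration.integrable_bound)
      show "integrable lborel (\<lambda>s. B * (indicator {-1..1} s *\<^sub>R norm (ndir u s)))"
        using norm_ndir_integrable[OF u1] unfolding set_integrable_def by (intro integrable_mult_right) simp
      have "F (arc_of u s) = FB (a + rad u s)" for s using cl by (simp add: FB_def arc_of_def)
      then show "(\<lambda>s. indicator {-1..1} s *\<^sub>R (F (arc_of u s) \<bullet> ndir u s)) \<in> borel_measurable lborel" by simp
      show "AE s in lborel. norm (indicator {-1..1} s *\<^sub>R (F (arc_of u s) \<bullet> ndir u s)) \<le> norm (B * (indicator {-1..1} s *\<^sub>R norm (ndir u s)))"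
      proof (intro AE_I2)
        fix s
        have "\<bar>F (arc_of u s) \<bullet> ndir u s\<bar> \<le> B * norm (ndir u s)"
          using Cauchy_Schwarz_ineq2[of "F (arc_of u s)" "ndir u s"] B cl[of s]
          unfolding arc_of_def by (meson mult_right_mono norm_ge_zero order_trans)
        then show "norm (indicator {-1..1} s *\<^sub>R (F (arc_of u s) \<bullet> ndir u s)) \<le> norm (B * (indicator {-1..1} s *\<^sub>R norm (ndir u s)))"
          using B(1) by (auto simp: indicator_def abs_mult)
      qed
    qed
    moreover have "indicator {-1..1} s *\<^sub>R (F (arc_of u s) \<bullet> ndir u s) = indicator {-1..1} s *\<^sub>R (f u (arc_of u s) * norm (rad' u s))" for s
      using f_arc[OF u, of s] by (auto simp: indicator_def)
    ultimately show "set_integrable hausdorff1 (arc_of u ` {-1..1}) (f u)"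
      "(LINT z:arc_of u ` {-1..1}|hausdorff1. f u z) = (LINT s:{-1..1}|lborel. F (arc_of u s) \<bullet> ndir u s)"
      unfolding rectifiable_arc.arc_integrable_iff[OF L fb[OF u]] rectifiable_arc.arc_integral[OF L fb[OF u]]
      by (simp_all only: set_integrable_def set_lebesgue_integral_def)
  qed
  let ?S = "\<lambda>z. \<Sum>u\<in>axis_dirs. indicator (arc_of u ` {-1..1}) z *\<^sub>R f u z"
  have intS: "integrable hausdorff1 ?S"
    using int_arc by (intro Bochner_Integration.integrable_sum) (simp add: set_integrable_def)
  have "AE z in hausdorff1. \<forall>u\<in>axis_dirs. z \<in> arc_of u ` {-1..1} \<longrightarrow>
     is_outer_normal T z (conormal u (slope u z) /\<^sub>R norm (conormal u (slope u z)))"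
    by (intro AE_finite_allI AE_normal_arc axis_dirs_norm) auto
  then have ae: "AE z in hausdorff1. indicator (frontier T) z *\<^sub>R (F z \<bullet> outer_normal T z) = ?S z"
    using AE_arcs_disjoint
  proof eventually_elim
    case (elim z)
    have "?S z = (\<Sum>u\<in>axis_dirs. indicator (arc_of u ` {-1..1}) z *\<^sub>R (F z \<bullet> outer_normal T z))"
    proof (intro sum.cong refl)
      fix u assume u: "u \<in> axis_dirs"
      show "indicator (arc_of u ` {-1..1}) z *\<^sub>R f u z = indicator (arc_of u ` {-1..1}) z *\<^sub>R (F z \<bullet> outer_normal T z)"
      proof (cases "z \<in> arc_of u ` {-1..1}")
        case True
        then have "conormal u (slope u z) /\<^sub>R norm (conormal u (slope u z)) = outer_normal T z"
          using elim(1) u outer_normal_eqI by metis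
        moreover have "z \<in> closure T" using True arc_in_frontier[OF axis_dirs_norm[OF u]] by (auto simp: frontier_def)
        ultimately show ?thesis by (simp add: f_def FB_def)
      qed simp
    qed
    also have "\<dots> = indicator (frontier T) z *\<^sub>R (F z \<bullet> outer_normal T z)"
      unfolding elim(2)[symmetric] by (simp add: scaleR_sum_left[symmetric] sum_distrib_right[symmetric])
    finally show ?case by simp
  qed
  have meas: "(\<lambda>z. indicator (frontier T) z *\<^sub>R (F z \<bullet> outer_normal T z)) \<in> borel_measurable hausdorff1"
    by (rule hausdorff1_measurable_AE[OF borel_measurable_integrable[OF intS] ae])
  show "set_integrable hausdorff1 (frontier T) (\<lambda>z. F z \<bullet> outer_normal T z)"
    unfolding set_integrable_def
    by (subst integrable_cong_AE[OF meas _ ae]) (use intS in auto)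
  have "(LINT z:frontier T|hausdorff1. F z \<bullet> outer_normal T z) = (\<integral>z. ?S z \<partial>hausdorff1)"
    unfolding set_lebesgue_integral_def by (intro integral_cong_AE meas ae) (use intS in auto)
  also have "\<dots> = (\<Sum>u\<in>axis_dirs. \<integral>z. indicator (arc_of u ` {-1..1}) z *\<^sub>R f u z \<partial>hausdorff1)"
    using int_arc by (intro Bochner_Integration.integral_sum) (simp add: set_integrable_def)
  also have "\<dots> = (\<Sum>u\<in>axis_dirs. LINT s:{-1..1}|lborel. F (arc_of u s) \<bullet> ndir u s)"
    using eq_arc by (intro sum.cong refl) (simp add: set_lebesgue_integral_def)
  finally show "(LINT z:T|lborel. dv z) = (LINT z:frontier T|hausdorff1. F z \<bullet> outer_normal T z)"
    using divergence_arcs[OF int] by simp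
qed

end

section \<open>Integrability of the derivatives of the coefficients\<close>

text \<open>Two lines from the end point give two nonnegative integrands \<open>G t + C' (t * Y1)\<close> and
  \<open>G t + C' (t * Y2)\<close> with bounded integrals. Hence \<open>C' (t * Y1) - C' (t * Y2)\<close> is integrable, and
  since the two scalings weight the total mass \<open>N\<close> of \<open>\<bar>C'\<bar>\<close> by \<open>1 / Y1 > 1 / Y2\<close>, \<open>N\<close> is finite.\<close>

lemma integrable_near_end:
  fixes A G C C' :: "real \<Rightarrow> real"
  assumes Y: "0 < Y1" "Y1 < Y2"
    and A: "\<And>t. t \<in> {0<..1} \<Longrightarrow> (A has_real_derivative G t) (at t)" "\<And>t. t \<in> {0<..1} \<Longrightarrow> \<bar>A t\<bar> \<le> M"
      "continuous_on {0<..1} G"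
    and C: "\<And>r. r \<in> {0<..Y2} \<Longrightarrow> (C has_real_derivative C' r) (at r)" "\<And>r. r \<in> {0<..Y2} \<Longrightarrow> \<bar>C r\<bar> \<le> M"
      "continuous_on {0<..Y2} C'"
    and pos: "\<And>t. t \<in> {0<..1} \<Longrightarrow> 0 \<le> G t + C' (t * Y1)" "\<And>t. t \<in> {0<..1} \<Longrightarrow> 0 \<le> G t + C' (t * Y2)"
  shows "set_integrable lborel {0<..Y2} C'"
proof -
  have ci: "set_integrable lborel {l..r} f" if "continuous_on {l..r} f" for l r :: real and f :: "real \<Rightarrow> real"
    unfolding set_integrable_def using that by (intro borel_integrable_compact) auto
  define N where "N x = (LINT r:{x..Y2}|lborel. \<bar>C' r\<bar>)" for x
  have contC: "continuous_on {l..r} (\<lambda>r. \<bar>C' r\<bar>)" if "0 < l" "r \<le> Y2" for l r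
    using that by (intro continuous_intros continuous_on_subset[OF C(3)]) auto
  have absC_int: "set_integrable lborel {l..r} (\<lambda>r. \<bar>C' r\<bar>)" if "0 < l" "r \<le> Y2" for l r
    by (intro ci contC that)
  have N_hk: "N x = integral {x..Y2} (\<lambda>r. \<bar>C' r\<bar>)" if "0 < x" for x
    unfolding N_def using set_borel_integral_eq_integral(2)[OF absC_int] that by simp
  have N_anti: "N y \<le> N x" if "0 < x" "x \<le> y" for x y
    using that unfolding N_hk[OF that(1)] N_hk[OF order.strict_trans2[OF that]]
    by (intro integral_subset_le integrable_continuous_real contC) auto
  have N_nonneg: "0 \<le> N x" for x
    unfolding N_def set_lebesgue_integral_def by (rule integral_nonneg_AE) auto
  have bound: "N (\<epsilon> * Y1) * (1 / Y1 - 1 / Y2) \<le> N Y1 / Y1 + (4 * M + 2 * M / Y1 + 2 * M / Y2)" if e: "0 < \<epsilon>" "\<epsilon> < 1" for \<epsilon>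
  proof -
    have sub: "t \<in> {\<epsilon>..1} \<Longrightarrow> t \<in> {0<..1}" for t using e by auto
    have scale_in: "t * Y \<in> {0<..Y2}" if "t \<in> {\<epsilon>..1}" "0 < Y" "Y \<le> Y2" for t Y
      using that e mult_mono[of t 1 Y Y2] by auto
    have cG: "continuous_on {\<epsilon>..1} G" using continuous_on_subset[OF A(3)] sub by blast
    have cC: "continuous_on {\<epsilon>..1} (\<lambda>t. C' (t * Y))" if "0 < Y" "Y \<le> Y2" for Y
      by (rule continuous_on_compose2[OF C(3)]) (use scale_in that in \<open>auto intro!: continuous_intros\<close>)
    have intG: "integral {\<epsilon>..1} G = A 1 - A \<epsilon>"
    proof (rule integral_unique[OF fundamental_theorem_of_calculus])
      fix t assume "t \<in> {\<epsilon>..1}"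
      then show "(A has_vector_derivative G t) (at t within {\<epsilon>..1})"
        using A(1)[OF sub] by (simp add: has_real_derivative_iff_has_vector_derivative has_vector_derivative_at_within)
    qed (use e in auto)
    have intC: "integral {\<epsilon>..1} (\<lambda>t. C' (t * Y)) = (C Y - C (\<epsilon> * Y)) / Y" if Y': "0 < Y" "Y \<le> Y2" for Y
    proof -
      have "((\<lambda>t. C' (t * Y)) has_integral (C (1 * Y) / Y - C (\<epsilon> * Y) / Y)) {\<epsilon>..1}"
      proof (rule fundamental_theorem_of_calculus)
        fix t assume t: "t \<in> {\<epsilon>..1}"
        have "((\<lambda>t. C (t * Y)) has_real_derivative C' (t * Y) * Y) (at t)"
          using C(1)[OF scale_in[OF t Y']]
          by (intro DERIV_chain2[where f = C and g = "\<lambda>t. t * Y"]) (auto intro!: derivative_eq_intros)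
        from DERIV_cdivide[OF this, of Y] have "((\<lambda>t. C (t * Y) / Y) has_real_derivative C' (t * Y)) (at t)" using Y' by simp
        then show "((\<lambda>t. C (t * Y) / Y) has_vector_derivative C' (t * Y)) (at t within {\<epsilon>..1})"
          by (simp add: has_real_derivative_iff_has_vector_derivative has_vector_derivative_at_within)
      qed (use e in auto)
      then show ?thesis by (simp add: integral_unique diff_divide_distrib)
    qed
    have int_h: "integral {\<epsilon>..1} (\<lambda>t. G t + C' (t * Y)) \<le> 2 * M + 2 * M / Y" if Y': "0 < Y" "Y \<le> Y2" for Y
    proof -
      have "integral {\<epsilon>..1} (\<lambda>t. G t + C' (t * Y)) = A 1 - A \<epsilon> + (C Y - C (\<epsilon> * Y)) / Y"
        using intG intC[OF Y'] by (subst integral_add) (auto intro!: integrable_continuous_real cG cC Y')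
      also have "\<dots> \<le> 2 * M + 2 * M / Y"
      proof (intro add_mono divide_right_mono)
        show "A 1 - A \<epsilon> \<le> 2 * M" using A(2)[of 1] A(2)[of \<epsilon>] e by (auto simp: abs_le_iff)
        show "C Y - C (\<epsilon> * Y) \<le> 2 * M"
          using C(2)[of Y] C(2)[OF scale_in[of \<epsilon> Y]] Y' e by (auto simp: abs_le_iff)
      qed (use Y' in auto)
      finally show ?thesis .
    qed
    have Y2: "0 < Y2" "Y1 \<le> Y2" using Y by auto
    have scaled: "integral {\<epsilon>..1} (\<lambda>t. \<bar>C' (t * Y)\<bar>) = (1 / Y) * (LINT r:{\<epsilon> * Y..Y}|lborel. \<bar>C' r\<bar>)"
      if Y': "0 < Y" "Y \<le> Y2" for Y
    proof -
      have "(LINT r:{\<epsilon> * Y..Y}|lborel. \<bar>C' r\<bar>) = \<bar>Y\<bar> *\<^sub>R (\<integral>t. indicator {\<epsilon> * Y..Y} (0 + Y * t) *\<^sub>R \<bar>C' (0 + Y * t)\<bar> \<partial>lborel)"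
        unfolding set_lebesgue_integral_def using Y' by (intro lborel_integral_real_affine) auto
      also have "(\<integral>t. indicator {\<epsilon> * Y..Y} (0 + Y * t) *\<^sub>R \<bar>C' (0 + Y * t)\<bar> \<partial>lborel) = (LINT t:{\<epsilon>..1}|lborel. \<bar>C' (t * Y)\<bar>)"
        unfolding set_lebesgue_integral_def using Y'
        by (intro Bochner_Integration.integral_cong refl) (auto simp: indicator_def mult.commute)
      also have "\<dots> = integral {\<epsilon>..1} (\<lambda>t. \<bar>C' (t * Y)\<bar>)"
        by (intro set_borel_integral_eq_integral ci continuous_intros cC Y')
      finally show ?thesis using Y' by simp
    qed
    \<comment> \<open>The two nonnegative integrands differ by
      \<open>C' (t * Y1) - C' (t * Y2)\<close>, so the modulus of this difference is at most their
      sum.\<close>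
    have le: "integral {\<epsilon>..1} (\<lambda>t. \<bar>C' (t * Y1)\<bar>) \<le> integral {\<epsilon>..1} (\<lambda>t. \<bar>C' (t * Y2)\<bar> + ((G t + C' (t * Y1)) + (G t + C' (t * Y2))))"
    proof (rule integral_le)
      fix t assume t: "t \<in> {\<epsilon>..1}"
      show "\<bar>C' (t * Y1)\<bar> \<le> \<bar>C' (t * Y2)\<bar> + ((G t + C' (t * Y1)) + (G t + C' (t * Y2)))"
        using pos(1)[OF sub[OF t]] pos(2)[OF sub[OF t]] by linarith
    qed (use Y Y2 in \<open>auto intro!: integrable_continuous_real continuous_intros cG cC\<close>)
    also have "\<dots> = integral {\<epsilon>..1} (\<lambda>t. \<bar>C' (t * Y2)\<bar>) + (integral {\<epsilon>..1} (\<lambda>t. G t + C' (t * Y1)) + integral {\<epsilon>..1} (\<lambda>t. G t + C' (t * Y2)))"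
      using Y Y2 by (subst integral_add integral_add, auto intro!: integrable_continuous_real continuous_intros cG cC)+
    also have "\<dots> \<le> integral {\<epsilon>..1} (\<lambda>t. \<bar>C' (t * Y2)\<bar>) + ((2 * M + 2 * M / Y1) + (2 * M + 2 * M / Y2))"
      using int_h[of Y1] int_h[of Y2] Y Y2 by simp
    finally have 1: "(1 / Y1) * (LINT r:{\<epsilon> * Y1..Y1}|lborel. \<bar>C' r\<bar>) \<le> (1 / Y2) * N (\<epsilon> * Y2) + (4 * M + 2 * M / Y1 + 2 * M / Y2)"
      using scaled[of Y1] scaled[of Y2] Y Y2 by (simp add: N_def)
    have 2: "(LINT r:{\<epsilon> * Y1..Y1}|lborel. \<bar>C' r\<bar>) = N (\<epsilon> * Y1) - N Y1"
    proof -
      have "integral {\<epsilon> * Y1..Y1} (\<lambda>r. \<bar>C' r\<bar>) + integral {Y1..Y2} (\<lambda>r. \<bar>C' r\<bar>) = integral {\<epsilon> * Y1..Y2} (\<lambda>r. \<bar>C' r\<bar>)"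
        using e Y by (intro Henstock_Kurzweil_Integration.integral_combine integrable_continuous_real contC) auto
      moreover have "(LINT r:{\<epsilon> * Y1..Y1}|lborel. \<bar>C' r\<bar>) = integral {\<epsilon> * Y1..Y1} (\<lambda>r. \<bar>C' r\<bar>)"
        using e Y by (intro set_borel_integral_eq_integral absC_int) auto
      ultimately show ?thesis using N_hk[of "\<epsilon> * Y1"] N_hk[of Y1] e Y by simp
    qed
    have 3: "N (\<epsilon> * Y2) \<le> N (\<epsilon> * Y1)" using e Y by (intro N_anti) auto
    have "(1 / Y2) * N (\<epsilon> * Y2) \<le> (1 / Y2) * N (\<epsilon> * Y1)" using 3 Y2 by (intro mult_left_mono) auto
    then show ?thesis using 1 unfolding 2 by (simp add: algebra_simps diff_divide_distrib)
  qed
  \<comment> \<open>The inequality just proved has absorbed the term with weight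
    \<open>1 / Y2\<close> into the one with weight \<open>1 / Y1\<close>; what remains on the left
    has the positive factor \<open>k\<close>.\<close>
  define k where "k = 1 / Y1 - 1 / Y2"
  define Q where "Q = (N Y1 / Y1 + (4 * M + 2 * M / Y1 + 2 * M / Y2)) / k"
  have k: "0 < k" using Y by (simp add: k_def field_simps)
  have N_bound: "N x \<le> Q" if x: "0 < x" "x < Y1" for x
    using bound[of "x / Y1"] x Y k by (simp add: Q_def k_def[symmetric] pos_le_divide_eq)
  \<comment> \<open>With \<open>n + 2\<close> in the denominator every \<open>e n\<close> is
    strictly below \<open>Y1\<close>, as \<open>N_bound\<close> requires.\<close>
  define e where "e n = Y1 / real (n + 2)" for n
  have e: "0 < e n" "e n < Y1" for n using Y by (auto simp: e_def divide_less_eq)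
  have "(\<integral>\<^sup>+r. ennreal (indicator {0<..Y2} r * \<bar>C' r\<bar>) \<partial>lborel)
      = (\<integral>\<^sup>+r. (SUP n. ennreal (indicator {e n..Y2} r * \<bar>C' r\<bar>)) \<partial>lborel)"
  proof (intro nn_integral_cong antisym)
    fix r
    show "(SUP n. ennreal (indicator {e n..Y2} r * \<bar>C' r\<bar>)) \<le> ennreal (indicator {0<..Y2} r * \<bar>C' r\<bar>)"
      by (intro SUP_least ennreal_leI) (auto simp: indicator_def dest: order.strict_trans2[OF e(1)])
    show "ennreal (indicator {0<..Y2} r * \<bar>C' r\<bar>) \<le> (SUP n. ennreal (indicator {e n..Y2} r * \<bar>C' r\<bar>))"
    proof (cases "r \<in> {0<..Y2}")
      case True
      obtain n :: nat where "Y1 / r < real n" using reals_Archimedean2 by blast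
      then have "e n \<le> r" using True Y by (auto simp: e_def field_simps)
      then show ?thesis using True by (intro SUP_upper2[of n]) auto
    qed simp
  qed
  also have "\<dots> = (SUP n. \<integral>\<^sup>+r. ennreal (indicator {e n..Y2} r * \<bar>C' r\<bar>) \<partial>lborel)"
  proof (rule nn_integral_monotone_convergence_SUP)
    show "incseq (\<lambda>n r. ennreal (indicator {e n..Y2} r * \<bar>C' r\<bar>))"
    proof (intro incseq_SucI le_funI ennreal_leI)
      fix n r
      have "e (Suc n) \<le> e n" using Y by (simp add: e_def frac_le)
      then show "indicator {e n..Y2} r * \<bar>C' r\<bar> \<le> indicator {e (Suc n)..Y2} r * \<bar>C' r\<bar>"
        by (auto simp: indicator_def)
    qed
    show "(\<lambda>r. ennreal (indicator {e n..Y2} r * \<bar>C' r\<bar>)) \<in> borel_measurable lborel" for n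
      using borel_measurable_integrable[OF absC_int[OF e(1) order_refl, unfolded set_integrable_def]] by simp
  qed
  also have "\<dots> \<le> ennreal Q"
  proof (rule SUP_least)
    fix n
    have "(\<integral>\<^sup>+r. ennreal (indicator {e n..Y2} r * \<bar>C' r\<bar>) \<partial>lborel) = ennreal (N (e n))"
      unfolding N_def set_lebesgue_integral_def
      using absC_int[OF e(1)[of n] order_refl, unfolded set_integrable_def]
      by (subst nn_integral_eq_integral) auto
    then show "(\<integral>\<^sup>+r. ennreal (indicator {e n..Y2} r * \<bar>C' r\<bar>) \<partial>lborel) \<le> ennreal Q"
      using N_bound[OF e] by (simp add: ennreal_leI)
  qed
  finally have fin: "(\<integral>\<^sup>+r. ennreal (indicator {0<..Y2} r * \<bar>C' r\<bar>) \<partial>lborel) < \<infinity>"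
    by (rule order_le_less_trans) simp
  show ?thesis
    unfolding set_integrable_def
  proof (rule integrableI_bounded)
    show "(\<lambda>r. indicator {0<..Y2} r *\<^sub>R C' r) \<in> borel_measurable lborel"
      using borel_measurable_continuous_on_indicator[OF _ C(3)] by simp
    have "ennreal (norm (indicator {0<..Y2} r *\<^sub>R C' r)) = ennreal (indicator {0<..Y2} r * \<bar>C' r\<bar>)" for r
      by (auto simp: indicator_def)
    then show "(\<integral>\<^sup>+r. ennreal (norm (indicator {0<..Y2} r *\<^sub>R C' r)) \<partial>lborel) < \<infinity>" using fin by simp
  qed
qed

section \<open>From one end of a projection to the whole element\<close>

context star_domain
begin

text \<open>Replace \<open>z\<close> by a nearby point \<open>z'\<close> of \<open>T\<close> and
  compensate by moving \<open>w\<close> to \<open>w'\<close> so that the point on the segment stays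
  fixed. For \<open>z'\<close> close enough, \<open>w'\<close> is still in the ball.\<close>

lemma closure_segment:
  assumes z: "z \<in> closure T" and w: "w \<in> ball a \<rho>" and t: "0 < t" "t \<le> 1"
  shows "z + t *\<^sub>R (w - z) \<in> T"
proof -
  define r where "r = t * (\<rho> - dist a w)"
  have r: "0 < r" using w t by (simp add: r_def)
  obtain z' where z': "z' \<in> T" "dist z' z < r" using z r by (meson closure_approachable)
  define w' where "w' = w + ((1 - t) / t) *\<^sub>R (z - z')"
  have "dist a w' \<le> dist a w + norm (((1 - t) / t) *\<^sub>R (z - z'))"
    unfolding w'_def dist_norm by (metis diff_diff_eq norm_triangle_ineq4)
  also have "norm (((1 - t) / t) *\<^sub>R (z - z')) \<le> (1 / t) * dist z' z"
    unfolding norm_scaleR dist_norm norm_minus_commute[of z' z]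
    using t by (intro mult_right_mono) (auto simp: field_simps)
  also have "(1 / t) * dist z' z < (1 / t) * r" using z' t by (intro mult_strict_left_mono) auto
  also have "(1 / t) * r = \<rho> - dist a w" using t by (simp add: r_def)
  finally have "w' \<in> ball a \<rho>" by simp
  then have "(1 - (1 - t)) *\<^sub>R w' + (1 - t) *\<^sub>R z' \<in> T" using z' t by (intro segment) auto
  moreover have "(1 - (1 - t)) *\<^sub>R w' + (1 - t) *\<^sub>R z' = z + t *\<^sub>R (w - z)"
    using t by (simp add: w'_def scaleR_add_right) (simp add: algebra_simps)
  ultimately show ?thesis by simp
qed

text \<open>Join a highest point \<open>zs\<close> of the closure to two points of the ball that
  differ only in height. At parameter \<open>t\<close> both lines have the same coordinate along
  \<open>rot u\<close>, so \<open>f'\<close> takes the same value, while \<open>g'\<close> is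
  evaluated at the depths \<open>t * Y1\<close> and \<open>t * Y2\<close> below the top. This is the
  situation of \<open>integrable_near_end\<close>.\<close>

lemma integrable_at_top:
  fixes f f' g g' :: "real \<Rightarrow> real"
  assumes u: "norm u = 1"
    and f: "\<And>z. z \<in> T \<Longrightarrow> (f has_real_derivative f' (z \<bullet> rot u)) (at (z \<bullet> rot u))" "\<And>z. z \<in> T \<Longrightarrow> \<bar>f (z \<bullet> rot u)\<bar> \<le> M"
      "continuous_on ((\<lambda>z. z \<bullet> rot u) ` T) f'"
    and g: "\<And>z. z \<in> T \<Longrightarrow> (g has_real_derivative g' (z \<bullet> u)) (at (z \<bullet> u))" "\<And>z. z \<in> T \<Longrightarrow> \<bar>g (z \<bullet> u)\<bar> \<le> M"
      "continuous_on ((\<lambda>z. z \<bullet> u) ` T) g'"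
    and pos: "\<And>z. z \<in> T \<Longrightarrow> 0 \<le> f' (z \<bullet> rot u) + g' (z \<bullet> u)"
  shows "\<exists>d>0. set_integrable lborel {Sup ((\<lambda>z. z \<bullet> u) ` T) - d..<Sup ((\<lambda>z. z \<bullet> u) ` T)} g'"
proof -
  note rel = u_rel[OF u]
  have com: "compact ((\<lambda>z. z \<bullet> u) ` closure T)" by (intro compact_continuous_image compact_closure_T continuous_intros)
  have ne: "(\<lambda>z. z \<bullet> u) ` closure T \<noteq> {}" using a_in closure_subset by blast
  obtain zs where "zs \<in> closure T" "\<forall>t\<in>(\<lambda>z. z \<bullet> u) ` closure T. t \<le> zs \<bullet> u"
    using compact_attains_sup[OF com ne] by blast
  then have zs: "zs \<in> closure T" "\<And>z. z \<in> closure T \<Longrightarrow> z \<bullet> u \<le> zs \<bullet> u" by auto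
  define h where "h = zs \<bullet> u"
  have top: "Sup ((\<lambda>z. z \<bullet> u) ` T) = h"
  proof (rule cSup_eq_non_empty)
    show "(\<lambda>z. z \<bullet> u) ` T \<noteq> {}" using a_in by blast
    show "x \<le> h" if "x \<in> (\<lambda>z. z \<bullet> u) ` T" for x using that zs(2) closure_subset unfolding h_def by blast
    fix y assume y: "\<And>x. x \<in> (\<lambda>z. z \<bullet> u) ` T \<Longrightarrow> x \<le> y"
    have "closure T \<subseteq> {z. z \<bullet> u \<le> y}" using y by (intro closure_minimal closed_Collect_le continuous_intros) auto
    then show "h \<le> y" using zs(1) by (auto simp: h_def)
  qed
  have strict: "z \<bullet> u < h" if z: "z \<in> T" for z
  proof -
    obtain e where e: "0 < e" "ball z e \<subseteq> T" using open_T z by (meson openE)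
    have "z + (e / 2) *\<^sub>R u \<in> T" using e u by (intro subsetD[OF e(2)]) (simp add: dist_norm)
    then have "(z + (e / 2) *\<^sub>R u) \<bullet> u \<le> h" using zs(2) closure_subset unfolding h_def by blast
    then show ?thesis using e rel by (simp add: inner_add_left)
  qed
  \<comment> \<open>A third of the radius, so that a shift of size \<open>e\<close> in each frame
    direction stays in the ball. The shift \<open>\<eta>\<close> below makes the horizontal slope
    \<open>X\<close> of the lines nonzero; then \<open>f / X\<close> along a line is a primitive of
    \<open>f'\<close> there.\<close>
  define e where "e = \<rho> / 3"
  have "\<exists>\<eta>. \<bar>\<eta>\<bar> \<le> e \<and> (a - zs) \<bullet> rot u + \<eta> \<noteq> 0"
    using \<rho> by (cases "(a - zs) \<bullet> rot u = 0") (auto simp: e_def intro: exI[of _ "\<rho> / 3"] exI[of _ 0])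
  then obtain \<eta> where \<eta>: "\<bar>\<eta>\<bar> \<le> e" "(a - zs) \<bullet> rot u + \<eta> \<noteq> 0" by blast
  define w where "w k = a + \<eta> *\<^sub>R rot u + k *\<^sub>R u" for k
  have w: "w k \<in> ball a \<rho>" if "\<bar>k\<bar> \<le> e" for k
  proof -
    have "a - w k = - (\<eta> *\<^sub>R rot u + k *\<^sub>R u)" by (simp add: w_def)
    then have "dist a (w k) = norm (\<eta> *\<^sub>R rot u + k *\<^sub>R u)"
      by (simp only: dist_norm norm_minus_cancel)
    also have "\<dots> \<le> e + e" using norm_triangle_ineq[of "\<eta> *\<^sub>R rot u" "k *\<^sub>R u"] \<eta> that u by (simp add: norm_rot_eq)
    also have "\<dots> < \<rho>" using \<rho> by (simp add: e_def)
    finally show ?thesis by simp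
  qed
  define X where "X = (a - zs) \<bullet> rot u + \<eta>"
  define Y where "Y k = h - w k \<bullet> u" for k
  have line: "zs + t *\<^sub>R (w k - zs) \<in> T" if "t \<in> {0<..1}" "\<bar>k\<bar> \<le> e" for t k
    using closure_segment[OF zs(1) w[OF that(2)]] that by auto
  have coords: "(zs + t *\<^sub>R (w k - zs)) \<bullet> rot u = zs \<bullet> rot u + t * X" "(zs + t *\<^sub>R (w k - zs)) \<bullet> u = h - t * Y k" for t k
    by (simp_all add: X_def Y_def w_def h_def inner_add_left inner_diff_left rel algebra_simps)
  have Ypos: "0 < Y k" if "\<bar>k\<bar> \<le> e" for k using strict[OF line[of 1 k]] that by (simp add: Y_def)
  define Y1 Y2 where "Y1 = Y e" and "Y2 = Y 0"
  have e0: "0 < e" using \<rho> by (simp add: e_def)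
  have Y12: "0 < Y1" "Y1 < Y2" using Ypos[of e] e0 by (auto simp: Y1_def Y2_def Y_def w_def inner_add_left rel)
  have X: "X \<noteq> 0" using \<eta> by (simp add: X_def)
  have in2: "\<exists>z\<in>T. z \<bullet> u = h - r" if "r \<in> {0<..Y2}" for r
    using line[of "r / Y2" 0] coords(2)[of "r / Y2" 0] that Y12 e0 by (intro bexI[of _ "zs + (r / Y2) *\<^sub>R (w 0 - zs)"]) (auto simp: Y2_def)
  have "set_integrable lborel {0<..Y2} (\<lambda>r. g' (h - r))"
  proof (rule integrable_near_end[where A = "\<lambda>t. f (zs \<bullet> rot u + t * X) / X" and G = "\<lambda>t. f' (zs \<bullet> rot u + t * X)"
        and C = "\<lambda>r. - g (h - r)" and M = "max M (M / \<bar>X\<bar>)", OF Y12])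
    fix t :: real assume t: "t \<in> {0<..1}"
    note l0 = line[OF t, of 0] and l1 = line[OF t, of e]
    have "((\<lambda>t. f (zs \<bullet> rot u + t * X)) has_real_derivative f' (zs \<bullet> rot u + t * X) * X) (at t)"
      using f(1)[OF l0] e0 unfolding coords by (intro DERIV_chain2[where g = "\<lambda>t. zs \<bullet> rot u + t * X"]) (auto intro!: derivative_eq_intros)
    from DERIV_cdivide[OF this, of X]
    show "((\<lambda>t. f (zs \<bullet> rot u + t * X) / X) has_real_derivative f' (zs \<bullet> rot u + t * X)) (at t)" using X by simp
    have "\<bar>f (zs \<bullet> rot u + t * X)\<bar> \<le> M" using f(2)[OF l0] e0 by (simp add: coords)
    then show "\<bar>f (zs \<bullet> rot u + t * X) / X\<bar> \<le> max M (M / \<bar>X\<bar>)"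
      using X by (simp add: abs_divide divide_right_mono le_max_iff_disj)
    show "0 \<le> f' (zs \<bullet> rot u + t * X) + g' (h - t * Y1)" using pos[OF l1] e0 by (simp add: coords Y1_def)
    show "0 \<le> f' (zs \<bullet> rot u + t * X) + g' (h - t * Y2)" using pos[OF l0] e0 by (simp add: coords Y2_def)
  next
    have "(\<lambda>t. zs \<bullet> rot u + t * X) ` {0<..1} \<subseteq> (\<lambda>z. z \<bullet> rot u) ` T"
    proof
      fix x assume "x \<in> (\<lambda>t. zs \<bullet> rot u + t * X) ` {0<..1}"
      then obtain t where t: "t \<in> {0<..1}" "x = zs \<bullet> rot u + t * X" by blast
      then show "x \<in> (\<lambda>z. z \<bullet> rot u) ` T" using line[OF t(1), of 0] e0 coords(1)[of t 0] by (metis abs_zero imageI less_imp_le)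
    qed
    then show "continuous_on {0<..1} (\<lambda>t. f' (zs \<bullet> rot u + t * X))"
      by (intro continuous_on_compose2[OF f(3)] continuous_intros) auto
  next
    fix r assume r: "r \<in> {0<..Y2}"
    obtain z where z: "z \<in> T" "z \<bullet> u = h - r" using in2[OF r] by blast
    have "((\<lambda>r. g (h - r)) has_real_derivative g' (h - r) * (-1)) (at r)"
      using g(1)[OF z(1)] unfolding z(2) by (intro DERIV_chain2[where g = "\<lambda>r. h - r"]) (auto intro!: derivative_eq_intros)
    from DERIV_minus[OF this] show "((\<lambda>r. - g (h - r)) has_real_derivative g' (h - r)) (at r)" by simp
    show "\<bar>- g (h - r)\<bar> \<le> max M (M / \<bar>X\<bar>)" using g(2)[OF z(1)] z(2) by simp
  next
    show "continuous_on {0<..Y2} (\<lambda>r. g' (h - r))"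
    proof (intro continuous_on_compose2[OF g(3)] continuous_intros subsetI)
      fix y assume "y \<in> (\<lambda>r. h - r) ` {0<..Y2}"
      then show "y \<in> (\<lambda>z. z \<bullet> u) ` T" using in2 by (metis (no_types, lifting) imageE imageI)
    qed
  qed
  then have "integrable lborel (\<lambda>r. indicator {0<..Y2} (h + (-1) * r) *\<^sub>R g' (h - (h + (-1) * r)))"
    unfolding set_integrable_def by (rule lborel_integrable_real_affine) simp
  moreover have "indicator {0<..Y2} (h + (-1) * r) *\<^sub>R g' (h - (h + (-1) * r)) = indicator {h - Y2..<h} r *\<^sub>R g' r" for r
    by (auto simp: indicator_def)
  ultimately have "set_integrable lborel {h - Y2..<h} g'" unfolding set_integrable_def by (simp only:)
  then show ?thesis using Y12 unfolding top by (intro exI[of _ Y2]) auto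
qed

lemma coord_image_interval:
  assumes "norm u = 1"
  shows "(\<lambda>z. z \<bullet> u) ` T = {Inf ((\<lambda>z. z \<bullet> u) ` T)<..<Sup ((\<lambda>z. z \<bullet> u) ` T)}"
proof -
  let ?J = "(\<lambda>z. z \<bullet> u) ` T"
  have u0: "u \<noteq> 0" using assms by auto
  have "bounded ?J" using bounded_T by (intro bounded_linear_image bounded_linear_inner_left)
  then have bdd: "bdd_above ?J" "bdd_below ?J" by (auto simp: bounded_imp_bdd_above bounded_imp_bdd_below)
  have ne: "?J \<noteq> {}" using a_in by blast
  have conn: "connected ?J"
  proof (intro connected_continuous_image continuous_intros)
    have "starlike T" unfolding starlike_def
      using star a_in \<rho> unfolding star_shaped_wrt_def by (metis centre_in_ball)
    then show "connected T" by (rule starlike_imp_connected)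
  qed
  have op: "open ?J"
    unfolding open_dist
  proof
    fix y assume "y \<in> ?J"
    then obtain z where z: "z \<in> T" "y = z \<bullet> u" by blast
    obtain e where e: "0 < e" "ball z e \<subseteq> T" using open_T z by (meson openE)
    show "\<exists>e>0. \<forall>y'. dist y' y < e \<longrightarrow> y' \<in> ?J"
    proof (intro exI[of _ e] conjI e(1) allI impI)
      fix y' assume y': "dist y' y < e"
      have "z + (y' - y) *\<^sub>R u \<in> ball z e" using y' assms by (simp add: dist_norm)
      moreover have "(z + (y' - y) *\<^sub>R u) \<bullet> u = y'" using z u_rel[OF assms] by (simp add: inner_add_left)
      ultimately show "y' \<in> ?J" using e(2) by (metis imageI subsetD)
    qed
  qed
  show ?thesis
  proof
    show "?J \<subseteq> {Inf ?J<..<Sup ?J}"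
    proof
      fix y assume y: "y \<in> ?J"
      obtain e where e: "0 < e" "\<And>y'. dist y' y < e \<Longrightarrow> y' \<in> ?J" using op y unfolding open_dist by blast
      have "y + e / 2 \<in> ?J" "y - e / 2 \<in> ?J" using e by (auto simp: dist_real_def)
      then have "y + e / 2 \<le> Sup ?J" "Inf ?J \<le> y - e / 2" using bdd by (auto intro: cSup_upper cInf_lower)
      then show "y \<in> {Inf ?J<..<Sup ?J}" using e(1) by auto
    qed
    show "{Inf ?J<..<Sup ?J} \<subseteq> ?J"
    proof
      fix y assume y: "y \<in> {Inf ?J<..<Sup ?J}"
      obtain y1 where "y1 \<in> ?J" "y < y1" using y less_cSup_iff[OF ne bdd(1)] by auto
      moreover obtain y0 where "y0 \<in> ?J" "y0 < y" using y cInf_less_iff[OF ne bdd(2)] by auto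
      ultimately show "y \<in> ?J" using connected_contains_Icc[OF conn, of y0 y1] by (meson atLeastAtMost_iff less_imp_le subsetD)
    qed
  qed
qed

text \<open>\<open>T\<close> is bounded, so on \<open>T\<close> a function of one coordinate equals
  its product with the indicator of an interval in the other.\<close>

lemma lift_integrable:
  fixes g :: "real \<Rightarrow> real"
  assumes g: "integrable lborel g"
  shows "set_integrable lborel T (\<lambda>z. g (fst z))" "set_integrable lborel T (\<lambda>z. g (snd z))"
proof -
  have [measurable]: "g \<in> borel_measurable borel" using borel_measurable_integrable[OF g] by simp
  obtain B where B: "\<And>z. z \<in> T \<Longrightarrow> norm z \<le> B" using bounded_T unfolding bounded_iff by blast
  let ?i = "\<lambda>x. indicator {-B..B} x :: real"
  have i: "integrable lborel ?i" by (intro integrable_real_indicator) (auto simp: emeasure_lborel_Icc_eq)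
  have prod: "integrable (lborel \<Otimes>\<^sub>M lborel) (\<lambda>p. f (fst p) * f2 (snd p))"
    if "integrable lborel f" "integrable lborel f2" for f f2 :: "real \<Rightarrow> real"
  proof (rule lborel_pair.Fubini_integrable)
    have [measurable]: "f \<in> borel_measurable borel" "f2 \<in> borel_measurable borel"
      using that[THEN borel_measurable_integrable] by auto
    show "(\<lambda>p. f (fst p) * f2 (snd p)) \<in> borel_measurable (lborel \<Otimes>\<^sub>M lborel)" by measurable
    show "integrable lborel (\<lambda>x. \<integral>y. norm (f (fst (x, y)) * f2 (snd (x, y))) \<partial>lborel)"
      using that by (simp add: abs_mult)
    show "AE x in lborel. integrable lborel (\<lambda>y. f (fst (x, y)) * f2 (snd (x, y)))"
      using that by simp
  qed
  have Tb: "T \<in> sets lborel" using open_T by simp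
  have int: "set_integrable lborel T h" if h: "integrable (lborel \<Otimes>\<^sub>M lborel) h'" and eq: "\<And>z. z \<in> T \<Longrightarrow> h z = h' z" for h h' :: "point \<Rightarrow> real"
  proof -
    have "integrable lborel h'" using h by (simp add: lborel_prod)
    then have "set_integrable lborel T h'" unfolding set_integrable_def by (rule integrable_mult_indicator[OF Tb])
    moreover have "indicator T z *\<^sub>R h z = indicator T z *\<^sub>R h' z" for z using eq by (auto simp: indicator_def)
    ultimately show ?thesis unfolding set_integrable_def by (simp only:)
  qed
  have b: "fst z \<in> {-B..B}" "snd z \<in> {-B..B}" if "z \<in> T" for z
    using B[OF that] abs_fst_le_norm[of z] abs_snd_le_norm[of z] by auto
  show "set_integrable lborel T (\<lambda>z. g (fst z))"
    by (rule int[OF prod[OF g i]]) (use b in auto)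
  show "set_integrable lborel T (\<lambda>z. g (snd z))"
    by (rule int[OF prod[OF i g]]) (use b in auto)
qed

text \<open>The bottom end is the top end for \<open>- u\<close>, after reflecting both functions;
  between the ends \<open>g'\<close> is continuous on a compact interval.\<close>

lemma integrable_coord:
  fixes f f' g g' :: "real \<Rightarrow> real"
  assumes u: "norm u = 1"
    and f: "\<And>z. z \<in> T \<Longrightarrow> (f has_real_derivative f' (z \<bullet> rot u)) (at (z \<bullet> rot u))" "\<And>z. z \<in> T \<Longrightarrow> \<bar>f (z \<bullet> rot u)\<bar> \<le> M"
      "continuous_on ((\<lambda>z. z \<bullet> rot u) ` T) f'"
    and g: "\<And>z. z \<in> T \<Longrightarrow> (g has_real_derivative g' (z \<bullet> u)) (at (z \<bullet> u))" "\<And>z. z \<in> T \<Longrightarrow> \<bar>g (z \<bullet> u)\<bar> \<le> M"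
      "continuous_on ((\<lambda>z. z \<bullet> u) ` T) g'"
    and pos: "\<And>z. z \<in> T \<Longrightarrow> 0 \<le> f' (z \<bullet> rot u) + g' (z \<bullet> u)"
  shows "set_integrable lborel ((\<lambda>z. z \<bullet> u) ` T) g'"
proof -
  let ?J = "(\<lambda>z. z \<bullet> u) ` T"
  define lo hi where "lo = Inf ?J" and "hi = Sup ?J"
  have J: "?J = {lo<..<hi}" unfolding lo_def hi_def by (rule coord_image_interval[OF u])
  have lohi: "lo < hi" using J a_in by (metis empty_iff greaterThanLessThan_empty_iff imageI not_le)
  obtain d where d: "d > 0" "set_integrable lborel {hi - d..<hi} g'"
    using integrable_at_top[OF assms] unfolding hi_def by blast
  have img: "(\<lambda>z. z \<bullet> (- v)) ` T = uminus ` (\<lambda>z. z \<bullet> v) ` T" for v by (simp add: image_image)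
  have rotm: "rot (- u) = - rot u" by (simp add: rot_def prod_eq_iff)
  have "\<exists>d>0. set_integrable lborel {Sup ((\<lambda>z. z \<bullet> (- u)) ` T) - d..<Sup ((\<lambda>z. z \<bullet> (- u)) ` T)} (\<lambda>r. g' (- r))"
  proof (rule integrable_at_top[where f = "\<lambda>r. - f (- r)" and f' = "\<lambda>r. f' (- r)" and g = "\<lambda>r. - g (- r)" and M = M])
    fix z assume z: "z \<in> T"
    have "((\<lambda>r. f (- r)) has_real_derivative f' (- (z \<bullet> rot (- u))) * (-1)) (at (z \<bullet> rot (- u)))"
      using f(1)[OF z] unfolding rotm by (intro DERIV_chain2[where g = uminus]) (auto intro!: derivative_eq_intros)
    from DERIV_minus[OF this] show "((\<lambda>r. - f (- r)) has_real_derivative f' (- (z \<bullet> rot (- u)))) (at (z \<bullet> rot (- u)))" by simp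
    have "((\<lambda>r. g (- r)) has_real_derivative g' (- (z \<bullet> (- u))) * (-1)) (at (z \<bullet> (- u)))"
      using g(1)[OF z] by (intro DERIV_chain2[where g = uminus]) (auto intro!: derivative_eq_intros)
    from DERIV_minus[OF this] show "((\<lambda>r. - g (- r)) has_real_derivative g' (- (z \<bullet> (- u)))) (at (z \<bullet> (- u)))" by simp
    show "\<bar>- f (- (z \<bullet> rot (- u)))\<bar> \<le> M" using f(2)[OF z] by (simp add: rotm)
    show "\<bar>- g (- (z \<bullet> (- u)))\<bar> \<le> M" using g(2)[OF z] by simp
    show "0 \<le> f' (- (z \<bullet> rot (- u))) + g' (- (z \<bullet> (- u)))" using pos[OF z] by (simp add: rotm)
  next
    show "continuous_on ((\<lambda>z. z \<bullet> rot (- u)) ` T) (\<lambda>r. f' (- r))"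
      unfolding rotm by (intro continuous_on_compose2[OF f(3)] continuous_intros) auto
    show "continuous_on ((\<lambda>z. z \<bullet> (- u)) ` T) (\<lambda>r. g' (- r))"
      by (intro continuous_on_compose2[OF g(3)] continuous_intros) auto
  qed (use u in auto)
  moreover have "Sup ((\<lambda>z. z \<bullet> (- u)) ` T) = - lo"
    unfolding img lo_def Inf_real_def by simp
  ultimately obtain d' where d': "d' > 0" "set_integrable lborel {- lo - d'..<- lo} (\<lambda>r. g' (- r))" by auto
  have "integrable lborel (\<lambda>r. indicator {- lo - d'..<- lo} (0 + (-1) * r) *\<^sub>R g' (- (0 + (-1) * r)))"
    using d'(2) unfolding set_integrable_def by (rule lborel_integrable_real_affine) simp
  moreover have "indicator {- lo - d'..<- lo} (0 + (-1) * r) *\<^sub>R g' (- (0 + (-1) * r)) = indicator {lo<..lo + d'} r *\<^sub>R g' r" for r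
    by (auto simp: indicator_def)
  ultimately have low: "set_integrable lborel {lo<..lo + d'} g'" unfolding set_integrable_def by (simp only:)
  \<comment> \<open>Halving makes \<open>m\<close> strictly smaller than \<open>d\<close> and
    \<open>d'\<close>; the third entry keeps the two end pieces apart.\<close>
  define m where "m = min d (min d' ((hi - lo) / 2)) / 2"
  have "min d (min d' ((hi - lo) / 2)) \<le> (hi - lo) / 2" by (rule min.coboundedI2[OF min.cobounded2])
  then have "m \<le> (hi - lo) / 2 / 2" unfolding m_def by (rule divide_right_mono) simp
  then have m4: "m \<le> (hi - lo) / 4" by simp
  have m: "0 < m" "m < d" "m < d'" using d d' lohi by (auto simp: m_def min_def)
  have m5: "lo + m < hi - m" using m4 lohi by (simp add: field_simps)
  have mid: "set_integrable lborel {lo + m..hi - m} g'"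
    unfolding set_integrable_def using m m5
    by (intro borel_integrable_compact continuous_on_subset[OF g(3)]) (auto simp: J)
  have "set_integrable lborel ({lo<..lo + d'} \<inter> {lo<..lo + m}) g'" using low by (rule set_integrable_subset) auto
  moreover have "set_integrable lborel ({hi - d..<hi} \<inter> {hi - m..<hi}) g'" using d(2) by (rule set_integrable_subset) auto
  ultimately have "set_integrable lborel (({lo<..lo + d'} \<inter> {lo<..lo + m}) \<union> {lo + m..hi - m} \<union> ({hi - d..<hi} \<inter> {hi - m..<hi})) g'"
    using mid by (intro set_integrable_Un) auto
  moreover have "({lo<..lo + d'} \<inter> {lo<..lo + m}) \<union> {lo + m..hi - m} \<union> ({hi - d..<hi} \<inter> {hi - m..<hi}) = ?J"
    unfolding J using m m5 by auto
  ultimately show ?thesis by simp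
qed

text \<open>Both claims are instances of \<open>integrable_coord\<close>, in the directions
  \<open>(1, 0)\<close> and \<open>(0, 1)\<close>. The nonnegative sum is in both cases
  \<open>b' - c'\<close>, a function of \<open>x\<close> plus a function of
  \<open>y\<close>.\<close>

lemma coefficient_derivatives_integrable:
  fixes b b' c c' :: "real \<Rightarrow> real"
  assumes b: "\<And>z. z \<in> T \<Longrightarrow> (b has_real_derivative b' (fst z)) (at (fst z))" "\<And>z. z \<in> T \<Longrightarrow> \<bar>b (fst z)\<bar> \<le> M"
      "continuous_on (fst ` T) b'"
    and c: "\<And>z. z \<in> T \<Longrightarrow> (c has_real_derivative c' (snd z)) (at (snd z))" "\<And>z. z \<in> T \<Longrightarrow> \<bar>c (snd z)\<bar> \<le> M"
      "continuous_on (snd ` T) c'"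
    and pos: "\<And>z. z \<in> T \<Longrightarrow> c' (snd z) \<le> b' (fst z)"
  shows "set_integrable lborel T (\<lambda>z. b' (fst z))" "set_integrable lborel T (\<lambda>z. c' (snd z))"
proof -
  have lift: "set_integrable lborel T (\<lambda>z. g (fst z))" if "set_integrable lborel (fst ` T) g" for g :: "real \<Rightarrow> real"
  proof -
    have "set_integrable lborel T (\<lambda>z. indicator (fst ` T) (fst z) *\<^sub>R g (fst z))"
      using lift_integrable(1) that unfolding set_integrable_def by blast
    moreover have "indicator T z *\<^sub>R (indicator (fst ` T) (fst z) *\<^sub>R g (fst z)) = indicator T z *\<^sub>R g (fst z)" for z
      by (auto simp: indicator_def)
    ultimately show ?thesis unfolding set_integrable_def by (simp only:)
  qed
  have lift': "set_integrable lborel T (\<lambda>z. g (snd z))" if "set_integrable lborel (snd ` T) g" for g :: "real \<Rightarrow> real"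
  proof -
    have "set_integrable lborel T (\<lambda>z. indicator (snd ` T) (snd z) *\<^sub>R g (snd z))"
      using lift_integrable(2) that unfolding set_integrable_def by blast
    moreover have "indicator T z *\<^sub>R (indicator (snd ` T) (snd z) *\<^sub>R g (snd z)) = indicator T z *\<^sub>R g (snd z)" for z
      by (auto simp: indicator_def)
    ultimately show ?thesis unfolding set_integrable_def by (simp only:)
  qed
  have "set_integrable lborel ((\<lambda>z. z \<bullet> (1, 0)) ` T) b'"
  proof (rule integrable_coord[where f = "\<lambda>s. - c s" and f' = "\<lambda>s. - c' s" and g = b and M = M])
    fix z assume z: "z \<in> T"
    show "((\<lambda>s. - c s) has_real_derivative - c' (z \<bullet> rot (1, 0))) (at (z \<bullet> rot (1, 0)))"
      using c(1)[OF z] by (auto simp: rot_def inner_prod intro: DERIV_minus)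
  qed (use b c pos in \<open>auto simp: rot_def inner_prod norm_prod_def intro!: continuous_intros\<close>)
  then show "set_integrable lborel T (\<lambda>z. b' (fst z))" by (intro lift) (simp add: inner_prod)
  \<comment> \<open>Since \<open>rot (0, 1)\<close> is \<open>(-1, 0)\<close>, the transversal
    coordinate is minus the first one, and \<open>b\<close> enters reflected.\<close>
  have "set_integrable lborel ((\<lambda>z. z \<bullet> (0, 1)) ` T) (\<lambda>s. - c' s)"
  proof (rule integrable_coord[where f = "\<lambda>s. - b (- s)" and f' = "\<lambda>s. b' (- s)" and g = "\<lambda>s. - c s" and M = M])
    fix z assume z: "z \<in> T"
    have "((\<lambda>s. b (- s)) has_real_derivative b' (- (z \<bullet> rot (0, 1))) * (-1)) (at (z \<bullet> rot (0, 1)))"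
      using b(1)[OF z] by (intro DERIV_chain2[where g = uminus]) (auto simp: rot_def inner_prod intro!: derivative_eq_intros)
    from DERIV_minus[OF this] show "((\<lambda>s. - b (- s)) has_real_derivative b' (- (z \<bullet> rot (0, 1)))) (at (z \<bullet> rot (0, 1)))" by simp
    show "((\<lambda>s. - c s) has_real_derivative - c' (z \<bullet> (0, 1))) (at (z \<bullet> (0, 1)))"
      using c(1)[OF z] by (auto simp: inner_prod intro: DERIV_minus)
  next
    show "continuous_on ((\<lambda>z. z \<bullet> rot (0, 1)) ` T) (\<lambda>s. b' (- s))"
      by (intro continuous_on_compose2[OF b(3)] continuous_intros) (force simp: rot_def inner_prod)
  qed (use b c pos in \<open>auto simp: rot_def inner_prod norm_prod_def intro!: continuous_intros\<close>)
  then have "set_integrable lborel T (\<lambda>z. - c' (snd z))" by (intro lift') (simp add: inner_prod)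
  then have "set_integrable lborel T (\<lambda>z. - (- c' (snd z)))" unfolding set_integrable_def
    by (auto dest: Bochner_Integration.integrable_minus)
  then show "set_integrable lborel T (\<lambda>z. c' (snd z))" by simp
qed

end

section \<open>Polynomials and the energy identity on one element\<close>

lemma poly_space_add: "f \<in> poly_space p \<Longrightarrow> g \<in> poly_space p \<Longrightarrow> (\<lambda>z. f z + g z) \<in> poly_space p"
proof -
  assume "f \<in> poly_space p" "g \<in> poly_space p"
  then obtain a b where "\<forall>x y. f (x, y) = (\<Sum>i\<le>p. \<Sum>j\<le>p - i. a i j * x ^ i * y ^ j)"
    "\<forall>x y. g (x, y) = (\<Sum>i\<le>p. \<Sum>j\<le>p - i. b i j * x ^ i * y ^ j)" by (auto simp: poly_space_def)
  then show ?thesis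
    unfolding poly_space_def
    by (intro CollectI exI[of _ "\<lambda>i j. a i j + b i j"]) (simp add: sum.distrib distrib_right)
qed

lemma poly_space_monom: "i + j \<le> p \<Longrightarrow> (\<lambda>z. c * fst z ^ i * snd z ^ j) \<in> poly_space p"
proof -
  assume ij: "i + j \<le> p"
  have "c * x ^ i * y ^ j = (\<Sum>i'\<le>p. \<Sum>j'\<le>p - i'. (if i' = i \<and> j' = j then c else 0) * x ^ i' * y ^ j')" for x y
  proof -
    have "(\<Sum>i'\<le>p. \<Sum>j'\<le>p - i'. (if i' = i \<and> j' = j then c else 0) * x ^ i' * y ^ j')
        = (\<Sum>i'\<le>p. if i' = i then c * x ^ i * y ^ j else 0)"
    proof (rule sum.cong[OF refl])
      fix i' assume "i' \<in> {..p}"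
      have "(\<Sum>j'\<le>p - i'. (if i' = i \<and> j' = j then c else 0) * x ^ i' * y ^ j')
          = (\<Sum>j'\<le>p - i'. if j' = j then (if i' = i then c * x ^ i * y ^ j else 0) else 0)"
        by (intro sum.cong) auto
      also have "\<dots> = (if i' = i then c * x ^ i * y ^ j else 0)" using ij by (auto simp: sum.delta)
      finally show "(\<Sum>j'\<le>p - i'. (if i' = i \<and> j' = j then c else 0) * x ^ i' * y ^ j')
          = (if i' = i then c * x ^ i * y ^ j else 0)" .
    qed
    then show ?thesis using ij by (simp add: sum.delta)
  qed
  then show ?thesis unfolding poly_space_def by (intro CollectI exI[of _ "\<lambda>i' j'. if i' = i \<and> j' = j then c else 0"]) simp
qed

lemma poly_space_sum: "(\<And>k. k \<in> A \<Longrightarrow> f k \<in> poly_space p) \<Longrightarrow> (\<lambda>z. \<Sum>k\<in>A. f k z) \<in> poly_space p"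
proof (induction A rule: infinite_finite_induct)
  case (insert x F)
  then show ?case using poly_space_add[of "f x" p "\<lambda>z. \<Sum>k\<in>F. f k z"] by simp
qed (use poly_space_monom[of 0 0 p 0] in simp_all)

lemma poly_space_calculus:
  assumes f: "f \<in> poly_space p"
  shows "\<And>x y. ((\<lambda>s. f (s, y)) has_real_derivative pd_x f (x, y)) (at x)"
    and "\<And>x y. ((\<lambda>s. f (x, s)) has_real_derivative pd_y f (x, y)) (at y)"
    and "pd_x f \<in> poly_space p" "pd_y f \<in> poly_space p"
    and "\<And>z. (f has_derivative (\<lambda>h. fst h * pd_x f z + snd h * pd_y f z)) (at z)"
    and "\<And>z. pd_y (pd_x f) z = pd_x (pd_y f) z"
proof -
  obtain a where a: "\<And>x y. f (x, y) = (\<Sum>i\<le>p. \<Sum>j\<le>p - i. a i j * x ^ i * y ^ j)"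
    using f by (auto simp: poly_space_def)
  define fx where "fx z = (\<Sum>i\<le>p. \<Sum>j\<le>p - i. (a i j * real i) * fst z ^ (i - 1) * snd z ^ j)" for z
  define fy where "fy z = (\<Sum>i\<le>p. \<Sum>j\<le>p - i. (a i j * real j) * fst z ^ i * snd z ^ (j - 1))" for z
  have dx: "((\<lambda>s. f (s, y)) has_real_derivative fx (x, y)) (at x)" for x y
    unfolding a fx_def by (auto intro!: derivative_eq_intros sum.cong simp: mult_ac)
  have dy: "((\<lambda>s. f (x, s)) has_real_derivative fy (x, y)) (at y)" for x y
    unfolding a fy_def by (auto intro!: derivative_eq_intros sum.cong simp: mult_ac)
  have px: "pd_x f = fx" using DERIV_imp_deriv[OF dx] by (auto simp: pd_x_def)
  have py: "pd_y f = fy" using DERIV_imp_deriv[OF dy] by (auto simp: pd_y_def)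
  show "((\<lambda>s. f (s, y)) has_real_derivative pd_x f (x, y)) (at x)" for x y using dx by (simp add: px)
  show "((\<lambda>s. f (x, s)) has_real_derivative pd_y f (x, y)) (at y)" for x y using dy by (simp add: py)
  show "pd_x f \<in> poly_space p" "pd_y f \<in> poly_space p"
    unfolding px py fx_def fy_def by (intro poly_space_sum poly_space_monom; simp)+
  show "(f has_derivative (\<lambda>h. fst h * pd_x f z + snd h * pd_y f z)) (at z)" for z
  proof -
    have f': "f = (\<lambda>z. \<Sum>i\<le>p. \<Sum>j\<le>p - i. a i j * fst z ^ i * snd z ^ j)"
      by (rule ext) (metis a prod.collapse)
    have "(f has_derivative (\<lambda>h. \<Sum>i\<le>p. \<Sum>j\<le>p - i.
        fst h * ((a i j * real i) * fst z ^ (i - 1) * snd z ^ j) + snd h * ((a i j * real j) * fst z ^ i * snd z ^ (j - 1)))) (at z)"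
      unfolding f'
    proof (intro has_derivative_sum)
      fix i j
      have 1: "((\<lambda>z. a i j * fst z ^ i) has_derivative (\<lambda>h. a i j * (real i * fst h * fst z ^ (i - 1)))) (at z)"
        by (intro has_derivative_mult_right has_derivative_power has_derivative_fst has_derivative_ident)
      have 2: "((\<lambda>z. snd z ^ j) has_derivative (\<lambda>h. real j * snd h * snd z ^ (j - 1))) (at z)"
        by (intro has_derivative_power has_derivative_snd has_derivative_ident)
      show "((\<lambda>z. a i j * fst z ^ i * snd z ^ j) has_derivative
          (\<lambda>h. fst h * ((a i j * real i) * fst z ^ (i - 1) * snd z ^ j) + snd h * ((a i j * real j) * fst z ^ i * snd z ^ (j - 1)))) (at z)"
        by (rule has_derivative_eq_rhs[OF has_derivative_mult[OF 1 2]]) (auto simp: algebra_simps)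
    qed
    moreover have "(\<Sum>i\<le>p. \<Sum>j\<le>p - i.
        fst h * ((a i j * real i) * fst z ^ (i - 1) * snd z ^ j) + snd h * ((a i j * real j) * fst z ^ i * snd z ^ (j - 1)))
        = fst h * fx z + snd h * fy z" for h :: point
      unfolding fx_def fy_def sum_distrib_left sum.distrib ..
    ultimately show ?thesis by (simp add: px py)
  qed
  show "pd_y (pd_x f) z = pd_x (pd_y f) z" for z
  proof -
    have 1: "((\<lambda>s. fx (fst z, s)) has_real_derivative
        (\<Sum>i\<le>p. \<Sum>j\<le>p - i. (a i j * real i * real j) * fst z ^ (i - 1) * snd z ^ (j - 1))) (at (snd z))"
      unfolding fx_def by (auto intro!: derivative_eq_intros sum.cong simp: mult_ac)
    have 2: "((\<lambda>s. fy (s, snd z)) has_real_derivative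
        (\<Sum>i\<le>p. \<Sum>j\<le>p - i. (a i j * real i * real j) * fst z ^ (i - 1) * snd z ^ (j - 1))) (at (fst z))"
      unfolding fy_def by (auto intro!: derivative_eq_intros sum.cong simp: mult_ac)
    show ?thesis unfolding px py unfolding pd_x_def pd_y_def using DERIV_imp_deriv[OF 1] DERIV_imp_deriv[OF 2] by simp
  qed
qed

lemma poly_space_continuous: "f \<in> poly_space p \<Longrightarrow> continuous_on S f"
  using poly_space_calculus(5) by (meson continuous_at_imp_continuous_on has_derivative_continuous)

lemma C1_real_derivative:
  fixes f :: "real \<Rightarrow> real"
  assumes "f C1_differentiable_on S"
  shows "\<And>x. x \<in> S \<Longrightarrow> (f has_real_derivative deriv f x) (at x)" "continuous_on S (deriv f)"
proof -
  obtain D where D: "\<And>x. x \<in> S \<Longrightarrow> (f has_real_derivative D x) (at x)" "continuous_on S D"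
    using assms by (auto simp: C1_differentiable_on_def has_real_derivative_iff_has_vector_derivative)
  then have eq: "\<And>x. x \<in> S \<Longrightarrow> deriv f x = D x" by (simp add: DERIV_imp_deriv)
  show "\<And>x. x \<in> S \<Longrightarrow> (f has_real_derivative deriv f x) (at x)" using D eq by simp
  show "continuous_on S (deriv f)" using D(2) eq by (simp cong: continuous_on_cong)
qed

section \<open>One element with its coefficients\<close>

locale star_element = star_domain +
  fixes K b c :: "real \<Rightarrow> real" and \<delta> :: real
  assumes K: "continuous_on (snd ` closure T) K" "K C1_differentiable_on (snd ` T)" "\<And>z. z \<in> T \<Longrightarrow> 0 \<le> deriv K (snd z)"
    and b: "continuous_on (fst ` closure T) b" "b C1_differentiable_on (fst ` T)"
    and c: "continuous_on (snd ` closure T) c" "c C1_differentiable_on (snd ` T)"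
    and \<delta>: "0 < \<delta>"
    and coercive: "\<And>z. z \<in> T \<Longrightarrow> - K (snd z) * deriv b (fst z) + deriv (\<lambda>s. K s * c s) (snd z) \<ge> \<delta>"
      "\<And>z. z \<in> T \<Longrightarrow> deriv b (fst z) - deriv c (snd z) \<ge> \<delta>"
begin

lemma cont_coeff:
  "continuous_on (closure T) (\<lambda>z. K (snd z))" "continuous_on (closure T) (\<lambda>z. b (fst z))" "continuous_on (closure T) (\<lambda>z. c (snd z))"
  by (auto intro!: continuous_on_compose2[OF K(1)] continuous_on_compose2[OF b(1)] continuous_on_compose2[OF c(1)] continuous_intros)

lemma bounded_closure_fun:
  fixes f :: "point \<Rightarrow> real"
  assumes "continuous_on (closure T) f"
  shows "\<exists>M\<ge>0. \<forall>z\<in>closure T. \<bar>f z\<bar> \<le> M"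
proof -
  have "bounded (f ` closure T)" by (intro compact_imp_bounded compact_continuous_image compact_closure_T assms)
  then obtain M where "\<And>z. z \<in> closure T \<Longrightarrow> norm (f z) \<le> M" unfolding bounded_iff by (metis imageI)
  then show ?thesis by (intro exI[of _ "\<bar>M\<bar>"]) (force intro: order_trans)
qed

lemma coeff_DERIV:
  "z \<in> T \<Longrightarrow> (K has_real_derivative deriv K (snd z)) (at (snd z))"
  "z \<in> T \<Longrightarrow> (b has_real_derivative deriv b (fst z)) (at (fst z))"
  "z \<in> T \<Longrightarrow> (c has_real_derivative deriv c (snd z)) (at (snd z))"
  using C1_real_derivative(1)[OF K(2)] C1_real_derivative(1)[OF b(2)] C1_real_derivative(1)[OF c(2)] by auto

lemma deriv_integrable:
  "set_integrable lborel T (\<lambda>z. deriv b (fst z))" "set_integrable lborel T (\<lambda>z. deriv c (snd z))"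
  "set_integrable lborel T (\<lambda>z. deriv K (snd z))"
proof -
  obtain M1 M2 M3 where M: "\<forall>z\<in>closure T. \<bar>K (snd z)\<bar> \<le> M1" "\<forall>z\<in>closure T. \<bar>b (fst z)\<bar> \<le> M2" "\<forall>z\<in>closure T. \<bar>c (snd z)\<bar> \<le> M3"
    using bounded_closure_fun cont_coeff by metis
  define M where "M = max 0 (max M1 (max M2 M3))"
  have Mb: "\<bar>K (snd z)\<bar> \<le> M" "\<bar>b (fst z)\<bar> \<le> M" "\<bar>c (snd z)\<bar> \<le> M" if "z \<in> T" for z
    using M closure_subset[of T] that by (force simp: M_def le_max_iff_disj)+
  have M0: "0 \<le> M" by (simp add: M_def)
  have le: "deriv c (snd z) \<le> deriv b (fst z)" if "z \<in> T" for z using coercive(2)[OF that] \<delta> by simp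
  show "set_integrable lborel T (\<lambda>z. deriv b (fst z))" "set_integrable lborel T (\<lambda>z. deriv c (snd z))"
    using coefficient_derivatives_integrable[of b "deriv b" M c "deriv c"] coeff_DERIV Mb le
      C1_real_derivative(2)[OF b(2)] C1_real_derivative(2)[OF c(2)] by blast+
  \<comment> \<open>Monotonicity of \<open>K\<close> alone suffices: take the zero function for
    \<open>b\<close> and \<open>- K\<close> for \<open>c\<close>.\<close>
  have "set_integrable lborel T (\<lambda>z. - deriv K (snd z))"
  proof (rule coefficient_derivatives_integrable(2)[of "\<lambda>x. 0" "\<lambda>x. 0" M "\<lambda>y. - K y" "\<lambda>y. - deriv K y"])
    fix z assume z: "z \<in> T"
    show "((\<lambda>y. - K y) has_real_derivative - deriv K (snd z)) (at (snd z))"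
      by (rule DERIV_minus[OF coeff_DERIV(1)[OF z]])
    show "\<bar>- K (snd z)\<bar> \<le> M" using Mb[OF z] by simp
    show "- deriv K (snd z) \<le> 0" using K(3)[OF z] by simp
  qed (use M0 C1_real_derivative(2)[OF K(2)] in \<open>auto intro!: continuous_intros\<close>)
  then have "set_integrable lborel T (\<lambda>z. - (- deriv K (snd z)))" unfolding set_integrable_def
    by (auto dest: Bochner_Integration.integrable_minus)
  then show "set_integrable lborel T (\<lambda>z. deriv K (snd z))" by simp
qed

lemma T_sets: "T \<in> sets lborel" using open_T by simp

text \<open>All integrands of the energy identity are sums of products of at most one coefficient
  derivative with functions continuous up to the boundary, so this rule and
  \<open>deriv_integrable\<close> settle their integrability.\<close>

lemma mult_continuous_integrable:
  fixes f g :: "point \<Rightarrow> real"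
  assumes f: "set_integrable lborel T f" and g: "continuous_on (closure T) g"
  shows "set_integrable lborel T (\<lambda>z. f z * g z)"
proof -
  obtain M where M: "M \<ge> 0" "\<forall>z\<in>closure T. \<bar>g z\<bar> \<le> M" using bounded_closure_fun[OF g] by blast
  show ?thesis
  unfolding set_integrable_def
  proof (rule Bochner_Integration.integrable_bound)
  show "integrable lborel (\<lambda>z. M * (indicator T z *\<^sub>R f z))"
    using f unfolding set_integrable_def by (intro integrable_mult_right) simp
  have "continuous_on T g" by (rule continuous_on_subset[OF g closure_subset])
  then have "(\<lambda>z. indicator T z *\<^sub>R g z) \<in> borel_measurable borel"
    using open_T by (intro borel_measurable_continuous_on_indicator) auto
  moreover have "(\<lambda>z. indicator T z *\<^sub>R f z) \<in> borel_measurable borel"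
    using f unfolding set_integrable_def by (auto dest: borel_measurable_integrable)
  ultimately have "(\<lambda>z. (indicator T z *\<^sub>R f z) * (indicator T z *\<^sub>R g z)) \<in> borel_measurable lborel" by simp
  moreover have "(indicator T z *\<^sub>R f z) * (indicator T z *\<^sub>R g z) = indicator T z *\<^sub>R (f z * g z)" for z
    by (auto simp: indicator_def)
  ultimately show "(\<lambda>z. indicator T z *\<^sub>R (f z * g z)) \<in> borel_measurable lborel" by (simp only:)
  show "AE z in lborel. norm (indicator T z *\<^sub>R (f z * g z)) \<le> norm (M * (indicator T z *\<^sub>R f z))"
  proof (intro AE_I2)
    fix z
    have "\<bar>f z\<bar> * \<bar>g z\<bar> \<le> \<bar>f z\<bar> * M" if "z \<in> T"
      using M that closure_subset[of T] by (intro mult_left_mono) auto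
    then show "norm (indicator T z *\<^sub>R (f z * g z)) \<le> norm (M * (indicator T z *\<^sub>R f z))"
      using M(1) by (auto simp: indicator_def abs_mult mult.commute)
  qed
  qed
qed

lemma continuous_integrable:
  fixes g :: "point \<Rightarrow> real"
  assumes g: "continuous_on (closure T) g"
  shows "set_integrable lborel T g"
proof -
  have "set_integrable lborel T (\<lambda>z. 1 :: real)"
    using T_sets emeasure_bounded_finite[OF bounded_T]
    by (simp add: set_integrable_def)
  from mult_continuous_integrable[OF this g] show ?thesis by simp
qed

text \<open>The divergence theorem is applied to the field \<open>(b, c)\<close> times the energy
  density \<open>w\<close>. Its divergence minus twice the volume integrand contains no second
  derivatives of \<open>v\<close>: only the squares of the first derivatives remain, with the two
  coefficients that are assumed to be at least \<open>\<delta>\<close>.\<close>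

theorem element_energy:
  fixes v :: "point \<Rightarrow> real"
  assumes v: "v \<in> poly_space p"
  defines "w \<equiv> \<lambda>z. W_grad K v z \<bullet> grad v z"
  shows "set_integrable hausdorff1 (frontier T) (\<lambda>z. w z * ((b (fst z), c (snd z)) \<bullet> outer_normal T z))"
    and "- (LINT z:T|lborel. W_grad K v z \<bullet> grad (multiplier_op b c v) z)
      \<ge> 1/2 * (LINT z:T|lborel. \<delta> * ((pd_x v z)\<^sup>2 + (pd_y v z)\<^sup>2))
        - 1/2 * (LINT z:frontier T|hausdorff1. w z * ((b (fst z), c (snd z)) \<bullet> outer_normal T z))"
proof -
  define P S where "P = pd_x v" and "S = pd_y v"
  note cv = poly_space_calculus[OF v]
  have P: "P \<in> poly_space p" and S: "S \<in> poly_space p" using cv(3,4) by (auto simp: P_def S_def)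
  note cP = poly_space_calculus[OF P] and cS = poly_space_calculus[OF S]
  define Px Py Sy where "Px = pd_x P" and "Py = pd_y P" and "Sy = pd_y S"
  have Sx: "pd_x S z = Py z" for z using cv(6) by (simp add: P_def S_def Py_def)
  have polys: "Px \<in> poly_space p" "Py \<in> poly_space p" "Sy \<in> poly_space p"
    using cP(3,4) cS(4) by (auto simp: Px_def Py_def Sy_def)
  have pc: "continuous_on X P" "continuous_on X S" "continuous_on X Px" "continuous_on X Py" "continuous_on X Sy" for X
    using P S polys by (auto intro: poly_space_continuous)
  have w: "w = (\<lambda>z. K (snd z) * (P z * P z) + S z * S z)"
    by (auto simp: w_def W_grad_def grad_def inner_prod P_def S_def)
  define wx where "wx z = K (snd z) * (2 * P z * Px z) + 2 * S z * Py z" for z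
  define wy where "wy z = deriv K (snd z) * (P z * P z) + (K (snd z) * (2 * P z * Py z) + 2 * S z * Sy z)" for z
  define F where "F z = (b (fst z) * w z, c (snd z) * w z)" for z
  define Fx where "Fx z = (deriv b (fst z) * w z + b (fst z) * wx z, c (snd z) * wx z)" for z
  define Fy where "Fy z = (b (fst z) * wy z, deriv c (snd z) * w z + c (snd z) * wy z)" for z
  have sub: "T \<subseteq> closure T" by (rule closure_subset)
  note cc = cont_coeff
  note ccT = cc[THEN continuous_on_subset[OF _ sub]]
  have cdT: "continuous_on T (\<lambda>z. deriv K (snd z))" "continuous_on T (\<lambda>z. deriv b (fst z))" "continuous_on T (\<lambda>z. deriv c (snd z))"
    using C1_real_derivative(2)[OF K(2)] C1_real_derivative(2)[OF b(2)] C1_real_derivative(2)[OF c(2)]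
    by (auto intro!: continuous_on_compose2[of "snd ` T" "deriv K"] continuous_on_compose2[of "fst ` T" "deriv b"]
        continuous_on_compose2[of "snd ` T" "deriv c"] continuous_intros)
  have wc: "continuous_on (closure T) w" "continuous_on T w" "continuous_on (closure T) wx" "continuous_on T wx" "continuous_on T wy"
    unfolding w wx_def[abs_def] wy_def[abs_def] by (intro continuous_intros cc ccT cdT pc)+
  have comp_fst: "((\<lambda>z. g (fst z)) has_derivative (\<lambda>h. fst h * g')) (at z)"
    if "(g has_real_derivative g') (at (fst z))" for g g' and z :: point
  proof -
    have "(g has_derivative (\<lambda>h. h * g')) (at (fst z))" using that by (simp add: has_field_derivative_def mult_commute_abs)
    from has_derivative_compose[OF has_derivative_fst[OF has_derivative_ident] this] show ?thesis .
  qed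
  have comp_snd: "((\<lambda>z. g (snd z)) has_derivative (\<lambda>h. snd h * g')) (at z)"
    if "(g has_real_derivative g') (at (snd z))" for g g' and z :: point
  proof -
    have "(g has_derivative (\<lambda>h. h * g')) (at (snd z))" using that by (simp add: has_field_derivative_def mult_commute_abs)
    from has_derivative_compose[OF has_derivative_snd[OF has_derivative_ident] this] show ?thesis .
  qed
  have dP: "(P has_derivative (\<lambda>h. fst h * Px z + snd h * Py z)) (at z)" for z using cP(5) by (simp add: Px_def Py_def)
  have dS: "(S has_derivative (\<lambda>h. fst h * Py z + snd h * Sy z)) (at z)" for z using cS(5) by (simp add: Sx Sy_def)
  have dw: "(w has_derivative (\<lambda>h. fst h * wx z + snd h * wy z)) (at z)" if z: "z \<in> T" for z
    unfolding w
    by (rule has_derivative_eq_rhs[OF has_derivative_add[OF has_derivative_mult[OF comp_snd[OF coeff_DERIV(1)[OF z]]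
      has_derivative_mult[OF dP dP]] has_derivative_mult[OF dS dS]]]) (auto simp: wx_def wy_def algebra_simps)
  interpret D: star_domain_field T a \<rho> F Fx Fy
  proof
    show "continuous_on (closure T) F" unfolding F_def by (intro continuous_intros cc wc)
    show "continuous_on T Fx" "continuous_on T Fy" unfolding Fx_def Fy_def by (intro continuous_intros ccT cdT wc)+
    fix z assume z: "z \<in> T"
    have 1: "((\<lambda>z. b (fst z) * w z) has_derivative (\<lambda>h. b (fst z) * (fst h * wx z + snd h * wy z) + fst h * deriv b (fst z) * w z)) (at z)"
      by (rule has_derivative_mult[OF comp_fst[OF coeff_DERIV(2)[OF z]] dw[OF z]])
    have 2: "((\<lambda>z. c (snd z) * w z) has_derivative (\<lambda>h. c (snd z) * (fst h * wx z + snd h * wy z) + snd h * deriv c (snd z) * w z)) (at z)"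
      by (rule has_derivative_mult[OF comp_snd[OF coeff_DERIV(3)[OF z]] dw[OF z]])
    show "(F has_derivative (\<lambda>h. fst h *\<^sub>R Fx z + snd h *\<^sub>R Fy z)) (at z)"
      unfolding F_def
      by (rule has_derivative_eq_rhs[OF has_derivative_Pair[OF 1 2]]) (auto simp: Fx_def Fy_def algebra_simps)
  qed
  define A where "A z = - K (snd z) * deriv b (fst z) + (deriv K (snd z) * c (snd z) + K (snd z) * deriv c (snd z))" for z
  define B where "B z = deriv b (fst z) - deriv c (snd z)" for z
  have A: "A z \<ge> \<delta>" if z: "z \<in> T" for z
  proof -
    have "deriv (\<lambda>s. K s * c s) (snd z) = deriv K (snd z) * c (snd z) + deriv c (snd z) * K (snd z)"
      by (rule DERIV_imp_deriv[OF DERIV_mult[OF coeff_DERIV(1)[OF z] coeff_DERIV(3)[OF z]]])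
    then show ?thesis using coercive(1)[OF z] by (simp add: A_def mult.commute)
  qed
  have B: "B z \<ge> \<delta>" if z: "z \<in> T" for z using coercive(2)[OF z] by (simp add: B_def)
  define E where "E z = W_grad K v z \<bullet> grad (multiplier_op b c v) z" for z
  have E: "E z = deriv b (fst z) * (K (snd z) * (P z * P z)) + deriv c (snd z) * (S z * S z)
      + (K (snd z) * P z * (b (fst z) * Px z + c (snd z) * Py z) + S z * (b (fst z) * Py z + c (snd z) * Sy z))"
    if z: "z \<in> T" for z
  proof -
    have "((\<lambda>s. b s * P (s, snd z) + c (snd z) * S (s, snd z)) has_real_derivative
        (deriv b (fst z) * P z + Px z * b (fst z)) + Py z * c (snd z)) (at (fst z))"
      using DERIV_add[OF DERIV_mult[OF coeff_DERIV(2)[OF z] cP(1)[of "snd z" "fst z"]]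
        DERIV_cmult[OF cS(1)[of "snd z" "fst z"], of "c (snd z)"]] by (simp add: Px_def Sx mult.commute)
    then have "deriv (\<lambda>s. b s * P (s, snd z) + c (snd z) * S (s, snd z)) (fst z)
        = (deriv b (fst z) * P z + Px z * b (fst z)) + Py z * c (snd z)" by (rule DERIV_imp_deriv)
    then have 1: "pd_x (multiplier_op b c v) z = (deriv b (fst z) * P z + Px z * b (fst z)) + Py z * c (snd z)"
      by (simp add: pd_x_def[of "multiplier_op b c v"] multiplier_op_def P_def S_def)
    have "((\<lambda>s. b (fst z) * P (fst z, s) + c s * S (fst z, s)) has_real_derivative
        Py z * b (fst z) + (deriv c (snd z) * S z + Sy z * c (snd z))) (at (snd z))"
      using DERIV_add[OF DERIV_cmult[OF cP(2)[of "fst z" "snd z"], of "b (fst z)"]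
        DERIV_mult[OF coeff_DERIV(3)[OF z] cS(2)[of "fst z" "snd z"]]] by (simp add: Py_def Sy_def mult.commute)
    then have "deriv (\<lambda>s. b (fst z) * P (fst z, s) + c s * S (fst z, s)) (snd z)
        = Py z * b (fst z) + (deriv c (snd z) * S z + Sy z * c (snd z))" by (rule DERIV_imp_deriv)
    then have 2: "pd_y (multiplier_op b c v) z = Py z * b (fst z) + (deriv c (snd z) * S z + Sy z * c (snd z))"
      by (simp add: pd_y_def[of "multiplier_op b c v"] multiplier_op_def P_def S_def)
    show ?thesis
      unfolding E_def W_grad_def grad_def inner_prod fst_conv snd_conv 1 2 P_def[symmetric] S_def[symmetric]
      by (simp add: algebra_simps)
  qed
  have int_cong: "set_integrable lborel T f \<longleftrightarrow> set_integrable lborel T g" if "\<And>z. z \<in> T \<Longrightarrow> f z = g z" for f g :: "point \<Rightarrow> real"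
  proof -
    have "indicator T z *\<^sub>R f z = indicator T z *\<^sub>R g z" for z using that by (auto simp: indicator_def)
    then show ?thesis unfolding set_integrable_def by (simp only:)
  qed
  have intE: "set_integrable lborel T E"
    by (rule iffD2[OF int_cong[OF E]], assumption,
        intro set_integral_add mult_continuous_integrable deriv_integrable continuous_integrable continuous_intros cc pc)
  have dv_eq: "D.dv z = deriv b (fst z) * w z + deriv c (snd z) * w z + deriv K (snd z) * (c (snd z) * (P z * P z))
      + (b (fst z) * wx z + c (snd z) * (K (snd z) * (2 * P z * Py z) + 2 * S z * Sy z))" for z
    by (simp add: D.dv_def Fx_def Fy_def wy_def algebra_simps)
  have intdv: "set_integrable lborel T D.dv"
    unfolding dv_eq[abs_def]
    by (intro set_integral_add mult_continuous_integrable deriv_integrable continuous_integrable continuous_intros cc pc wc)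
  note DIV = D.divergence[OF intdv]
  have Fn: "F z \<bullet> n = w z * ((b (fst z), c (snd z)) \<bullet> n)" for z n by (simp add: F_def inner_prod algebra_simps)
  show "set_integrable hausdorff1 (frontier T) (\<lambda>z. w z * ((b (fst z), c (snd z)) \<bullet> outer_normal T z))"
    using DIV(1) by (simp add: Fn)
  \<comment> \<open>The second derivatives cancel because the mixed ones agree and the lower-order
    coefficient \<open>(b, c)\<close> multiplies the gradient of \<open>w\<close> on both
    sides.\<close>
  have key: "D.dv z - 2 * E z = A z * (P z * P z) + B z * (S z * S z)" if z: "z \<in> T" for z
    unfolding dv_eq E[OF z] A_def B_def w wx_def by (simp add: algebra_simps)
  have "(LINT z:T|lborel. \<delta> * ((P z)\<^sup>2 + (S z)\<^sup>2)) \<le> (LINT z:T|lborel. D.dv z - 2 * E z)"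
  proof (rule set_integral_mono)
    show "set_integrable lborel T (\<lambda>z. \<delta> * ((P z)\<^sup>2 + (S z)\<^sup>2))"
      by (intro continuous_integrable continuous_intros pc)
    show "set_integrable lborel T (\<lambda>z. D.dv z - 2 * E z)"
      by (intro set_integral_diff intdv set_integrable_mult_right intE)
    fix z assume z: "z \<in> T"
    have "\<delta> * (P z * P z) \<le> A z * (P z * P z)" "\<delta> * (S z * S z) \<le> B z * (S z * S z)"
      using A[OF z] B[OF z] by (intro mult_right_mono; simp)+
    then show "\<delta> * ((P z)\<^sup>2 + (S z)\<^sup>2) \<le> D.dv z - 2 * E z"
      unfolding key[OF z] by (simp add: power2_eq_square distrib_left)
  qed
  also have "(LINT z:T|lborel. D.dv z - 2 * E z) = (LINT z:T|lborel. D.dv z) - 2 * (LINT z:T|lborel. E z)"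
    by (subst set_integral_diff(2)[OF intdv set_integrable_mult_right[OF intE]]) simp
  finally have "(LINT z:T|lborel. \<delta> * ((P z)\<^sup>2 + (S z)\<^sup>2)) \<le> (LINT z:frontier T|hausdorff1. F z \<bullet> outer_normal T z) - 2 * (LINT z:T|lborel. E z)"
    unfolding DIV(2) .
  then show "- (LINT z:T|lborel. W_grad K v z \<bullet> grad (multiplier_op b c v) z)
      \<ge> 1/2 * (LINT z:T|lborel. \<delta> * ((pd_x v z)\<^sup>2 + (pd_y v z)\<^sup>2))
        - 1/2 * (LINT z:frontier T|hausdorff1. w z * ((b (fst z), c (snd z)) \<bullet> outer_normal T z))"
    unfolding E_def P_def S_def Fn by simp
qed

end

section \<open>The domain\<close>

text \<open>Near \<open>\<gamma> t0\<close> the points outside a thin double cone around the tangent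
  line are interior or exterior to \<open>S\<close>. A curve with velocity not orthogonal to
  \<open>\<nu>\<close> enters that region, yet its points are frontier points.\<close>

lemma outer_normal_perp_curve:
  fixes \<gamma> :: "real \<Rightarrow> point"
  assumes n: "is_outer_normal S (\<gamma> t0) \<nu>" and S: "open S"
    and d: "(\<gamma> has_vector_derivative d) (at t0)"
    and fr: "\<forall>\<^sub>F t in at t0. \<gamma> t \<in> frontier S"
  shows "d \<bullet> \<nu> = 0"
proof (rule ccontr)
  assume ne: "d \<bullet> \<nu> \<noteq> 0"
  \<comment> \<open>Chosen so that \<open>e * norm d < \<bar>d \<bullet> \<nu>\<bar>\<close>: the
    velocity then lies strictly inside the forbidden region.\<close>
  define e where "e = \<bar>d \<bullet> \<nu>\<bar> / (2 * (norm d + 1))"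
  have nd: "0 < 2 * (norm d + 1)" by (intro mult_pos_pos add_nonneg_pos) auto
  have e: "0 < e" using ne nd by (simp add: e_def)
  obtain r where r: "r > 0" "\<And>w. w \<in> ball (\<gamma> t0) r \<Longrightarrow>
      ((w - \<gamma> t0) \<bullet> \<nu> < - e * norm (w - \<gamma> t0) \<longrightarrow> w \<in> S) \<and> ((w - \<gamma> t0) \<bullet> \<nu> > e * norm (w - \<gamma> t0) \<longrightarrow> w \<notin> S)"
    using n e unfolding is_outer_normal_def by blast
  define U where "U = {w \<in> ball (\<gamma> t0) r. e * norm (w - \<gamma> t0) < \<bar>(w - \<gamma> t0) \<bullet> \<nu>\<bar>}"
  have U_eq: "U = ball (\<gamma> t0) r \<inter> {w. (w - \<gamma> t0) \<bullet> \<nu> < - e * norm (w - \<gamma> t0)} \<union> ball (\<gamma> t0) r \<inter> {w. e * norm (w - \<gamma> t0) < (w - \<gamma> t0) \<bullet> \<nu>}"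
    unfolding U_def by auto
  have noU: "w \<notin> frontier S" if w: "w \<in> U" for w
  proof -
    let ?A = "ball (\<gamma> t0) r \<inter> {w. (w - \<gamma> t0) \<bullet> \<nu> < - e * norm (w - \<gamma> t0)}"
    let ?B = "ball (\<gamma> t0) r \<inter> {w. e * norm (w - \<gamma> t0) < (w - \<gamma> t0) \<bullet> \<nu>}"
    have "?A \<subseteq> S" using r(2) by blast
    moreover have "?B \<inter> closure S = {}"
    proof (subst open_Int_closure_eq_empty)
      show "open ?B" by (intro open_Int open_ball open_Collect_less continuous_intros)
      show "?B \<inter> S = {}" using r(2) by blast
    qed
    ultimately show ?thesis
      using w S unfolding U_eq frontier_def interior_open[OF S] by blast
  qed
  have "\<forall>\<^sub>F t in at t0. \<gamma> t \<in> U"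
  proof -
    have q: "((\<lambda>h. (\<gamma> (t0 + h) - \<gamma> t0) /\<^sub>R h) \<longlongrightarrow> d) (at 0)" by (rule has_vector_derivative_quotient[OF d])
    have "((\<lambda>h. \<bar>((\<gamma> (t0 + h) - \<gamma> t0) /\<^sub>R h) \<bullet> \<nu>\<bar> - e * norm ((\<gamma> (t0 + h) - \<gamma> t0) /\<^sub>R h)) \<longlongrightarrow> \<bar>d \<bullet> \<nu>\<bar> - e * norm d) (at 0)"
      by (intro tendsto_intros q)
    moreover have "0 < \<bar>d \<bullet> \<nu>\<bar> - e * norm d"
    proof -
      have "e * norm d < e * (2 * (norm d + 1))" using e by (intro mult_strict_left_mono) (auto intro: add_nonneg_pos)
      also have "\<dots> = \<bar>d \<bullet> \<nu>\<bar>" using nd by (simp add: e_def)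
      finally show ?thesis by simp
    qed
    ultimately have "\<forall>\<^sub>F h in at 0. 0 < \<bar>((\<gamma> (t0 + h) - \<gamma> t0) /\<^sub>R h) \<bullet> \<nu>\<bar> - e * norm ((\<gamma> (t0 + h) - \<gamma> t0) /\<^sub>R h)"
      by (rule order_tendstoD)
    moreover have "\<forall>\<^sub>F h :: real in at 0. h \<noteq> 0" by (simp add: eventually_at_filter)
    ultimately have "\<forall>\<^sub>F h in at 0. e * norm (\<gamma> (t0 + h) - \<gamma> t0) < \<bar>(\<gamma> (t0 + h) - \<gamma> t0) \<bullet> \<nu>\<bar>"
    proof eventually_elim
      case (elim h)
      have "0 < \<bar>inverse h\<bar> * (\<bar>(\<gamma> (t0 + h) - \<gamma> t0) \<bullet> \<nu>\<bar> - e * norm (\<gamma> (t0 + h) - \<gamma> t0))"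
        using elim(1) by (simp add: abs_mult right_diff_distrib mult.left_commute)
      then show ?case by (simp add: zero_less_mult_iff)
    qed
    then have 1: "\<forall>\<^sub>F t in at t0. e * norm (\<gamma> t - \<gamma> t0) < \<bar>(\<gamma> t - \<gamma> t0) \<bullet> \<nu>\<bar>"
      unfolding eventually_at_to_0[of _ t0] by (simp add: add.commute)
    have "isCont \<gamma> t0" using d by (rule has_vector_derivative_continuous)
    then have "(\<gamma> \<longlongrightarrow> \<gamma> t0) (at t0)" by (simp add: isCont_def)
    then have "\<forall>\<^sub>F t in at t0. dist (\<gamma> t) (\<gamma> t0) < r" using r(1) by (rule tendstoD)
    then have 2: "\<forall>\<^sub>F t in at t0. \<gamma> t \<in> ball (\<gamma> t0) r" by (simp add: dist_commute)
    show ?thesis using 1 2 by eventually_elim (auto simp: U_def)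
  qed
  then have "\<forall>\<^sub>F t in at t0. False" using fr by eventually_elim (use noU in blast)
  then show False by simp
qed

text \<open>\<open>\<Omega>\<close> is one component of the complement of the Jordan curve. Being
  bounded it misses some point off the curve, and by the Jordan-Brouwer theorem the component of
  that point has the whole curve as its frontier. So every boundary point is also approached from
  outside.\<close>

lemma jordan_domain_frontier:
  fixes \<Omega> :: "point set"
  assumes \<Omega>: "open \<Omega>" "connected \<Omega>" "bounded \<Omega>" "\<Omega> \<noteq> {}"
    and fr: "frontier \<Omega> = path_image \<gamma>" "simple_path \<gamma>" "pathfinish \<gamma> = pathstart \<gamma>"
  shows "frontier \<Omega> \<subseteq> closure (- closure \<Omega>)"
proof -
  let ?\<Gamma> = "path_image \<gamma>"
  have hom: "?\<Gamma> homeomorphic sphere (0 :: point) 1"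
  proof -
    have "?\<Gamma> homeomorphic sphere (0 :: complex) 1" by (rule homeomorphic_simple_path_image_circle[OF fr(2,3)]) simp
    moreover have "sphere (0 :: complex) 1 homeomorphic sphere (0 :: point) 1" by (intro homeomorphic_spheres_gen) auto
    ultimately show ?thesis by (rule homeomorphic_trans)
  qed
  have disj: "\<Omega> \<inter> ?\<Gamma> = {}"
    unfolding fr(1)[symmetric] frontier_def interior_open[OF \<Omega>(1)] by blast
  have comp: "\<Omega> \<in> components (- ?\<Gamma>)"
    unfolding in_components_maximal
  proof (intro conjI allI impI)
    fix D assume D: "D \<noteq> {} \<and> \<Omega> \<subseteq> D \<and> D \<subseteq> - ?\<Gamma> \<and> connected D"
    show "D = \<Omega>"
    proof (rule ccontr)
      assume "D \<noteq> \<Omega>"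
      then have "D - \<Omega> \<noteq> {}" "D \<inter> \<Omega> \<noteq> {}" using D \<Omega>(4) by auto
      then have "D \<inter> frontier \<Omega> \<noteq> {}" using D by (intro connected_Int_frontier) auto
      then show False using D fr(1) by auto
    qed
  qed (use \<Omega> disj in auto)
  have "bounded (closure \<Omega>)" by (rule bounded_closure[OF \<Omega>(3)])
  then have "bounded (\<Omega> \<union> ?\<Gamma>)" unfolding closure_Un_frontier fr(1) .
  then have "\<Omega> \<union> ?\<Gamma> \<noteq> UNIV" using not_bounded_UNIV by metis
  then obtain z where z: "z \<notin> \<Omega>" "z \<notin> ?\<Gamma>" by blast
  define C where "C = connected_component_set (- ?\<Gamma>) z"
  have C: "C \<in> components (- ?\<Gamma>)" "z \<in> C"
    using z by (auto simp: C_def components_def)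
  have "C \<noteq> \<Omega>" using C z by auto
  then have disjC: "C \<inter> \<Omega> = {}" using components_nonoverlap[OF C(1) comp] by simp
  have "C \<inter> ?\<Gamma> = {}" using in_components_subset[OF C(1)] by auto
  moreover have "closure \<Omega> = \<Omega> \<union> ?\<Gamma>"
    using fr(1) closure_Un_frontier by metis
  ultimately have sub: "C \<subseteq> - closure \<Omega>" using disjC by auto
  have "frontier C = ?\<Gamma>" by (rule Jordan_Brouwer_frontier[OF hom C(1)]) simp
  moreover have "frontier C \<subseteq> closure C" unfolding frontier_def by blast
  ultimately have "frontier \<Omega> \<subseteq> closure C" using fr(1) by blast
  then show ?thesis using closure_mono[OF sub] by blast
qed

locale mixed_domain =
  fixes K :: "real \<Rightarrow> real" and yc :: real and \<Omega> :: "point set"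
  assumes domain: "mixed_type_domain K yc \<Omega>"
begin

lemma basics:
  "open \<Omega>" "connected \<Omega>" "bounded \<Omega>" "continuous_on (snd ` closure \<Omega>) K" "K C1_differentiable_on (snd ` \<Omega>)"
  "\<And>y. y \<in> snd ` closure \<Omega> \<Longrightarrow> y \<noteq> 0 \<Longrightarrow> K y * y > 0" "\<And>y. y \<in> snd ` \<Omega> \<Longrightarrow> deriv K y > 0"
  "frontier \<Omega> = Gamma0 \<Omega> \<union> Gamma1 K yc \<union> Gamma2 K yc" "yc < 0"
  using domain unfolding mixed_type_domain_def by auto

text \<open>The horizontal displacement along a characteristic between the levels 0 and
  \<open>y\<close>.\<close>

definition "chi y = integral {y..0} (\<lambda>t. sqrt (- K t))"

lemma chi_yc: "chi yc = 1"
  using domain unfolding mixed_type_domain_def chi_def by auto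

lemma chi_0: "chi 0 = 0" by (simp add: chi_def)

lemma Gamma1_eq: "Gamma1 K yc = (\<lambda>y. (- 1 + chi y, y)) ` {yc..0}"
  unfolding Gamma1_def chi_def by auto

lemma Gamma2_eq: "Gamma2 K yc = (\<lambda>y. (1 - chi y, y)) ` {yc..0}"
  unfolding Gamma2_def chi_def by auto

lemma yc_range: "{yc..0} \<subseteq> snd ` closure \<Omega>"
proof
  fix y assume y: "y \<in> {yc..0}"
  then have "(- 1 + chi y, y) \<in> frontier \<Omega>" using basics(8) Gamma1_eq by auto
  then show "y \<in> snd ` closure \<Omega>" unfolding frontier_def by force
qed

lemma K_neg: "y \<in> {yc..<0} \<Longrightarrow> K y < 0"
  using basics(6)[of y] yc_range by (auto simp: zero_less_mult_iff subset_iff)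

text \<open>The sign condition on \<open>K\<close> excludes the level 0, which is reached by
  continuity.\<close>

lemma K_nonpos: "y \<in> {yc..0} \<Longrightarrow> K y \<le> 0"
proof -
  have "continuous_on {yc..0} K" using basics(4) yc_range continuous_on_subset by blast
  moreover have "K y \<le> 0" if "y \<in> {yc..<0}" for y using K_neg[OF that] by simp
  moreover have "closure {yc..<0} = {yc..0}" using basics(9) by (rule closure_atLeastLessThan)
  ultimately show "y \<in> {yc..0} \<Longrightarrow> K y \<le> 0"
    using continuous_le_on_closure[of "{yc..<0}" K y 0] by auto
qed

lemma cont_sqrt: "continuous_on {yc..0} (\<lambda>t. sqrt (- K t))"
  by (intro continuous_intros continuous_on_subset[OF basics(4) yc_range])

lemma chi_deriv_within: "y \<in> {yc..0} \<Longrightarrow> (chi has_real_derivative - sqrt (- K y)) (at y within {yc..0})"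
  unfolding chi_def by (rule integral_has_real_derivative'[OF cont_sqrt])

lemma chi_continuous: "continuous_on {yc..0} chi"
  using chi_deriv_within by (meson DERIV_continuous continuous_on_eq_continuous_within)

lemma chi_deriv: "y \<in> {yc<..<0} \<Longrightarrow> (chi has_real_derivative - sqrt (- K y)) (at y)"
  using chi_deriv_within[of y] at_within_interior[of y "{yc..0}"] by auto

lemma chi_less_1: "y \<in> {yc<..0} \<Longrightarrow> chi y < 1"
proof -
  assume y: "y \<in> {yc<..0}"
  have "\<exists>l z. yc < z \<and> z < y \<and> (chi has_real_derivative l) (at z) \<and> chi y - chi yc = (y - yc) * l"
  proof (rule MVT)
    show "continuous_on {yc..y} chi" using y by (intro continuous_on_subset[OF chi_continuous]) auto
    show "chi differentiable at x" if "yc < x" "x < y" for x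
      using chi_deriv[of x] that y by (auto simp: real_differentiable_def)
  qed (use y in auto)
  then obtain l z where z': "yc < z" "z < y" "(chi has_real_derivative l) (at z)" "chi y - chi yc = (y - yc) * l" by blast
  then have "l = - sqrt (- K z)" using DERIV_unique[OF z'(3) chi_deriv[of z]] y by simp
  then have z: "yc < z" "z < y" "chi y - chi yc = (y - yc) * (- sqrt (- K z))" using z' by auto
  have "0 < (y - yc) * sqrt (- K z)" using z y K_neg[of z] by (intro mult_pos_pos) auto
  then show ?thesis using z(3) chi_yc by simp
qed

lemma Gamma_disjoint:
  "Gamma0 \<Omega> \<inter> Gamma1 K yc = {}" "Gamma0 \<Omega> \<inter> Gamma2 K yc = {}" "Gamma1 K yc \<inter> Gamma2 K yc \<subseteq> {(0, yc)}"
proof -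
  show "Gamma0 \<Omega> \<inter> Gamma1 K yc = {}" "Gamma0 \<Omega> \<inter> Gamma2 K yc = {}"
    by (auto simp: Gamma0_def Gamma1_def Gamma2_def)
  show "Gamma1 K yc \<inter> Gamma2 K yc \<subseteq> {(0, yc)}"
  proof
    fix z assume "z \<in> Gamma1 K yc \<inter> Gamma2 K yc"
    then obtain y where y: "y \<in> {yc..0}" "z = (- 1 + chi y, y)" "- 1 + chi y = 1 - chi y"
      by (auto simp: Gamma1_eq Gamma2_eq)
    then have "chi y = 1" by simp
    then have "y = yc" using chi_less_1[of y] y(1) by (cases "y = yc") auto
    then show "z \<in> {(0, yc)}" using y by simp
  qed
qed

lemma Gamma_sets: "Gamma0 \<Omega> \<in> sets borel" "closed (Gamma1 K yc)" "closed (Gamma2 K yc)"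
proof -
  have "{z :: point. snd z > 0} \<in> sets borel" by (intro borel_open open_Collect_less continuous_intros)
  then show "Gamma0 \<Omega> \<in> sets borel" unfolding Gamma0_def by (rule sets.Int[OF borel_closed[OF frontier_closed]])
  show "closed (Gamma1 K yc)" "closed (Gamma2 K yc)"
    unfolding Gamma1_eq Gamma2_eq
    by (auto intro!: compact_imp_closed compact_continuous_image continuous_intros chi_continuous)
qed

lemma nonempty: "\<Omega> \<noteq> {}"
proof
  assume "\<Omega> = {}"
  then have "frontier \<Omega> = {}" by simp
  then show False using basics(8,9) Gamma1_eq by auto
qed

text \<open>The Lipschitz arc above and the two characteristics below join to a closed simple path,
  since the characteristics meet only at their common lower end. This excludes a domain that lies on
  both sides of its boundary.\<close>

lemma no_slit: "frontier \<Omega> \<subseteq> closure (- closure \<Omega>)"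
proof -
  obtain g L where g: "arc g" "pathstart g = (1, 0)" "pathfinish g = (- 1, 0)" "Gamma0 \<Omega> = g ` {0<..<1}"
    using domain unfolding mixed_type_domain_def by blast
  \<comment> \<open>\<open>h1\<close> descends along the left characteristic to its lower end,
    \<open>h2\<close> climbs along the right one to \<open>(1, 0)\<close>, where \<open>g\<close>
    starts.\<close>
  define h1 h2 where "h1 t = (- 1 + chi (yc * t), yc * t)" and "h2 t = (1 - chi (yc * (1 - t)), yc * (1 - t))" for t
  have r: "yc * t \<in> {yc..0}" if "t \<in> {0..1}" for t
    using that basics(9) by (auto simp: mult_le_0_iff)
  have cont: "continuous_on {0..1} (\<lambda>t. chi (yc * t))" "continuous_on {0..1} (\<lambda>t. chi (yc * (1 - t)))"
    by (rule continuous_on_compose2[OF chi_continuous]; use r r[of "1 - _"] in \<open>auto intro!: continuous_intros\<close>)+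
  have arc1: "arc h1" unfolding arc_def path_def h1_def inj_on_def
    using basics(9) by (auto intro!: continuous_intros cont)
  have arc2: "arc h2" unfolding arc_def path_def h2_def inj_on_def
    using basics(9) by (auto intro!: continuous_intros cont)
  have im: "(\<lambda>t. yc * t) ` {0..1} = {yc..0}" "(\<lambda>t. yc * (1 - t)) ` {0..1} = {yc..0}"
  proof -
    show 1: "(\<lambda>t. yc * t) ` {0..1} = {yc..0}"
    proof
      show "{yc..0} \<subseteq> (\<lambda>t. yc * t) ` {0..1}"
      proof
        fix y assume "y \<in> {yc..0}"
        then show "y \<in> (\<lambda>t. yc * t) ` {0..1}" using basics(9)
          by (intro image_eqI[of _ _ "y / yc"]) (auto simp: divide_le_eq zero_le_divide_iff)
      qed
    qed (use r in auto)
    have "(\<lambda>t. yc * (1 - t)) ` {0..1} = (\<lambda>t. yc * t) ` (\<lambda>t. 1 - t) ` {0..1}" by (simp only: image_image)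
    also have "(\<lambda>t. 1 - t) ` {0..1} = {0..1 :: real}" by (simp add: image_diff_atLeastAtMost)
    finally show "(\<lambda>t. yc * (1 - t)) ` {0..1} = {yc..0}" using 1 by simp
  qed
  have p1: "path_image h1 = Gamma1 K yc"
    unfolding path_image_def Gamma1_eq im(1)[symmetric] h1_def by (simp add: image_image)
  have p2: "path_image h2 = Gamma2 K yc"
    unfolding path_image_def Gamma2_eq im(2)[symmetric] h2_def by (simp add: image_image)
  have ends: "pathstart h1 = (- 1, 0)" "pathfinish h1 = (0, yc)" "pathstart h2 = (0, yc)" "pathfinish h2 = (1, 0)"
    by (auto simp: pathstart_def pathfinish_def h1_def h2_def chi_0 chi_yc)
  have arc12: "arc (h1 +++ h2)"
    by (rule arc_join[OF arc1 arc2]) (use ends p1 p2 Gamma_disjoint(3) in auto)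
  have pg: "path_image g = insert (1, 0) (insert (- 1, 0) (Gamma0 \<Omega>))"
  proof -
    have "{0..1 :: real} = insert 0 (insert 1 {0<..<1})" by auto
    then have "path_image g = insert (g 0) (insert (g 1) (g ` {0<..<1}))" unfolding path_image_def by (metis image_insert)
    then show ?thesis using g(2-4) by (simp add: pathstart_def pathfinish_def)
  qed
  have p12: "path_image (h1 +++ h2) = Gamma1 K yc \<union> Gamma2 K yc"
    using ends p1 p2 by (simp add: path_image_join)
  have e12: "pathstart (h1 +++ h2) = (- 1, 0)" "pathfinish (h1 +++ h2) = (1, 0)" using ends by auto
  have sp: "simple_path (g +++ (h1 +++ h2))"
  proof (rule simple_path_join_loop[OF g(1) arc12])
    have "path_image g \<inter> path_image (h1 +++ h2) \<subseteq> {(1, 0), (- 1, 0)}"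
      unfolding pg p12 using Gamma_disjoint(1,2) by blast
    then show "path_image g \<inter> path_image (h1 +++ h2) \<subseteq> {pathstart g, pathstart (h1 +++ h2)}"
      using g(2) e12(1) by simp
  qed (use g e12 in simp_all)
  have loop: "pathfinish (g +++ (h1 +++ h2)) = pathstart (g +++ (h1 +++ h2))" using g e12 by simp
  have "path_image (g +++ (h1 +++ h2)) = path_image g \<union> (Gamma1 K yc \<union> Gamma2 K yc)"
    using g e12 p12 by (simp add: path_image_join)
  also have "\<dots> = frontier \<Omega>"
    unfolding basics(8) pg using ends p1 p2 by (metis (no_types, lifting) Un_assoc Un_insert_left insert_absorb insert_commute UnCI
      pathfinish_in_path_image pathstart_in_path_image)
  finally show ?thesis
    using jordan_domain_frontier[OF basics(1,2,3) nonempty _ sp loop] by simp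
qed

text \<open>The velocity of the characteristic in the parameter \<open>y\<close> is
  \<open>(- sqrt (- K y), 1)\<close>, and the normal is orthogonal to it. The relation makes the
  form with matrix W vanish on the normal.\<close>

lemma normal_perp_Gamma1:
  assumes y: "y \<in> {yc<..<0}" and n: "is_outer_normal \<Omega> (- 1 + chi y, y) \<nu>"
  shows "snd \<nu> = sqrt (- K y) * fst \<nu>"
proof -
  have "(- sqrt (- K y), 1) \<bullet> \<nu> = 0"
  proof (rule outer_normal_perp_curve[of \<Omega> "\<lambda>y. (- 1 + chi y, y)"])
    have "(chi has_vector_derivative - sqrt (- K y)) (at y)"
      using chi_deriv[OF y] by (simp add: has_real_derivative_iff_has_vector_derivative)
    then show "((\<lambda>y. (- 1 + chi y, y)) has_vector_derivative (- sqrt (- K y), 1)) (at y)"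
      by (intro has_vector_derivative_Pair) (auto intro!: derivative_eq_intros)
    have "\<forall>\<^sub>F t in at y. t \<in> {yc<..<0}" using y by (intro eventually_at_in_open') auto
    then show "\<forall>\<^sub>F t in at y. (- 1 + chi t, t) \<in> frontier \<Omega>"
      by eventually_elim (auto simp: basics(8) Gamma1_eq)
  qed (use n basics in auto)
  then show ?thesis by (simp add: inner_prod)
qed

text \<open>Here the sign is needed too. Were the normal pointing left, points just to the right of
  the curve would lie in \<open>\<Omega>\<close>. Moving on to the right one has to leave the
  bounded set through its frontier, but at a negative level the frontier contains only the two
  characteristics, and neither lies further right.\<close>

lemma normal_perp_Gamma2:
  assumes y: "y \<in> {yc<..<0}" and n: "is_outer_normal \<Omega> (1 - chi y, y) \<nu>"
  shows "snd \<nu> = - sqrt (- K y) * fst \<nu>" "0 < fst \<nu>"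
proof -
  have "(sqrt (- K y), 1) \<bullet> \<nu> = 0"
  proof (rule outer_normal_perp_curve[of \<Omega> "\<lambda>y. (1 - chi y, y)"])
    have "(chi has_vector_derivative - sqrt (- K y)) (at y)"
      using chi_deriv[OF y] by (simp add: has_real_derivative_iff_has_vector_derivative)
    then show "((\<lambda>y. (1 - chi y, y)) has_vector_derivative (sqrt (- K y), 1)) (at y)"
      by (intro has_vector_derivative_Pair) (auto intro!: derivative_eq_intros)
    have "\<forall>\<^sub>F t in at y. t \<in> {yc<..<0}" using y by (intro eventually_at_in_open') auto
    then show "\<forall>\<^sub>F t in at y. (1 - chi t, t) \<in> frontier \<Omega>"
      by eventually_elim (auto simp: basics(8) Gamma2_eq)
  qed (use n basics in auto)
  then show perp: "snd \<nu> = - sqrt (- K y) * fst \<nu>" by (simp add: inner_prod)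
  show "0 < fst \<nu>"
  proof (rule ccontr)
    assume np: "\<not> 0 < fst \<nu>"
    have "fst \<nu> \<noteq> 0"
    proof
      assume "fst \<nu> = 0"
      then have "\<nu> = 0" using perp by (simp add: prod_eq_iff)
      then show False using n by (simp add: is_outer_normal_def)
    qed
    then have neg: "fst \<nu> < 0" using np by simp
    define x where "x = 1 - chi y"
    have "- fst \<nu> / 2 > 0" using neg by simp
    then obtain r where r: "r > 0" "\<And>w. w \<in> ball (x, y) r \<Longrightarrow> (w - (x, y)) \<bullet> \<nu> < - (- fst \<nu> / 2) * norm (w - (x, y)) \<Longrightarrow> w \<in> \<Omega>"
      using n unfolding is_outer_normal_def x_def by meson
    have "(x + r / 2, y) \<in> \<Omega>"
    proof (rule r(2))
      show "(x + r / 2, y) \<in> ball (x, y) r" using r(1) by (simp add: dist_Pair_Pair dist_real_def)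
      have "(r / 2) * fst \<nu> < (r / 2) * (fst \<nu> / 2)" using neg r(1) by (intro mult_strict_left_mono) auto
      then show "((x + r / 2, y) - (x, y)) \<bullet> \<nu> < - (- fst \<nu> / 2) * norm ((x + r / 2, y) - (x, y))"
        using r(1) by (simp add: inner_prod norm_Pair mult.commute)
    qed
    moreover obtain B where B: "\<And>z. z \<in> \<Omega> \<Longrightarrow> norm z \<le> B" using basics(3) unfolding bounded_iff by blast
    have "(x + r / 2 + (\<bar>B\<bar> + \<bar>x\<bar> + 1), y) \<notin> \<Omega>"
      using B[of "(x + r / 2 + (\<bar>B\<bar> + \<bar>x\<bar> + 1), y)"] abs_fst_le_norm[of "(x + r / 2 + (\<bar>B\<bar> + \<bar>x\<bar> + 1), y)"] r(1) by auto
    moreover have "(x + r / 2, y) \<in> (\<lambda>s. (s, y)) ` {x + r / 2..x + r / 2 + (\<bar>B\<bar> + \<bar>x\<bar> + 1)}"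
      "(x + r / 2 + (\<bar>B\<bar> + \<bar>x\<bar> + 1), y) \<in> (\<lambda>s. (s, y)) ` {x + r / 2..x + r / 2 + (\<bar>B\<bar> + \<bar>x\<bar> + 1)}"
      by auto
    ultimately have "(\<lambda>s. (s, y)) ` {x + r / 2..x + r / 2 + (\<bar>B\<bar> + \<bar>x\<bar> + 1)} \<inter> frontier \<Omega> \<noteq> {}"
      by (intro connected_Int_frontier connected_continuous_image continuous_intros connected_Icc) blast+
    then obtain s where s: "s > x" "(s, y) \<in> frontier \<Omega>" using r(1) by force
    then have "s = - 1 + chi y \<or> s = 1 - chi y"
      using y unfolding basics(8) Gamma1_eq Gamma2_eq by (auto simp: Gamma0_def)
    then show False using s(1) chi_less_1[of y] y by (auto simp: x_def)
  qed
qed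

end

section \<open>The mesh\<close>

lemma perp_rot_parallel:
  fixes v d :: point
  assumes "v \<bullet> rot d = 0"
  shows "(d \<bullet> d) *\<^sub>R v = (v \<bullet> d) *\<^sub>R d"
proof -
  have e: "snd v * fst d = fst v * snd d" using assms by (simp add: inner_prod rot_def)
  have "(fst d * fst d + snd d * snd d) * fst v = (fst v * fst d + snd v * snd d) * fst d"
    using e by (simp add: algebra_simps)
  moreover have "(fst d * fst d + snd d * snd d) * snd v = (fst v * fst d + snd v * snd d) * snd d"
    using e by (simp add: algebra_simps)
  ultimately show ?thesis by (simp add: prod_eq_iff inner_prod)
qed

lemma unit_normals_parallel:
  fixes N N' d :: point
  assumes "norm N = 1" "norm N' = 1" "N \<bullet> d = 0" "N' \<bullet> d = 0" "d \<noteq> 0"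
  shows "N' = N \<or> N' = - N"
proof -
  have par: "(d \<bullet> d) *\<^sub>R v = (v \<bullet> rot d) *\<^sub>R rot d" if "v \<bullet> d = 0" for v
  proof -
    have "rot d \<bullet> rot d = d \<bullet> d" "v \<bullet> rot (rot d) = 0" using that by (auto simp: inner_prod rot_def)
    then show ?thesis using perp_rot_parallel[of v "rot d"] by simp
  qed
  have dd: "0 < d \<bullet> d" using assms(5) by simp
  define e where "e = rot d /\<^sub>R norm d"
  have e: "norm e = 1" using assms(5) by (simp add: e_def norm_rot_eq)
  have "\<exists>k. v = k *\<^sub>R e" if "v \<bullet> d = 0" for v
  proof -
    have "(1 / (d \<bullet> d)) *\<^sub>R ((d \<bullet> d) *\<^sub>R v) = (1 / (d \<bullet> d)) *\<^sub>R ((v \<bullet> rot d) *\<^sub>R rot d)" using par[OF that] by simp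
    then have "v = ((v \<bullet> rot d) / (d \<bullet> d) * norm d) *\<^sub>R e" using dd assms(5) by (simp add: e_def mult.assoc)
    then show ?thesis by blast
  qed
  then obtain k k' where k: "N = k *\<^sub>R e" "N' = k' *\<^sub>R e" using assms(3,4) by metis
  then have "\<bar>k\<bar> = 1" "\<bar>k'\<bar> = 1" using assms(1,2) e by auto
  then have "k' = k \<or> k' = - k" by linarith
  then show ?thesis using k by auto
qed

text \<open>On the cone from \<open>a\<close> over the segment the gauge is linear, since it is
  homogeneous and equals 1 on the segment. Around an inner point of the segment \<open>T\<close> is
  therefore exactly the side of a line.\<close>

lemma (in star_domain) flat_side:
  assumes pq: "x0 \<noteq> x1" and seg: "closed_segment x0 x1 \<subseteq> frontier T"
  shows "\<exists>N. norm N = 1 \<and> N \<bullet> (x1 - x0) = 0 \<and>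
    (\<forall>z\<in>open_segment x0 x1. \<exists>\<epsilon>>0. \<forall>w\<in>ball z \<epsilon>. w \<in> T \<longleftrightarrow> (w - z) \<bullet> N < 0)"
proof -
  define d where "d = x1 - x0"
  have d0: "d \<noteq> 0" and dd: "0 < d \<bullet> d" using pq by (auto simp: d_def)
  define N0 where "N0 = rot d /\<^sub>R norm d"
  have N0: "norm N0 = 1" "N0 \<bullet> d = 0"
  proof -
    show "norm N0 = 1" using d0 by (simp add: N0_def norm_rot_eq)
    show "N0 \<bullet> d = 0" by (simp add: N0_def inner_prod rot_def)
  qed
  define k0 where "k0 = (x0 - a) \<bullet> N0"
  have pt: "gauge_fun (x0 + l *\<^sub>R d - a) = 1" if "0 \<le> l" "l \<le> 1" for l
  proof -
    have "x0 + l *\<^sub>R d = (1 - l) *\<^sub>R x0 + l *\<^sub>R x1" by (simp add: d_def algebra_simps)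
    then have "x0 + l *\<^sub>R d \<in> closed_segment x0 x1" using that by (auto simp: in_segment)
    then show ?thesis using seg by (auto simp: frontier_T)
  qed
  \<comment> \<open>The line of the segment misses \<open>a\<close>: along a ray from
    \<open>a\<close> the gauge is strictly increasing, so it cannot equal 1 at two points.\<close>
  have k0: "k0 \<noteq> 0"
  proof
    assume "k0 = 0"
    then have "(x0 - a) \<bullet> rot d = 0" using d0 by (simp add: k0_def N0_def)
    then have "(d \<bullet> d) *\<^sub>R (x0 - a) = ((x0 - a) \<bullet> d) *\<^sub>R d" by (rule perp_rot_parallel)
    then have "(1 / (d \<bullet> d)) *\<^sub>R ((d \<bullet> d) *\<^sub>R (x0 - a)) = (1 / (d \<bullet> d)) *\<^sub>R (((x0 - a) \<bullet> d) *\<^sub>R d)" by simp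
    then obtain \<alpha> where \<alpha>: "x0 - a = \<alpha> *\<^sub>R d" using dd by auto
    have g: "gauge_fun ((\<alpha> + l) *\<^sub>R d) = 1" if "0 \<le> l" "l \<le> 1" for l
    proof -
      have "x0 + l *\<^sub>R d - a = (\<alpha> + l) *\<^sub>R d" using \<alpha> by (simp add: algebra_simps)
      then show ?thesis using pt[OF that] by simp
    qed
    \<comment> \<open>One half of the segment lies on a single ray from \<open>a\<close>, in
      direction \<open>d\<close> or \<open>- d\<close>; two of its points contradict
      homogeneity.\<close>
    show False
    proof (cases "0 \<le> \<alpha> + 1/2")
      case True
      then have "(\<alpha> + 1/2) * gauge_fun d = 1" "(\<alpha> + 1) * gauge_fun d = 1"
        using g[of "1/2"] g[of 1] gauge_scale[of "\<alpha> + 1/2" d] gauge_scale[of "\<alpha> + 1" d] by auto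
      then show False using gauge_pos[OF d0] by (simp add: distrib_right)
    next
      case False
      have m: "k *\<^sub>R d = (- k) *\<^sub>R (- d)" for k by simp
      have "(- (\<alpha> + 1/2)) * gauge_fun (- d) = gauge_fun ((\<alpha> + 1/2) *\<^sub>R d)"
        unfolding m[of "\<alpha> + 1/2"] by (rule gauge_scale[symmetric]) (use False in simp)
      moreover have "(- \<alpha>) * gauge_fun (- d) = gauge_fun (\<alpha> *\<^sub>R d)"
        unfolding m[of \<alpha>] by (rule gauge_scale[symmetric]) (use False in simp)
      ultimately have "(- (\<alpha> + 1/2)) * gauge_fun (- d) = 1" "(- \<alpha>) * gauge_fun (- d) = 1"
        using g[of "1/2"] g[of 0] by simp_all
      then show False using gauge_pos[of "- d"] d0 by (simp add: distrib_right left_diff_distrib)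
    qed
  qed
  \<comment> \<open>The sign is chosen so that \<open>N\<close> points away from
    \<open>a\<close>.\<close>
  define N where "N = sgn k0 *\<^sub>R N0"
  define k where "k = (x0 - a) \<bullet> N"
  have N: "norm N = 1" "N \<bullet> d = 0" using N0 k0 by (auto simp: N_def sgn_if)
  have k: "0 < k" using k0 by (auto simp: k_def N_def k0_def[symmetric] sgn_if)
  have "\<exists>\<epsilon>>0. \<forall>w\<in>ball z \<epsilon>. w \<in> T \<longleftrightarrow> (w - z) \<bullet> N < 0" if z: "z \<in> open_segment x0 x1" for z
  proof -
    obtain l where l: "0 < l" "l < 1" "z = (1 - l) *\<^sub>R x0 + l *\<^sub>R x1" using z by (auto simp: in_segment)
    have zl: "z = x0 + l *\<^sub>R d" using l by (simp add: d_def algebra_simps)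
    have zk: "(z - a) \<bullet> N = k"     proof -
      have "z - a = (x0 - a) + l *\<^sub>R d" by (simp add: zl)
      then have "(z - a) \<bullet> N = k + l * (N \<bullet> d)"
        by (simp only: inner_add_left k_def inner_scaleR_left inner_commute[of d])
      then show ?thesis using N(2) by simp
    qed
    \<comment> \<open>\<open>s w\<close> is the claimed value of the gauge at \<open>w - a\<close>,
      \<open>X w\<close> the central projection of \<open>w\<close> onto the line of the segment,
      and \<open>\<tau> w\<close> the parameter of that projection. By continuity the projection
      hits the segment for \<open>w\<close> near \<open>z\<close>.\<close>
    define s where "s w = ((w - a) \<bullet> N) / k" for w
    define X where "X w = a + (w - a) /\<^sub>R s w" for w
    define \<tau> where "\<tau> w = ((X w - x0) \<bullet> d) / (d \<bullet> d)" for w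
    have sz: "s z = 1" using zk k by (simp add: s_def)
    have "X z = z" by (simp add: X_def sz)
    then have "X z - x0 = l *\<^sub>R d" by (simp only:) (simp add: zl)
    then have "\<tau> z = l" using dd by (simp add: \<tau>_def)
    have cs: "isCont s z" unfolding s_def using k by (intro continuous_intros) auto
    have c\<tau>: "isCont \<tau> z" unfolding \<tau>_def X_def using dd sz by (intro continuous_intros cs) auto
    have "(s \<longlongrightarrow> s z) (nhds z)" "(\<tau> \<longlongrightarrow> \<tau> z) (nhds z)"
      using cs c\<tau> by (simp_all add: isCont_def tendsto_at_iff_tendsto_nhds)
    then have "\<forall>\<^sub>F w in nhds z. 0 < s w" "\<forall>\<^sub>F w in nhds z. 0 < \<tau> w" "\<forall>\<^sub>F w in nhds z. \<tau> w < 1"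
      using sz \<open>\<tau> z = l\<close> l by (auto intro: order_tendstoD)
    then have "\<forall>\<^sub>F w in nhds z. 0 < s w \<and> 0 < \<tau> w \<and> \<tau> w < 1" by eventually_elim simp
    then obtain \<epsilon> where \<epsilon>: "0 < \<epsilon>" "\<And>w. dist w z < \<epsilon> \<Longrightarrow> 0 < s w \<and> 0 < \<tau> w \<and> \<tau> w < 1"
      unfolding eventually_nhds_metric by blast
    have "w \<in> T \<longleftrightarrow> (w - z) \<bullet> N < 0" if w: "w \<in> ball z \<epsilon>" for w
    proof -
      have st: "0 < s w" "0 < \<tau> w" "\<tau> w < 1" using \<epsilon>(2)[of w] w by (auto simp: dist_commute)
      have sk: "(w - a) \<bullet> N = k * s w" using k by (simp add: s_def)
      have "(X w - x0) \<bullet> N = (w - a) \<bullet> N / s w - k"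
        by (simp add: X_def k_def inner_diff_left inner_add_left divide_inverse_commute)
      also have "\<dots> = 0" using sk st by simp
      finally have "(X w - x0) \<bullet> rot d = 0" using k0 d0 by (auto simp: N_def N0_def sgn_if split: if_splits)
      then have "(d \<bullet> d) *\<^sub>R (X w - x0) = ((X w - x0) \<bullet> d) *\<^sub>R d" by (rule perp_rot_parallel)
      then have "(1 / (d \<bullet> d)) *\<^sub>R ((d \<bullet> d) *\<^sub>R (X w - x0)) = (1 / (d \<bullet> d)) *\<^sub>R (((X w - x0) \<bullet> d) *\<^sub>R d)" by simp
      then have "X w - x0 = \<tau> w *\<^sub>R d" using dd by (simp add: \<tau>_def)
      then have "X w = x0 + \<tau> w *\<^sub>R d" by (simp add: algebra_simps)
      then have "gauge_fun (X w - a) = 1" using pt[of "\<tau> w"] st by simp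
      moreover have "w - a = s w *\<^sub>R (X w - a)" using st by (simp add: X_def)
      ultimately have "gauge_fun (w - a) = s w" using gauge_scale[of "s w" "X w - a"] st by simp
      then have "w \<in> T \<longleftrightarrow> s w < 1" by (simp add: mem_T_iff)
      also have "\<dots> \<longleftrightarrow> (w - a) \<bullet> N < (z - a) \<bullet> N" unfolding zk s_def using k by (simp add: divide_less_eq)
      also have "\<dots> \<longleftrightarrow> (w - z) \<bullet> N < 0" by (simp add: inner_diff_left)
      finally show ?thesis .
    qed
    then show ?thesis using \<epsilon>(1) by blast
  qed
  then show ?thesis using N unfolding d_def by blast
qed

lemma half_plane_normal:
  assumes N: "norm N = 1" and "0 < \<epsilon>" "\<And>w. w \<in> ball z \<epsilon> \<Longrightarrow> w \<in> S \<longleftrightarrow> (w - z) \<bullet> N < 0"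
  shows "is_outer_normal S z N"
  unfolding is_outer_normal_def
proof (intro conjI N allI impI)
  fix e :: real assume e: "0 < e"
  show "\<exists>r>0. \<forall>w\<in>ball z r. ((w - z) \<bullet> N < - e * norm (w - z) \<longrightarrow> w \<in> S) \<and> ((w - z) \<bullet> N > e * norm (w - z) \<longrightarrow> w \<notin> S)"
  proof (intro exI[of _ \<epsilon>] conjI assms(2) ballI impI)
    fix w assume w: "w \<in> ball z \<epsilon>"
    have n: "0 \<le> e * norm (w - z)" using e by simp
    show "w \<in> S" if "(w - z) \<bullet> N < - e * norm (w - z)" using assms(3)[OF w] that n by simp
    show "w \<notin> S" if "(w - z) \<bullet> N > e * norm (w - z)" using assms(3)[OF w] that n by simp
  qed
qed

text \<open>The two open half discs leave out only a piece of a line, which contains no nonempty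
  open set.\<close>

lemma two_half_planes_cover:
  fixes N z :: point
  assumes N: "norm N = 1" and \<epsilon>: "0 < \<epsilon>"
    and T: "\<And>w. w \<in> ball z \<epsilon> \<Longrightarrow> (w - z) \<bullet> N < 0 \<Longrightarrow> w \<in> T" "\<And>w. w \<in> ball z \<epsilon> \<Longrightarrow> (w - z) \<bullet> N > 0 \<Longrightarrow> w \<in> T'"
    and U: "open U" "U \<inter> T = {}" "U \<inter> T' = {}"
  shows "z \<notin> closure U"
proof
  assume "z \<in> closure U"
  then obtain w where w: "w \<in> U" "dist w z < \<epsilon>" using \<epsilon> by (meson closure_approachable)
  have "open (U \<inter> ball z \<epsilon>)" "w \<in> U \<inter> ball z \<epsilon>" using U w by (auto simp: dist_commute)
  then obtain t where t: "0 < t" "ball w t \<subseteq> U \<inter> ball z \<epsilon>" by (meson openE)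
  have z0: "(w - z) \<bullet> N = 0"
  proof (rule ccontr)
    assume "(w - z) \<bullet> N \<noteq> 0"
    then consider "(w - z) \<bullet> N < 0" | "(w - z) \<bullet> N > 0" by linarith
    then show False using T[of w] w U by cases (auto simp: dist_commute)
  qed
  define w' where "w' = w - (t / 2) *\<^sub>R N"
  have w': "w' \<in> U \<inter> ball z \<epsilon>" using t N by (intro subsetD[OF t(2)]) (simp add: w'_def dist_norm)
  have "N \<bullet> N = 1" using N by (simp add: norm_eq_1)
  then have "(w' - z) \<bullet> N < 0" using z0 t(1) by (simp add: w'_def inner_diff_left)
  then show False using T(1)[of w'] w' U by auto
qed

section \<open>Elements, corners and facets\<close>

locale mixed_mesh = mixed_domain +
  fixes M :: mesh
  assumes mesh: "mesh_of \<Omega> M"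
    and stars: "\<And>T. T \<in> M \<Longrightarrow> \<exists>a \<rho>. star_domain T a \<rho>"
begin

lemma mesh_basics:
  "finite M" "\<And>T. T \<in> M \<Longrightarrow> open T" "\<And>T. T \<in> M \<Longrightarrow> T \<noteq> {}" "\<And>T. T \<in> M \<Longrightarrow> T \<subseteq> \<Omega>"
  "\<And>T T'. T \<in> M \<Longrightarrow> T' \<in> M \<Longrightarrow> T \<noteq> T' \<Longrightarrow> T \<inter> T' = {}" "closure \<Omega> = (\<Union>T\<in>M. closure T)"
  "\<And>T T'. T \<in> M \<Longrightarrow> T' \<in> M \<Longrightarrow> T \<noteq> T' \<Longrightarrow> frontier T \<inter> frontier T' = {} \<or> (\<exists>a b. frontier T \<inter> frontier T' = closed_segment a b)"
  using mesh unfolding mesh_of_def by (auto simp: disjoint_def pairwise_def disjnt_def)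

text \<open>Existence is witnessed by the end points of all pairwise intersections, one-point
  intersections included. Off this finite set two element frontiers meet only in the relative
  interior of a segment.\<close>

definition corners :: "point set" where
  "corners = (SOME C. finite C \<and> (\<forall>T\<in>M. \<forall>T'\<in>M. T \<noteq> T' \<longrightarrow> (\<forall>z\<in>frontier T \<inter> frontier T'. z \<notin> C \<longrightarrow>
     (\<exists>p q. p \<noteq> q \<and> frontier T \<inter> frontier T' = closed_segment p q \<and> z \<in> open_segment p q))))"

lemma corners:
  "finite corners"
  "\<And>T T' z. T \<in> M \<Longrightarrow> T' \<in> M \<Longrightarrow> T \<noteq> T' \<Longrightarrow> z \<in> frontier T \<Longrightarrow> z \<in> frontier T' \<Longrightarrow> z \<notin> corners \<Longrightarrow>
     \<exists>p q. p \<noteq> q \<and> frontier T \<inter> frontier T' = closed_segment p q \<and> z \<in> open_segment p q"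
proof -
  have "\<forall>T T'. \<exists>a b. T \<in> M \<longrightarrow> T' \<in> M \<longrightarrow> T \<noteq> T' \<longrightarrow> frontier T \<inter> frontier T' = {} \<or> frontier T \<inter> frontier T' = closed_segment a b"
    using mesh_basics(7) by blast
  then obtain A B where AB: "\<And>T T'. T \<in> M \<Longrightarrow> T' \<in> M \<Longrightarrow> T \<noteq> T' \<Longrightarrow>
      frontier T \<inter> frontier T' = {} \<or> frontier T \<inter> frontier T' = closed_segment (A T T') (B T T')"
    by metis
  define C where "C = (\<lambda>(T, T'). A T T') ` (M \<times> M) \<union> (\<lambda>(T, T'). B T T') ` (M \<times> M)"
  have "finite C" using mesh_basics(1) by (auto simp: C_def)
  moreover have "\<exists>p q. p \<noteq> q \<and> frontier T \<inter> frontier T' = closed_segment p q \<and> z \<in> open_segment p q"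
    if T: "T \<in> M" "T' \<in> M" "T \<noteq> T'" and z: "z \<in> frontier T \<inter> frontier T'" "z \<notin> C" for T T' z
  proof -
    have eq: "frontier T \<inter> frontier T' = closed_segment (A T T') (B T T')" using AB[OF T] z by auto
    have "A T T' \<in> C" "B T T' \<in> C" using T by (auto simp: C_def)
    then have ne: "z \<noteq> A T T'" "z \<noteq> B T T'" using z(2) by auto
    then have os: "z \<in> open_segment (A T T') (B T T')" using z(1) eq by (simp add: open_segment_def)
    then have "A T T' \<noteq> B T T'" by auto
    then show ?thesis using eq os by blast
  qed
  ultimately have "\<exists>C. finite C \<and> (\<forall>T\<in>M. \<forall>T'\<in>M. T \<noteq> T' \<longrightarrow> (\<forall>z\<in>frontier T \<inter> frontier T'. z \<notin> C \<longrightarrow>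
     (\<exists>p q. p \<noteq> q \<and> frontier T \<inter> frontier T' = closed_segment p q \<and> z \<in> open_segment p q)))" by blast
  then have *: "finite corners \<and> (\<forall>T\<in>M. \<forall>T'\<in>M. T \<noteq> T' \<longrightarrow> (\<forall>z\<in>frontier T \<inter> frontier T'. z \<notin> corners \<longrightarrow>
     (\<exists>p q. p \<noteq> q \<and> frontier T \<inter> frontier T' = closed_segment p q \<and> z \<in> open_segment p q)))"
    unfolding corners_def by (rule someI_ex)
  show "finite corners" using * by blast
  show "\<exists>p q. p \<noteq> q \<and> frontier T \<inter> frontier T' = closed_segment p q \<and> z \<in> open_segment p q"
    if "T \<in> M" "T' \<in> M" "T \<noteq> T'" "z \<in> frontier T" "z \<in> frontier T'" "z \<notin> corners" for T T' z
    using * that by blast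
qed

text \<open>Each element is locally a half plane along the segment, with a normal orthogonal to it.
  The two normals are equal or opposite, and equal ones would make the elements overlap.\<close>

lemma interior_pair:
  assumes T: "T \<in> M" "T' \<in> M" "T \<noteq> T'" and seg: "frontier T \<inter> frontier T' = closed_segment p q" "p \<noteq> q"
  shows "\<exists>N. norm N = 1 \<and> (\<forall>z\<in>open_segment p q. \<exists>\<epsilon>>0. \<forall>w\<in>ball z \<epsilon>.
    (w \<in> T \<longleftrightarrow> (w - z) \<bullet> N < 0) \<and> (w \<in> T' \<longleftrightarrow> (w - z) \<bullet> N > 0))"
proof -
  obtain a \<rho> where "star_domain T a \<rho>" using stars[OF T(1)] by blast
  from star_domain.flat_side[OF this seg(2)] obtain N where N: "norm N = 1" "N \<bullet> (q - p) = 0"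
    "\<And>z. z \<in> open_segment p q \<Longrightarrow> \<exists>\<epsilon>>0. \<forall>w\<in>ball z \<epsilon>. w \<in> T \<longleftrightarrow> (w - z) \<bullet> N < 0" using seg(1) by blast
  obtain a' \<rho>' where "star_domain T' a' \<rho>'" using stars[OF T(2)] by blast
  from star_domain.flat_side[OF this seg(2)] obtain N' where N': "norm N' = 1" "N' \<bullet> (q - p) = 0"
    "\<And>z. z \<in> open_segment p q \<Longrightarrow> \<exists>\<epsilon>>0. \<forall>w\<in>ball z \<epsilon>. w \<in> T' \<longleftrightarrow> (w - z) \<bullet> N' < 0" using seg(1) by blast
  have both: "\<exists>\<epsilon>>0. \<forall>w\<in>ball z \<epsilon>. (w \<in> T \<longleftrightarrow> (w - z) \<bullet> N < 0) \<and> (w \<in> T' \<longleftrightarrow> (w - z) \<bullet> N' < 0)"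
    if z: "z \<in> open_segment p q" for z
  proof -
    obtain \<epsilon>1 where "\<epsilon>1 > 0" "\<forall>w\<in>ball z \<epsilon>1. w \<in> T \<longleftrightarrow> (w - z) \<bullet> N < 0" using N(3)[OF z] by blast
    moreover obtain \<epsilon>2 where "\<epsilon>2 > 0" "\<forall>w\<in>ball z \<epsilon>2. w \<in> T' \<longleftrightarrow> (w - z) \<bullet> N' < 0" using N'(3)[OF z] by blast
    ultimately show ?thesis by (intro exI[of _ "min \<epsilon>1 \<epsilon>2"]) auto
  qed
  have "N' \<noteq> N"
  proof
    assume eq: "N' = N"
    have z: "midpoint p q \<in> open_segment p q" using seg(2) by simp
    obtain \<epsilon> where \<epsilon>: "\<epsilon> > 0" "\<forall>w\<in>ball (midpoint p q) \<epsilon>. (w \<in> T \<longleftrightarrow> (w - midpoint p q) \<bullet> N < 0) \<and> (w \<in> T' \<longleftrightarrow> (w - midpoint p q) \<bullet> N < 0)"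
      using both[OF z] eq by blast
    define w where "w = midpoint p q - (\<epsilon> / 2) *\<^sub>R N"
    have "w \<in> ball (midpoint p q) \<epsilon>" using \<epsilon>(1) N(1) by (simp add: w_def dist_norm)
    moreover have "(w - midpoint p q) \<bullet> N < 0" using \<epsilon>(1) N(1) by (simp add: w_def norm_eq_1)
    ultimately have "w \<in> T \<inter> T'" using \<epsilon>(2) by blast
    then show False using mesh_basics(5)[OF T] by blast
  qed
  then have "N' = - N" using unit_normals_parallel[OF N(1) N'(1) N(2) N'(2)] seg(2) by auto
  then show ?thesis using N(1) both by (intro exI[of _ N]) simp
qed

text \<open>The two elements fill a neighbourhood of \<open>z\<close> up to a line, so
  \<open>z\<close> is not in the closure of any open set disjoint from both. This applies to a third
  element and to the exterior of \<open>\<Omega>\<close>; for the latter \<open>no_slit\<close>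
  gives the claim about the frontier.\<close>

lemma
  assumes T: "T \<in> M" "T' \<in> M" "T \<noteq> T'" and z: "z \<in> frontier T" "z \<in> frontier T'" "z \<notin> corners"
  shows not_in_third: "\<And>T''. T'' \<in> M \<Longrightarrow> z \<in> closure T'' \<Longrightarrow> T'' = T \<or> T'' = T'"
    and interior_pt_not_boundary: "z \<notin> frontier \<Omega>"
proof -
  obtain p q where pq: "p \<noteq> q" "frontier T \<inter> frontier T' = closed_segment p q" "z \<in> open_segment p q"
    using corners(2)[OF T z] by blast
  obtain N \<epsilon> where N: "norm N = 1" "\<epsilon> > 0" "\<And>w. w \<in> ball z \<epsilon> \<Longrightarrow> (w \<in> T \<longleftrightarrow> (w - z) \<bullet> N < 0) \<and> (w \<in> T' \<longleftrightarrow> (w - z) \<bullet> N > 0)"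
    using interior_pair[OF T pq(2,1)] pq(3) by blast
  have *: "z \<notin> closure U" if "open U" "U \<inter> T = {}" "U \<inter> T' = {}" for U
    by (rule two_half_planes_cover[OF N(1,2) _ _ that]) (use N(3) in blast)+
  show "T'' = T \<or> T'' = T'" if "T'' \<in> M" "z \<in> closure T''" for T''
    using *[of T''] mesh_basics(2)[OF that(1)] mesh_basics(5)[OF that(1)] T that(2) by blast
  have "open (- closure \<Omega>)" by (intro open_Compl closed_closure)
  moreover have "- closure \<Omega> \<inter> T = {}" "- closure \<Omega> \<inter> T' = {}"
    using mesh_basics(4)[OF T(1)] mesh_basics(4)[OF T(2)] closure_subset[of \<Omega>] by auto
  ultimately have "z \<notin> closure (- closure \<Omega>)" by (rule *)
  then show "z \<notin> frontier \<Omega>" using no_slit by blast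
qed

lemma frontier_subset_closure: "T \<in> M \<Longrightarrow> frontier T \<subseteq> closure \<Omega>"
  using mesh_basics(6) unfolding frontier_def by blast

text \<open>If no other element touched \<open>z\<close>, a neighbourhood of \<open>z\<close> would
  lie in the closure of \<open>T\<close>, and \<open>interior_closure_T\<close> would put
  \<open>z\<close> into \<open>T\<close>.\<close>

lemma frontier_cases:
  assumes T: "T \<in> M" and z: "z \<in> frontier T" "z \<notin> frontier \<Omega>"
  shows "\<exists>T'\<in>M. T' \<noteq> T \<and> z \<in> frontier T'"
proof (rule ccontr)
  assume no: "\<not> ?thesis"
  obtain a \<rho> where st: "star_domain T a \<rho>" using stars[OF T] by blast
  have "z \<in> \<Omega>" using z frontier_subset_closure[OF T] basics(1) by (auto simp: frontier_def interior_open)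
  have "z \<notin> closure T'" if T': "T' \<in> M" "T' \<noteq> T" for T'
  proof
    assume "z \<in> closure T'"
    moreover have "z \<notin> T'"
    proof
      assume "z \<in> T'"
      then have "T' \<inter> closure T \<noteq> {}" using z by (auto simp: frontier_def)
      then have "T' \<inter> T \<noteq> {}" using open_Int_closure_eq_empty[OF mesh_basics(2)[OF T'(1)], of T] by blast
      then show False using mesh_basics(5)[OF T'(1) T] T'(2) by blast
    qed
    ultimately show False using no T' mesh_basics(2)[OF T'(1)] by (auto simp: frontier_def interior_open)
  qed
  then have z': "z \<in> \<Omega> - (\<Union>T'\<in>M - {T}. closure T')" using \<open>z \<in> \<Omega>\<close> by blast
  have op: "open (\<Omega> - (\<Union>T'\<in>M - {T}. closure T'))"
    using basics(1) mesh_basics(1) by (intro open_Diff closed_UN) auto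
  have "\<Omega> - (\<Union>T'\<in>M - {T}. closure T') \<subseteq> closure T" using mesh_basics(6) closure_subset[of \<Omega>] by blast
  then have "\<Omega> - (\<Union>T'\<in>M - {T}. closure T') \<subseteq> interior (closure T)" using op by (rule interior_maximal)
  then have "z \<in> T" using z' star_domain.interior_closure_T[OF st] by blast
  then show False using z(1) mesh_basics(2)[OF T] by (simp add: frontier_def interior_open)
qed

text \<open>Other elements keep away from \<open>z\<close>, since a common frontier point off the
  corners is not a boundary point of \<open>\<Omega>\<close>; regularity of \<open>T\<close> removes
  the closure. Hence both sets have the same normal at \<open>z\<close>.\<close>

lemma local_at_boundary:
  assumes T: "T \<in> M" and z: "z \<in> frontier T" "z \<in> frontier \<Omega>" "z \<notin> corners"
  shows "\<exists>\<epsilon>>0. \<forall>w\<in>ball z \<epsilon>. w \<in> \<Omega> \<longleftrightarrow> w \<in> T"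
proof -
  obtain a \<rho> where st: "star_domain T a \<rho>" using stars[OF T] by blast
  have "z \<notin> \<Omega>" using z(2) basics(1) by (simp add: frontier_def interior_open)
  have "z \<notin> closure T'" if T': "T' \<in> M" "T' \<noteq> T" for T'
  proof
    assume "z \<in> closure T'"
    then have "z \<in> frontier T'" using \<open>z \<notin> \<Omega>\<close> mesh_basics(2,4)[OF T'(1)] by (auto simp: frontier_def interior_open)
    then show False using interior_pt_not_boundary[OF T'(1) T T'(2)] z by blast
  qed
  then have "z \<in> - (\<Union>T'\<in>M - {T}. closure T')" by blast
  moreover have "open (- (\<Union>T'\<in>M - {T}. closure T'))" using mesh_basics(1) by (intro open_Compl closed_UN) auto
  ultimately obtain \<epsilon> where \<epsilon>: "0 < \<epsilon>" "ball z \<epsilon> \<subseteq> - (\<Union>T'\<in>M - {T}. closure T')" by (meson openE)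
  have "\<Omega> \<inter> ball z \<epsilon> \<subseteq> closure T" using mesh_basics(6) closure_subset[of \<Omega>] \<epsilon>(2) by blast
  then have "\<Omega> \<inter> ball z \<epsilon> \<subseteq> interior (closure T)" using basics(1) by (intro interior_maximal) auto
  then have "\<Omega> \<inter> ball z \<epsilon> \<subseteq> T" using star_domain.interior_closure_T[OF st] by blast
  then show ?thesis using \<epsilon>(1) mesh_basics(4)[OF T] by blast
qed

definition "pieces = {Gamma0 \<Omega>, Gamma1 K yc, Gamma2 K yc}"

definition "bfacets = boundary_facets (Gamma0 \<Omega>) M \<union> boundary_facets (Gamma1 K yc) M \<union> boundary_facets (Gamma2 K yc) M"

lemma bfacets_iff: "F \<in> bfacets \<longleftrightarrow> (\<exists>T\<in>M. \<exists>G\<in>pieces. F = frontier T \<inter> G \<and> emeasure hausdorff1 F > 0)"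
  unfolding bfacets_def boundary_facets_def pieces_def by blast

lemma pieces_frontier: "\<Union>pieces = frontier \<Omega>"
  using basics(8) by (auto simp: pieces_def)

lemma pieces_borel: "G \<in> pieces \<Longrightarrow> G \<in> sets borel"
  using Gamma_sets by (auto simp: pieces_def)

lemma finite_facets: "finite (interior_facets M)" "finite bfacets"
proof -
  have "interior_facets M \<subseteq> (\<lambda>(T, T'). frontier T \<inter> frontier T') ` (M \<times> M)"
    unfolding interior_facets_def by auto
  then show "finite (interior_facets M)" using mesh_basics(1) by (meson finite_SigmaI finite_imageI finite_subset)
  have "bfacets \<subseteq> (\<lambda>(T, G). frontier T \<inter> G) ` (M \<times> pieces)" unfolding subset_iff bfacets_iff by auto
  moreover have "finite pieces" by (simp add: pieces_def)
  ultimately show "finite bfacets" using mesh_basics(1) by (meson finite_SigmaI finite_imageI finite_subset)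
qed

lemma facet_borel: "F \<in> interior_facets M \<union> bfacets \<Longrightarrow> F \<in> sets borel"
proof (elim UnE)
  show "F \<in> interior_facets M \<Longrightarrow> F \<in> sets borel" unfolding interior_facets_def by (auto intro!: borel_closed closed_Int)
  assume "F \<in> bfacets"
  then obtain T G where "G \<in> pieces" "F = frontier T \<inter> G" by (auto simp: bfacets_iff)
  then show "F \<in> sets borel" using pieces_borel by (auto intro!: sets.Int borel_closed)
qed

lemma positive_imp_off_corners:
  assumes "emeasure hausdorff1 F > 0"
  shows "\<exists>z\<in>F. z \<notin> corners"
proof (rule ccontr)
  assume "\<not> ?thesis"
  then have "F \<subseteq> corners" by blast
  then have "F \<in> null_sets hausdorff1" using hausdorff1_null_subset finite_null_hausdorff1[OF corners(1)] by blast
  then show False using assms by (simp add: null_sets_def)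
qed

text \<open>A set of positive length contains a point off the corners, and such a boundary point
  belongs to the frontier of only one element.\<close>

lemma boundary_facet:
  assumes F: "F \<in> bfacets"
  shows "\<exists>T\<in>M. (\<exists>G\<in>pieces. F = frontier T \<inter> G) \<and> sides M F = {T} \<and> boundary_elem M F = T"
    and "F \<subseteq> frontier \<Omega>" "F \<notin> interior_facets M" "emeasure hausdorff1 F > 0"
proof -
  obtain T G where T: "T \<in> M" "G \<in> pieces" "F = frontier T \<inter> G" "emeasure hausdorff1 F > 0" using F by (auto simp: bfacets_iff)
  obtain z where z: "z \<in> F" "z \<notin> corners" using positive_imp_off_corners[OF T(4)] by blast
  show sub: "F \<subseteq> frontier \<Omega>" using T(2,3) pieces_frontier by blast
  have uniq: "T' = T" if "T' \<in> M" "F \<subseteq> frontier T'" for T'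
    using interior_pt_not_boundary[OF that(1) T(1), of z] that z sub T(3) by blast
  have "sides M F = {T}" unfolding sides_def using uniq T by blast
  moreover have "boundary_elem M F = T" unfolding boundary_elem_def using uniq T by (intro the_equality) auto
  ultimately show "\<exists>T\<in>M. (\<exists>G\<in>pieces. F = frontier T \<inter> G) \<and> sides M F = {T} \<and> boundary_elem M F = T" using T by blast
  show "F \<notin> interior_facets M"
  proof
    assume "F \<in> interior_facets M"
    then obtain T1 T2 where "T1 \<in> M" "T2 \<in> M" "T1 \<noteq> T2" "F = frontier T1 \<inter> frontier T2" unfolding interior_facets_def by blast
    then show False using uniq[of T1] uniq[of T2] by blast
  qed
  show "emeasure hausdorff1 F > 0" by (rule T(4))
qed

lemma interior_facet:
  assumes F: "F \<in> interior_facets M"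
  shows "\<exists>T T' N. T \<in> M \<and> T' \<in> M \<and> T \<noteq> T' \<and> sides M F = {T, T'} \<and> norm N = 1 \<and>
    (\<forall>z\<in>F - corners. is_outer_normal T z N \<and> is_outer_normal T' z (- N))"
    and "emeasure hausdorff1 F > 0"
proof -
  obtain T T' p q where T: "T \<in> M" "T' \<in> M" "T \<noteq> T'" "F = frontier T \<inter> frontier T'" "p \<noteq> q" "F = closed_segment p q"
    using F unfolding interior_facets_def by blast
  obtain N where N: "norm N = 1" "\<And>z. z \<in> open_segment p q \<Longrightarrow> \<exists>\<epsilon>>0. \<forall>w\<in>ball z \<epsilon>.
    (w \<in> T \<longleftrightarrow> (w - z) \<bullet> N < 0) \<and> (w \<in> T' \<longleftrightarrow> (w - z) \<bullet> N > 0)"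
    using interior_pair[OF T(1-3), of p q] T by blast
  have "ennreal (dist p q) \<le> hausdorff1_outer F" unfolding T(6) by (rule hausdorff1_outer_connected) auto
  moreover have "F \<in> sets hausdorff1" unfolding T(6) by (intro borel_imp_hausdorff1 borel_closed) simp
  ultimately show pos: "emeasure hausdorff1 F > 0"
    using T(5) by (simp add: emeasure_hausdorff1 order_less_le_trans[of 0 "ennreal (dist p q)"])
  obtain z0 where z0: "z0 \<in> F" "z0 \<notin> corners" using positive_imp_off_corners[OF pos] by blast
  have "T'' = T \<or> T'' = T'" if "T'' \<in> M" "F \<subseteq> frontier T''" for T''
  proof (rule not_in_third[OF T(1-3) _ _ z0(2) that(1)])
    show "z0 \<in> closure T''" using that(2) z0(1) by (auto simp: frontier_def)
  qed (use z0(1) T(4) in auto)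
  then have "sides M F = {T, T'}" unfolding sides_def using T by blast
  moreover have "is_outer_normal T z N \<and> is_outer_normal T' z (- N)" if z: "z \<in> F - corners" for z
  proof -
    obtain p' q' where pq: "p' \<noteq> q'" "frontier T \<inter> frontier T' = closed_segment p' q'" "z \<in> open_segment p' q'"
      using corners(2)[OF T(1-3), of z] z T(4) by blast
    \<comment> \<open>\<open>corners\<close> may represent the facet by end points in another order;
      the open segment is the same.\<close>
    have "closed_segment p q = closed_segment p' q'" using pq(2) T(4,6) by simp
    then have "{p, q} = {p', q'}" by (simp add: closed_segment_eq)
    then have "z \<in> open_segment p q" using pq(3) by (metis open_segment_commute doubleton_eq_iff)
    then obtain \<epsilon> where e: "\<epsilon> > 0" "\<And>w. w \<in> ball z \<epsilon> \<Longrightarrow> (w \<in> T \<longleftrightarrow> (w - z) \<bullet> N < 0) \<and> (w \<in> T' \<longleftrightarrow> (w - z) \<bullet> N > 0)"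
      using N(2) by blast
    show ?thesis
      using half_plane_normal[OF N(1) e(1), of z T] half_plane_normal[of "- N" \<epsilon> z T'] N(1) e by auto
  qed
  ultimately show "\<exists>T T' N. T \<in> M \<and> T' \<in> M \<and> T \<noteq> T' \<and> sides M F = {T, T'} \<and> norm N = 1 \<and>
    (\<forall>z\<in>F - corners. is_outer_normal T z N \<and> is_outer_normal T' z (- N))" using T N(1) by blast
qed

definition "facets = interior_facets M \<union> bfacets"

text \<open>A generic point of the frontier of \<open>T\<close> is either on
  \<open>frontier \<Omega>\<close> and then in one boundary piece, or shared with exactly one other
  element. Since facets are intersections, hanging nodes need no separate treatment.\<close>

lemma facet_partition:
  assumes T: "T \<in> M"
  shows "AE z in hausdorff1. (\<Sum>F\<in>{F \<in> facets. F \<subseteq> frontier T}. indicator F z) = (indicator (frontier T) z :: real)"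
proof -
  \<comment> \<open>Besides the corners, the exceptions are the point where the two characteristics
    meet and those contacts of \<open>T\<close> with the boundary that are too small to be
    facets.\<close>
  define N where "N = corners \<union> {(0, yc)} \<union> (\<Union>G\<in>{G \<in> pieces. frontier T \<inter> G \<notin> bfacets}. frontier T \<inter> G)"
  have null: "N \<in> null_sets hausdorff1"
    unfolding N_def
  proof (intro null_sets.Un)
    show "corners \<in> null_sets hausdorff1" "{(0, yc)} \<in> null_sets hausdorff1"
      by (rule finite_null_hausdorff1, simp add: corners(1))+
    show "(\<Union>G\<in>{G \<in> pieces. frontier T \<inter> G \<notin> bfacets}. frontier T \<inter> G) \<in> null_sets hausdorff1"
    proof (rule null_sets_UN')
      show "countable {G \<in> pieces. frontier T \<inter> G \<notin> bfacets}" by (simp add: pieces_def countable_finite)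
      fix G assume G: "G \<in> {G \<in> pieces. frontier T \<inter> G \<notin> bfacets}"
      have "frontier T \<inter> G \<in> sets hausdorff1"
        by (rule borel_imp_hausdorff1, rule sets.Int[OF borel_closed[OF frontier_closed] pieces_borel]) (use G in auto)
      moreover have "\<not> emeasure hausdorff1 (frontier T \<inter> G) > 0" using G T by (auto simp: bfacets_iff)
      ultimately show "frontier T \<inter> G \<in> null_sets hausdorff1" by auto
    qed
  qed
  have main: "\<exists>F\<in>facets. F \<subseteq> frontier T \<and> z \<in> F \<and> (\<forall>F'\<in>facets. F' \<subseteq> frontier T \<longrightarrow> z \<in> F' \<longrightarrow> F' = F)"
    if z: "z \<in> frontier T" "z \<notin> N" for z
  proof (cases "z \<in> frontier \<Omega>")
    case True
    have zc: "z \<notin> corners" using z by (simp add: N_def)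
    obtain G where G: "G \<in> pieces" "z \<in> G" using True pieces_frontier by blast
    have F: "frontier T \<inter> G \<in> bfacets" using z G by (auto simp: N_def)
    show ?thesis
    proof (intro bexI[of _ "frontier T \<inter> G"] conjI ballI impI)
      fix F' assume F': "F' \<in> facets" "F' \<subseteq> frontier T" "z \<in> F'"
      have "F' \<notin> interior_facets M"
      proof
        assume "F' \<in> interior_facets M"
        then obtain T1 T2 where "T1 \<in> M" "T2 \<in> M" "T1 \<noteq> T2" "F' = frontier T1 \<inter> frontier T2" unfolding interior_facets_def by blast
        then show False using interior_pt_not_boundary[of T1 T2 z] F' zc True by blast
      qed
      then obtain T2 G2 where T2: "T2 \<in> M" "G2 \<in> pieces" "F' = frontier T2 \<inter> G2" using F' by (auto simp: facets_def bfacets_iff)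
      have "T2 = T" using interior_pt_not_boundary[OF T2(1) T, of z] zc True T2 F' z by blast
      moreover have "G2 = G"
      proof (rule ccontr)
        assume "G2 \<noteq> G"
        then have "z = (0, yc)" using G T2 F' Gamma_disjoint by (auto simp: pieces_def)
        then show False using z by (simp add: N_def)
      qed
      ultimately show "F' = frontier T \<inter> G" using T2 by simp
    qed (use F z G in \<open>auto simp: facets_def\<close>)
  next
    case False
    have zc: "z \<notin> corners" using z by (simp add: N_def)
    obtain T' where T': "T' \<in> M" "T' \<noteq> T" "z \<in> frontier T'" using frontier_cases[OF T z(1) False] by blast
    obtain p q where pq: "p \<noteq> q" "frontier T \<inter> frontier T' = closed_segment p q"
      using corners(2)[OF T T'(1) _ z(1) T'(3) zc] T'(2) by blast
    have F: "frontier T \<inter> frontier T' \<in> interior_facets M" unfolding interior_facets_def using T T' pq by blast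
    show ?thesis
    proof (intro bexI[of _ "frontier T \<inter> frontier T'"] conjI ballI impI)
      fix F' assume F': "F' \<in> facets" "F' \<subseteq> frontier T" "z \<in> F'"
      have "F' \<notin> bfacets" using boundary_facet(2) F' False by blast
      then have "F' \<in> interior_facets M" using F' by (simp add: facets_def)
      then obtain T1 T2 where T12: "T1 \<in> M" "T2 \<in> M" "T1 \<noteq> T2" "F' = frontier T1 \<inter> frontier T2" unfolding interior_facets_def by blast
      have "z \<in> closure T1" "z \<in> closure T2" using T12(4) F'(3) by (auto simp: frontier_def)
      then have "T1 = T \<or> T1 = T'" "T2 = T \<or> T2 = T'"
        using not_in_third[OF T T'(1) _ z(1) T'(3) zc] T12 T'(2) by blast+
      then show "F' = frontier T \<inter> frontier T'" using T12 by blast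
    qed (use F z T' in \<open>auto simp: facets_def\<close>)
  qed
  have "(\<Sum>F\<in>{F \<in> facets. F \<subseteq> frontier T}. indicator F z) = (indicator (frontier T) z :: real)" if zN: "z \<notin> N" for z
  proof (cases "z \<in> frontier T")
    case True
    obtain F where F: "F \<in> facets" "F \<subseteq> frontier T" "z \<in> F" "\<And>F'. F' \<in> facets \<Longrightarrow> F' \<subseteq> frontier T \<Longrightarrow> z \<in> F' \<Longrightarrow> F' = F"
      using main[OF True zN] by blast
    have fin: "finite {F \<in> facets. F \<subseteq> frontier T}" using finite_facets by (simp add: facets_def)
    have "(\<Sum>F'\<in>{F \<in> facets. F \<subseteq> frontier T}. indicator F' z) = (\<Sum>F'\<in>{F \<in> facets. F \<subseteq> frontier T}. if F' = F then 1 else 0 :: real)"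
    proof (rule sum.cong[OF refl])
      fix F' assume "F' \<in> {F \<in> facets. F \<subseteq> frontier T}"
      then have "z \<in> F' \<longleftrightarrow> F' = F" using F(3) F(4)[of F'] by blast
      then show "indicator F' z = (if F' = F then 1 else 0 :: real)"
        using F(3) by (cases "F' = F") simp_all
    qed
    also have "\<dots> = 1" using F(1,2) fin by (simp add: sum.delta)
    finally show ?thesis using True by simp
  next
    case False
    then show ?thesis by (auto intro!: sum.neutral simp: indicator_def)
  qed
  then have "{z \<in> space hausdorff1. \<not> (\<Sum>F\<in>{F \<in> facets. F \<subseteq> frontier T}. indicator F z) = (indicator (frontier T) z :: real)} \<subseteq> N" by blast
  then show ?thesis by (rule AE_I'[OF null])
qed

end

section \<open>The facet estimates\<close>

text \<open>If a continuous function exceeds an essential bound somewhere in the open set, it does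
  so on a nonempty open subset, which is not negligible; continuity extends the bound to the
  closure.\<close>

lemma abs_le_Linf_norm:
  fixes f :: "point \<Rightarrow> real"
  assumes \<Omega>: "open \<Omega>" "bounded \<Omega>" and f: "continuous_on (closure \<Omega>) f" and z: "z \<in> closure \<Omega>"
  shows "\<bar>f z\<bar> \<le> Linf_norm \<Omega> f"
proof -
  let ?S = "{C. 0 \<le> C \<and> (AE z in lborel. z \<in> \<Omega> \<longrightarrow> \<bar>f z\<bar> \<le> C)}"
  have "compact (closure \<Omega>)" using \<Omega>(2) by simp
  then have "bounded (f ` closure \<Omega>)" by (intro compact_imp_bounded compact_continuous_image f)
  then obtain B where B: "\<And>z. z \<in> closure \<Omega> \<Longrightarrow> \<bar>f z\<bar> \<le> B" unfolding bounded_iff by (metis imageI real_norm_def)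
  have "\<bar>B\<bar> \<in> ?S" using B closure_subset[of \<Omega>] by (auto intro!: AE_I2 intro: order_trans[OF _ abs_ge_self])
  then have ne: "?S \<noteq> {}" by blast
  have in_open: "\<bar>f z\<bar> \<le> Linf_norm \<Omega> f" if z: "z \<in> \<Omega>" for z
    unfolding Linf_norm_def
  proof (rule cInf_greatest[OF ne])
    fix C assume C: "C \<in> ?S"
    show "\<bar>f z\<bar> \<le> C"
    proof (rule ccontr)
      assume "\<not> \<bar>f z\<bar> \<le> C"
      define U where "U = \<Omega> \<inter> (\<lambda>z. \<bar>f z\<bar>) -` {C<..}"
      have "continuous_on \<Omega> (\<lambda>z. \<bar>f z\<bar>)" by (intro continuous_intros continuous_on_subset[OF f closure_subset])
      then have "open U" unfolding U_def using \<Omega>(1) by (simp add: continuous_on_open_vimage Int_commute)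
      moreover have "z \<in> U" using z \<open>\<not> \<bar>f z\<bar> \<le> C\<close> by (simp add: U_def)
      ultimately have "\<not> negligible U" using open_not_negligible by blast
      moreover have "AE z in lborel. z \<notin> U" using C by (auto simp: U_def elim!: eventually_mono)
      then have "U \<in> null_sets lborel" using \<open>open U\<close> by (subst AE_iff_null_sets) auto
      then have "negligible U" by (simp add: negligible_iff_null_sets null_sets_completionI)
      ultimately show False by blast
    qed
  qed
  have "continuous_on (closure \<Omega>) (\<lambda>z. \<bar>f z\<bar>)" by (intro continuous_intros f)
  from continuous_le_on_closure[OF this z in_open] show ?thesis .
qed

text \<open>With \<open>y = \<delta> / (8 * C\<^sup>2) * (h / P)\<close> the square of
  \<open>y * s - 5 * \<beta> * t\<close> leaves \<open>25 * \<beta>\<^sup>2 * t\<^sup>2 / y\<close>.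
  Its factor 25 is enlarged to 27 so that 27 * 8 = 3/4 * 288.\<close>

lemma young_penalty:
  fixes \<beta> C \<delta> P h s t \<gamma> :: real
  assumes "0 < C" "0 < \<delta>" "0 < P" "0 < h" "0 \<le> \<beta>" "288 * \<beta>\<^sup>2 * C\<^sup>2 / \<delta> \<le> \<gamma>"
  shows "10 * \<beta> * s * t \<le> 3/4 * (\<gamma> * P / h * t\<^sup>2) + \<delta> / (8 * C\<^sup>2) * (h / P * s\<^sup>2)"
proof -
  define y where "y = \<delta> / (8 * C\<^sup>2) * (h / P)"
  have y: "0 < y" using assms by (simp add: y_def)
  have "0 \<le> (y * s - 5 * \<beta> * t)\<^sup>2 / y" using y by simp
  also have "(y * s - 5 * \<beta> * t)\<^sup>2 / y = y * s\<^sup>2 - 10 * \<beta> * s * t + 25 * \<beta>\<^sup>2 * t\<^sup>2 / y"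
    using y by (simp add: field_simps power2_eq_square)
  finally have 1: "10 * \<beta> * s * t \<le> y * s\<^sup>2 + 25 * \<beta>\<^sup>2 * t\<^sup>2 / y" by simp
  have "25 * \<beta>\<^sup>2 * t\<^sup>2 / y \<le> 27 * \<beta>\<^sup>2 * t\<^sup>2 / y" using y by (intro divide_right_mono mult_right_mono) auto
  also have "27 * \<beta>\<^sup>2 * t\<^sup>2 / y = 3/4 * (288 * \<beta>\<^sup>2 * C\<^sup>2 / \<delta> * P / h * t\<^sup>2)"
    using assms by (simp add: y_def field_simps)
  also have "\<dots> \<le> 3/4 * (\<gamma> * P / h * t\<^sup>2)"
    using assms by (intro mult_left_mono mult_right_mono divide_right_mono) auto
  finally show ?thesis using 1 by (simp add: y_def)
qed

text \<open>The boundary integrand on an interior facet is the product of two determinants: with the mean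
  gradient \<open>A\<close> and the gradient jump \<open>D\<close> it equals \<open>det (W A, m) * det (N, D)\<close>.\<close>

lemma interior_integrand_bound:
  fixes k b c g1 g2 h1 h2 n1 n2 \<beta> :: real
  assumes \<beta>: "\<bar>k * c\<bar> \<le> \<beta>" "\<bar>b\<bar> \<le> \<beta>" and n: "\<bar>n1\<bar> \<le> 1" "\<bar>n2\<bar> \<le> 1"
  defines "E \<equiv> 1/2 * (k * (g1 + h1) * n1 + (g2 + h2) * n2) * (b * (g1 - h1) + c * (g2 - h2))
    - 1/2 * ((k * g1\<^sup>2 + g2\<^sup>2) * (b * n1 + c * n2) - (k * h1\<^sup>2 + h2\<^sup>2) * (b * n1 + c * n2))"
  shows "\<bar>E\<bar> \<le> 10 * \<beta> * sqrt (g1\<^sup>2 + g2\<^sup>2 + (h1\<^sup>2 + h2\<^sup>2)) * sqrt ((g1 - h1)\<^sup>2 + (g2 - h2)\<^sup>2)"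
proof -
  define s t where "s = sqrt (g1\<^sup>2 + g2\<^sup>2 + (h1\<^sup>2 + h2\<^sup>2))" and "t = sqrt ((g1 - h1)\<^sup>2 + (g2 - h2)\<^sup>2)"
  have E: "E = (k * c * ((g1 + h1) / 2) - b * ((g2 + h2) / 2)) * (n1 * (g2 - h2) - n2 * (g1 - h1))"
    by (simp add: E_def field_simps power2_eq_square)
  have b0: "0 \<le> \<beta>" using \<beta> by linarith
  have le_s: "\<bar>g1\<bar> \<le> s" "\<bar>g2\<bar> \<le> s" "\<bar>h1\<bar> \<le> s" "\<bar>h2\<bar> \<le> s"
    unfolding s_def by (rule real_le_rsqrt; simp)+
  have le_t: "\<bar>g1 - h1\<bar> \<le> t" "\<bar>g2 - h2\<bar> \<le> t"
    unfolding t_def by (rule real_le_rsqrt; simp)+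
  have "\<bar>g1 + h1\<bar> \<le> 2 * s" "\<bar>g2 + h2\<bar> \<le> 2 * s" using le_s by linarith+
  then have A: "\<bar>(g1 + h1) / 2\<bar> \<le> s" "\<bar>(g2 + h2) / 2\<bar> \<le> s" by (simp_all add: abs_divide)
  have s0: "0 \<le> s" "0 \<le> t" by (simp_all add: s_def t_def)
  have "\<bar>k * c * ((g1 + h1) / 2)\<bar> \<le> \<beta> * s" "\<bar>b * ((g2 + h2) / 2)\<bar> \<le> \<beta> * s"
    unfolding abs_mult[of "k * c"] abs_mult[of b] using \<beta> A b0 by (intro mult_mono; simp)+
  then have 1: "\<bar>k * c * ((g1 + h1) / 2) - b * ((g2 + h2) / 2)\<bar> \<le> 2 * (\<beta> * s)" by linarith
  have "\<bar>n1 * (g2 - h2)\<bar> \<le> 1 * t" "\<bar>n2 * (g1 - h1)\<bar> \<le> 1 * t"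
    unfolding abs_mult using n le_t by (intro mult_mono; simp)+
  then have 2: "\<bar>n1 * (g2 - h2) - n2 * (g1 - h1)\<bar> \<le> 2 * t" by linarith
  have "\<bar>E\<bar> \<le> (2 * (\<beta> * s)) * (2 * t)" unfolding E abs_mult using 1 2 b0 s0 by (intro mult_mono) auto
  \<comment> \<open>The factor 4 is enlarged to 10 so that interior and boundary facets share
    \<open>young_penalty\<close>.\<close>
  also have "\<dots> \<le> 10 * (\<beta> * s * t)" using b0 s0 by simp
  finally show ?thesis by (simp add: s_def t_def mult.assoc)
qed

lemma unit_pair_products:
  fixes n1 n2 :: real
  assumes "n1\<^sup>2 + n2\<^sup>2 = 1"
  shows "\<bar>n1\<bar> \<le> 1" "\<bar>n2\<bar> \<le> 1"
proof -
  have "n1\<^sup>2 \<le> 1" "n2\<^sup>2 \<le> 1" using assms zero_le_power2[of n1] zero_le_power2[of n2] by linarith+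
  then show "\<bar>n1\<bar> \<le> 1" "\<bar>n2\<bar> \<le> 1" by (simp_all add: abs_square_le_1)
qed

text \<open>Splitting the gradient into its normal part \<open>gn\<close> and tangential part \<open>gt\<close>, every term of the
  boundary integrand except \<open>gn\<^sup>2 * (m \<bullet> n) * (W n \<bullet> n) / 2\<close> contains a factor \<open>gt\<close>.\<close>

lemma boundary_integrand_bound:
  fixes k b c g1 g2 n1 n2 \<beta> :: real
  assumes \<beta>: "\<bar>k * b\<bar> \<le> \<beta>" "\<bar>b\<bar> \<le> \<beta>" "\<bar>k * c\<bar> \<le> \<beta>" "\<bar>c\<bar> \<le> \<beta>" and n: "n1\<^sup>2 + n2\<^sup>2 = 1"
    and sgn: "0 \<le> (b * n1 + c * n2) * (k * n1\<^sup>2 + n2\<^sup>2)"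
  defines "Q \<equiv> (k * g1 * n1 + g2 * n2) * (b * g1 + c * g2) - 1/2 * ((k * g1\<^sup>2 + g2\<^sup>2) * (b * n1 + c * n2))"
  shows "- Q \<le> 10 * \<beta> * sqrt (g1\<^sup>2 + g2\<^sup>2) * \<bar>- g1 * n2 + g2 * n1\<bar>"
proof -
  define gn gt where "gn = g1 * n1 + g2 * n2" and "gt = - g1 * n2 + g2 * n1"
  define s where "s = sqrt (g1\<^sup>2 + g2\<^sup>2)"
  have g: "g1 = gn * n1 - gt * n2" "g2 = gn * n2 + gt * n1"
  proof -
    have "gn * n1 - gt * n2 = g1 * (n1\<^sup>2 + n2\<^sup>2)" "gn * n2 + gt * n1 = g2 * (n1\<^sup>2 + n2\<^sup>2)"
      by (simp_all add: gn_def gt_def algebra_simps power2_eq_square)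
    then show "g1 = gn * n1 - gt * n2" "g2 = gn * n2 + gt * n1" using n by simp_all
  qed
  define P1 where "P1 = (k * n1\<^sup>2 + n2\<^sup>2) * (- b * n2 + c * n1)"
  define P2 where "P2 = (n1 * n2 - k * n1 * n2) * (- b * n2 + c * n1) - 1/2 * ((b * n1 + c * n2) * (k * n2\<^sup>2 + n1\<^sup>2))"
  have Q: "Q = 1/2 * gn\<^sup>2 * ((b * n1 + c * n2) * (k * n1\<^sup>2 + n2\<^sup>2)) + gn * gt * P1 + gt\<^sup>2 * P2"
    unfolding Q_def g P1_def P2_def by (simp add: field_simps power2_eq_square)
  note n1 = unit_pair_products[OF n]
  have b0: "0 \<le> \<beta>" using \<beta> by linarith
  have sq: "n1\<^sup>2 \<le> 1" "n2\<^sup>2 \<le> 1" using n zero_le_power2[of n1] zero_le_power2[of n2] by linarith+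
  have m1: "\<bar>x * y\<bar> \<le> \<beta>" if "\<bar>x\<bar> \<le> \<beta>" "\<bar>y\<bar> \<le> 1" for x y
    unfolding abs_mult using mult_mono[OF that] b0 by simp
  have m2: "\<bar>x * y\<bar> \<le> 1" if "\<bar>x\<bar> \<le> 1" "\<bar>y\<bar> \<le> 1" for x y :: real
    unfolding abs_mult using mult_mono[OF that] by simp
  have sq': "\<bar>n1\<^sup>2\<bar> \<le> 1" "\<bar>n2\<^sup>2\<bar> \<le> 1" using sq by auto
  note mm = m2 n1 sq'
  \<comment> \<open>Four products, each of a coefficient bounded by \<open>\<beta>\<close> and
    monomials in the normal bounded by 1.\<close>
  have P1: "\<bar>P1\<bar> \<le> 4 * \<beta>"
  proof -
    have "P1 = (k * c) * (n1\<^sup>2 * n1) - (k * b) * (n1\<^sup>2 * n2) + c * (n2\<^sup>2 * n1) - b * (n2\<^sup>2 * n2)"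
      by (simp add: P1_def algebra_simps)
    moreover have "\<bar>(k * c) * (n1\<^sup>2 * n1)\<bar> \<le> \<beta>" "\<bar>(k * b) * (n1\<^sup>2 * n2)\<bar> \<le> \<beta>" "\<bar>c * (n2\<^sup>2 * n1)\<bar> \<le> \<beta>" "\<bar>b * (n2\<^sup>2 * n2)\<bar> \<le> \<beta>"
      by (intro m1 \<beta> mm)+
    ultimately show ?thesis by linarith
  qed
  \<comment> \<open>Four products of this kind with factor 1 and four with factor 1/2; together with
    the 4 from \<open>P1\<close> the total is 10.\<close>
  have P2: "\<bar>P2\<bar> \<le> 6 * \<beta>"
  proof -
    have "2 * P2 = 2 * (c * (n1 * n2 * n1)) - 2 * (b * (n1 * n2 * n2)) - 2 * ((k * c) * (n1 * n2 * n1)) + 2 * ((k * b) * (n1 * n2 * n2))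
        - ((k * b) * (n1 * n2\<^sup>2) + b * (n1 * n1\<^sup>2) + (k * c) * (n2 * n2\<^sup>2) + c * (n2 * n1\<^sup>2))"
      by (simp add: P2_def field_simps)
    moreover have "\<bar>c * (n1 * n2 * n1)\<bar> \<le> \<beta>" "\<bar>b * (n1 * n2 * n2)\<bar> \<le> \<beta>" "\<bar>(k * c) * (n1 * n2 * n1)\<bar> \<le> \<beta>" "\<bar>(k * b) * (n1 * n2 * n2)\<bar> \<le> \<beta>"
      "\<bar>(k * b) * (n1 * n2\<^sup>2)\<bar> \<le> \<beta>" "\<bar>b * (n1 * n1\<^sup>2)\<bar> \<le> \<beta>" "\<bar>(k * c) * (n2 * n2\<^sup>2)\<bar> \<le> \<beta>" "\<bar>c * (n2 * n1\<^sup>2)\<bar> \<le> \<beta>"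
      by (intro m1 \<beta> mm)+
    moreover have "\<bar>y\<bar> \<le> 6 * \<beta>"
      if "2 * y = 2 * x1 - 2 * x2 - 2 * x3 + 2 * x4 - (x5 + x6 + x7 + x8)" "\<bar>x1\<bar> \<le> \<beta>" "\<bar>x2\<bar> \<le> \<beta>" "\<bar>x3\<bar> \<le> \<beta>" "\<bar>x4\<bar> \<le> \<beta>"
        "\<bar>x5\<bar> \<le> \<beta>" "\<bar>x6\<bar> \<le> \<beta>" "\<bar>x7\<bar> \<le> \<beta>" "\<bar>x8\<bar> \<le> \<beta>" for y x1 x2 x3 x4 x5 x6 x7 x8
    proof -
      have "2 * y \<le> 12 * \<beta>" using that[unfolded abs_le_iff] by linarith
      moreover have "- (2 * y) \<le> 12 * \<beta>" using that[unfolded abs_le_iff] by linarith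
      ultimately show ?thesis by simp
    qed
    ultimately show ?thesis by blast
  qed
  have gs: "gn\<^sup>2 + gt\<^sup>2 = g1\<^sup>2 + g2\<^sup>2"
  proof -
    have "gn\<^sup>2 + gt\<^sup>2 = (g1\<^sup>2 + g2\<^sup>2) * (n1\<^sup>2 + n2\<^sup>2)" by (simp add: gn_def gt_def algebra_simps power2_eq_square)
    then show ?thesis using n by simp
  qed
  have le_s: "\<bar>gn\<bar> \<le> s" "\<bar>gt\<bar> \<le> s"
    unfolding s_def gs[symmetric] by (rule real_le_rsqrt; simp)+
  have s0: "0 \<le> s" by (simp add: s_def)
  have "\<bar>gn * gt * P1\<bar> \<le> s * \<bar>gt\<bar> * (4 * \<beta>)" unfolding abs_mult using le_s P1 s0 by (intro mult_mono) auto
  moreover have "\<bar>gt * gt * P2\<bar> \<le> s * \<bar>gt\<bar> * (6 * \<beta>)" unfolding abs_mult using le_s P2 s0 by (intro mult_mono) auto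
  moreover define R where "R = 1/2 * gn\<^sup>2 * ((b * n1 + c * n2) * (k * n1\<^sup>2 + n2\<^sup>2))"
  have "0 \<le> R" unfolding R_def by (rule mult_nonneg_nonneg[OF _ sgn]) simp
  moreover have "Q = R + gn * gt * P1 + gt * gt * P2" unfolding Q R_def power2_eq_square[of gt] by simp
  ultimately have "- Q \<le> s * \<bar>gt\<bar> * (4 * \<beta>) + s * \<bar>gt\<bar> * (6 * \<beta>)" by linarith
  also have "\<dots> = 10 * \<beta> * s * \<bar>gt\<bar>" by (simp add: algebra_simps)
  finally show ?thesis by (simp add: s_def gt_def)
qed

text \<open>The class is closed under sums and products and contains the coefficients, polynomial
  gradients and components of normals. This settles integrability of all facet integrands by their
  form; the bound is required almost everywhere because normals are.\<close>

definition tame :: "point set \<Rightarrow> (point \<Rightarrow> real) \<Rightarrow> bool" where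
  "tame F f \<longleftrightarrow> (\<lambda>z. indicator F z * f z) \<in> borel_measurable hausdorff1 \<and>
     (\<exists>B. AE z in hausdorff1. z \<in> F \<longrightarrow> \<bar>f z\<bar> \<le> B)"

lemma tame_add: "tame F f \<Longrightarrow> tame F g \<Longrightarrow> tame F (\<lambda>z. f z + g z)"
proof -
  assume f: "tame F f" and g: "tame F g"
  obtain B1 B2 where B: "AE z in hausdorff1. z \<in> F \<longrightarrow> \<bar>f z\<bar> \<le> B1" "AE z in hausdorff1. z \<in> F \<longrightarrow> \<bar>g z\<bar> \<le> B2"
    using f g by (auto simp: tame_def)
  have "AE z in hausdorff1. z \<in> F \<longrightarrow> \<bar>f z + g z\<bar> \<le> B1 + B2"
    using B by eventually_elim (auto intro: order_trans[OF abs_triangle_ineq])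
  moreover have "(\<lambda>z. indicator F z * f z + indicator F z * g z) \<in> borel_measurable hausdorff1"
    using f g by (auto simp: tame_def)
  ultimately show ?thesis by (auto simp: tame_def distrib_left)
qed

lemma tame_mult: "tame F f \<Longrightarrow> tame F g \<Longrightarrow> tame F (\<lambda>z. f z * g z)"
proof -
  assume f: "tame F f" and g: "tame F g"
  obtain B1 B2 where B: "AE z in hausdorff1. z \<in> F \<longrightarrow> \<bar>f z\<bar> \<le> B1" "AE z in hausdorff1. z \<in> F \<longrightarrow> \<bar>g z\<bar> \<le> B2"
    using f g by (auto simp: tame_def)
  have "AE z in hausdorff1. z \<in> F \<longrightarrow> \<bar>f z * g z\<bar> \<le> \<bar>B1\<bar> * \<bar>B2\<bar>"
    using B by eventually_elim (auto simp: abs_mult intro!: mult_mono)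
  moreover have "(\<lambda>z. (indicator F z * f z) * (indicator F z * g z)) \<in> borel_measurable hausdorff1"
    using f g by (auto simp: tame_def)
  moreover have "(indicator F z * f z) * (indicator F z * g z) = indicator F z * (f z * g z)" for z
    by (auto simp: indicator_def)
  ultimately show ?thesis unfolding tame_def by (metis (no_types, lifting) ext)
qed

lemma tame_const: "F \<in> sets borel \<Longrightarrow> tame F (\<lambda>z. k)"
  unfolding tame_def by (auto intro!: borel_measurable_hausdorff1 exI[of _ "\<bar>k\<bar>"])

lemma tame_diff: "F \<in> sets borel \<Longrightarrow> tame F f \<Longrightarrow> tame F g \<Longrightarrow> tame F (\<lambda>z. f z - g z)"
  using tame_add[of F f "\<lambda>z. (-1) * g z"] tame_mult[of F "\<lambda>z. -1" g] tame_const[of F "-1"] by simp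

lemma tame_power2: "tame F f \<Longrightarrow> tame F (\<lambda>z. (f z)\<^sup>2)"
  unfolding power2_eq_square by (rule tame_mult)

lemma tame_cong_AE:
  assumes "tame F f" "AE z in hausdorff1. z \<in> F \<longrightarrow> g z = f z"
  shows "tame F g"
  unfolding tame_def
proof
  show "(\<lambda>z. indicator F z * g z) \<in> borel_measurable hausdorff1"
  proof (rule hausdorff1_measurable_AE)
    show "(\<lambda>z. indicator F z * f z) \<in> borel_measurable hausdorff1" using assms(1) by (simp add: tame_def)
    show "AE z in hausdorff1. indicator F z * g z = indicator F z * f z"
      using assms(2) by eventually_elim (auto simp: indicator_def)
  qed
  obtain B where "AE z in hausdorff1. z \<in> F \<longrightarrow> \<bar>f z\<bar> \<le> B" using assms(1) by (auto simp: tame_def)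
  with assms(2) have "AE z in hausdorff1. z \<in> F \<longrightarrow> \<bar>g z\<bar> \<le> B" by eventually_elim auto
  then show "\<exists>B. AE z in hausdorff1. z \<in> F \<longrightarrow> \<bar>g z\<bar> \<le> B" by blast
qed

lemma tame_continuous:
  fixes f :: "point \<Rightarrow> real"
  assumes "F \<in> sets borel" "F \<subseteq> S" "compact S" "continuous_on S f"
  shows "tame F f"
  unfolding tame_def
proof
  have "(\<lambda>z. indicator S z *\<^sub>R f z) \<in> borel_measurable borel"
    using assms by (intro borel_measurable_continuous_on_indicator borel_closed compact_imp_closed)
  then have "(\<lambda>z. indicator F z * (indicator S z *\<^sub>R f z)) \<in> borel_measurable borel" using assms(1) by simp
  moreover have "indicator F z * (indicator S z *\<^sub>R f z) = indicator F z * f z" for z using assms(2) by (auto simp: indicator_def)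
  ultimately show "(\<lambda>z. indicator F z * f z) \<in> borel_measurable hausdorff1"
    by (intro borel_measurable_hausdorff1) (simp only:)
  have "bounded (f ` S)" by (intro compact_imp_bounded compact_continuous_image assms)
  then obtain B where "\<And>z. z \<in> S \<Longrightarrow> \<bar>f z\<bar> \<le> B" unfolding bounded_iff by (metis imageI real_norm_def)
  then show "\<exists>B. AE z in hausdorff1. z \<in> F \<longrightarrow> \<bar>f z\<bar> \<le> B" using assms(2) by (intro exI[of _ B] AE_I2) auto
qed

lemma tame_integrable:
  assumes "tame F f" "F \<in> sets borel" "emeasure hausdorff1 F < top"
  shows "set_integrable hausdorff1 F f"
proof -
  obtain B where B: "AE z in hausdorff1. z \<in> F \<longrightarrow> \<bar>f z\<bar> \<le> B" using assms(1) by (auto simp: tame_def)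
  show ?thesis
    unfolding set_integrable_def
  proof (rule integrableI_bounded_set[where A = F and B = B])
    show "(\<lambda>z. indicator F z *\<^sub>R f z) \<in> borel_measurable hausdorff1" using assms(1) by (simp add: tame_def)
    show "AE z in hausdorff1. z \<in> F \<longrightarrow> norm (indicator F z *\<^sub>R f z) \<le> B"
      using B by eventually_elim (auto simp: indicator_def)
  qed (use assms borel_imp_hausdorff1 in auto)
qed

lemma (in star_domain) tame_normal:
  assumes "F \<in> sets borel" "F \<subseteq> frontier T"
  shows "tame F (\<lambda>z. fst (outer_normal T z))" "tame F (\<lambda>z. snd (outer_normal T z))"
proof -
  have F: "F \<in> sets hausdorff1" using assms(1) by (rule borel_imp_hausdorff1)
  let ?n = "\<lambda>z. indicator (frontier T) z *\<^sub>R outer_normal T z"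
  have m: "(\<lambda>z. fst (?n z)) \<in> borel_measurable hausdorff1" "(\<lambda>z. snd (?n z)) \<in> borel_measurable hausdorff1"
    by (intro borel_measurable_fst borel_measurable_snd outer_normal_measurable)+
  have m': "(\<lambda>z. indicator F z * fst (?n z)) \<in> borel_measurable hausdorff1" "(\<lambda>z. indicator F z * snd (?n z)) \<in> borel_measurable hausdorff1"
    by (intro borel_measurable_times borel_measurable_indicator F m)+
  have eq: "indicator F z * fst (?n z) = indicator F z * fst (outer_normal T z)" "indicator F z * snd (?n z) = indicator F z * snd (outer_normal T z)" for z
    using assms(2) by (auto simp: indicator_def)
  have n1: "AE z in hausdorff1. z \<in> frontier T \<longrightarrow> norm (outer_normal T z) = 1"
    using AE_normal_field by eventually_elim (auto simp: is_outer_normal_def)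
  have b: "AE z in hausdorff1. z \<in> F \<longrightarrow> \<bar>fst (outer_normal T z)\<bar> \<le> 1" "AE z in hausdorff1. z \<in> F \<longrightarrow> \<bar>snd (outer_normal T z)\<bar> \<le> 1"
    using n1 by (eventually_elim, use assms(2) abs_fst_le_norm abs_snd_le_norm in \<open>metis subsetD\<close>)+
  show "tame F (\<lambda>z. fst (outer_normal T z))" "tame F (\<lambda>z. snd (outer_normal T z))"
    unfolding tame_def using m' b unfolding eq by blast+
qed

text \<open>The common shape of the facet estimates: consistency term, half the element fluxes,
  penalty and trace remainder.\<close>

lemma tame_combination_nonneg:
  assumes F: "F \<in> sets borel" "emeasure hausdorff1 F < top"
    and f: "tame F f1" "tame F f2" "tame F f3" "tame F f4"
    and nonneg: "AE z in hausdorff1. z \<in> F \<longrightarrow> 0 \<le> f1 z - f2 z / 2 + k * f3 z + l * f4 z"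
  shows "0 \<le> (LINT z:F|hausdorff1. f1 z) - (LINT z:F|hausdorff1. f2 z) / 2
    + k * (LINT z:F|hausdorff1. f3 z) + l * (LINT z:F|hausdorff1. f4 z)"
proof -
  note I = f[THEN tame_integrable[OF _ F]]
  have "AE z in hausdorff1. 0 \<le> indicator F z *\<^sub>R (f1 z - f2 z / 2 + k * f3 z + l * f4 z)"
    using nonneg by eventually_elim (auto simp: indicator_def)
  then have "0 \<le> (LINT z:F|hausdorff1. f1 z - f2 z / 2 + k * f3 z + l * f4 z)"
    unfolding set_lebesgue_integral_def by (rule integral_nonneg_AE)
  also have "\<dots> = (LINT z:F|hausdorff1. f1 z) - (LINT z:F|hausdorff1. f2 z) / 2
    + k * (LINT z:F|hausdorff1. f3 z) + l * (LINT z:F|hausdorff1. f4 z)"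
    using I by (simp add: set_integral_add set_integral_diff)
  finally show ?thesis .
qed

section \<open>The discrete problem and its estimates on single facets\<close>

locale mixed_problem = mixed_mesh +
  fixes b c :: "real \<Rightarrow> real" and \<delta> \<beta> C :: real and p :: nat and v :: broken
  assumes multiplier: "admissible_multiplier K yc \<Omega> b c \<delta>"
    and coeff_bounds: "\<And>z. z \<in> closure \<Omega> \<Longrightarrow> \<bar>K (snd z) * b (fst z)\<bar> \<le> \<beta>" "\<And>z. z \<in> closure \<Omega> \<Longrightarrow> \<bar>b (fst z)\<bar> \<le> \<beta>"
      "\<And>z. z \<in> closure \<Omega> \<Longrightarrow> \<bar>K (snd z) * c (snd z)\<bar> \<le> \<beta>" "\<And>z. z \<in> closure \<Omega> \<Longrightarrow> \<bar>c (snd z)\<bar> \<le> \<beta>"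
    and trace: "\<And>T f. T \<in> M \<Longrightarrow> f \<in> poly_space p \<Longrightarrow> L2_norm_on hausdorff1 (frontier T) f
      \<le> C * real p * diameter T powr (- 1/2) * L2_norm_on lborel T f"
    and C: "0 < C" and p: "1 \<le> p" and v: "\<And>T. T \<in> M \<Longrightarrow> v T \<in> poly_space p"
begin

lemma multiplier_props:
  "continuous_on (fst ` closure \<Omega>) b" "b C1_differentiable_on (fst ` \<Omega>)"
  "continuous_on (snd ` closure \<Omega>) c" "c C1_differentiable_on (snd ` \<Omega>)" "0 < \<delta>"
  "\<And>z. z \<in> \<Omega> \<Longrightarrow> - K (snd z) * deriv b (fst z) + deriv (\<lambda>s. K s * c s) (snd z) \<ge> \<delta>"
  "\<And>z. z \<in> \<Omega> \<Longrightarrow> deriv b (fst z) - deriv c (snd z) \<ge> \<delta>"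
  "\<And>z. z \<in> Gamma2 K yc \<Longrightarrow> b (fst z) + c (snd z) * sqrt (- K (snd z)) \<le> 0"
  "\<And>z \<nu>. z \<in> Gamma0 \<Omega> \<Longrightarrow> is_outer_normal \<Omega> z \<nu> \<Longrightarrow> 0 \<le> (b (fst z), c (snd z)) \<bullet> \<nu>"
  using multiplier unfolding admissible_multiplier_def by (auto simp: case_prod_beta)

lemma beta_nonneg: "0 \<le> \<beta>"
  using coeff_bounds(2) nonempty closure_subset[of \<Omega>] abs_ge_zero order_trans by blast

definition flux :: "point set \<Rightarrow> point \<Rightarrow> real" where
  "flux T z = (W_grad K (v T) z \<bullet> grad (v T) z) * ((b (fst z), c (snd z)) \<bullet> outer_normal T z)"

definition grad_sq :: "point set \<Rightarrow> point \<Rightarrow> real" where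
  "grad_sq T z = (pd_x (v T) z)\<^sup>2 + (pd_y (v T) z)\<^sup>2"

lemma tame_coeff:
  assumes "F \<in> sets borel" "F \<subseteq> closure \<Omega>"
  shows "tame F (\<lambda>z. K (snd z))" "tame F (\<lambda>z. b (fst z))" "tame F (\<lambda>z. c (snd z))"
    and "T \<in> M \<Longrightarrow> tame F (pd_x (v T))" "T \<in> M \<Longrightarrow> tame F (pd_y (v T))"
proof -
  have "compact (closure \<Omega>)" using basics(3) by simp
  note * = tame_continuous[OF assms this]
  show "tame F (\<lambda>z. K (snd z))" by (intro * continuous_on_compose2[OF basics(4)] continuous_intros) auto
  show "tame F (\<lambda>z. b (fst z))" by (intro * continuous_on_compose2[OF multiplier_props(1)] continuous_intros) auto
  show "tame F (\<lambda>z. c (snd z))" by (intro * continuous_on_compose2[OF multiplier_props(3)] continuous_intros) auto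
  show "T \<in> M \<Longrightarrow> tame F (pd_x (v T))" "T \<in> M \<Longrightarrow> tame F (pd_y (v T))"
    using poly_space_calculus(3,4)[OF v[of T]] by (intro * poly_space_continuous[of _ p]; blast)+
qed

lemma tame_outer_normal:
  assumes "T \<in> M" "F \<in> sets borel" "F \<subseteq> frontier T"
  shows "tame F (\<lambda>z. fst (outer_normal T z))" "tame F (\<lambda>z. snd (outer_normal T z))"
  using stars[OF assms(1)] star_domain.tame_normal[OF _ assms(2,3)] by blast+

lemma flux_eq: "flux T z = (K (snd z) * (pd_x (v T) z)\<^sup>2 + (pd_y (v T) z)\<^sup>2)
    * (b (fst z) * fst (outer_normal T z) + c (snd z) * snd (outer_normal T z))"
  by (simp add: flux_def W_grad_def grad_def inner_prod power2_eq_square mult.assoc)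

lemma tame_flux:
  assumes "T \<in> M" "F \<in> sets borel" "F \<subseteq> frontier T"
  shows "tame F (flux T)"
proof -
  note * = tame_coeff[OF assms(2) subset_trans[OF assms(3) frontier_subset_closure[OF assms(1)]]]
  have "tame F (\<lambda>z. (K (snd z) * (pd_x (v T) z)\<^sup>2 + (pd_y (v T) z)\<^sup>2)
    * (b (fst z) * fst (outer_normal T z) + c (snd z) * snd (outer_normal T z)))"
    by (intro tame_add tame_mult tame_power2 * assms tame_outer_normal)
  then show ?thesis unfolding flux_eq[symmetric] .
qed

lemma tame_grad_sq:
  assumes "T \<in> M" "F \<in> sets borel" "F \<subseteq> closure \<Omega>"
  shows "tame F (grad_sq T)"
  unfolding grad_sq_def using tame_coeff(4,5)[OF assms(2,3,1)] by (intro tame_add tame_power2)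

lemma finite_measure:
  assumes "T \<in> M" "F \<in> sets borel" "F \<subseteq> frontier T"
  shows "emeasure hausdorff1 F < top"
proof -
  have "emeasure hausdorff1 F \<le> emeasure hausdorff1 (frontier T)"
    by (rule emeasure_mono) (use assms borel_imp_hausdorff1[OF borel_closed[OF frontier_closed]] in auto)
  also have "\<dots> < top" using stars[OF assms(1)] star_domain.emeasure_frontier_finite by blast
  finally show ?thesis .
qed

lemma diameter_pos:
  assumes "F \<subseteq> closure \<Omega>" "0 < emeasure hausdorff1 F"
  shows "0 < diameter F"
proof -
  have "\<exists>x\<in>F. \<exists>y\<in>F. x \<noteq> y"
  proof (rule ccontr)
    assume "\<not> ?thesis"
    then have "\<exists>x. F \<subseteq> {x}" by blast
    then obtain x where "F \<subseteq> {x}" by blast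
    then have "F \<in> null_sets hausdorff1" by (rule hausdorff1_null_subset) (simp add: finite_null_hausdorff1)
    then show False using assms(2) by auto
  qed
  then obtain x y where xy: "x \<in> F" "y \<in> F" "x \<noteq> y" by blast
  have "bounded F" using assms(1) basics(3) bounded_closure bounded_subset by blast
  then have "dist x y \<le> diameter F" using xy by (simp add: diameter_bounded_bound)
  moreover have "0 < dist x y" using xy by simp
  ultimately show ?thesis by linarith
qed

lemma off_finite_AE: "finite A \<Longrightarrow> AE z in hausdorff1. z \<notin> A"
  using AE_not_in[OF finite_null_hausdorff1] .

text \<open>Off the corners the two normals are opposite, so averages and jumps become explicit and
  the inequality holds pointwise. Three quarters of the penalty are spent; the trace remainder is
  weighted so that all facets together cost an eighth of the volume term.\<close>

lemma interior_facet_estimate: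
  assumes F: "F \<in> interior_facets M" and \<gamma>: "288 * \<beta>\<^sup>2 * C\<^sup>2 / \<delta> \<le> \<gamma>"
  shows "0 \<le> (LINT z:F|hausdorff1. average M F (\<lambda>T. W_grad K (v T)) z \<bullet> jump \<Omega> M F (\<lambda>T. multiplier_op b c (v T)) z)
    - (\<Sum>T\<in>sides M F. LINT z:F|hausdorff1. flux T z) / 2
    + 3/4 * (\<gamma> * (real p)\<^sup>2 / diameter F) * (LINT z:F|hausdorff1.
        jump \<Omega> M F (\<lambda>T. pd_x (v T)) z \<bullet> jump \<Omega> M F (\<lambda>T. pd_x (v T)) z
        + jump \<Omega> M F (\<lambda>T. pd_y (v T)) z \<bullet> jump \<Omega> M F (\<lambda>T. pd_y (v T)) z)
    + \<delta> / (8 * C\<^sup>2) * (diameter F / (real p)\<^sup>2) * (\<Sum>T\<in>sides M F. LINT z:F|hausdorff1. grad_sq T z)"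
proof -
  obtain T T' N where T: "T \<in> M" "T' \<in> M" "T \<noteq> T'" "sides M F = {T, T'}" "norm N = 1"
    and N: "\<And>z. z \<in> F - corners \<Longrightarrow> is_outer_normal T z N" "\<And>z. z \<in> F - corners \<Longrightarrow> is_outer_normal T' z (- N)"
    using interior_facet(1)[OF F] by blast
  have FT: "F \<subseteq> frontier T" "F \<subseteq> frontier T'" using T(4) unfolding sides_def by blast+
  have FB: "F \<in> sets borel" using facet_borel F by blast
  have F\<Omega>: "F \<subseteq> closure \<Omega>" using FT(1) frontier_subset_closure[OF T(1)] by blast
  have fin: "emeasure hausdorff1 F < top" using finite_measure[OF T(1) FB FT(1)] .
  note h = diameter_pos[OF F\<Omega> interior_facet(2)[OF F]]
  obtain n1 n2 where N12: "N = (n1, n2)" by (cases N)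
  have unit: "n1\<^sup>2 + n2\<^sup>2 = 1" using T(5) by (simp add: N12 norm_prod_sq norm_eq_1 inner_prod power2_eq_square)
  define A where "A z = average M F (\<lambda>T. W_grad K (v T)) z \<bullet> jump \<Omega> M F (\<lambda>T. multiplier_op b c (v T)) z" for z
  define J where "J z = jump \<Omega> M F (\<lambda>T. pd_x (v T)) z \<bullet> jump \<Omega> M F (\<lambda>T. pd_x (v T)) z
        + jump \<Omega> M F (\<lambda>T. pd_y (v T)) z \<bullet> jump \<Omega> M F (\<lambda>T. pd_y (v T)) z" for z
  define A' where "A' z = 1/2 * (K (snd z) * (pd_x (v T) z + pd_x (v T') z) * n1 + (pd_y (v T) z + pd_y (v T') z) * n2)
    * (b (fst z) * (pd_x (v T) z - pd_x (v T') z) + c (snd z) * (pd_y (v T) z - pd_y (v T') z))" for z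
  define J' where "J' z = (pd_x (v T) z - pd_x (v T') z)\<^sup>2 + (pd_y (v T) z - pd_y (v T') z)\<^sup>2" for z
  have normals: "outer_normal T z = (n1, n2)" "outer_normal T' z = (- n1, - n2)" if "z \<in> F - corners" for z
    using N(1)[OF that] N(2)[OF that] by (simp_all add: outer_normal_eqI N12)
  have jump: "jump \<Omega> M F \<phi> z = (\<phi> T z - \<phi> T' z) *\<^sub>R (n1, n2)" if "z \<in> F - corners" for \<phi> :: broken and z
    using F T(3) normals[OF that] by (simp add: jump_def T(4) algebra_simps)
  have A: "A z = A' z" if z: "z \<in> F - corners" for z
    unfolding A_def jump[OF z] A'_def average_def T(4) using T(3)
    by (simp add: W_grad_def multiplier_op_def inner_prod algebra_simps)
  have J: "J z = J' z" if z: "z \<in> F - corners" for z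
  proof -
    have "J z = ((pd_x (v T) z - pd_x (v T') z)\<^sup>2 + (pd_y (v T) z - pd_y (v T') z)\<^sup>2) * (n1\<^sup>2 + n2\<^sup>2)"
      unfolding J_def jump[OF z] by (simp add: inner_prod algebra_simps power2_eq_square)
    then show ?thesis using unit by (simp add: J'_def)
  qed
  note tc = tame_coeff[OF FB F\<Omega>]
  have off: "AE z in hausdorff1. z \<notin> corners" by (rule off_finite_AE[OF corners(1)])
  have tA: "tame F A"
  proof (rule tame_cong_AE)
    show "tame F A'" unfolding A'_def by (intro tame_mult tame_add tame_diff tame_const tc FB T)
    show "AE z in hausdorff1. z \<in> F \<longrightarrow> A z = A' z" using off by eventually_elim (simp add: A)
  qed
  have tJ: "tame F J"
  proof (rule tame_cong_AE)
    show "tame F J'" unfolding J'_def by (intro tame_power2 tame_add tame_diff tc FB T)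
    show "AE z in hausdorff1. z \<in> F \<longrightarrow> J z = J' z" using off by eventually_elim (simp add: J)
  qed
  have tf: "tame F (flux T)" "tame F (flux T')" "tame F (grad_sq T)" "tame F (grad_sq T')"
    by (intro tame_flux tame_grad_sq T FB FT F\<Omega>)+
  have point: "0 \<le> A z - (flux T z + flux T' z) / 2 + 3/4 * (\<gamma> * (real p)\<^sup>2 / diameter F) * J z
      + \<delta> / (8 * C\<^sup>2) * (diameter F / (real p)\<^sup>2) * (grad_sq T z + grad_sq T' z)" if z: "z \<in> F - corners" for z
  proof -
    define s t where "s = sqrt (grad_sq T z + grad_sq T' z)" and "t = sqrt (J' z)"
    have st: "s\<^sup>2 = grad_sq T z + grad_sq T' z" "t\<^sup>2 = J' z" by (simp_all add: s_def t_def grad_sq_def J'_def)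
    have z\<Omega>: "z \<in> closure \<Omega>" using z F\<Omega> by blast
    define E where "E = A z - (flux T z + flux T' z) / 2"
    have "E = 1/2 * (K (snd z) * (pd_x (v T) z + pd_x (v T') z) * n1 + (pd_y (v T) z + pd_y (v T') z) * n2)
        * (b (fst z) * (pd_x (v T) z - pd_x (v T') z) + c (snd z) * (pd_y (v T) z - pd_y (v T') z))
      - 1/2 * ((K (snd z) * (pd_x (v T) z)\<^sup>2 + (pd_y (v T) z)\<^sup>2) * (b (fst z) * n1 + c (snd z) * n2)
        - (K (snd z) * (pd_x (v T') z)\<^sup>2 + (pd_y (v T') z)\<^sup>2) * (b (fst z) * n1 + c (snd z) * n2))"
      unfolding E_def A[OF z] A'_def flux_eq normals[OF z] by (simp add: field_simps)
    then have "\<bar>E\<bar> \<le> 10 * \<beta> * s * t"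
      using interior_integrand_bound[OF coeff_bounds(3,2)[OF z\<Omega>] unit_pair_products[OF unit]]
      unfolding s_def t_def grad_sq_def J'_def by simp
    also have "\<dots> \<le> 3/4 * (\<gamma> * (real p)\<^sup>2 / diameter F * t\<^sup>2) + \<delta> / (8 * C\<^sup>2) * (diameter F / (real p)\<^sup>2 * s\<^sup>2)"
      by (rule young_penalty[OF C multiplier_props(5) _ h beta_nonneg \<gamma>]) (use p in simp)
    finally have "0 \<le> E + 3/4 * (\<gamma> * (real p)\<^sup>2 / diameter F * t\<^sup>2) + \<delta> / (8 * C\<^sup>2) * (diameter F / (real p)\<^sup>2 * s\<^sup>2)"
      by linarith
    then show ?thesis unfolding st J[OF z] E_def mult.assoc .
  qed
  have "AE z in hausdorff1. z \<in> F \<longrightarrow> 0 \<le> A z - (flux T z + flux T' z) / 2 + 3/4 * (\<gamma> * (real p)\<^sup>2 / diameter F) * J z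
      + \<delta> / (8 * C\<^sup>2) * (diameter F / (real p)\<^sup>2) * (grad_sq T z + grad_sq T' z)"
    using off by eventually_elim (use point in blast)
  from tame_combination_nonneg[OF FB fin tA tame_add[OF tf(1,2)] tJ tame_add[OF tf(3,4)] this]
  show ?thesis
    using T(3) tf[THEN tame_integrable[OF _ FB fin]]
    by (simp add: T(4) A_def J_def set_integral_add)
qed

text \<open>The form \<open>A_h\<close> uses the normal of \<open>\<Omega>\<close>, the integration
  by parts that of the element; this identifies the two.\<close>

lemma boundary_normal:
  assumes T: "T \<in> M" and F: "F \<subseteq> frontier T" "F \<subseteq> frontier \<Omega>"
  shows "AE z in hausdorff1. z \<in> F \<longrightarrow> z \<notin> corners \<and> outer_normal \<Omega> z = outer_normal T z \<and> is_outer_normal \<Omega> z (outer_normal T z)"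
proof -
  obtain a \<rho> where "star_domain T a \<rho>" using stars[OF T] by blast
  from star_domain.AE_normal_field[OF this] off_finite_AE[OF corners(1)] show ?thesis
  proof eventually_elim
    case (elim z)
    show ?case
    proof (intro impI)
      assume z: "z \<in> F"
      then have "is_outer_normal T z (outer_normal T z)" using elim F(1) by auto
      moreover obtain r where "0 < r" "\<And>w. w \<in> ball z r \<Longrightarrow> w \<in> \<Omega> \<longleftrightarrow> w \<in> T"
        using local_at_boundary[OF T _ _ elim(2)] z F by blast
      ultimately have "is_outer_normal \<Omega> z (outer_normal T z)" using is_outer_normal_local[of r z \<Omega> T] by blast
      then show "z \<notin> corners \<and> outer_normal \<Omega> z = outer_normal T z \<and> is_outer_normal \<Omega> z (outer_normal T z)"
        using elim(2) outer_normal_eqI by auto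
    qed
  qed
qed

definition boundary_flux :: "point set \<Rightarrow> point \<Rightarrow> real" where
  "boundary_flux T z = (W_grad K (v T) z \<bullet> outer_normal \<Omega> z) * multiplier_op b c (v T) z"

lemma boundary_flux_eq: "boundary_flux T z = (K (snd z) * pd_x (v T) z * fst (outer_normal \<Omega> z) + pd_y (v T) z * snd (outer_normal \<Omega> z))
    * (b (fst z) * pd_x (v T) z + c (snd z) * pd_y (v T) z)"
  by (simp add: boundary_flux_def W_grad_def multiplier_op_def inner_prod)

lemma tame_boundary_flux:
  assumes T: "T \<in> M" and F: "F \<in> sets borel" "F \<subseteq> frontier T" "F \<subseteq> frontier \<Omega>"
  shows "tame F (boundary_flux T)"
proof (rule tame_cong_AE)
  note tc = tame_coeff[OF F(1) subset_trans[OF F(2) frontier_subset_closure[OF T]]]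
  show "tame F (\<lambda>z. (K (snd z) * pd_x (v T) z * fst (outer_normal T z) + pd_y (v T) z * snd (outer_normal T z))
    * (b (fst z) * pd_x (v T) z + c (snd z) * pd_y (v T) z))"
    by (intro tame_mult tame_add tc tame_outer_normal T F)
  show "AE z in hausdorff1. z \<in> F \<longrightarrow> boundary_flux T z = (K (snd z) * pd_x (v T) z * fst (outer_normal T z) + pd_y (v T) z * snd (outer_normal T z))
    * (b (fst z) * pd_x (v T) z + c (snd z) * pd_y (v T) z)"
    using boundary_normal[OF T F(2,3)] by eventually_elim (simp add: boundary_flux_eq)
qed

lemma tame_tangential:
  assumes T: "T \<in> M" and F: "F \<in> sets borel" "F \<subseteq> frontier T" "F \<subseteq> frontier \<Omega>"
  shows "tame F (\<lambda>z. (grad (v T) z \<bullet> tangent \<Omega> z) * (grad (v T) z \<bullet> tangent \<Omega> z))"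
proof (rule tame_cong_AE)
  note tc = tame_coeff[OF F(1) subset_trans[OF F(2) frontier_subset_closure[OF T]]]
  show "tame F (\<lambda>z. (pd_y (v T) z * fst (outer_normal T z) - pd_x (v T) z * snd (outer_normal T z))\<^sup>2)"
    by (intro tame_mult tame_diff tame_power2 tc tame_outer_normal T F)
  show "AE z in hausdorff1. z \<in> F \<longrightarrow> (grad (v T) z \<bullet> tangent \<Omega> z) * (grad (v T) z \<bullet> tangent \<Omega> z)
      = (pd_y (v T) z * fst (outer_normal T z) - pd_x (v T) z * snd (outer_normal T z))\<^sup>2"
    using boundary_normal[OF T F(2,3)]
    by eventually_elim (simp add: grad_def tangent_def inner_prod power2_eq_square algebra_simps)
qed

text \<open>On \<open>Gamma0\<close> both factors are nonnegative, as \<open>K\<close> is positive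
  there. On \<open>Gamma1\<close> the second factor vanishes because the curve is
  characteristic.\<close>

lemma D_facet_sign:
  assumes F: "F \<subseteq> Gamma0 \<Omega> \<or> F \<subseteq> Gamma1 K yc" and T: "T \<in> M" "F \<subseteq> frontier T"
  shows "AE z in hausdorff1. z \<in> F \<longrightarrow> 0 \<le> (b (fst z) * fst (outer_normal T z) + c (snd z) * snd (outer_normal T z))
    * (K (snd z) * (fst (outer_normal T z))\<^sup>2 + (snd (outer_normal T z))\<^sup>2)"
proof -
  have F\<Omega>: "F \<subseteq> frontier \<Omega>" using F basics(8) by blast
  have "AE z in hausdorff1. z \<notin> {(0, yc), (- 1, 0)}" by (rule off_finite_AE) simp
  with boundary_normal[OF T F\<Omega>] show ?thesis
  proof eventually_elim
    case (elim z)
    show ?case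
    proof (intro impI)
      assume z: "z \<in> F"
      define n where "n = outer_normal T z"
      have n: "is_outer_normal \<Omega> z n" using elim(1) z by (simp add: n_def)
      have "z \<in> Gamma0 \<Omega> \<or> z \<in> Gamma1 K yc" using F z by blast
      then show "0 \<le> (b (fst z) * fst (outer_normal T z) + c (snd z) * snd (outer_normal T z))
        * (K (snd z) * (fst (outer_normal T z))\<^sup>2 + (snd (outer_normal T z))\<^sup>2)"
      proof
        assume z0: "z \<in> Gamma0 \<Omega>"
        have "0 \<le> b (fst z) * fst n + c (snd z) * snd n" using multiplier_props(9)[OF z0 n] by (simp add: inner_prod)
        moreover have "0 < snd z" "snd z \<in> snd ` closure \<Omega>" using z0 by (auto simp: Gamma0_def frontier_def)
        then have "0 < K (snd z)" using basics(6)[of "snd z"] by (simp add: zero_less_mult_iff)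
        ultimately show ?thesis unfolding n_def[symmetric] by (intro mult_nonneg_nonneg) auto
      next
        assume "z \<in> Gamma1 K yc"
        then obtain y where y: "y \<in> {yc..0}" "z = (- 1 + chi y, y)" by (auto simp: Gamma1_eq)
        have "y \<noteq> yc" "y \<noteq> 0" using elim(2) y(2) by (auto simp: chi_0 chi_yc)
        then have "y \<in> {yc<..<0}" using y(1) by auto
        then have sn: "snd n = sqrt (- K y) * fst n" using normal_perp_Gamma1 n y(2) by blast
        have "(snd n)\<^sup>2 = - K y * (fst n)\<^sup>2" unfolding sn power_mult_distrib using K_nonpos[OF y(1)] by simp
        then have "K (snd z) * (fst n)\<^sup>2 + (snd n)\<^sup>2 = 0" using y(2) by simp
        then show ?thesis unfolding n_def[symmetric] by simp
      qed
    qed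
  qed
qed

lemma D_facet_estimate:
  assumes F: "F \<in> facets_D K yc \<Omega> M" and \<gamma>: "288 * \<beta>\<^sup>2 * C\<^sup>2 / \<delta> \<le> \<gamma>"
  shows "0 \<le> (LINT z:F|hausdorff1. boundary_flux (boundary_elem M F) z)
    - (\<Sum>T\<in>sides M F. LINT z:F|hausdorff1. flux T z) / 2
    + 3/4 * (\<gamma> * (real p)\<^sup>2 / diameter F) * (LINT z:F|hausdorff1.
        (grad (v (boundary_elem M F)) z \<bullet> tangent \<Omega> z) * (grad (v (boundary_elem M F)) z \<bullet> tangent \<Omega> z))
    + \<delta> / (8 * C\<^sup>2) * (diameter F / (real p)\<^sup>2) * (\<Sum>T\<in>sides M F. LINT z:F|hausdorff1. grad_sq T z)"
proof -
  have bF: "F \<in> bfacets" using F by (auto simp: bfacets_def facets_D_def)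
  obtain T where T: "T \<in> M" "sides M F = {T}" "boundary_elem M F = T" using boundary_facet(1)[OF bF] by blast
  have FT: "F \<subseteq> frontier T" using T(2) unfolding sides_def by blast
  have F\<Omega>: "F \<subseteq> frontier \<Omega>" by (rule boundary_facet(2)[OF bF])
  have FB: "F \<in> sets borel" using facet_borel bF by blast
  have Fc: "F \<subseteq> closure \<Omega>" using FT frontier_subset_closure[OF T(1)] by blast
  have fin: "emeasure hausdorff1 F < top" using finite_measure[OF T(1) FB FT] .
  note h = diameter_pos[OF Fc boundary_facet(4)[OF bF]]
  have kind: "F \<subseteq> Gamma0 \<Omega> \<or> F \<subseteq> Gamma1 K yc" using F by (auto simp: facets_D_def boundary_facets_def)
  define J where "J z = (grad (v T) z \<bullet> tangent \<Omega> z) * (grad (v T) z \<bullet> tangent \<Omega> z)" for z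
  have tJ: "tame F J" unfolding J_def by (rule tame_tangential[OF T(1) FB FT F\<Omega>])
  have "AE z in hausdorff1. z \<in> F \<longrightarrow> 0 \<le> boundary_flux T z - flux T z / 2 + 3/4 * (\<gamma> * (real p)\<^sup>2 / diameter F) * J z
      + \<delta> / (8 * C\<^sup>2) * (diameter F / (real p)\<^sup>2) * grad_sq T z"
    using boundary_normal[OF T(1) FT F\<Omega>] D_facet_sign[OF kind T(1) FT]
  proof eventually_elim
    case (elim z)
    show ?case
    proof (intro impI)
      assume z: "z \<in> F"
      define n1 n2 where "n1 = fst (outer_normal T z)" and "n2 = snd (outer_normal T z)"
      have N: "outer_normal \<Omega> z = outer_normal T z" "norm (outer_normal T z) = 1"
        using elim(1) z by (auto simp: is_outer_normal_def)
      have unit: "n1\<^sup>2 + n2\<^sup>2 = 1"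
        using N(2) by (simp add: n1_def n2_def norm_eq_1 inner_prod power2_eq_square)
      have z\<Omega>: "z \<in> closure \<Omega>" using z Fc by blast
      have sgn: "0 \<le> (b (fst z) * n1 + c (snd z) * n2) * (K (snd z) * n1\<^sup>2 + n2\<^sup>2)"
        using elim(2) z by (simp add: n1_def n2_def)
      define s t where "s = sqrt (grad_sq T z)" and "t = \<bar>- pd_x (v T) z * n2 + pd_y (v T) z * n1\<bar>"
      have J: "J z = t\<^sup>2"
        by (simp add: J_def t_def tangent_def N(1) grad_def inner_prod n1_def n2_def power2_eq_square)
      have s2: "s\<^sup>2 = grad_sq T z" by (simp add: s_def grad_sq_def)
      define Q where "Q = boundary_flux T z - flux T z / 2"
      have "Q = (K (snd z) * pd_x (v T) z * n1 + pd_y (v T) z * n2) * (b (fst z) * pd_x (v T) z + c (snd z) * pd_y (v T) z)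
          - 1/2 * ((K (snd z) * (pd_x (v T) z)\<^sup>2 + (pd_y (v T) z)\<^sup>2) * (b (fst z) * n1 + c (snd z) * n2))"
        unfolding Q_def boundary_flux_eq flux_eq N(1) n1_def n2_def by simp
      then have "- Q \<le> 10 * \<beta> * s * t"
        using boundary_integrand_bound[OF coeff_bounds[OF z\<Omega>] unit sgn]
        unfolding s_def t_def grad_sq_def by simp
      also have "\<dots> \<le> 3/4 * (\<gamma> * (real p)\<^sup>2 / diameter F * t\<^sup>2) + \<delta> / (8 * C\<^sup>2) * (diameter F / (real p)\<^sup>2 * s\<^sup>2)"
        by (rule young_penalty[OF C multiplier_props(5) _ h beta_nonneg \<gamma>]) (use p in simp)
      finally have "0 \<le> Q + 3/4 * (\<gamma> * (real p)\<^sup>2 / diameter F * t\<^sup>2) + \<delta> / (8 * C\<^sup>2) * (diameter F / (real p)\<^sup>2 * s\<^sup>2)"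
        by linarith
      then show "0 \<le> boundary_flux T z - flux T z / 2 + 3/4 * (\<gamma> * (real p)\<^sup>2 / diameter F) * J z
          + \<delta> / (8 * C\<^sup>2) * (diameter F / (real p)\<^sup>2) * grad_sq T z"
        unfolding s2 J Q_def mult.assoc .
    qed
  qed
  from tame_combination_nonneg[OF FB fin tame_boundary_flux[OF T(1) FB FT F\<Omega>] tame_flux[OF T(1) FB FT] tJ tame_grad_sq[OF T(1) FB Fc] this]
  show ?thesis by (simp add: T(2,3) J_def)
qed

text \<open>The form has no penalty on this part, so a sign must do the work. With
  \<open>q = sqrt (- K)\<close> and normal proportional to \<open>(1, - q)\<close>, consistency term
  and flux combine to \<open>- (b + c * q)\<close> times a nonnegative factor and the square of
  \<open>v_y + q * v_x\<close>, the derivative along the characteristic up to scaling.\<close>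

lemma Gamma2_facet_estimate:
  assumes F: "F \<in> boundary_facets (Gamma2 K yc) M"
  shows "0 \<le> (LINT z:F|hausdorff1. boundary_flux (boundary_elem M F) z)
    - (\<Sum>T\<in>sides M F. LINT z:F|hausdorff1. flux T z) / 2"
proof -
  have bF: "F \<in> bfacets" using F by (auto simp: bfacets_def)
  obtain T where T: "T \<in> M" "sides M F = {T}" "boundary_elem M F = T" using boundary_facet(1)[OF bF] by blast
  have FT: "F \<subseteq> frontier T" using T(2) unfolding sides_def by blast
  have F\<Omega>: "F \<subseteq> frontier \<Omega>" by (rule boundary_facet(2)[OF bF])
  have FB: "F \<in> sets borel" using facet_borel bF by blast
  have fin: "emeasure hausdorff1 F < top" using finite_measure[OF T(1) FB FT] .
  have F2: "F \<subseteq> Gamma2 K yc" using F by (auto simp: boundary_facets_def)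
  have "AE z in hausdorff1. z \<notin> {(0, yc), (1, 0)}" by (rule off_finite_AE) simp
  with boundary_normal[OF T(1) FT F\<Omega>]
  \<comment> \<open>The zero summands match the shape of
    \<open>tame_combination_nonneg\<close>.\<close>
  have "AE z in hausdorff1. z \<in> F \<longrightarrow> 0 \<le> boundary_flux T z - flux T z / 2 + 0 * 0 + 0 * 0"
  proof eventually_elim
    case (elim z)
    show ?case
    proof (intro impI)
      assume z: "z \<in> F"
      obtain y where y: "y \<in> {yc..0}" "z = (1 - chi y, y)" using z F2 by (auto simp: Gamma2_eq)
      have "y \<noteq> yc" "y \<noteq> 0" using elim(2) y(2) by (auto simp: chi_0 chi_yc)
      then have y': "y \<in> {yc<..<0}" using y(1) by auto
      define n where "n = outer_normal T z"
      have n: "is_outer_normal \<Omega> (1 - chi y, y) n" "outer_normal \<Omega> z = n" using elim(1) z y(2) by (auto simp: n_def)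
      define q where "q = sqrt (- K y)"
      have K: "K (snd z) = - (q * q)" using K_nonpos[OF y(1)] y(2) by (simp add: q_def)
      have sn: "snd n = - q * fst n" "0 < fst n" using normal_perp_Gamma2[OF y' n(1)] by (simp_all add: q_def)
      have m: "b (fst z) + c (snd z) * q \<le> 0" using multiplier_props(8)[of z] z F2 y(2) by (auto simp: q_def)
      have "boundary_flux T z - flux T z / 2 = fst n / 2 * (- (b (fst z) + c (snd z) * q)) * (pd_y (v T) z + q * pd_x (v T) z)\<^sup>2"
        unfolding boundary_flux_eq flux_eq n(2) n_def[symmetric] sn(1) K by (simp add: field_simps power2_eq_square)
      also have "0 \<le> \<dots>" using sn(2) m by (intro mult_nonneg_nonneg) auto
      finally show "0 \<le> boundary_flux T z - flux T z / 2 + 0 * 0 + 0 * 0" by simp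
    qed
  qed
  from tame_combination_nonneg[OF FB fin tame_boundary_flux[OF T(1) FB FT F\<Omega>] tame_flux[OF T(1) FB FT] tame_const[OF FB] tame_const[OF FB] this]
  show ?thesis by (simp add: T(2,3))
qed

end

section \<open>Summation over the mesh\<close>

context mixed_problem
begin

lemma element_frontier_sum:
  assumes T: "T \<in> M" and f: "tame (frontier T) f"
  shows "(LINT z:frontier T|hausdorff1. f z) = (\<Sum>F\<in>{F \<in> facets. F \<subseteq> frontier T}. LINT z:F|hausdorff1. f z)"
proof -
  have B: "frontier T \<in> sets borel" by (rule borel_closed[OF frontier_closed])
  have I: "set_integrable hausdorff1 (frontier T) f"
    by (rule tame_integrable[OF f B finite_measure[OF T B order_refl]])
  have IF: "set_integrable hausdorff1 F f" if "F \<in> {F \<in> facets. F \<subseteq> frontier T}" for F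
  proof (rule set_integrable_subset[OF I])
    show "F \<in> sets hausdorff1" using that facet_borel borel_imp_hausdorff1 unfolding facets_def by blast
  qed (use that in auto)
  have "(LINT z:frontier T|hausdorff1. f z) = (\<integral>z. (\<Sum>F\<in>{F \<in> facets. F \<subseteq> frontier T}. indicator F z *\<^sub>R f z) \<partial>hausdorff1)"
    unfolding set_lebesgue_integral_def
  proof (rule integral_cong_AE)
    show "(\<lambda>z. indicator (frontier T) z *\<^sub>R f z) \<in> borel_measurable hausdorff1"
      using I unfolding set_integrable_def by (rule borel_measurable_integrable)
    show "(\<lambda>z. \<Sum>F\<in>{F \<in> facets. F \<subseteq> frontier T}. indicator F z *\<^sub>R f z) \<in> borel_measurable hausdorff1"
      using IF unfolding set_integrable_def by (intro borel_measurable_sum borel_measurable_integrable)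
    show "AE z in hausdorff1. indicator (frontier T) z *\<^sub>R f z = (\<Sum>F\<in>{F \<in> facets. F \<subseteq> frontier T}. indicator F z *\<^sub>R f z)"
      using facet_partition[OF T] by eventually_elim (simp add: scaleR_left.sum[symmetric] sum_distrib_right[symmetric])
  qed
  also have "\<dots> = (\<Sum>F\<in>{F \<in> facets. F \<subseteq> frontier T}. LINT z:F|hausdorff1. f z)"
    unfolding set_lebesgue_integral_def
    using IF unfolding set_integrable_def by (rule Bochner_Integration.integral_sum)
  finally show ?thesis .
qed

lemma finite_all_facets: "finite facets"
  using finite_facets by (simp add: facets_def)

lemma sum_over_sides:
  fixes \<phi> :: "point set \<Rightarrow> point set \<Rightarrow> real"
  shows "(\<Sum>T\<in>M. \<Sum>F\<in>{F \<in> facets. F \<subseteq> frontier T}. \<phi> F T) = (\<Sum>F\<in>facets. \<Sum>T\<in>sides M F. \<phi> F T)"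
  unfolding sides_def by (rule sum.swap_restrict[OF mesh_basics(1) finite_all_facets])

lemma trace_sq:
  assumes T: "T \<in> M" and f: "f \<in> poly_space p" and h: "0 < diameter T"
  shows "diameter T / (real p)\<^sup>2 * (LINT z:frontier T|hausdorff1. (f z)\<^sup>2) \<le> C\<^sup>2 * (LINT z:T|lborel. (f z)\<^sup>2)"
proof -
  define X Y where "X = (LINT z:frontier T|hausdorff1. (f z)\<^sup>2)" and "Y = (LINT z:T|lborel. (f z)\<^sup>2)"
  have XY: "0 \<le> X" "0 \<le> Y" unfolding X_def Y_def set_lebesgue_integral_def by (auto intro!: integral_nonneg_AE AE_I2)
  have "sqrt X \<le> C * real p * diameter T powr (- 1/2) * sqrt Y"
    using trace[OF T f] unfolding L2_norm_on_def X_def Y_def .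
  then have "(sqrt X)\<^sup>2 \<le> (C * real p * diameter T powr (- 1/2) * sqrt Y)\<^sup>2"
    using XY by (intro power_mono) auto
  moreover have "(diameter T powr (- 1/2))\<^sup>2 = 1 / diameter T"
  proof -
    have "(diameter T powr (- 1/2))\<^sup>2 = diameter T powr (- 1/2 + - 1/2)"
      unfolding power2_eq_square by (rule powr_add[symmetric])
    also have "\<dots> = 1 / diameter T" using h by (simp add: powr_minus_divide)
    finally show ?thesis .
  qed
  ultimately have "X \<le> C\<^sup>2 * (real p)\<^sup>2 * (1 / diameter T) * Y"
    using XY by (simp only: power_mult_distrib real_sqrt_pow2)
  then have "diameter T / (real p)\<^sup>2 * X \<le> diameter T / (real p)\<^sup>2 * (C\<^sup>2 * (real p)\<^sup>2 * (1 / diameter T) * Y)"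
    using h by (intro mult_left_mono) auto
  also have "\<dots> = C\<^sup>2 * Y" using h p by simp
  finally show ?thesis unfolding X_def Y_def .
qed

lemma element_diameter:
  assumes "T \<in> M"
  shows "0 < diameter T" "bounded T"
proof -
  obtain a \<rho> where "star_domain T a \<rho>" using stars[OF assms] by blast
  then interpret star_domain T a \<rho> .
  show bd: "bounded T" by (rule bounded_T)
  obtain r where r: "0 < r" "ball a r \<subseteq> T" using open_T a_in open_contains_ball by blast
  have "diameter (ball a r) \<le> diameter T" using r bd by (intro diameter_subset)
  then show "0 < diameter T" using r(1) by simp
qed

lemma poly_set_integrable:
  assumes "T \<in> M" "f \<in> poly_space p"
  shows "set_integrable lborel T (\<lambda>z. (f z)\<^sup>2)"
proof (rule set_integrable_subset)
  have "compact (closure T)" using element_diameter(2)[OF assms(1)] by simp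
  moreover have "continuous_on (closure T) (\<lambda>z. (f z)\<^sup>2)" by (intro continuous_intros poly_space_continuous[OF assms(2)])
  ultimately show "set_integrable lborel (closure T) (\<lambda>z. (f z)\<^sup>2)"
    unfolding set_integrable_def by (rule borel_integrable_compact)
  show "T \<in> sets lborel" using mesh_basics(2)[OF assms(1)] by simp
qed (rule closure_subset)

text \<open>Regrouped by elements, each facet diameter is at most that of its element, and the
  facets of an element add up to its frontier. The trace inequality is applied to both first
  derivatives, which are again polynomials of degree at most \<open>p\<close>.\<close>

lemma trace_sum:
  "(\<Sum>F\<in>facets. diameter F / (real p)\<^sup>2 * (\<Sum>T\<in>sides M F. LINT z:F|hausdorff1. grad_sq T z))
    \<le> C\<^sup>2 * (\<Sum>T\<in>M. LINT z:T|lborel. grad_sq T z)"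
proof -
  have nn: "0 \<le> (LINT z:F|hausdorff1. grad_sq T z)" for F T
    unfolding set_lebesgue_integral_def grad_sq_def by (auto intro!: integral_nonneg_AE AE_I2)
  have "(\<Sum>F\<in>facets. diameter F / (real p)\<^sup>2 * (\<Sum>T\<in>sides M F. LINT z:F|hausdorff1. grad_sq T z))
      = (\<Sum>T\<in>M. \<Sum>F\<in>{F \<in> facets. F \<subseteq> frontier T}. diameter F / (real p)\<^sup>2 * (LINT z:F|hausdorff1. grad_sq T z))"
    unfolding sum_over_sides sum_distrib_left ..
  also have "\<dots> \<le> (\<Sum>T\<in>M. C\<^sup>2 * (LINT z:T|lborel. grad_sq T z))"
  proof (rule sum_mono)
    fix T assume T: "T \<in> M"
    have B: "frontier T \<in> sets borel" by (rule borel_closed[OF frontier_closed])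
    note fin = finite_measure[OF T B order_refl]
    have "(\<Sum>F\<in>{F \<in> facets. F \<subseteq> frontier T}. diameter F / (real p)\<^sup>2 * (LINT z:F|hausdorff1. grad_sq T z))
        \<le> (\<Sum>F\<in>{F \<in> facets. F \<subseteq> frontier T}. diameter T / (real p)\<^sup>2 * (LINT z:F|hausdorff1. grad_sq T z))"
    proof (intro sum_mono mult_right_mono divide_right_mono nn)
      fix F assume "F \<in> {F \<in> facets. F \<subseteq> frontier T}"
      then have "F \<subseteq> closure T" by (auto simp: frontier_def)
      then have "diameter F \<le> diameter (closure T)" using element_diameter(2)[OF T] by (intro diameter_subset) auto
      then show "diameter F \<le> diameter T" using element_diameter(2)[OF T] by (simp add: diameter_closure)
    qed simp
    also have "\<dots> = diameter T / (real p)\<^sup>2 * (LINT z:frontier T|hausdorff1. grad_sq T z)"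
      unfolding element_frontier_sum[OF T tame_grad_sq[OF T B frontier_subset_closure[OF T]]] sum_distrib_left ..
    also have "\<dots> = diameter T / (real p)\<^sup>2 * (LINT z:frontier T|hausdorff1. (pd_x (v T) z)\<^sup>2)
        + diameter T / (real p)\<^sup>2 * (LINT z:frontier T|hausdorff1. (pd_y (v T) z)\<^sup>2)"
    proof -
      have "set_integrable hausdorff1 (frontier T) (\<lambda>z. (pd_x (v T) z)\<^sup>2)" "set_integrable hausdorff1 (frontier T) (\<lambda>z. (pd_y (v T) z)\<^sup>2)"
        by (intro tame_integrable tame_power2 B fin tame_coeff(4,5)[OF B frontier_subset_closure[OF T] T])+
      then show ?thesis unfolding grad_sq_def by (simp add: set_integral_add distrib_left)
    qed
    also have "\<dots> \<le> C\<^sup>2 * (LINT z:T|lborel. (pd_x (v T) z)\<^sup>2) + C\<^sup>2 * (LINT z:T|lborel. (pd_y (v T) z)\<^sup>2)"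
      by (intro add_mono trace_sq[OF T _ element_diameter(1)[OF T]] poly_space_calculus(3,4) v T)
    also have "\<dots> = C\<^sup>2 * (LINT z:T|lborel. grad_sq T z)"
      unfolding grad_sq_def using poly_set_integrable[OF T] poly_space_calculus(3,4)[OF v[OF T]]
      by (simp add: set_integral_add distrib_left)
    finally show "(\<Sum>F\<in>{F \<in> facets. F \<subseteq> frontier T}. diameter F / (real p)\<^sup>2 * (LINT z:F|hausdorff1. grad_sq T z))
      \<le> C\<^sup>2 * (LINT z:T|lborel. grad_sq T z)" .
  qed
  finally show ?thesis by (simp add: sum_distrib_left)
qed

lemma element_estimate:
  assumes T: "T \<in> M"
  shows "- (LINT z:T|lborel. W_grad K (v T) z \<bullet> grad (multiplier_op b c (v T)) z)
    \<ge> \<delta> * (LINT z:T|lborel. grad_sq T z) / 2 - (LINT z:frontier T|hausdorff1. flux T z) / 2"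
proof -
  obtain a \<rho> where "star_domain T a \<rho>" using stars[OF T] by blast
  then interpret star_domain T a \<rho> .
  have T\<Omega>: "T \<subseteq> \<Omega>" "closure T \<subseteq> closure \<Omega>" using mesh_basics(4)[OF T] closure_mono by blast+
  have sub: "fst ` T \<subseteq> fst ` \<Omega>" "snd ` T \<subseteq> snd ` \<Omega>" "fst ` closure T \<subseteq> fst ` closure \<Omega>" "snd ` closure T \<subseteq> snd ` closure \<Omega>"
    using T\<Omega> by (auto intro: image_mono)
  interpret star_element T a \<rho> K b c \<delta>
  proof
    show "0 \<le> deriv K (snd z)" if "z \<in> T" for z using basics(7)[of "snd z"] that T\<Omega>(1) by force
    show "continuous_on (snd ` closure T) K" by (rule continuous_on_subset[OF basics(4) sub(4)])
    show "continuous_on (fst ` closure T) b" by (rule continuous_on_subset[OF multiplier_props(1) sub(3)])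
    show "continuous_on (snd ` closure T) c" by (rule continuous_on_subset[OF multiplier_props(3) sub(4)])
    show "K C1_differentiable_on (snd ` T)" by (rule C1_differentiable_on_subset[OF basics(5) sub(2)])
    show "b C1_differentiable_on (fst ` T)" by (rule C1_differentiable_on_subset[OF multiplier_props(2) sub(1)])
    show "c C1_differentiable_on (snd ` T)" by (rule C1_differentiable_on_subset[OF multiplier_props(4) sub(2)])
    show "0 < \<delta>" by (rule multiplier_props(5))
    show "\<delta> \<le> - K (snd z) * deriv b (fst z) + deriv (\<lambda>s. K s * c s) (snd z)" "\<delta> \<le> deriv b (fst z) - deriv c (snd z)" if "z \<in> T" for z
      using multiplier_props(6,7)[of z] that T\<Omega>(1) by auto
  qed
  show ?thesis using element_energy(2)[OF v[OF T]] by (simp add: flux_def[abs_def] grad_sq_def)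
qed

text \<open>The balance: the volume term keeps 1/2 - 1/8 = 3/8 of its weight, the gradient penalties
  keep 1 - 3/4 = 1/4, and the penalty on the jump of \<open>v\<close> itself is kept in
  full.\<close>

theorem coercivity:
  assumes \<gamma>: "0 < \<gamma>1" "288 * \<beta>\<^sup>2 * C\<^sup>2 / \<delta> \<le> \<gamma>2" "288 * \<beta>\<^sup>2 * C\<^sup>2 / \<delta> \<le> \<gamma>3"
  shows "A_h K yc \<Omega> b c M v v + A_J K yc \<Omega> \<gamma>1 \<gamma>2 \<gamma>3 p M v v \<ge> 1/4 * (triple_norm K yc \<Omega> \<delta> \<gamma>1 \<gamma>2 \<gamma>3 p M v)\<^sup>2"
proof -
  define J1 where "J1 = (\<Sum>F\<in>interior_facets M \<union> facets_D K yc \<Omega> M. \<gamma>1 / diameter F ^ 3 *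
          (LINT z:F|hausdorff1. jump \<Omega> M F v z \<bullet> jump \<Omega> M F v z))"
  define j2 where "j2 F = (LINT z:F|hausdorff1.
          jump \<Omega> M F (\<lambda>T. pd_x (v T)) z \<bullet> jump \<Omega> M F (\<lambda>T. pd_x (v T)) z
          + jump \<Omega> M F (\<lambda>T. pd_y (v T)) z \<bullet> jump \<Omega> M F (\<lambda>T. pd_y (v T)) z)" for F
  define j3 where "j3 F = (LINT z:F|hausdorff1.
          (grad (v (boundary_elem M F)) z \<bullet> tangent \<Omega> z) * (grad (v (boundary_elem M F)) z \<bullet> tangent \<Omega> z))" for F
  define J2 where "J2 = (\<Sum>F\<in>interior_facets M. \<gamma>2 * (real p)\<^sup>2 / diameter F * j2 F)"
  define J3 where "J3 = (\<Sum>F\<in>facets_D K yc \<Omega> M. \<gamma>3 * (real p)\<^sup>2 / diameter F * j3 F)"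
  define E where "E = (\<Sum>T\<in>M. LINT z:T|lborel. grad_sq T z)"
  define flux_sum where "flux_sum F = (\<Sum>T\<in>sides M F. LINT z:F|hausdorff1. flux T z)" for F
  define trace_F where "trace_F F = diameter F / (real p)\<^sup>2 * (\<Sum>T\<in>sides M F. LINT z:F|hausdorff1. grad_sq T z)" for F
  define \<kappa> where "\<kappa> = \<delta> / (8 * C\<^sup>2)"
  define \<phi>i where "\<phi>i F = (LINT z:F|hausdorff1. average M F (\<lambda>T. W_grad K (v T)) z \<bullet> jump \<Omega> M F (\<lambda>T. multiplier_op b c (v T)) z)" for F
  define \<phi>b where "\<phi>b F = (LINT z:F|hausdorff1. boundary_flux (boundary_elem M F) z)" for F
  define V where "V = (\<Sum>T\<in>M. LINT z:T|lborel. W_grad K (v T) z \<bullet> grad (multiplier_op b c (v T)) z)"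
  have \<delta>: "0 < \<delta>" by (rule multiplier_props(5))
  have \<kappa>: "0 \<le> \<kappa>" using \<delta> by (simp add: \<kappa>_def)
  have "0 \<le> 288 * \<beta>\<^sup>2 * C\<^sup>2 / \<delta>" using \<delta> by simp
  then have \<gamma>0: "0 \<le> \<gamma>2" "0 \<le> \<gamma>3" using \<gamma> by linarith+
  have diam: "0 \<le> diameter F" if "F \<in> facets" for F
  proof -
    have "F \<subseteq> closure \<Omega>"
      using that interior_facet(1)[of F] boundary_facet(2)[of F] frontier_subset_closure
      unfolding facets_def sides_def frontier_def by blast
    then show ?thesis using diameter_ge_0 basics(3) bounded_closure bounded_subset by blast
  qed
  have D_sub: "facets_D K yc \<Omega> M \<subseteq> bfacets" unfolding facets_D_def bfacets_def by blast
  have bf: "facets_D K yc \<Omega> M \<union> boundary_facets (Gamma2 K yc) M = bfacets" unfolding facets_D_def bfacets_def ..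
  have tr0: "0 \<le> trace_F F" if "F \<in> facets" for F
    unfolding trace_F_def set_lebesgue_integral_def grad_sq_def
    by (intro mult_nonneg_nonneg divide_nonneg_nonneg sum_nonneg integral_nonneg_AE AE_I2 diam that) auto
  have j0: "0 \<le> j2 F" "0 \<le> j3 F" for F
    unfolding j2_def j3_def set_lebesgue_integral_def by (intro integral_nonneg_AE AE_I2; simp)+
  have J0: "0 \<le> J1" "0 \<le> J2" "0 \<le> J3"
  proof -
    show "0 \<le> J1" unfolding J1_def set_lebesgue_integral_def
      using D_sub \<gamma>(1) by (intro sum_nonneg mult_nonneg_nonneg divide_nonneg_nonneg zero_le_power diam integral_nonneg_AE AE_I2)
        (auto simp: facets_def)
    show "0 \<le> J2" unfolding J2_def
      by (intro sum_nonneg mult_nonneg_nonneg divide_nonneg_nonneg diam j0 \<gamma>0) (auto simp: facets_def)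
    show "0 \<le> J3" unfolding J3_def
      using D_sub by (intro sum_nonneg mult_nonneg_nonneg divide_nonneg_nonneg diam j0 \<gamma>0) (auto simp: facets_def)
  qed
  have "0 \<le> (\<Sum>F\<in>interior_facets M. \<phi>i F - flux_sum F / 2 + 3/4 * (\<gamma>2 * (real p)\<^sup>2 / diameter F * j2 F) + \<kappa> * trace_F F)"
    using interior_facet_estimate[OF _ \<gamma>(2)]
    by (intro sum_nonneg) (simp add: \<phi>i_def flux_sum_def j2_def \<kappa>_def trace_F_def mult.assoc)
  then have int: "0 \<le> (\<Sum>F\<in>interior_facets M. \<phi>i F) - (\<Sum>F\<in>interior_facets M. flux_sum F) / 2 + 3/4 * J2 + \<kappa> * (\<Sum>F\<in>interior_facets M. trace_F F)"
    by (simp add: sum.distrib sum_subtractf sum_divide_distrib sum_distrib_left J2_def)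
  \<comment> \<open>The tangential penalty is extended by zero to the facets of
    \<open>Gamma2\<close>, so that one sum runs over all boundary facets.\<close>
  have "0 \<le> (\<Sum>F\<in>bfacets. \<phi>b F - flux_sum F / 2 + 3/4 * (if F \<in> facets_D K yc \<Omega> M then \<gamma>3 * (real p)\<^sup>2 / diameter F * j3 F else 0) + \<kappa> * trace_F F)"
  proof (rule sum_nonneg)
    fix F assume F: "F \<in> bfacets"
    show "0 \<le> \<phi>b F - flux_sum F / 2 + 3/4 * (if F \<in> facets_D K yc \<Omega> M then \<gamma>3 * (real p)\<^sup>2 / diameter F * j3 F else 0) + \<kappa> * trace_F F"
    proof (cases "F \<in> facets_D K yc \<Omega> M")
      case True
      then show ?thesis using D_facet_estimate[OF _ \<gamma>(3)]
        by (simp add: \<phi>b_def flux_sum_def j3_def \<kappa>_def trace_F_def mult.assoc)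
    next
      case False
      then have "F \<in> boundary_facets (Gamma2 K yc) M" using F bf by blast
      then have "0 \<le> \<phi>b F - flux_sum F / 2" unfolding \<phi>b_def flux_sum_def by (rule Gamma2_facet_estimate)
      moreover have "0 \<le> \<kappa> * trace_F F" using \<kappa> tr0[of F] F by (simp add: facets_def)
      ultimately show ?thesis using False by simp
    qed
  qed
  moreover have "(\<Sum>F\<in>bfacets. if F \<in> facets_D K yc \<Omega> M then \<gamma>3 * (real p)\<^sup>2 / diameter F * j3 F else 0) = J3"
    unfolding J3_def sum.inter_restrict[OF finite_facets(2), symmetric] using D_sub by (simp add: Int_absorb1)
  ultimately have bd: "0 \<le> (\<Sum>F\<in>bfacets. \<phi>b F) - (\<Sum>F\<in>bfacets. flux_sum F) / 2 + 3/4 * J3 + \<kappa> * (\<Sum>F\<in>bfacets. trace_F F)"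
    by (simp only: sum.distrib sum_subtractf sum_divide_distrib[symmetric] sum_distrib_left[symmetric])
  have split: "(\<Sum>F\<in>facets. \<phi> F) = (\<Sum>F\<in>interior_facets M. \<phi> F) + (\<Sum>F\<in>bfacets. \<phi> F)" for \<phi> :: "point set \<Rightarrow> real"
    unfolding facets_def using boundary_facet(3) by (intro sum.union_disjoint finite_facets) blast
  have fluxes: "(\<Sum>T\<in>M. LINT z:frontier T|hausdorff1. flux T z) = (\<Sum>F\<in>facets. flux_sum F)"
    unfolding flux_sum_def sum_over_sides[symmetric]
    by (intro sum.cong refl element_frontier_sum tame_flux borel_closed frontier_closed order_refl)
  have "(\<Sum>T\<in>M. \<delta> * (LINT z:T|lborel. grad_sq T z) / 2 - (LINT z:frontier T|hausdorff1. flux T z) / 2)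
      \<le> (\<Sum>T\<in>M. - (LINT z:T|lborel. W_grad K (v T) z \<bullet> grad (multiplier_op b c (v T)) z))"
    by (intro sum_mono element_estimate)
  then have el: "\<delta> * E / 2 - (\<Sum>F\<in>facets. flux_sum F) / 2 \<le> - V"
    unfolding sum_subtractf sum_divide_distrib[symmetric] sum_distrib_left[symmetric] fluxes sum_negf E_def[symmetric] V_def[symmetric] .
  have "\<kappa> * (\<Sum>F\<in>facets. trace_F F) \<le> \<kappa> * (C\<^sup>2 * E)"
    unfolding trace_F_def E_def by (rule mult_left_mono[OF trace_sum \<kappa>])
  also have "\<dots> = \<delta> * E / 8" using C by (simp add: \<kappa>_def)
  finally have tr: "\<kappa> * (\<Sum>F\<in>facets. trace_F F) \<le> \<delta> * E / 8" .
  have Ah: "A_h K yc \<Omega> b c M v v = - V + (\<Sum>F\<in>interior_facets M. \<phi>i F) + (\<Sum>F\<in>bfacets. \<phi>b F)"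
    unfolding A_h_def bf V_def \<phi>i_def \<phi>b_def boundary_flux_def ..
  have AJ: "A_J K yc \<Omega> \<gamma>1 \<gamma>2 \<gamma>3 p M v v = J1 + J2 + J3"
    unfolding A_J_def J1_def J2_def J3_def j2_def j3_def ..
  have E0: "0 \<le> \<delta> * E" unfolding E_def set_lebesgue_integral_def grad_sq_def
    using \<delta> by (intro mult_nonneg_nonneg sum_nonneg integral_nonneg_AE AE_I2) auto
  have "(\<Sum>T\<in>M. LINT z:T|lborel. \<delta> * ((pd_x (v T) z)\<^sup>2 + (pd_y (v T) z)\<^sup>2)) = \<delta> * E"
    unfolding E_def grad_sq_def sum_distrib_left by simp
  then have norm: "(triple_norm K yc \<Omega> \<delta> \<gamma>1 \<gamma>2 \<gamma>3 p M v)\<^sup>2 = \<delta> * E + (J1 + J2 + J3)"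
    using J0 E0 by (simp add: triple_norm_def AJ)
  have trs: "\<kappa> * (\<Sum>F\<in>interior_facets M. trace_F F) + \<kappa> * (\<Sum>F\<in>bfacets. trace_F F) \<le> \<delta> * E / 8"
    using tr unfolding split by (simp add: distrib_left)
  \<comment> \<open>The element fluxes cancel between the facet and element inequalities; the rest
    is linear arithmetic after clearing denominators.\<close>
  have combine: "(e + (J1 + J2 + J3)) / 4 \<le> - V + Fi + Fb + (J1 + J2 + J3)"
    if "0 \<le> Fi - Gi / 2 + 3/4 * J2 + ti" "0 \<le> Fb - Gb / 2 + 3/4 * J3 + tb" "e / 2 - (Gi + Gb) / 2 \<le> - V" "ti + tb \<le> e / 8" "0 \<le> e"
    for e Fi Fb Gi Gb ti tb
  proof -
    have "0 \<le> 4 * Fi - 2 * Gi + 3 * J2 + 4 * ti" "0 \<le> 4 * Fb - 2 * Gb + 3 * J3 + 4 * tb" using that(1,2) by (simp_all add: field_simps)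
    moreover have "e - (Gi + Gb) \<le> - (2 * V)" using that(3) by (simp add: field_simps)
    moreover have "8 * (ti + tb) \<le> e" using that(4) by simp
    ultimately have "e + (J1 + J2 + J3) \<le> 4 * (- V + Fi + Fb + (J1 + J2 + J3))" using that(5) J0 by argo
    then show ?thesis by simp
  qed
  show ?thesis unfolding Ah AJ norm times_divide_eq_left mult_1
    using combine[OF int bd el[unfolded split] trs E0] by (simp only: add.assoc)
qed

end

section \<open>The estimate for a family of meshes\<close>

theorem proposition3p3:
  fixes K b c :: "real \<Rightarrow> real" and \<Omega> :: "point set" and H :: "real set" and Th :: "real \<Rightarrow> mesh"
    and yc r Cg Ctr \<delta> \<beta> \<gamma>star \<gamma>1 \<gamma>2 \<gamma>3 h :: real and p :: nat and V :: "broken set"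
  assumes domain: "mixed_type_domain K yc \<Omega>"
    and mesh: "mesh_family K yc \<Omega> r Cg H Th"
    and trace: "discrete_trace_constant H Th Ctr"
    and multiplier: "admissible_multiplier K yc \<Omega> b c \<delta>"
    and beta: "\<beta> = Max {Linf_norm \<Omega> (\<lambda>z. K (snd z) * b (fst z)), Linf_norm \<Omega> (\<lambda>z. b (fst z)),
                        Linf_norm \<Omega> (\<lambda>z. K (snd z) * c (snd z)), Linf_norm \<Omega> (\<lambda>z. c (snd z))}"
    and gamma_star: "\<gamma>star = 288 * \<beta>\<^sup>2 * Ctr\<^sup>2 / \<delta>"
    and h: "h \<in> H"
    and p: "p \<ge> 1"
    and V: "linear_subspace V" "V \<subseteq> broken_poly_space p (Th h)"
    and gammas: "\<gamma>1 > 0" "\<gamma>2 \<ge> \<gamma>star" "\<gamma>3 \<ge> \<gamma>star"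
  shows "\<forall>v\<in>V. A_h K yc \<Omega> b c (Th h) v v + A_J K yc \<Omega> \<gamma>1 \<gamma>2 \<gamma>3 p (Th h) v v
           \<ge> 1/4 * (triple_norm K yc \<Omega> \<delta> \<gamma>1 \<gamma>2 \<gamma>3 p (Th h) v)\<^sup>2"
proof
  fix v assume v: "v \<in> V"
  interpret mixed_domain K yc \<Omega> by unfold_locales (rule domain)
  have mesh_h: "mesh_of \<Omega> (Th h)" and star_h: "\<And>T. T \<in> Th h \<Longrightarrow> \<exists>a\<in>T. star_shaped_wrt T (ball a (r * diameter T))"
    and r: "0 < r" using mesh h unfolding mesh_family_def by blast+
  interpret mixed_mesh K yc \<Omega> "Th h"
  proof
    show "mesh_of \<Omega> (Th h)" by (rule mesh_h)
    fix T assume T: "T \<in> Th h"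
    obtain a where a: "a \<in> T" "star_shaped_wrt T (ball a (r * diameter T))" using star_h[OF T] by blast
    have "\<forall>T\<in>Th h. open T \<and> T \<noteq> {} \<and> T \<subseteq> \<Omega>" using mesh_h unfolding mesh_of_def by (elim conjE)
    then have oT: "open T" "T \<subseteq> \<Omega>" using T by blast+
    have bd: "bounded T" using oT(2) basics(3) bounded_subset by blast
    obtain e where e: "0 < e" "ball a e \<subseteq> T" using oT(1) a(1) open_contains_ball by blast
    have "diameter (ball a e) \<le> diameter T" using e bd by (intro diameter_subset)
    then have "0 < diameter T" using e(1) by simp
    then have "star_domain T a (r * diameter T)" using r a oT bd by unfold_locales auto
    then show "\<exists>a \<rho>. star_domain T a \<rho>" by blast
  qed
  have cont: "continuous_on (closure \<Omega>) (\<lambda>z. K (snd z))" "continuous_on (closure \<Omega>) (\<lambda>z. b (fst z))" "continuous_on (closure \<Omega>) (\<lambda>z. c (snd z))"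
    using multiplier basics(4) unfolding admissible_multiplier_def
    by (auto intro!: continuous_intros intro: continuous_on_compose2)
  \<comment> \<open>The products of coefficients are continuous on the closure of
    \<open>\<Omega>\<close>, so the essential suprema in \<open>\<beta>\<close> bound them
    pointwise, including on the boundary, where the facet estimates use them.\<close>
  note Linf = abs_le_Linf_norm[OF basics(1,3)]
  interpret mixed_problem K yc \<Omega> "Th h" b c \<delta> \<beta> Ctr p v
  proof
    fix z assume z: "z \<in> closure \<Omega>"
    have "\<bar>K (snd z) * b (fst z)\<bar> \<le> Linf_norm \<Omega> (\<lambda>z. K (snd z) * b (fst z))"
      "\<bar>K (snd z) * c (snd z)\<bar> \<le> Linf_norm \<Omega> (\<lambda>z. K (snd z) * c (snd z))"
      by (rule Linf[OF _ z], intro continuous_intros cont)+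
    moreover have "\<bar>b (fst z)\<bar> \<le> Linf_norm \<Omega> (\<lambda>z. b (fst z))" "\<bar>c (snd z)\<bar> \<le> Linf_norm \<Omega> (\<lambda>z. c (snd z))"
      by (rule Linf[OF _ z], rule cont)+
    ultimately show "\<bar>K (snd z) * b (fst z)\<bar> \<le> \<beta>" "\<bar>b (fst z)\<bar> \<le> \<beta>" "\<bar>K (snd z) * c (snd z)\<bar> \<le> \<beta>" "\<bar>c (snd z)\<bar> \<le> \<beta>"
      unfolding beta by (auto intro: order_trans)
  next
    show "admissible_multiplier K yc \<Omega> b c \<delta>" "1 \<le> p" by (rule multiplier p)+
    show "0 < Ctr" using trace unfolding discrete_trace_constant_def by blast
    show "v T \<in> poly_space p" if "T \<in> Th h" for T using v V(2) that unfolding broken_poly_space_def by blast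
    show "L2_norm_on hausdorff1 (frontier T) f \<le> Ctr * real p * diameter T powr (- 1/2) * L2_norm_on lborel T f"
      if "T \<in> Th h" "f \<in> poly_space p" for T f using trace h p that unfolding discrete_trace_constant_def by blast
  qed
  show "A_h K yc \<Omega> b c (Th h) v v + A_J K yc \<Omega> \<gamma>1 \<gamma>2 \<gamma>3 p (Th h) v v
           \<ge> 1/4 * (triple_norm K yc \<Omega> \<delta> \<gamma>1 \<gamma>2 \<gamma>3 p (Th h) v)\<^sup>2"
    using coercivity gammas unfolding gamma_star by blast
qed

end
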